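(* Let $L$ and $L'$ be series-parallel tropical linear spaces in $n$-space of dimensions $d$ and $d'$ with $d+d'\ge n$. Let $a,b\in\mathbb{R}^n$ be such that $L$ meets $L'+a$ transversely and $L$ meets $L'+b$ transversely. Then $L\cap(L'+a)$ and $L\cap(L'+b)$ have the same number of bounded faces of each dimension.
   Context: $p:\binom{[n]}{d}\to\mathbb{R}$ is a tropical Plücker vector if for every $S\in\binom{[n]}{d-2}$ and distinct $i,j,k,l\notin S$, the minimum of $p_{S\cup\{i,j\}}+p_{S\cup\{k,l\}}$, $p_{S\cup\{i,k\}}+p_{S\cup\{j,l\}}$, $p_{S\cup\{i,l\}}+p_{S\cup\{j,k\}}$ is attained at least twice; $L(p)=\{x\in\mathbb{R}^n:$ for every $J\in\binom{[n]}{d+1}$ the minimum over $j\in J$ of $p_{J\setminus\{j\}}+x_j$ is attained at least twice$\}$ is a $d$-dimensional tropical linear space. For $w$ let $M_w$ be the set of $I$ minimizing $p_I-\sum_{i\in I}w_i$; faces of $L(p)$ are closures of sets $\{w:M_w=\mathcal{M}\}$ contained in $L(p)$, with dimension taken in $\mathbb{R}^n$, bounded meaning bounded image in $\mathbb{R}^n/\mathbb{R}(1,\dots,1)$. $L(p)+a=L(p^a)$ with $p^a_I=p_I+\sum_{i\in I}a_i$. $L,L'$ meet transversely if whenever faces $F,F'$ have intersecting relative interiors, the direction spaces of their affine hulls together span $\mathbb{R}^n$; in that case $L(p)\cap L(p')=L(q)$ with $q_J=\min\{p_I+p'_{I'}:|I|=d,|I'|=d',I\cap I'=J\}$, and faces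 of $L\cap L'$ are its faces as the tropical linear space $L(q)$. $\mathcal{D}_p$ is the regular subdivision of $\Delta(d,n)=\mathrm{conv}\{\sum_{i\in I}e_i\}$ obtained by projecting the lower faces of $\mathrm{conv}\{(\sum_{i\in I}e_i,p_I)\}$. A matroid is series-parallel if it is the cycle matroid of a graph obtained from a single edge joining two distinct vertices by repeated series extensions (subdividing an edge) and parallel extensions (adding a parallel edge). $L(p)$ is series-parallel if every maximal cell of $\mathcal{D}_p$ is the basis polytope $\mathrm{conv}\{\sum_{i\in B}e_i: B\text{ basis}\}$ of a series-parallel matroid. *)

theory Defs
  imports "HOL-Analysis.Analysis"
begin

text \<open>
  The ground set $[n]$ is the finite type \<open>'n\<close>, with $n$ being \<open>CARD('n)\<close>.  A function on
  $d$-subsets of $[n]$ is a function on all of \<open>'n set\<close>; only its values on sets of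
  cardinality \<open>d\<close> are ever used.
\<close>

definition min_attained_twice :: "'a set \<Rightarrow> ('a \<Rightarrow> real) \<Rightarrow> bool" where
  "min_attained_twice A f \<longleftrightarrow>
     (\<exists>i\<in>A. \<exists>j\<in>A. i \<noteq> j \<and> f i = f j \<and> (\<forall>k\<in>A. f i \<le> f k))"

text \<open>The bound on \<open>d\<close> makes sure that there are $d$-subsets at all.\<close>

definition tropical_pluecker :: "nat \<Rightarrow> ('n::finite set \<Rightarrow> real) \<Rightarrow> bool" where
  "tropical_pluecker d p \<longleftrightarrow> d \<le> CARD('n) \<and>
     (\<forall>S i j k l. card S + 2 = d \<longrightarrow> distinct [i, j, k, l] \<longrightarrow> S \<inter> {i, j, k, l} = {} \<longrightarrow>
        min_attained_twice {0, 1, 2}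
          ((!) [p (S \<union> {i, j}) + p (S \<union> {k, l}),
                p (S \<union> {i, k}) + p (S \<union> {j, l}),
                p (S \<union> {i, l}) + p (S \<union> {j, k})]))"

definition tropical_linear_space :: "nat \<Rightarrow> ('n::finite set \<Rightarrow> real) \<Rightarrow> (real ^ 'n) set" where
  "tropical_linear_space d p =
     {x. \<forall>J. card J = d + 1 \<longrightarrow> min_attained_twice J (\<lambda>j. p (J - {j}) + x $ j)}"

definition minimizers :: "nat \<Rightarrow> ('n::finite set \<Rightarrow> real) \<Rightarrow> real ^ 'n \<Rightarrow> 'n set set" where
  "minimizers d p w =
     {I. card I = d \<and>
         (\<forall>K. card K = d \<longrightarrow> p I - (\<Sum>i\<in>I. w $ i) \<le> p K - (\<Sum>i\<in>K. w $ i))}"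

text \<open>Faces are nonempty.\<close>

definition tropical_faces :: "nat \<Rightarrow> ('n::finite set \<Rightarrow> real) \<Rightarrow> (real ^ 'n) set set" where
  "tropical_faces d p =
     {closure {w. minimizers d p w = M} | M.
        {w. minimizers d p w = M} \<noteq> {} \<and>
        {w. minimizers d p w = M} \<subseteq> tropical_linear_space d p}"

text \<open>
  The norm of the class of \<open>x\<close> in $\mathbb{R}^n/\mathbb{R}(1,\dots,1)$ is the distance from \<open>x\<close>
  to the line spanned by $(1,\dots,1)$, which is \<open>1\<close> in \<^typ>\<open>real ^ 'n\<close>.
\<close>

definition bounded_mod_ones :: "(real ^ 'n::finite) set \<Rightarrow> bool" where
  "bounded_mod_ones F \<longleftrightarrow> (\<exists>B. \<forall>x\<in>F. infdist x (span {1}) \<le> B)"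

text \<open>The vector $p^a$, for which $L(p^a) = L(p) + a$.\<close>

definition translate_pluecker :: "real ^ 'n::finite \<Rightarrow> ('n set \<Rightarrow> real) \<Rightarrow> 'n set \<Rightarrow> real" where
  "translate_pluecker a p I = p I + (\<Sum>i\<in>I. a $ i)"

definition direction_space :: "'a::real_vector set \<Rightarrow> 'a set" where
  "direction_space F = {x - y | x y. x \<in> affine hull F \<and> y \<in> affine hull F}"

definition meet_transversely ::
  "nat \<Rightarrow> ('n::finite set \<Rightarrow> real) \<Rightarrow> nat \<Rightarrow> ('n set \<Rightarrow> real) \<Rightarrow> bool" where
  "meet_transversely d p d' p' \<longleftrightarrow>
     (\<forall>F\<in>tropical_faces d p. \<forall>F'\<in>tropical_faces d' p'.
        rel_interior F \<inter> rel_interior F' \<noteq> {} \<longrightarrow>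
        span (direction_space F \<union> direction_space F') = UNIV)"

text \<open>
  The vector \<open>q\<close> of $L(p) \cap L(p')$.  It is meant for sets \<open>J\<close> of cardinality
  $d + d' - n$, for which the minimum is over a nonempty set.
\<close>

definition intersection_pluecker ::
  "nat \<Rightarrow> ('n::finite set \<Rightarrow> real) \<Rightarrow> nat \<Rightarrow> ('n set \<Rightarrow> real) \<Rightarrow> 'n set \<Rightarrow> real" where
  "intersection_pluecker d p d' p' J =
     Min {p I + p' I' | I I'. card I = d \<and> card I' = d' \<and> I \<inter> I' = J}"

text \<open>
  The faces of the transverse intersection $L(p) \cap L(p')$, which are by definition its faces as
  the tropical linear space $L(q)$ of dimension $d + d' - n$ (used only when $d + d' \ge n$).
\<close>

definition intersection_faces ::
  "nat \<Rightarrow> ('n::finite set \<Rightarrow> real) \<Rightarrow> nat \<Rightarrow> ('n set \<Rightarrow> real) \<Rightarrow> (real ^ 'n) set set" where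
  "intersection_faces d p d' p' =
     tropical_faces (d + d' - CARD('n)) (intersection_pluecker d p d' p')"

definition indicator_vec :: "'n::finite set \<Rightarrow> real ^ 'n" where
  "indicator_vec I = (\<Sum>i\<in>I. axis i 1)"

text \<open>Lower faces are the nonempty faces having an inner normal with last coordinate \<open>1\<close>.\<close>

definition lower_faces :: "('a::real_inner \<times> real) set \<Rightarrow> ('a \<times> real) set set" where
  "lower_faces P =
     {F. F \<noteq> {} \<and> (\<exists>c b. (\<forall>z\<in>P. b \<le> (c, 1) \<bullet> z) \<and> F = {z\<in>P. (c, 1) \<bullet> z = b})}"

definition regular_subdivision :: "nat \<Rightarrow> ('n::finite set \<Rightarrow> real) \<Rightarrow> (real ^ 'n) set set" where
  "regular_subdivision d p =
     (\<lambda>F. fst ` F) ` lower_faces (convex hull {(indicator_vec I, p I) | I. card I = d})"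

definition maximal_cells :: "'a set set \<Rightarrow> 'a set set" where
  "maximal_cells D = {C\<in>D. \<forall>C'\<in>D. C \<subseteq> C' \<longrightarrow> C' = C}"

text \<open>
  A multigraph is given by its vertex set, its edge set and the function sending an edge to its
  set of endpoints (a singleton for a loop).
\<close>

inductive series_parallel_graph :: "'v set \<Rightarrow> 'e set \<Rightarrow> ('e \<Rightarrow> 'v set) \<Rightarrow> bool" where
  single_edge:
    "\<lbrakk>u \<noteq> v; ends e = {u, v}\<rbrakk> \<Longrightarrow> series_parallel_graph {u, v} {e} ends"
| series_extension:
    "\<lbrakk>series_parallel_graph V E ends; e \<in> E; ends e = {u, v}; w \<notin> V; f \<notin> E\<rbrakk> \<Longrightarrow>
     series_parallel_graph (insert w V) (insert f E) (ends(e := {u, w}, f := {w, v}))"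
| parallel_extension:
    "\<lbrakk>series_parallel_graph V E ends; e \<in> E; f \<notin> E\<rbrakk> \<Longrightarrow>
     series_parallel_graph V (insert f E) (ends(f := ends e))"

definition graph_cycle :: "('e \<Rightarrow> 'v set) \<Rightarrow> 'e set \<Rightarrow> bool" where
  "graph_cycle ends C \<longleftrightarrow>
     (\<exists>vs es. vs \<noteq> [] \<and> length es = length vs \<and> distinct vs \<and> distinct es \<and> set es = C \<and>
        (\<forall>i<length vs. ends (es ! i) = {vs ! i, vs ! ((i + 1) mod length vs)}))"

definition graph_forest :: "('e \<Rightarrow> 'v set) \<Rightarrow> 'e set \<Rightarrow> bool" where
  "graph_forest ends A \<longleftrightarrow> (\<forall>C\<subseteq>A. \<not> graph_cycle ends C)"

text \<open>A matroid is given by its set of bases.\<close>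

definition cycle_matroid_bases :: "'e set \<Rightarrow> ('e \<Rightarrow> 'v set) \<Rightarrow> 'e set set" where
  "cycle_matroid_bases E ends =
     {B. B \<subseteq> E \<and> graph_forest ends B \<and> (\<forall>A. B \<subset> A \<longrightarrow> A \<subseteq> E \<longrightarrow> \<not> graph_forest ends A)}"

definition series_parallel_matroid :: "'n::finite set set \<Rightarrow> bool" where
  "series_parallel_matroid \<B> \<longleftrightarrow>
     (\<exists>(V :: nat set) ends. series_parallel_graph V UNIV ends \<and> \<B> = cycle_matroid_bases UNIV ends)"

definition basis_polytope :: "'n::finite set set \<Rightarrow> (real ^ 'n) set" where
  "basis_polytope \<B> = convex hull (indicator_vec ` \<B>)"

definition series_parallel_tropical :: "nat \<Rightarrow> ('n::finite set \<Rightarrow> real) \<Rightarrow> bool" where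
  "series_parallel_tropical d p \<longleftrightarrow>
     (\<forall>C\<in>maximal_cells (regular_subdivision d p).
        \<exists>\<B>. series_parallel_matroid \<B> \<and> C = basis_polytope \<B>)"

end

theory Submission
  imports Defs "HOL-Combinatorics.Transposition" "HOL-Computational_Algebra.Polynomial"
begin

text \<open>
  A pair \<open>(w, w - a)\<close> has as minimizers of \<open>p \<oplus> p'\<close> a direct sum \<open>M\<close> of two families, and the cells of
  \<open>L(p) \<inter> (L(p') + a)\<close> are the slices of the cells of \<open>L(p) \<times> L(p')\<close> by the affine space of all
  \<open>(w, w')\<close> with \<open>w - w' = a\<close>. A cell is bounded iff no element is a coloop on both sides. As \<open>a\<close> moves
  along a generic path, the polynomial counting these bounded cells by dimension can only change when
  \<open>a\<close> crosses a wall. Near a wall point, gluing all pairs of twin elements but one turns \<open>M\<close> into a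
  series-parallel family again, so that the cells created and the cells destroyed correspond to the faces
  of a series-parallel matroid on which one of two given elements dominates the other. These two face
  counts agree for series-parallel matroids, by induction on series and parallel extensions.
\<close>

text \<open>The path from \<open>a\<close> to \<open>b\<close> is run in axis-parallel steps, so
  that on a wall only one coordinate \<open>i0\<close> is special: the lineality spaces there still
  realize every prescription of the other differences. This freedom puts the two elements of each
  next twin pair into different components of the family glued so far, which is what keeps gluing
  inside the series-parallel class.

  Two obstacles shape the rest. The induction step for a series extension at one of the compared
  elements needs more than equality of the two counts, so a second identity is carried along; it
  links the two directions of domination with a shift of dimension, recorded by multiplication with
  \<open>tt\<close>. Moreover, the local identity holds at each point over the wall separately,
  while one cell may reach several such points. The overlapping local sums are untangled by
  induction over optimal families, which is possible because among those over the wall that contain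
  a given cell there is a least one.

  Cells on which the moving coordinate is constant belong to both local counts and cancel.\<close>

definition wt :: "real ^ 'g::finite \<Rightarrow> 'g set \<Rightarrow> real" where
  "wt w B = (\<Sum>i\<in>B. w $ i)"

lemma wt_simps [simp]:
  "wt (v + w) B = wt v B + wt w B" "wt (v - w) B = wt v B - wt w B"
  "wt (c *\<^sub>R v) B = c * wt v B" "wt 0 B = 0" "wt v {} = 0" "wt (- v) B = - wt v B"
  by (simp_all add: wt_def sum.distrib sum_subtractf sum_distrib_left sum_negf)

lemma wt_insert: "x \<notin> B \<Longrightarrow> wt w (insert x B) = w $ x + wt w B"
  by (simp add: wt_def)

lemma wt_remove: "x \<in> B \<Longrightarrow> wt w (B - {x}) = wt w B - w $ x"
  by (simp add: wt_def sum_diff1)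

lemma wt_exchange: "x \<in> B \<Longrightarrow> y \<notin> B \<Longrightarrow> wt w (insert y (B - {x})) = wt w B - w $ x + w $ y"
  by (simp add: wt_insert wt_remove)

lemma wt_cong: "(\<And>i. i \<in> B \<Longrightarrow> v $ i = w $ i) \<Longrightarrow> wt v B = wt w B"
  by (simp add: wt_def)

lemma wt_Un: "A \<inter> B = {} \<Longrightarrow> wt w (A \<union> B) = wt w A + wt w B"
  by (simp add: wt_def sum.union_disjoint)

lemma abs_wt_le: "\<bar>wt v B\<bar> \<le> real CARD('g) * norm (v :: real ^ 'g::finite)"
proof -
  have "\<bar>wt v B\<bar> \<le> (\<Sum>i\<in>B. \<bar>v $ i\<bar>)" unfolding wt_def by (rule sum_abs)
  also have "\<dots> \<le> (\<Sum>i\<in>(UNIV::'g set). norm v)"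
    by (rule order_trans[OF sum_mono2[of UNIV B "\<lambda>i. \<bar>v $ i\<bar>"] sum_mono]) (auto intro: component_le_norm_cart)
  finally show ?thesis by simp
qed

section \<open>Optimal families, initial families and their lineality spaces\<close>

definition opt :: "'g::finite set set \<Rightarrow> ('g set \<Rightarrow> real) \<Rightarrow> real ^ 'g \<Rightarrow> 'g set set" where
  "opt \<B> P w = {B\<in>\<B>. \<forall>C\<in>\<B>. P B - wt w B \<le> P C - wt w C}"

text \<open>The members on the face of the basis polytope in direction \<open>v\<close>. By
  \<open>opt_perturb\<close> these families describe all cells in a neighbourhood of a
  point.\<close>

definition ini :: "'g::finite set set \<Rightarrow> real ^ 'g \<Rightarrow> 'g set set" where
  "ini \<B> v = {B\<in>\<B>. \<forall>C\<in>\<B>. wt v C \<le> wt v B}"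

text \<open>For \<open>G = opt \<B> P w\<close> this is the direction space of the cell of all
  weights with optimal family \<open>G\<close>.\<close>

definition lin :: "'g::finite set set \<Rightarrow> (real ^ 'g) set" where
  "lin G = {v. \<forall>B\<in>G. \<forall>C\<in>G. wt v B = wt v C}"

definition is_loop :: "'g set set \<Rightarrow> 'g \<Rightarrow> bool" where
  "is_loop G x \<longleftrightarrow> (\<forall>B\<in>G. x \<notin> B)"

definition is_coloop :: "'g set set \<Rightarrow> 'g \<Rightarrow> bool" where
  "is_coloop G x \<longleftrightarrow> (\<forall>B\<in>G. x \<in> B)"

lemma linI: "(\<And>B C. B \<in> G \<Longrightarrow> C \<in> G \<Longrightarrow> wt v B = wt v C) \<Longrightarrow> v \<in> lin G"
  unfolding lin_def by blast

lemma linD: "v \<in> lin G \<Longrightarrow> B \<in> G \<Longrightarrow> C \<in> G \<Longrightarrow> wt v B = wt v C"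
  unfolding lin_def by blast

lemma subspace_lin: "subspace (lin G)"
proof -
  have "v + w \<in> lin G" if "v \<in> lin G" "w \<in> lin G" for v w
    by (rule linI) (metis linD that wt_simps(1))
  moreover have "c *\<^sub>R v \<in> lin G" if "v \<in> lin G" for c v
    by (rule linI) (metis linD that wt_simps(3))
  moreover have "0 \<in> lin G" by (rule linI) simp
  ultimately show ?thesis by (simp add: subspace_def)
qed

lemma lin_antimono: "G \<subseteq> M \<Longrightarrow> lin M \<subseteq> lin G"
  by (blast intro: linI dest: linD)

lemma opt_subset: "opt \<B> P w \<subseteq> \<B>" and ini_subset: "ini \<B> v \<subseteq> \<B>"
  by (auto simp: opt_def ini_def)

lemma ini_eq_opt: "ini \<B> = opt \<B> (\<lambda>_. 0)"
  by (auto simp: ini_def opt_def)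

lemma opt_nonempty:
  fixes \<B> :: "'g::finite set set" assumes "\<B> \<noteq> {}" shows "opt \<B> P w \<noteq> {}"
proof -
  let ?f = "\<lambda>B. P B - wt w B"
  have "Min (?f ` \<B>) \<in> ?f ` \<B>" using assms by (intro Min_in) auto
  then obtain B where "B \<in> \<B>" "?f B = Min (?f ` \<B>)" by auto
  then have "B \<in> opt \<B> P w" unfolding opt_def by simp
  then show ?thesis by blast
qed

lemma ini_nonempty: "\<B> \<noteq> {} \<Longrightarrow> ini \<B> v \<noteq> {}"
  by (simp add: ini_eq_opt opt_nonempty)

lemma ini_scaleR: "0 < c \<Longrightarrow> ini \<B> (c *\<^sub>R v) = ini \<B> v"
  by (simp add: ini_def)

lemma ini_add_lin: "u \<in> lin \<B> \<Longrightarrow> ini \<B> (v + u) = ini \<B> v"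
proof -
  assume u: "u \<in> lin \<B>"
  have "wt (v + u) C \<le> wt (v + u) B \<longleftrightarrow> wt v C \<le> wt v B" if "B \<in> \<B>" "C \<in> \<B>" for B C
    unfolding wt_simps linD[OF u that] by simp
  then show ?thesis unfolding ini_def by blast
qed

lemma ini_lin: "u \<in> lin \<B> \<Longrightarrow> ini \<B> u = \<B>"
  unfolding ini_def using linD[of u \<B>] by (blast intro: eq_refl)

lemma ini_self_imp_lin: "ini \<B> u = \<B> \<Longrightarrow> u \<in> lin \<B>"
  unfolding ini_def by (rule linI, rule antisym) blast+

text \<open>Members that are not optimal at \<open>w\<close> miss the optimum by at least some gap
  \<open>g\<close>. A perturbation too small to bridge the gap only breaks ties among the optimal
  members.\<close>

lemma opt_perturb:
  fixes \<B> :: "'g::finite set set" and w :: "real ^ 'g"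
  assumes "\<B> \<noteq> {}"
  shows "\<exists>\<epsilon>>0. \<forall>v. norm v < \<epsilon> \<longrightarrow> opt \<B> P (w + v) = ini (opt \<B> P w) v"
proof -
  let ?O = "opt \<B> P w" and ?n = "real CARD('g)"
  obtain B0 where B0: "B0 \<in> ?O" using opt_nonempty[OF assms] by blast
  define m where "m = P B0 - wt w B0"
  have m: "P B - wt w B = m" if "B \<in> ?O" for B
    using that B0 unfolding m_def opt_def by (auto intro: antisym)
  have gt: "P C - wt w C > m" if C: "C \<in> \<B> - ?O" for C
  proof (rule ccontr)
    assume "\<not> P C - wt w C > m"
    then have "C \<in> ?O" using C B0 unfolding opt_def m_def by force
    then show False using C by blast
  qed
  obtain g where g: "g > 0" "\<And>C. C \<in> \<B> - ?O \<Longrightarrow> P C - wt w C \<ge> m + g"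
  proof (cases "\<B> - ?O = {}")
    case True then show ?thesis using that[of 1] by auto
  next
    case False
    let ?S = "(\<lambda>C. P C - wt w C - m) ` (\<B> - ?O)"
    have "Min ?S \<in> ?S" using False by (intro Min_in) auto
    then have "Min ?S > 0" using gt by auto
    moreover have "P C - wt w C - m \<ge> Min ?S" if "C \<in> \<B> - ?O" for C using that by (intro Min_le) auto
    ultimately show ?thesis by (intro that[of "Min ?S"]) (auto simp: algebra_simps)
  qed
  \<comment> \<open>By \<open>abs_wt_le\<close> two sets differ in \<open>wt v\<close> by at most
    \<open>2 * ?n * norm v\<close>, which this bound keeps below \<open>g\<close>.\<close>
  have "opt \<B> P (w + v) = ini ?O v" if v: "norm v < g / (2 * ?n + 1)" for v
  proof -
    have "norm v * (2 * ?n + 1) < g" using v by (simp add: pos_less_divide_eq)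
    then have "2 * (?n * norm v) + norm v < g" by (simp add: algebra_simps)
    then have "2 * (?n * norm v) < g" using norm_ge_zero[of v] by linarith
    then have wv: "wt v B + g > wt v C" for B C using abs_wt_le[of v B] abs_wt_le[of v C] by linarith
    have less: "P B - wt (w + v) B < P C - wt (w + v) C" if "B \<in> ?O" "C \<in> \<B> - ?O" for B C
      using m[OF that(1)] g(2)[OF that(2)] wv[of C B] by simp
    have sub: "B \<in> ?O" if "B \<in> opt \<B> P (w + v)" for B
    proof (rule ccontr)
      assume "B \<notin> ?O"
      then have "P B0 - wt (w + v) B0 < P B - wt (w + v) B" using that B0 less opt_subset by blast
      moreover have "B0 \<in> \<B>" using B0 opt_subset by blast
      ultimately show False using that unfolding opt_def by force
    qed
    show ?thesis
    proof (intro equalityI subsetI)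
      fix B assume B: "B \<in> opt \<B> P (w + v)"
      then have "B \<in> ?O" using sub by blast
      moreover have "wt v C \<le> wt v B" if "C \<in> ?O" for C
      proof -
        have "P B - wt (w + v) B \<le> P C - wt (w + v) C" using B that opt_subset unfolding opt_def by blast
        then show ?thesis using m[OF that] m[OF \<open>B \<in> ?O\<close>] by simp
      qed
      ultimately show "B \<in> ini ?O v" by (simp add: ini_def)
    next
      fix B assume B: "B \<in> ini ?O v"
      then have BO: "B \<in> ?O" by (simp add: ini_def)
      have "P B - wt (w + v) B \<le> P C - wt (w + v) C" if "C \<in> \<B>" for C
      proof (cases "C \<in> ?O")
        case True
        then have "wt v C \<le> wt v B" using B by (simp add: ini_def)
        then show ?thesis using m[OF True] m[OF BO] by simp
      next
        case False then show ?thesis using less[OF BO] that by (simp add: less_imp_le)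
      qed
      then show "B \<in> opt \<B> P (w + v)" using BO opt_subset unfolding opt_def by blast
    qed
  qed
  moreover have "g / (2 * ?n + 1) > 0" using g by simp
  ultimately show ?thesis by blast
qed

lemma opt_perturb_ray:
  fixes \<B> :: "'g::finite set set"
  assumes "\<B> \<noteq> {}"
  obtains \<delta> where "\<delta> > 0" "opt \<B> P (w + \<delta> *\<^sub>R v) = ini (opt \<B> P w) v"
proof -
  obtain \<epsilon> where e: "\<epsilon> > 0" "\<And>v. norm v < \<epsilon> \<Longrightarrow> opt \<B> P (w + v) = ini (opt \<B> P w) v"
    using opt_perturb[OF assms] by metis
  \<comment> \<open>The summand \<open>1\<close> in the denominator covers
    \<open>v = 0\<close>.\<close>
  define \<delta> where "\<delta> = \<epsilon> / (norm v + 1)"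
  have d: "\<delta> > 0" using e by (simp add: \<delta>_def add_nonneg_pos)
  have "norm (\<delta> *\<^sub>R v) = \<epsilon> * (norm v / (norm v + 1))" using e by (simp add: \<delta>_def)
  also have "\<dots> < \<epsilon> * 1" using e by (intro mult_strict_left_mono) (auto simp: pos_divide_less_eq add_nonneg_pos)
  finally have "norm (\<delta> *\<^sub>R v) < \<epsilon>" by simp
  then show ?thesis using that[OF d] e(2) ini_scaleR[OF d] by metis
qed

text \<open>On \<open>opt \<B> P w\<close> the value \<open>P B - wt w B\<close> is constant, so
  there minimizing \<open>P - wt w'\<close> is the same as maximizing
  \<open>wt (w' - w)\<close>.\<close>

lemma opt_refine:
  assumes "opt \<B> P w' \<subseteq> opt \<B> P w" "\<B> \<noteq> {}"
  shows "opt \<B> P w' = ini (opt \<B> P w) (w' - w)"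
proof -
  obtain B0 where B0: "B0 \<in> opt \<B> P w'" using opt_nonempty[OF assms(2)] by blast
  have B0w: "B0 \<in> opt \<B> P w" using B0 assms by blast
  have v: "P B - wt w B = P B0 - wt w B0" if "B \<in> opt \<B> P w" for B
    using that B0w unfolding opt_def by (auto intro: antisym)
  show ?thesis
  proof (intro equalityI subsetI)
    fix B assume B: "B \<in> opt \<B> P w'"
    then have Bw: "B \<in> opt \<B> P w" using assms by blast
    have "wt (w' - w) C \<le> wt (w' - w) B" if "C \<in> opt \<B> P w" for C
    proof -
      have "P B - wt w' B \<le> P C - wt w' C" using B that opt_subset[of \<B> P w] unfolding opt_def by blast
      then show ?thesis using v[OF that] v[OF Bw] by simp
    qed
    then show "B \<in> ini (opt \<B> P w) (w' - w)" using Bw unfolding ini_def by blast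
  next
    fix B assume B: "B \<in> ini (opt \<B> P w) (w' - w)"
    have "P B - wt w' B \<le> P C - wt w' C" if C: "C \<in> \<B>" for C
    proof -
      have 1: "P B0 - wt w' B0 \<le> P C - wt w' C" using B0 C by (simp add: opt_def)
      have "wt (w' - w) B0 \<le> wt (w' - w) B" using B B0w unfolding ini_def by blast
      moreover have "B \<in> opt \<B> P w" using B unfolding ini_def by blast
      ultimately show ?thesis using 1 v[of B] by simp
    qed
    then show "B \<in> opt \<B> P w'" using B opt_subset[of \<B> P w] unfolding ini_def opt_def[of _ _ w'] by blast
  qed
qed

lemma opt_same_diff_lin:
  assumes "opt \<B> P w' = opt \<B> P w" shows "w' - w \<in> lin (opt \<B> P w)"
proof (rule linI)
  fix B C assume B: "B \<in> opt \<B> P w" and C: "C \<in> opt \<B> P w"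
  have "P B - wt w B = P C - wt w C" "P B - wt w' B = P C - wt w' C"
    using B C assms by (auto simp: opt_def intro: antisym)
  then show "wt (w' - w) B = wt (w' - w) C" by simp
qed

text \<open>The excess \<open>h\<close> over a common optimal member is nonnegative at both ends and
  affine along the segment. It vanishes at an interior point iff it vanishes at both ends.\<close>

lemma opt_segment:
  assumes "opt \<B> P w \<inter> opt \<B> P w' \<noteq> {}" "0 < c" "c < 1"
  shows "opt \<B> P (w + c *\<^sub>R (w' - w)) = opt \<B> P w \<inter> opt \<B> P w'"
proof -
  obtain B0 where B0: "B0 \<in> opt \<B> P w" "B0 \<in> opt \<B> P w'" using assms by blast
  define h where "h w B = P B - wt w B - (P B0 - wt w B0)" for w B
  have O: "opt \<B> P u = {B\<in>\<B>. h u B \<le> 0}" if "B0 \<in> opt \<B> P u" for u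
    using that unfolding opt_def h_def by force
  have nn: "h w B \<ge> 0" "h w' B \<ge> 0" if "B \<in> \<B>" for B
    using that B0 unfolding opt_def h_def by force+
  have eq: "h (w + c *\<^sub>R (w' - w)) B = (1 - c) * h w B + c * h w' B" for B
    by (simp add: h_def algebra_simps)
  have B0s: "B0 \<in> opt \<B> P (w + c *\<^sub>R (w' - w))"
  proof -
    have "h (w + c *\<^sub>R (w' - w)) B \<ge> 0" if "B \<in> \<B>" for B
      unfolding eq using nn[OF that] assms by (intro add_nonneg_nonneg mult_nonneg_nonneg) auto
    then show ?thesis using B0 unfolding opt_def h_def by force
  qed
  have iff: "(1 - c) * a + c * b \<le> 0 \<longleftrightarrow> a \<le> 0 \<and> b \<le> 0" if "a \<ge> 0" "b \<ge> 0" for a b :: real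
  proof
    assume *: "(1 - c) * a + c * b \<le> 0"
    have "(1 - c) * a \<ge> 0" "c * b \<ge> 0" using assms that by auto
    then have "(1 - c) * a = 0" "c * b = 0" using * by linarith+
    then show "a \<le> 0 \<and> b \<le> 0" using assms by auto
  next
    assume "a \<le> 0 \<and> b \<le> 0" then show "(1 - c) * a + c * b \<le> 0" using that by auto
  qed
  show ?thesis
    unfolding O[OF B0s] O[OF B0(1)] O[OF B0(2)] eq using iff[OF nn] by blast
qed

lemma dim_kernel:
  fixes S :: "'a::euclidean_space set" and f :: "'a \<Rightarrow> real"
  assumes "subspace S" "linear f" "u \<in> S" "f u \<noteq> 0"
  shows "dim S = Suc (dim {v\<in>S. f v = 0})"
proof -
  let ?K = "{v\<in>S. f v = 0}"
  interpret f: linear f by fact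
  have K: "subspace ?K"
    using assms(1) unfolding subspace_def by (auto simp: f.add f.scale f.zero)
  have "span (insert u ?K) = S"
  proof
    show "span (insert u ?K) \<subseteq> S" using assms by (intro span_minimal) auto
    show "S \<subseteq> span (insert u ?K)"
    proof
      fix v assume v: "v \<in> S"
      have "v - (f v / f u) *\<^sub>R u \<in> ?K"
        using assms v by (auto simp: f.diff f.scale intro!: subspace_diff subspace_scale)
      then have "v - (f v / f u) *\<^sub>R u \<in> span ?K" by (rule span_base)
      then show "v \<in> span (insert u ?K)" unfolding span_breakdown_eq by blast
    qed
  qed
  moreover have "u \<notin> span ?K" using K assms by (simp add: span_eq_iff[THEN iffD2])
  ultimately show ?thesis using dim_insert[of u ?K] by (metis (no_types, lifting) Suc_eq_plus1 dim_span)
qed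

section \<open>Valuated exchange from the three-term relations\<close>

lemma tropical_pluecker_three_term:
  fixes p :: "'n::finite set \<Rightarrow> real"
  assumes "tropical_pluecker d p" "card S + 2 = d" "distinct [i, j, k, l]" "S \<inter> {i, j, k, l} = {}"
  shows "p (S \<union> {i, k}) + p (S \<union> {j, l}) \<le> p (S \<union> {i, j}) + p (S \<union> {k, l}) \<or>
         p (S \<union> {i, l}) + p (S \<union> {j, k}) \<le> p (S \<union> {i, j}) + p (S \<union> {k, l})"
proof -
  have "min_attained_twice {0, 1, 2}
          ((!) [p (S \<union> {i, j}) + p (S \<union> {k, l}), p (S \<union> {i, k}) + p (S \<union> {j, l}),
                p (S \<union> {i, l}) + p (S \<union> {j, k})])"
    using assms unfolding tropical_pluecker_def by blast
  then show ?thesis unfolding min_attained_twice_def by (auto simp: numeral_2_eq_2)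
qed

text \<open>The three-term relations give the exchange for sets that differ in two elements, and
  induction on \<open>card (I - K)\<close> spreads it. A violating \<open>K\<close> is moved towards
  \<open>I\<close> by its cheapest exchange to \<open>K2\<close>, where the induction hypothesis
  holds; the three-term relation on the common part \<open>S\<close> then contradicts the choice of
  the exchange.\<close>

lemma valuated_exchange:
  fixes p :: "'n::finite set \<Rightarrow> real"
  assumes tp: "tropical_pluecker d p" and I: "card I = d" and "card K = d" and e: "e \<in> I - K"
  shows "\<exists>j\<in>K - I. p (insert j (I - {e})) + p (insert e (K - {j})) \<le> p I + p K"
  using assms(3) e
proof (induction "card (I - K)" arbitrary: K rule: less_induct)
  case less
  have cardeq: "card (I - K) = card (K - I)"
    using I less.prems by (simp add: card_Diff_subset_Int Int_commute)
  show ?case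
  proof (rule ccontr)
    assume "\<not> ?thesis"
    then have viol: "p I + p K < p (insert j (I - {e})) + p (insert e (K - {j}))" if "j \<in> K - I" for j
      using that by force
    have KI: "K - I \<noteq> {}" using cardeq less.prems by (metis card_gt_0_iff empty_iff finite)
    show False
    proof (cases "I - K = {e}")
      case True
      then obtain j where j: "K - I = {j}" using cardeq by (metis card_1_singletonE is_singletonI is_singleton_altdef)
      have "insert j (I - {e}) = K" "insert e (K - {j}) = I" using True j by blast+
      then show False using viol[of j] j by simp
    next
      case False
      \<comment> \<open>A modular correction that makes every exchange of \<open>e\<close> out of
        \<open>I\<close> free of cost (\<open>f1\<close>). A violation then says only that putting
        \<open>e\<close> into \<open>K\<close> strictly increases \<open>f\<close>
        (\<open>f2\<close>).\<close>
      define g where "g x = (if x \<in> K - I then p (insert x (I - {e})) - p I else 0)" for x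
      define f where "f X = p X - sum g X" for X
      have gI: "sum g X = 0" if "X \<inter> (K - I) = {}" for X
        using that by (intro sum.neutral) (auto simp: g_def)
      have f1: "f (insert j (I - {e})) = f I" if "j \<in> K - I" for j
      proof -
        have "sum g (insert j (I - {e})) = g j + sum g (I - {e})" using that by (subst sum.insert) auto
        also have "sum g (I - {e}) = 0" by (rule gI) blast
        finally show ?thesis using that gI[of I] by (simp add: f_def g_def)
      qed
      have sg: "sum g (insert e (X - {j})) = sum g X - g j" if "j \<in> X" "e \<notin> X" for X j
        using that e by (simp add: sum_diff1 g_def)
      have f2: "f (insert e (K - {j})) > f K" if "j \<in> K - I" for j
        using viol[OF that] f1[OF that] sg[of j K] that less.prems gI[of I]
        by (auto simp: f_def g_def)
      let ?X = "(\<lambda>(u, v). f (insert u (K - {v}))) ` ((I - K - {e}) \<times> (K - I))"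
      have ne: "(I - K - {e}) \<times> (K - I) \<noteq> {}" using False e less.prems KI by blast
      have "Min ?X \<in> ?X" using ne by (intro Min_in) auto
      then obtain u v where u: "u \<in> I - K - {e}" and v: "v \<in> K - I"
        and uv: "f (insert u (K - {v})) = Min ?X" unfolding image_iff by force
      have minuv: "f (insert u (K - {v})) \<le> f (insert u (K - {j}))" if "j \<in> K - I" for j
        unfolding uv using that u by (intro Min_le) auto
      \<comment> \<open>\<open>u\<close> and \<open>v\<close> are chosen so that this is the
        cheapest exchange that brings an element other than \<open>e\<close> from \<open>I\<close>
        into \<open>K\<close>.\<close>
      define K2 where "K2 = insert u (K - {v})"
      have c2: "card K2 = d" using u v less.prems unfolding K2_def
        by (simp add: card_Diff_singleton_if) (metis Suc_pred card_gt_0_iff empty_iff finite)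
      have "I - K2 = (I - K) - {u}" using u v by (auto simp: K2_def)
      then have "card (I - K2) < card (I - K)" using u by (metis DiffD1 card_Diff1_less finite)
      then obtain j where j: "j \<in> K2 - I"
        and le: "p (insert j (I - {e})) + p (insert e (K2 - {j})) \<le> p I + p K2"
        using less.hyps[of K2] c2 e u less.prems by (auto simp: K2_def)
      have jK: "j \<in> K - I" "j \<noteq> v" using j u by (auto simp: K2_def)
      have eK2: "e \<notin> K2" using u less.prems by (auto simp: K2_def)
      have small: "f (insert e (K2 - {j})) \<le> f K2"
        using le sg[of j K2] j eK2 jK by (auto simp: f_def g_def)
      define S where "S = K - {v, j}"
      have S: "card S + 2 = d"
      proof -
        have "card (K - {v, j}) = card K - card {v, j}" using jK v by (intro card_Diff_subset) auto
        moreover have "card {v, j} \<le> card K" using jK v by (intro card_mono) auto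
        ultimately show ?thesis using jK less.prems by (simp add: S_def)
      qed
      have dist: "distinct [v, j, u, e]" "S \<inter> {v, j, u, e} = {}" using jK u v e less.prems by (auto simp: S_def)
      have fS: "f (S \<union> {x, y}) + f (S \<union> {z, w}) =
        p (S \<union> {x, y}) + p (S \<union> {z, w}) - (2 * sum g S + (g x + g y + g z + g w))"
        if "distinct [x, y, z, w]" "S \<inter> {x, y, z, w} = {}" for x y z w
      proof -
        have s: "sum g (S \<union> {a, b}) = sum g S + (g a + g b)" if "a \<noteq> b" "S \<inter> {a, b} = {}" for a b
          using that by (subst sum.union_disjoint) auto
        have "S \<inter> {x, y} = {}" "S \<inter> {z, w} = {}" using that by blast+
        then show ?thesis using that s[of x y] s[of z w] by (simp add: f_def)
      qed
      \<comment> \<open>\<open>g\<close> is modular, so passing from \<open>p\<close> to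
        \<open>f\<close> changes all three terms of the relation by the same amount.\<close>
      have three: "f (S \<union> {v, u}) + f (S \<union> {j, e}) \<le> f (S \<union> {v, j}) + f (S \<union> {u, e}) \<or>
         f (S \<union> {v, e}) + f (S \<union> {j, u}) \<le> f (S \<union> {v, j}) + f (S \<union> {u, e})"
        using tropical_pluecker_three_term[OF tp S dist] dist
        by (subst (1 2 3 4) fS) (auto simp: algebra_simps)
      have sets: "S \<union> {v, u} = insert u (K - {j})" "S \<union> {j, e} = insert e (K - {v})"
        "S \<union> {v, j} = K" "S \<union> {u, e} = insert e (K2 - {j})" "S \<union> {v, e} = insert e (K - {j})"
        "S \<union> {j, u} = K2"
        using jK v u e less.prems by (auto simp: S_def K2_def)
      show False
        using three f2[OF v] f2[OF jK(1)] minuv[OF jK(1)] small unfolding sets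
        by (auto simp: K2_def)
    qed
  qed
qed

section \<open>Series-parallel families and the operations that build them\<close>

definition col :: "'g \<Rightarrow> 'g set set \<Rightarrow> 'g set set" where
  "col x M = (\<Union>B\<in>M. {insert x B})"

text \<open>Elements not in use are loops, and \<open>x\<close> is meant to be one of them:
  \<open>col\<close>, \<open>par\<close> and \<open>ser\<close> bring it into use as a coloop,
  parallel to \<open>y\<close>, or in series with \<open>y\<close>. Writing each operation as a
  union of small blocks, one for each old member, lets commutation rules and initial families be
  computed block by block.\<close>

definition par :: "'g \<Rightarrow> 'g \<Rightarrow> 'g set set \<Rightarrow> 'g set set" where
  "par x y M = (\<Union>B\<in>M. if y \<in> B then {B, insert x (B - {y})} else {B})"

definition ser :: "'g \<Rightarrow> 'g \<Rightarrow> 'g set set \<Rightarrow> 'g set set" where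
  "ser x y M = (\<Union>B\<in>M. if y \<in> B then {insert x B} else {insert x B, insert y B})"

text \<open>The shape of \<open>I \<inter> I'\<close> for covering pairs, at a single twin pair:
  members that miss both \<open>e\<close> and \<open>f\<close> are dropped, and the merged element
  \<open>e\<close> stays only where both are present. \<open>f\<close> becomes a loop.\<close>

definition ident :: "'g \<Rightarrow> 'g \<Rightarrow> 'g set set \<Rightarrow> 'g set set" where
  "ident e f M = (\<Union>B\<in>M. if e \<in> B \<and> f \<in> B then {B - {f}} else if e \<in> B \<or> f \<in> B then {B - {e, f}} else {})"

definition relabel :: "('g \<Rightarrow> 'g) \<Rightarrow> 'g set set \<Rightarrow> 'g set set" where
  "relabel \<pi> M = (\<Union>B\<in>M. {\<pi> ` B})"

inductive Cl :: "'g set \<Rightarrow> 'g set set set \<Rightarrow> 'g set set \<Rightarrow> bool" for R \<A> where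
  base: "M \<in> \<A> \<Longrightarrow> Cl R \<A> M"
| col: "\<lbrakk>Cl R \<A> M; is_loop M x; x \<notin> R\<rbrakk> \<Longrightarrow> Cl R \<A> (col x M)"
| par: "\<lbrakk>Cl R \<A> M; is_loop M x; x \<noteq> y; x \<notin> R; y \<notin> R\<rbrakk> \<Longrightarrow> Cl R \<A> (par x y M)"
| ser: "\<lbrakk>Cl R \<A> M; is_loop M x; x \<noteq> y; x \<notin> R; y \<notin> R\<rbrakk> \<Longrightarrow> Cl R \<A> (ser x y M)"

abbreviation sp_family :: "'g set set \<Rightarrow> bool" where
  "sp_family \<equiv> Cl {} {{{}}}"

lemma col_nonempty [simp]: "col x M \<noteq> {} \<longleftrightarrow> M \<noteq> {}" by (auto simp: col_def)
lemma par_nonempty [simp]: "par x y M \<noteq> {} \<longleftrightarrow> M \<noteq> {}" by (auto simp: par_def)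
lemma ser_nonempty [simp]: "ser x y M \<noteq> {} \<longleftrightarrow> M \<noteq> {}" by (auto simp: ser_def)

lemma Cl_nonempty: "Cl R \<A> M \<Longrightarrow> {} \<notin> \<A> \<Longrightarrow> M \<noteq> {}"
  by (induction rule: Cl.induct) auto

lemma sp_family_nonempty: "sp_family M \<Longrightarrow> M \<noteq> {}"
  by (rule Cl_nonempty) auto

lemma subset_par: "M \<subseteq> par x y M"
  by (auto simp: par_def)

lemma par_loop: "is_loop M y \<Longrightarrow> par x y M = M"
  by (auto simp: par_def is_loop_def)

lemma is_loop_col: "M \<noteq> {} \<Longrightarrow> is_loop (col x M) z \<longleftrightarrow> z \<noteq> x \<and> is_loop M z"
  by (auto simp: is_loop_def col_def)

lemma is_loop_par:
  "x \<noteq> y \<Longrightarrow> is_loop (par x y M) z \<longleftrightarrow> is_loop M z \<and> (z = x \<longrightarrow> is_loop M y)"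
  by (auto simp: is_loop_def par_def split: if_splits)

lemma is_loop_ser:
  "M \<noteq> {} \<Longrightarrow> is_loop (ser x y M) z \<longleftrightarrow> z \<noteq> x \<and> z \<noteq> y \<and> is_loop M z"
proof -
  assume ne: "M \<noteq> {}"
  have "(\<forall>C\<in>(if y \<in> B then {insert x B} else {insert x B, insert y B}). z \<notin> C) \<longleftrightarrow>
      z \<noteq> x \<and> z \<noteq> y \<and> z \<notin> B" for B by auto
  then have "is_loop (ser x y M) z \<longleftrightarrow> (\<forall>B\<in>M. z \<noteq> x \<and> z \<noteq> y \<and> z \<notin> B)"
    by (simp only: is_loop_def ser_def ball_UN)
  then show ?thesis using ne unfolding is_loop_def by (metis all_not_in_conv)
qed

lemma UN_commute:
  assumes "\<And>B. (\<Union>C\<in>F B. G C) = (\<Union>C\<in>G B. F C)"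
  shows "(\<Union>C\<in>(\<Union>B\<in>M. F B). G C) = (\<Union>C\<in>(\<Union>B\<in>M. G B). F C)"
  unfolding UN_UN_flatten by (rule SUP_cong[OF refl assms])

lemmas op_defs = col_def par_def ser_def ident_def

lemma col_col: "col x (col z M) = col z (col x M)"
  unfolding op_defs by (rule UN_commute) (auto simp: insert_commute)

lemma col_par: "x \<notin> {z, u} \<Longrightarrow> col x (par z u M) = par z u (col x M)"
  unfolding op_defs by (rule UN_commute) (auto simp: insert_Diff_if insert_commute)

lemma col_ser: "x \<notin> {z, u} \<Longrightarrow> col x (ser z u M) = ser z u (col x M)"
  unfolding op_defs by (rule UN_commute) (auto simp: insert_Diff_if insert_commute)

lemma Diff_singleton_commute: "A - {x} - {y} = A - {y} - {x}" by blast

lemma par_par: "{x, y} \<inter> {z, u} = {} \<Longrightarrow> par x y (par z u M) = par z u (par x y M)"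
  unfolding op_defs by (rule UN_commute)
    (auto simp: insert_Diff_if insert_commute Diff_singleton_commute[of _ y u])

lemma par_ser: "{x, y} \<inter> {z, u} = {} \<Longrightarrow> par x y (ser z u M) = ser z u (par x y M)"
  unfolding op_defs by (rule UN_commute) (auto simp: insert_Diff_if insert_commute)

lemma ser_ser: "{x, y} \<inter> {z, u} = {} \<Longrightarrow> ser x y (ser z u M) = ser z u (ser x y M)"
  unfolding op_defs by (rule UN_commute) (auto simp: insert_commute)

lemma ident_col: "z \<notin> {e, f} \<Longrightarrow> ident e f (col z M) = col z (ident e f M)"
  unfolding op_defs by (rule UN_commute) (auto simp: insert_Diff_if)

lemma ident_par: "{z, u} \<inter> {e, f} = {} \<Longrightarrow> ident e f (par z u M) = par z u (ident e f M)"
proof -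
  assume d: "{z, u} \<inter> {e, f} = {}"
  have h: "insert z (B - {u}) - X = insert z (B - X - {u})" if "z \<notin> X" for B X using that by blast
  show ?thesis
    unfolding op_defs
  proof (rule UN_commute)
    fix B
    show "(\<Union>C\<in>(if u \<in> B then {B, insert z (B - {u})} else {B}).
        if e \<in> C \<and> f \<in> C then {C - {f}} else if e \<in> C \<or> f \<in> C then {C - {e, f}} else {}) =
      (\<Union>C\<in>(if e \<in> B \<and> f \<in> B then {B - {f}} else if e \<in> B \<or> f \<in> B then {B - {e, f}} else {}).
        if u \<in> C then {C, insert z (C - {u})} else {C})"
      using d by (cases "u \<in> B"; cases "e \<in> B"; cases "f \<in> B") (auto simp: h)
  qed
qed

lemma ident_ser: "{z, u} \<inter> {e, f} = {} \<Longrightarrow> ident e f (ser z u M) = ser z u (ident e f M)"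
  unfolding op_defs by (rule UN_commute) (auto simp: insert_Diff_if)

text \<open>A loop of the final family was never touched by the construction, except by parallel
  extensions of loops, which change nothing. Hence an operation \<open>\<Theta>\<close> at elements
  of \<open>R\<close> and \<open>X\<close> can be commuted through all steps down to the starting
  families, and only these have to be inspected.\<close>

lemma Cl_map:
  assumes "Cl R \<A> M" "\<forall>x\<in>X. is_loop M x" "{} \<notin> \<A>" "R' \<subseteq> R \<union> X"
    and base: "\<And>A. A \<in> \<A> \<Longrightarrow> \<forall>x\<in>X. is_loop A x \<Longrightarrow> Cl R' \<A>' (\<Theta> A)"
    and col: "\<And>M z. z \<notin> R \<union> X \<Longrightarrow> \<Theta> (col z M) = col z (\<Theta> M)"
    and par: "\<And>M z u. z \<notin> R \<union> X \<Longrightarrow> u \<notin> R \<union> X \<Longrightarrow> \<Theta> (par z u M) = par z u (\<Theta> M)"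
    and ser: "\<And>M z u. z \<notin> R \<union> X \<Longrightarrow> u \<notin> R \<union> X \<Longrightarrow> \<Theta> (ser z u M) = ser z u (\<Theta> M)"
    and loop: "\<And>M z. z \<notin> R \<union> X \<Longrightarrow> is_loop M z \<Longrightarrow> is_loop (\<Theta> M) z"
  shows "Cl R' \<A>' (\<Theta> M)"
  using assms(1,2)
proof (induction rule: Cl.induct)
  case (base M) then show ?case using assms(5) by blast
next
  case (col M x)
  have "M \<noteq> {}" using Cl_nonempty col assms by blast
  then have *: "\<forall>z\<in>X. z \<noteq> x \<and> is_loop M z" using col.prems by (simp add: is_loop_col)
  then have x: "x \<notin> R \<union> X" using col by blast
  show ?case unfolding assms(6)[OF x] using col * x loop assms(4) by (intro Cl.col) blast+
next
  case (par M x y)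
  have X: "\<forall>z\<in>X. is_loop M z" using par by (simp add: is_loop_par)
  show ?case
  proof (cases "is_loop M y")
    case True then show ?thesis using par X by (simp add: par_loop)
  next
    case False
    then have xy: "x \<notin> R \<union> X" "y \<notin> R \<union> X" using par X by (auto simp: is_loop_par)
    show ?thesis unfolding assms(7)[OF xy] using par X xy loop assms(4) by (intro Cl.par) blast+
  qed
next
  case (ser M x y)
  have "M \<noteq> {}" using Cl_nonempty ser assms by blast
  then have X: "\<forall>z\<in>X. z \<noteq> x \<and> z \<noteq> y \<and> is_loop M z" using ser.prems by (simp add: is_loop_ser)
  then have xy: "x \<notin> R \<union> X" "y \<notin> R \<union> X" using ser by blast+
  show ?case unfolding assms(8)[OF xy] using ser X xy loop assms(4) by (intro Cl.ser) blast+
qed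

lemma Cl_mono:
  assumes "Cl R \<A> M" "\<And>A. A \<in> \<A> \<Longrightarrow> Cl R' \<A>' A" "R' \<subseteq> R"
  shows "Cl R' \<A>' M"
  using assms(1)
proof (induction rule: Cl.induct)
  case (base M) then show ?case using assms(2) by blast
next
  case (col M x) then show ?case using assms(3) by (blast intro: Cl.col)
next
  case (par M x y) then show ?case using assms(3) by (blast intro: Cl.par)
next
  case (ser M x y) then show ?case using assms(3) by (blast intro: Cl.ser)
qed

text \<open>Steps that avoid \<open>f\<close> never change whether \<open>f\<close> is a
  loop.\<close>

lemma Cl_nonloop_base:
  assumes "Cl R \<A> M" "f \<in> R" "\<not> is_loop M f" "{} \<notin> \<A>"
  shows "Cl R {A\<in>\<A>. \<not> is_loop A f} M"
  using assms(1,3)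
proof (induction rule: Cl.induct)
  case (base M) then show ?case by (simp add: Cl.base)
next
  case (col M x)
  have "M \<noteq> {}" using Cl_nonempty col assms by blast
  then show ?case using col assms(2) by (intro Cl.col) (auto simp: is_loop_col)
next
  case (par M x y) then show ?case using assms(2) by (intro Cl.par) (auto simp: is_loop_par)
next
  case (ser M x y)
  have "M \<noteq> {}" using Cl_nonempty ser assms by blast
  then show ?case using ser assms(2) by (intro Cl.ser) (auto simp: is_loop_ser)
qed

lemma is_loop_relabel: "inj \<pi> \<Longrightarrow> is_loop M x \<Longrightarrow> is_loop (relabel \<pi> M) (\<pi> x)"
  by (auto simp: is_loop_def relabel_def inj_def)

lemma relabel_col: "relabel \<pi> (col x M) = col (\<pi> x) (relabel \<pi> M)"
  by (auto simp: relabel_def col_def)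

lemma relabel_par: "inj \<pi> \<Longrightarrow> relabel \<pi> (par x y M) = par (\<pi> x) (\<pi> y) (relabel \<pi> M)"
  unfolding relabel_def par_def UN_UN_flatten
  by (rule SUP_cong[OF refl]) (simp add: inj_image_mem_iff image_set_diff insert_commute)

lemma relabel_ser: "inj \<pi> \<Longrightarrow> relabel \<pi> (ser x y M) = ser (\<pi> x) (\<pi> y) (relabel \<pi> M)"
  unfolding relabel_def ser_def UN_UN_flatten
  by (rule SUP_cong[OF refl]) (simp add: inj_image_mem_iff insert_commute)

lemma Cl_relabel:
  assumes "Cl R \<A> M" "inj \<pi>"
  shows "Cl (\<pi> ` R) (relabel \<pi> ` \<A>) (relabel \<pi> M)"
  using assms(1)
proof (induction rule: Cl.induct)
  case (base M) then show ?case by (intro Cl.base) blast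
next
  case (col M x) then show ?case using assms(2)
    by (simp add: relabel_col inj_image_mem_iff Cl.col is_loop_relabel)
next
  case (par M x y) then show ?case using assms(2)
    by (simp add: relabel_par inj_image_mem_iff inj_eq Cl.par is_loop_relabel)
next
  case (ser M x y) then show ?case using assms(2)
    by (simp add: relabel_ser inj_image_mem_iff inj_eq Cl.ser is_loop_relabel)
qed

abbreviation swp :: "'g \<Rightarrow> 'g \<Rightarrow> 'g \<Rightarrow> 'g" where
  "swp \<equiv> Transposition.transpose"

lemma swp_image:
  "swp x y ` B = (if x \<in> B then if y \<in> B then B else insert y (B - {x})
     else if y \<in> B then insert x (B - {y}) else B)"
  by (auto simp: Transposition.transpose_def image_iff split: if_splits)

text \<open>The two elements of a parallel pair are interchangeable. Together with the series
  version this reduces later claims about the new element \<open>x\<close> to the old element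
  \<open>y\<close>.\<close>

lemma relabel_par_self:
  assumes "is_loop M x" "x \<noteq> y"
  shows "relabel (swp x y) (par x y M) = par x y M"
proof -
  have "(\<Union>C\<in>(if y \<in> B then {B, insert x (B - {y})} else {B}). {swp x y ` C}) =
     (if y \<in> B then {B, insert x (B - {y})} else {B})" if "B \<in> M" for B
    using that assms by (auto simp: swp_image is_loop_def insert_absorb)
  then show ?thesis unfolding relabel_def par_def UN_UN_flatten by (rule SUP_cong[OF refl])
qed

lemma relabel_ser_self:
  assumes "is_loop M x" "x \<noteq> y"
  shows "relabel (swp x y) (ser x y M) = ser x y M"
proof -
  have "(\<Union>C\<in>(if y \<in> B then {insert x B} else {insert x B, insert y B}). {swp x y ` C}) =
     (if y \<in> B then {insert x B} else {insert x B, insert y B})" if "B \<in> M" for B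
    using that assms by (auto simp: swp_image is_loop_def insert_absorb)
  then show ?thesis unfolding relabel_def ser_def UN_UN_flatten by (rule SUP_cong[OF refl])
qed

section \<open>Rebuilding a family around one marked element\<close>

definition pointed_bases :: "'g \<Rightarrow> 'g set set set" where
  "pointed_bases f = {{{}}, {{f}}} \<union> {{{e}, {f}} | e. e \<noteq> f}"

lemma pointed_bases_nonempty: "{} \<notin> pointed_bases f"
  by (auto simp: pointed_bases_def)

lemma relabel_pointed_bases: "inj \<pi> \<Longrightarrow> relabel \<pi> ` pointed_bases f \<subseteq> pointed_bases (\<pi> f)"
  by (auto simp: pointed_bases_def relabel_def inj_eq)

lemma pointed_col:
  assumes "Cl {f} (pointed_bases f) M" "is_loop M f"
  shows "Cl {f} (pointed_bases f) (col f M)"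
proof (rule Cl_map[OF assms(1), of "{f}"])
  fix A assume "A \<in> pointed_bases f" "\<forall>x\<in>{f}. is_loop A x"
  then have "A = {{}}" by (auto simp: pointed_bases_def is_loop_def)
  then show "Cl {f} (pointed_bases f) (col f A)" by (intro Cl.base) (simp add: pointed_bases_def col_def)
qed (use assms in \<open>auto simp: pointed_bases_nonempty col_col col_par col_ser is_loop_def\<close>, auto simp: col_def)

lemma pointed_par:
  assumes "Cl {y} (pointed_bases y) M" "is_loop M x" "x \<noteq> y"
  shows "Cl {y} (pointed_bases y) (par x y M)"
proof (rule Cl_map[OF assms(1), of "{x}"])
  fix A assume A: "A \<in> pointed_bases y" and l: "\<forall>x\<in>{x}. is_loop A x"
  consider "A = {{}}" | "A = {{y}}" | e where "A = {{e}, {y}}" "e \<noteq> y"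
    using A by (auto simp: pointed_bases_def)
  then show "Cl {y} (pointed_bases y) (par x y A)"
  proof cases
    case 1 then show ?thesis using A by (simp add: par_def Cl.base)
  next
    case 2 then have "par x y A = {{x}, {y}}" using assms by (auto simp: par_def)
    then show ?thesis using assms by (intro Cl.base) (auto simp: pointed_bases_def)
  next
    case 3
    then have "par x y A = par x e A" using assms by (auto simp: par_def)
    moreover have "x \<noteq> e" using 3 l by (auto simp: is_loop_def)
    ultimately show ?thesis using Cl.par[OF Cl.base[OF A], of x e] l 3 assms by simp
  qed
qed (use assms in \<open>auto simp: pointed_bases_nonempty col_par par_par par_ser is_loop_par\<close>)

lemma pointed_ser:
  assumes "Cl {y} (pointed_bases y) M" "is_loop M x" "x \<noteq> y"
  shows "Cl {y} (pointed_bases y) (ser x y M)"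
proof (rule Cl_map[OF assms(1), of "{x}"])
  fix A assume A: "A \<in> pointed_bases y" and l: "\<forall>x\<in>{x}. is_loop A x"
  consider "A = {{}}" | "A = {{y}}" | e where "A = {{e}, {y}}" "e \<noteq> y"
    using A by (auto simp: pointed_bases_def)
  then show "Cl {y} (pointed_bases y) (ser x y A)"
  proof cases
    case 1 then show ?thesis using assms by (intro Cl.base) (auto simp: pointed_bases_def ser_def)
  next
    case 2 then have "ser x y A = col x A" using assms by (auto simp: ser_def col_def)
    then show ?thesis using Cl.col[OF Cl.base[OF A]] l assms by simp
  next
    case 3
    then have "ser x y A = ser x e A" using assms by (auto simp: ser_def)
    moreover have "x \<noteq> e" using 3 l by (auto simp: is_loop_def)
    ultimately show ?thesis using Cl.ser[OF Cl.base[OF A], of x e] l 3 assms by simp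
  qed
next
  fix M z assume "z \<notin> {y} \<union> {x}" "is_loop M z"
  then show "is_loop (ser x y M) z" by (auto simp: is_loop_def ser_def split: if_splits)
qed (use assms in \<open>auto simp: pointed_bases_nonempty col_ser par_ser[symmetric] ser_ser\<close>)

lemma pointed_swap:
  assumes "Cl {y} (pointed_bases y) M" "relabel (swp x y) M = M"
  shows "Cl {x} (pointed_bases x) M"
proof -
  have "Cl (swp x y ` {y}) (relabel (swp x y) ` pointed_bases y) M"
    using Cl_relabel[OF assms(1), of "swp x y"] assms(2) by simp
  then show ?thesis
    using relabel_pointed_bases[of "swp x y" y] by (elim Cl_mono) (auto intro: Cl.base)
qed

text \<open>The starting families record the possible roles of \<open>f\<close>: loop, coloop, or
  half of a parallel pair. An operation at \<open>f\<close> commutes down to the start, where it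
  either produces another of these families or becomes an operation at the partner of
  \<open>f\<close>; if \<open>f\<close> is the new element, swapping with \<open>y\<close> reduces
  to that case.\<close>

lemma sp_family_pointed: "sp_family M \<Longrightarrow> Cl {f} (pointed_bases f) M"
proof (induction arbitrary: f rule: Cl.induct)
  case (base M) then show ?case by (intro Cl.base) (simp add: pointed_bases_def)
next
  case (col M x) then show ?case by (cases "x = f") (auto intro: pointed_col Cl.col)
next
  case (par M x y)
  consider "f = x" | "f = y" | "f \<notin> {x, y}" by blast
  then show ?case
  proof cases
    case 1 then show ?thesis
      using par pointed_swap[OF pointed_par[OF par.IH(1)] relabel_par_self] by blast
  qed (use par in \<open>auto intro: pointed_par Cl.par\<close>)
next
  case (ser M x y)
  consider "f = x" | "f = y" | "f \<notin> {x, y}" by blast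
  then show ?case
  proof cases
    case 1 then show ?thesis
      using ser pointed_swap[OF pointed_ser[OF ser.IH(1)] relabel_ser_self] by blast
  qed (use ser in \<open>auto intro: pointed_ser Cl.ser\<close>)
qed

lemma sp_family_relabel: "sp_family M \<Longrightarrow> inj \<pi> \<Longrightarrow> sp_family (relabel \<pi> M)"
  using Cl_relabel[of "{}" "{{{}}}" M \<pi>] by (simp add: relabel_def)

section \<open>Initial families and lineality spaces under the operations\<close>

abbreviation pv :: "('g \<Rightarrow> 'g) \<Rightarrow> real ^ 'g::finite \<Rightarrow> real ^ 'g" where
  "pv \<pi> v \<equiv> (\<chi> i. v $ \<pi> i)"

text \<open>If in every block the heaviest members exceed the weight of \<open>B\<close> by the same
  \<open>k\<close>, then maximizing over the union amounts to maximizing over the blocks and then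
  inside them.\<close>

lemma ini_UN:
  assumes F': "\<And>B. B \<in> M \<Longrightarrow> F' B \<noteq> {} \<and> F' B \<subseteq> F B"
    and eq: "\<And>B C. B \<in> M \<Longrightarrow> C \<in> F' B \<Longrightarrow> wt v C = wt v B + k"
    and less: "\<And>B C. B \<in> M \<Longrightarrow> C \<in> F B \<Longrightarrow> C \<notin> F' B \<Longrightarrow> wt v C < wt v B + k"
  shows "ini (\<Union>B\<in>M. F B) v = (\<Union>B\<in>ini M v. F' B)"
proof (intro equalityI subsetI)
  fix C assume C: "C \<in> ini (\<Union>B\<in>M. F B) v"
  then obtain B where B: "B \<in> M" "C \<in> F B" by (auto simp: ini_def)
  have ge: "wt v B' + k \<le> wt v C" if B': "B' \<in> M" for B'
  proof -
    obtain C' where C': "C' \<in> F' B'" using F'[OF B'] by blast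
    then have "wt v C' \<le> wt v C" using C F'[OF B'] B' unfolding ini_def by blast
    then show ?thesis using eq[OF B' C'] by simp
  qed
  have CF: "C \<in> F' B" using less[OF B] ge[OF B(1)] by force
  then have "wt v B' \<le> wt v B" if "B' \<in> M" for B' using ge[OF that] eq[OF B(1) CF] by simp
  then show "C \<in> (\<Union>B\<in>ini M v. F' B)" using CF B by (auto simp: ini_def)
next
  fix C assume "C \<in> (\<Union>B\<in>ini M v. F' B)"
  then obtain B where B: "B \<in> M" "\<And>B'. B' \<in> M \<Longrightarrow> wt v B' \<le> wt v B" "C \<in> F' B"
    by (auto simp: ini_def)
  have "wt v D \<le> wt v C" if D: "D \<in> F B'" "B' \<in> M" for D B'
  proof -
    have "wt v D \<le> wt v B' + k" using eq[OF D(2)] less[OF D(2) D(1)] by force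
    then show ?thesis using B(2)[OF D(2)] eq[OF B(1) B(3)] by simp
  qed
  moreover have "C \<in> (\<Union>B\<in>M. F B)" using B F' by blast
  ultimately show "C \<in> ini (\<Union>B\<in>M. F B) v" by (auto simp: ini_def)
qed

lemma wt_pv: "inj \<pi> \<Longrightarrow> wt v (\<pi> ` B) = wt (pv \<pi> v) B"
  by (simp add: wt_def sum.reindex inj_on_subset[of \<pi> UNIV])

lemma ini_relabel: "inj \<pi> \<Longrightarrow> ini (relabel \<pi> M) v = relabel \<pi> (ini M (pv \<pi> v))"
proof -
  assume i: "inj \<pi>"
  have "ini (\<Union>B\<in>M. {\<pi> ` B}) v = {\<pi> ` B | B. B \<in> ini M (pv \<pi> v)}"
    by (auto simp: ini_def wt_pv[OF i])
  then show ?thesis unfolding relabel_def by auto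
qed

lemma ini_col: "is_loop M x \<Longrightarrow> ini (col x M) v = col x (ini M v)"
  unfolding col_def by (rule ini_UN[where k = "v $ x"]) (auto simp: is_loop_def wt_insert)

text \<open>Only the order of \<open>v $ x\<close> and \<open>v $ y\<close> matters here and below:
  at equality the extension survives in the initial family; otherwise the lighter of two parallel
  elements becomes a loop and the heavier of two series elements a coloop.\<close>

lemma ini_par_eq:
  "is_loop M x \<Longrightarrow> x \<noteq> y \<Longrightarrow> v $ x = v $ y \<Longrightarrow> ini (par x y M) v = par x y (ini M v)"
  unfolding par_def
  by (rule ini_UN[where k = 0]) (auto simp: is_loop_def wt_exchange split: if_splits)

lemma ini_par_less:
  assumes "is_loop M x" "x \<noteq> y" "v $ x < v $ y" shows "ini (par x y M) v = ini M v"
proof -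
  have "ini (par x y M) v = (\<Union>B\<in>ini M v. {B})"
    unfolding par_def using assms
    by (intro ini_UN[where k = 0]) (auto simp: is_loop_def wt_exchange split: if_splits)
  then show ?thesis by simp
qed

lemma ini_ser_eq:
  "is_loop M x \<Longrightarrow> x \<noteq> y \<Longrightarrow> v $ x = v $ y \<Longrightarrow> ini (ser x y M) v = ser x y (ini M v)"
  unfolding ser_def
  by (rule ini_UN[where k = "v $ x"]) (auto simp: is_loop_def wt_insert split: if_splits)

lemma ini_ser_greater:
  assumes "is_loop M x" "x \<noteq> y" "v $ y < v $ x" shows "ini (ser x y M) v = col x (ini M v)"
  unfolding ser_def col_def using assms
  by (intro ini_UN[where k = "v $ x"]) (auto simp: is_loop_def wt_insert split: if_splits)

lemma ini_par_greater:
  assumes "is_loop M x" "x \<noteq> y" "v $ y < v $ x"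
  shows "ini (par x y M) v = relabel (swp x y) (ini M (pv (swp x y) v))"
  using ini_relabel[of "swp x y" "par x y M" v] ini_par_less[OF assms(1,2), of "pv (swp x y) v"] assms
  by (simp add: relabel_par_self)

lemma ini_ser_less:
  assumes "is_loop M x" "x \<noteq> y" "v $ x < v $ y"
  shows "ini (ser x y M) v = relabel (swp x y) (col x (ini M (pv (swp x y) v)))"
  using ini_relabel[of "swp x y" "ser x y M" v] ini_ser_greater[OF assms(1,2), of "pv (swp x y) v"] assms
  by (simp add: relabel_ser_self)

lemma is_loop_mono: "is_loop M x \<Longrightarrow> G \<subseteq> M \<Longrightarrow> is_loop G x"
  by (auto simp: is_loop_def)

lemma is_loop_ini: "is_loop M x \<Longrightarrow> is_loop (ini M v) x"
  by (rule is_loop_mono[OF _ ini_subset])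

lemma sp_family_ini: "sp_family M \<Longrightarrow> sp_family (ini M v)"
proof (induction arbitrary: v rule: Cl.induct)
  case (base M)
  have "ini {{}} v = {{}}" by (auto simp: ini_def)
  then show ?case using base by (simp add: Cl.base)
next
  case (col M x) then show ?case by (simp add: ini_col Cl.col is_loop_ini)
next
  case (par M x y)
  consider "v $ x = v $ y" | "v $ x < v $ y" | "v $ y < v $ x" by linarith
  then show ?case
    by cases (use par in \<open>auto simp: ini_par_eq ini_par_less ini_par_greater
      intro: Cl.par is_loop_ini sp_family_relabel\<close>)
next
  case (ser M x y)
  consider "v $ x = v $ y" | "v $ x < v $ y" | "v $ y < v $ x" by linarith
  then show ?case
    by cases (use ser in \<open>auto simp: ini_ser_eq ini_ser_less ini_ser_greater
      intro!: Cl.ser Cl.col is_loop_ini sp_family_relabel\<close>)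
qed

lemma lin_par:
  assumes "is_loop M x" "x \<noteq> y" "\<not> is_loop M y"
  shows "lin (par x y M) = {v\<in>lin M. v $ x = v $ y}"
proof (intro equalityI subsetI)
  fix v assume v: "v \<in> lin (par x y M)"
  obtain B where B: "B \<in> M" "y \<in> B" using assms by (auto simp: is_loop_def)
  then have "insert x (B - {y}) \<in> par x y M" "B \<in> par x y M" by (auto simp: par_def)
  then have "wt v (insert x (B - {y})) = wt v B" by (rule linD[OF v])
  then have "v $ x = v $ y" using B assms by (simp add: wt_exchange is_loop_def)
  then show "v \<in> {v\<in>lin M. v $ x = v $ y}" using v lin_antimono[OF subset_par] by blast
next
  fix v assume v: "v \<in> {v\<in>lin M. v $ x = v $ y}"
  then have "ini (par x y M) v = par x y M" using ini_par_eq[of M x y v] assms ini_lin[of v M] by simp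
  then show "v \<in> lin (par x y M)" by (rule ini_self_imp_lin)
qed

lemma lin_ser_subset: "is_loop M x \<Longrightarrow> v \<in> lin (ser x y M) \<Longrightarrow> v \<in> lin M"
proof (rule linI)
  fix B C assume l: "is_loop M x" and v: "v \<in> lin (ser x y M)" and B: "B \<in> M" and C: "C \<in> M"
  have "insert x B \<in> ser x y M" "insert x C \<in> ser x y M" using B C by (auto simp: ser_def)
  then have "wt v (insert x B) = wt v (insert x C)" by (rule linD[OF v])
  then show "wt v B = wt v C" using l B C by (simp add: wt_insert is_loop_def)
qed

lemma lin_ser:
  assumes "is_loop M x" "x \<noteq> y" "\<not> is_coloop M y"
  shows "lin (ser x y M) = {v\<in>lin M. v $ x = v $ y}"
proof (intro equalityI subsetI)
  fix v assume v: "v \<in> lin (ser x y M)"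
  obtain B where B: "B \<in> M" "y \<notin> B" using assms by (auto simp: is_coloop_def)
  then have "insert x B \<in> ser x y M" "insert y B \<in> ser x y M" by (auto simp: ser_def)
  then have "wt v (insert x B) = wt v (insert y B)" by (rule linD[OF v])
  then have "v $ x = v $ y" using B assms by (simp add: wt_insert is_loop_def)
  then show "v \<in> {v\<in>lin M. v $ x = v $ y}" using v lin_ser_subset[OF assms(1)] by blast
next
  fix v assume v: "v \<in> {v\<in>lin M. v $ x = v $ y}"
  then have "ini (ser x y M) v = ser x y M" using ini_ser_eq[of M x y v] assms ini_lin[of v M] by simp
  then show "v \<in> lin (ser x y M)" by (rule ini_self_imp_lin)
qed

lemma lin_col: "is_loop M x \<Longrightarrow> lin (col x M) = lin M"
proof (intro equalityI subsetI)
  fix v assume l: "is_loop M x" and v: "v \<in> lin (col x M)"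
  show "v \<in> lin M"
  proof (rule linI)
    fix B C assume B: "B \<in> M" and C: "C \<in> M"
    have "insert x B \<in> col x M" "insert x C \<in> col x M" using B C by (auto simp: col_def)
    then have "wt v (insert x B) = wt v (insert x C)" by (rule linD[OF v])
    then show "wt v B = wt v C" using l B C by (simp add: wt_insert is_loop_def)
  qed
next
  fix v assume l: "is_loop M x" and v: "v \<in> lin M"
  then show "v \<in> lin (col x M)" using ini_col[OF l, of v] ini_lin[OF v] ini_self_imp_lin by metis
qed

lemma lin_relabel_self:
  assumes "inj \<pi>" "relabel \<pi> M = M" "v \<in> lin M" shows "pv \<pi> v \<in> lin M"
proof (rule linI)
  fix B C assume "B \<in> M" "C \<in> M"
  then have "\<pi> ` B \<in> M" "\<pi> ` C \<in> M" using assms(2) by (auto simp: relabel_def)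
  then show "wt (pv \<pi> v) B = wt (pv \<pi> v) C"
    unfolding wt_pv[OF assms(1), symmetric] by (rule linD[OF assms(3)])
qed

lemma par_iff: "B \<in> par x y M \<longleftrightarrow> (\<exists>B0\<in>M. B = B0 \<or> (y \<in> B0 \<and> B = insert x (B0 - {y})))"
proof -
  have "B \<in> (if y \<in> B0 then {B0, insert x (B0 - {y})} else {B0}) \<longleftrightarrow>
    B = B0 \<or> (y \<in> B0 \<and> B = insert x (B0 - {y}))" for B0 by simp
  then show ?thesis unfolding par_def by (simp only: UN_iff)
qed

lemma ser_iff: "B \<in> ser x y M \<longleftrightarrow> (\<exists>B0\<in>M. B = insert x B0 \<or> (y \<notin> B0 \<and> B = insert y B0))"
proof -
  have "B \<in> (if y \<in> B0 then {insert x B0} else {insert x B0, insert y B0}) \<longleftrightarrow>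
    B = insert x B0 \<or> (y \<notin> B0 \<and> B = insert y B0)" for B0 by simp
  then show ?thesis unfolding ser_def by (simp only: UN_iff)
qed

text \<open>A lineality vector agrees on the two elements of each extension unless they are loops or
  coloops, so its superlevel sets are unions of components. Members can be recombined freely across
  such a separation.\<close>

lemma sp_family_mix:
  fixes M :: "'g::finite set set"
  assumes "sp_family M" "v \<in> lin M" "B \<in> M" "C \<in> M"
  shows "(B \<inter> {i. c < v $ i}) \<union> (C - {i. c < v $ i}) \<in> M"
  using assms
proof (induction arbitrary: B C rule: Cl.induct)
  case (base M) then show ?case by auto
next
  case (col M x)
  define S where "S = {i. c < v $ i}"
  have IH: "(B0 \<inter> S) \<union> (C0 - S) \<in> M" if "B0 \<in> M" "C0 \<in> M" for B0 C0
    using col that lin_col unfolding S_def by blast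
  obtain B0 C0 where "B0 \<in> M" "C0 \<in> M" and BC: "B = insert x B0" "C = insert x C0"
    using col.prems by (auto simp: col_def)
  then have "(B0 \<inter> S) \<union> (C0 - S) \<in> M" using IH by blast
  moreover have "(B \<inter> S) \<union> (C - S) = insert x ((B0 \<inter> S) \<union> (C0 - S))" unfolding BC by blast
  ultimately show ?case unfolding S_def[symmetric] col_def by blast
next
  case (par M x y)
  define S where "S = {i. c < v $ i}"
  show ?case
  proof (cases "is_loop M y")
    case True then show ?thesis using par by (simp add: par_loop)
  next
    case False
    have lin: "v \<in> lin M" "v $ x = v $ y" using par lin_par[OF _ _ False] by blast+
    then have S: "x \<in> S \<longleftrightarrow> y \<in> S" by (simp add: S_def)
    obtain B0 C0 where B0: "B0 \<in> M" "C0 \<in> M"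
      and B: "B = B0 \<or> (y \<in> B0 \<and> B = insert x (B0 - {y}))"
      and C: "C = C0 \<or> (y \<in> C0 \<and> C = insert x (C0 - {y}))"
      using par.prems(2,3) unfolding par_iff by blast
    define D where "D = (B0 \<inter> S) \<union> (C0 - S)"
    have D: "D \<in> M" using par.IH[OF lin(1) B0] by (simp add: D_def S_def)
    have "(B \<inter> S) \<union> (C - S) = D \<or> (y \<in> D \<and> (B \<inter> S) \<union> (C - S) = insert x (D - {y}))"
    proof (cases "y \<in> S")
      case True
      then have "C - S = C0 - S" using C S by blast
      then show ?thesis using B S True unfolding D_def by blast
    next
      case False
      then have "B \<inter> S = B0 \<inter> S" using B S by blast
      then show ?thesis using C S False unfolding D_def by blast
    qed
    then show ?thesis unfolding S_def[symmetric] par_iff using D by blast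
  qed
next
  case (ser M x y)
  define S where "S = {i. c < v $ i}"
  have lin: "v \<in> lin M" using ser lin_ser_subset by blast
  obtain B0 C0 where B0: "B0 \<in> M" "C0 \<in> M"
    and B: "B = insert x B0 \<or> (y \<notin> B0 \<and> B = insert y B0)"
    and C: "C = insert x C0 \<or> (y \<notin> C0 \<and> C = insert y C0)"
    using ser.prems(2,3) unfolding ser_iff by blast
  define D where "D = (B0 \<inter> S) \<union> (C0 - S)"
  have D: "D \<in> M" using ser.IH[OF lin B0] by (simp add: D_def S_def)
  have "(B \<inter> S) \<union> (C - S) = insert x D \<or> (y \<notin> D \<and> (B \<inter> S) \<union> (C - S) = insert y D)"
  proof (cases "is_coloop M y")
    case True
    then have "B = insert x B0" "C = insert x C0" using B C B0 by (auto simp: is_coloop_def)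
    then show ?thesis unfolding D_def by blast
  next
    case False
    then have "v $ x = v $ y" using ser lin_ser[OF _ _ False] by blast
    then have "x \<in> S \<longleftrightarrow> y \<in> S" by (simp add: S_def)
    then have S: "x \<in> S \<longleftrightarrow> y \<in> S" .
    show ?thesis
    proof (cases "y \<in> S")
      case True
      then have "C - S = C0 - S" using C S by blast
      then show ?thesis using B S True unfolding D_def by blast
    next
      case False
      then have "B \<inter> S = B0 \<inter> S" using B S by blast
      then show ?thesis using C S False unfolding D_def by blast
    qed
  qed
  then show ?case unfolding S_def[symmetric] ser_iff using D by blast
qed

section \<open>Two elements in different components, and their identification\<close>

lemma sp_family_split:
  fixes M :: "'g::finite set set"
  assumes "sp_family M" "v \<in> lin M" "v $ e \<noteq> v $ f"
  obtains S where "e \<in> S" "f \<notin> S" "\<And>B C. B \<in> M \<Longrightarrow> C \<in> M \<Longrightarrow> (B \<inter> S) \<union> (C - S) \<in> M"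
proof (cases "v $ f < v $ e")
  case True then show ?thesis using that[of "{i. v $ f < v $ i}"] sp_family_mix[OF assms(1,2)] by simp
next
  case False
  have "- v \<in> lin M" using assms(2) subspace_neg subspace_lin by blast
  then show ?thesis
    using that[of "{i. - v $ f < (- v) $ i}"] sp_family_mix[OF assms(1), of "- v" _ _ "- v $ f"] False assms
    by simp
qed

text \<open>All four are direct sums of a piece at \<open>e\<close>, which is a coloop or the
  parallel pair \<open>e, g\<close>, and a piece at \<open>f\<close>, which is a coloop or the
  parallel pair \<open>f, h\<close>.\<close>

definition two_pointed_bases :: "'g \<Rightarrow> 'g \<Rightarrow> 'g set set set" where
  "two_pointed_bases e f = {A. A = {{e, f}} \<or> (\<exists>g. g \<notin> {e, f} \<and> A = {{e, f}, {g, f}}) \<or>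
     (\<exists>h. h \<notin> {e, f} \<and> A = {{e, f}, {e, h}}) \<or>
     (\<exists>g h. g \<notin> {e, f} \<and> h \<notin> {e, f} \<and> g \<noteq> h \<and> A = {{e, f}, {e, h}, {g, f}, {g, h}})}"

lemma two_pointed_cases:
  assumes "A \<in> two_pointed_bases e f"
  obtains "A = {{e, f}}" | g where "g \<notin> {e, f}" "A = {{e, f}, {g, f}}"
  | h where "h \<notin> {e, f}" "A = {{e, f}, {e, h}}"
  | g h where "g \<notin> {e, f}" "h \<notin> {e, f}" "g \<noteq> h" "A = {{e, f}, {e, h}, {g, f}, {g, h}}"
  using assms unfolding two_pointed_bases_def mem_Collect_eq
  apply (elim disjE exE conjE)
     apply (erule that(1))
    apply (erule (1) that(2))
   apply (erule (1) that(3))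
  apply (erule (3) that(4))
  done

lemma two_pointed_bases_nonempty: "{} \<notin> two_pointed_bases e f"
  by (auto simp: two_pointed_bases_def)

lemma two_pointed_intros:
  "{{e, f}} \<in> two_pointed_bases e f"
  "g \<notin> {e, f} \<Longrightarrow> {{e, f}, {g, f}} \<in> two_pointed_bases e f"
  "h \<notin> {e, f} \<Longrightarrow> {{e, f}, {e, h}} \<in> two_pointed_bases e f"
  "g \<notin> {e, f} \<Longrightarrow> h \<notin> {e, f} \<Longrightarrow> g \<noteq> h \<Longrightarrow> {{e, f}, {e, h}, {g, f}, {g, h}} \<in> two_pointed_bases e f"
  unfolding two_pointed_bases_def mem_Collect_eq
  by (rule disjI1, rule refl) (rule disjI2, metis)+

lemma relabel_two_pointed_bases:
  assumes "inj \<pi>" shows "relabel \<pi> ` two_pointed_bases e f \<subseteq> two_pointed_bases (\<pi> e) (\<pi> f)"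
proof
  fix A' assume "A' \<in> relabel \<pi> ` two_pointed_bases e f"
  then obtain A where A: "A \<in> two_pointed_bases e f" and A': "A' = relabel \<pi> A" by blast
  have n: "\<pi> g \<notin> {\<pi> e, \<pi> f}" if "g \<notin> {e, f}" for g using that assms by (auto simp: inj_eq)
  have ne: "\<pi> g \<noteq> \<pi> h" if "g \<noteq> h" for g h using that assms by (auto simp: inj_eq)
  from A show "A' \<in> two_pointed_bases (\<pi> e) (\<pi> f)" unfolding A'
  proof (cases rule: two_pointed_cases)
    case 1
    then have "relabel \<pi> A = {{\<pi> e, \<pi> f}}" by (simp add: relabel_def)
    then show "relabel \<pi> A \<in> two_pointed_bases (\<pi> e) (\<pi> f)" by (simp add: two_pointed_intros)
  next
    case (2 g)
    then have "relabel \<pi> A = {{\<pi> e, \<pi> f}, {\<pi> g, \<pi> f}}" by (simp add: relabel_def insert_commute)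
    then show "relabel \<pi> A \<in> two_pointed_bases (\<pi> e) (\<pi> f)" using two_pointed_intros(2)[OF n[OF 2(1)]] by simp
  next
    case (3 h)
    then have "relabel \<pi> A = {{\<pi> e, \<pi> f}, {\<pi> e, \<pi> h}}" by (simp add: relabel_def insert_commute)
    then show "relabel \<pi> A \<in> two_pointed_bases (\<pi> e) (\<pi> f)" using two_pointed_intros(3)[OF n[OF 3(1)]] by simp
  next
    case (4 g h)
    then have "relabel \<pi> A = {{\<pi> e, \<pi> f}, {\<pi> e, \<pi> h}, {\<pi> g, \<pi> f}, {\<pi> g, \<pi> h}}"
      by (simp add: relabel_def insert_commute)
    then show "relabel \<pi> A \<in> two_pointed_bases (\<pi> e) (\<pi> f)"
      using two_pointed_intros(4)[OF n[OF 4(1)] n[OF 4(2)] ne[OF 4(3)]] by simp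
  qed
qed

lemma pointed_cases:
  assumes "A \<in> pointed_bases f" "\<not> is_loop A f"
  obtains "A = {{f}}" | g where "g \<noteq> f" "A = {{g}, {f}}"
proof -
  have "A = {{}} \<or> A = {{f}} \<or> (\<exists>g. g \<noteq> f \<and> A = {{g}, {f}})"
    using assms(1) unfolding pointed_bases_def by blast
  moreover have "A \<noteq> {{}}" using assms(2) by (auto simp: is_loop_def)
  ultimately show ?thesis using that by blast
qed

lemma two_pointed_col:
  assumes "Cl {f} (pointed_bases f) M" "is_loop M e" "\<not> is_loop M f" "e \<noteq> f"
  shows "Cl {e, f} (two_pointed_bases e f) (col e M)"
proof -
  have M: "Cl {f} {A\<in>pointed_bases f. \<not> is_loop A f} M"
    by (rule Cl_nonloop_base[OF assms(1) _ assms(3) pointed_bases_nonempty]) simp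
  show ?thesis
  proof (rule Cl_map[OF M, where X = "{e}" and \<Theta> = "col e"])
  fix A assume A: "A \<in> {A\<in>pointed_bases f. \<not> is_loop A f}" and l: "\<forall>x\<in>{e}. is_loop A x"
  from A have "A \<in> pointed_bases f" "\<not> is_loop A f" by blast+
  then show "Cl {e, f} (two_pointed_bases e f) (col e A)"
  proof (cases rule: pointed_cases)
    case 1
    then have "col e A = {{e, f}}" by (auto simp: col_def)
    then show ?thesis by (simp add: Cl.base two_pointed_intros)
  next
    case (2 g)
    then have "col e A = {{e, f}, {e, g}}" by (simp add: col_def insert_commute)
    moreover have "g \<noteq> e" using 2 l by (auto simp: is_loop_def)
    ultimately show ?thesis using 2 by (simp add: Cl.base two_pointed_intros)
  qed
next
  fix M z assume "z \<notin> {f} \<union> {e}" "is_loop M z"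
  then show "is_loop (col e M) z" by (auto simp: is_loop_def col_def)
qed (use assms in \<open>auto simp: pointed_bases_nonempty col_col col_par col_ser\<close>)
qed

text \<open>Subdividing a loop \<open>e\<close> makes \<open>e\<close> and \<open>x\<close> a
  parallel pair, so \<open>x\<close> takes the place of the partner \<open>g\<close> in the starting
  family.\<close>

lemma two_pointed_ser0:
  assumes "Cl {f} (pointed_bases f) M" "is_loop M e" "is_loop M x" "\<not> is_loop M f" "e \<noteq> f" "x \<noteq> e" "x \<noteq> f"
  shows "Cl {e, f} (two_pointed_bases e f) (ser x e M)"
proof -
  have M: "Cl {f} {A\<in>pointed_bases f. \<not> is_loop A f} M"
    by (rule Cl_nonloop_base[OF assms(1) _ assms(4) pointed_bases_nonempty]) simp
  show ?thesis
  proof (rule Cl_map[OF M, where X = "{e, x}" and \<Theta> = "ser x e"])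
  fix A assume A: "A \<in> {A\<in>pointed_bases f. \<not> is_loop A f}" and l: "\<forall>x\<in>{e, x}. is_loop A x"
  from A have "A \<in> pointed_bases f" "\<not> is_loop A f" by blast+
  then show "Cl {e, f} (two_pointed_bases e f) (ser x e A)"
  proof (cases rule: pointed_cases)
    case 1
    then have "ser x e A = {{e, f}, {x, f}}" using assms by (simp add: ser_def insert_commute)
    then show ?thesis using assms by (simp add: Cl.base two_pointed_intros)
  next
    case (2 g)
    moreover have "g \<noteq> e" "g \<noteq> x" using 2 l by (auto simp: is_loop_def)
    ultimately have "ser x e A = {{e, f}, {e, g}, {x, f}, {x, g}}" using assms by (simp add: ser_def insert_commute)
    then show ?thesis using 2 \<open>g \<noteq> e\<close> \<open>g \<noteq> x\<close> assms by (simp add: Cl.base two_pointed_intros)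
  qed
next
  fix M z assume "z \<notin> {f} \<union> {e, x}" "is_loop M z"
  then show "is_loop (ser x e M) z" by (auto simp: is_loop_def ser_def split: if_splits)
qed (use assms in \<open>auto simp: pointed_bases_nonempty col_ser par_ser[symmetric] ser_ser\<close>)
qed

lemma two_pointed_par:
  assumes "Cl {e, f} (two_pointed_bases e f) M" "is_loop M x" "x \<notin> {e, f}" "e \<noteq> f"
  shows "Cl {e, f} (two_pointed_bases e f) (par x e M)"
proof (rule Cl_map[OF assms(1), of "{x}"])
  fix A assume A: "A \<in> two_pointed_bases e f" and l: "\<forall>x\<in>{x}. is_loop A x"
  note par' = Cl.par[OF Cl.base[OF A]]
  from A show "Cl {e, f} (two_pointed_bases e f) (par x e A)"
  proof (cases rule: two_pointed_cases)
    case 1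
    then have "par x e A = {{e, f}, {x, f}}" using assms by (auto simp: par_def)
    then show ?thesis using assms by (simp add: Cl.base two_pointed_intros)
  next
    case (2 g)
    then have "par x e A = par x g A" "x \<noteq> g" using assms l by (auto simp: par_def is_loop_def)
    then show ?thesis using par'[of x g] 2 l assms by simp
  next
    case (3 h)
    then have "par x e A = {{e, f}, {e, h}, {x, f}, {x, h}}" using assms by (auto simp: par_def)
    moreover have "x \<noteq> h" using 3 l by (auto simp: is_loop_def)
    ultimately show ?thesis using 3 assms by (simp add: Cl.base two_pointed_intros)
  next
    case (4 g h)
    then have "par x e A = par x g A" "x \<noteq> g" using assms l by (auto simp: par_def is_loop_def)
    then show ?thesis using par'[of x g] 4 l assms by simp
  qed
qed (use assms in \<open>auto simp: two_pointed_bases_nonempty col_par par_par par_ser is_loop_par\<close>)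

lemma two_pointed_ser:
  assumes "Cl {e, f} (two_pointed_bases e f) M" "is_loop M x" "x \<notin> {e, f}" "e \<noteq> f"
  shows "Cl {e, f} (two_pointed_bases e f) (ser x e M)"
proof (rule Cl_map[OF assms(1), of "{x}"])
  fix A assume A: "A \<in> two_pointed_bases e f" and l: "\<forall>x\<in>{x}. is_loop A x"
  note ser' = Cl.ser[OF Cl.base[OF A]] and col' = Cl.col[OF Cl.base[OF A]]
  from A show "Cl {e, f} (two_pointed_bases e f) (ser x e A)"
  proof (cases rule: two_pointed_cases)
    case 1
    then have "ser x e A = col x A" using assms by (auto simp: ser_def col_def)
    then show ?thesis using col'[of x] l assms by simp
  next
    case (2 g)
    then have "ser x e A = ser x g A" "x \<noteq> g" using assms l by (auto simp: ser_def is_loop_def)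
    then show ?thesis using ser'[of x g] 2 l assms by simp
  next
    case (3 h)
    then have "ser x e A = col x A" using assms by (auto simp: ser_def col_def)
    then show ?thesis using col'[of x] l assms by simp
  next
    case (4 g h)
    then have "ser x e A = ser x g A" "x \<noteq> g" using assms l by (auto simp: ser_def is_loop_def)
    then show ?thesis using ser'[of x g] 4 l assms by simp
  qed
next
  fix M z assume "z \<notin> {e, f} \<union> {x}" "is_loop M z"
  then show "is_loop (ser x e M) z" by (auto simp: is_loop_def ser_def split: if_splits)
qed (use assms in \<open>auto simp: two_pointed_bases_nonempty col_ser par_ser[symmetric] ser_ser\<close>)

lemma two_pointed_swap:
  assumes "Cl {y, f} (two_pointed_bases y f) M" "relabel (swp x y) M = M" "f \<notin> {x, y}"
  shows "Cl {x, f} (two_pointed_bases x f) M"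
proof -
  have "Cl (swp x y ` {y, f}) (relabel (swp x y) ` two_pointed_bases y f) M"
    using Cl_relabel[OF assms(1), of "swp x y"] assms(2) by simp
  moreover have "swp x y f = f" using assms(3) by (simp add: Transposition.transpose_def)
  ultimately show ?thesis
    using relabel_two_pointed_bases[of "swp x y" y f] by (elim Cl_mono) (auto intro: Cl.base)
qed

text \<open>The construction already avoids \<open>f\<close>; now steps at \<open>e\<close> are
  pushed down as well. The vector \<open>v\<close> keeps \<open>e\<close> apart from
  \<open>f\<close> at every stage, and in particular rules out the starting family in which
  \<open>e\<close> is the parallel partner of \<open>f\<close>.\<close>

lemma two_pointed:
  fixes M :: "'g::finite set set"
  assumes "Cl {f} (pointed_bases f) M" "e \<noteq> f" "\<not> is_loop M e" "\<not> is_loop M f" "v \<in> lin M" "v $ e \<noteq> v $ f"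
  shows "Cl {e, f} (two_pointed_bases e f) M"
  using assms
proof (induction arbitrary: e v rule: Cl.induct)
  case (base M)
  have False if "M = {{g}, {f}}" "g \<noteq> f" for g
  proof -
    have "wt v {g} = wt v {f}" using base that by (intro linD[of v M]) auto
    then show False using base that by (auto simp: is_loop_def wt_def)
  qed
  then show ?case using base by (auto simp: pointed_bases_def is_loop_def)
next
  case (col M x)
  have "M \<noteq> {}" using Cl_nonempty[OF col.hyps(1) pointed_bases_nonempty] .
  show ?case
  proof (cases "e = x")
    case True then show ?thesis using col \<open>M \<noteq> {}\<close> two_pointed_col[of f M e] by (auto simp: is_loop_col)
  next
    case False
    then show ?thesis using col \<open>M \<noteq> {}\<close> lin_col[of M x] by (intro Cl.col col.IH) (auto simp: is_loop_col)
  qed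
next
  case (par M x y)
  show ?case
  proof (cases "is_loop M y")
    case True then show ?thesis using par by (simp add: par_loop)
  next
    case False
    have xy: "x \<noteq> f" "y \<noteq> f" using par by auto
    have fl: "\<not> is_loop M f" using par by (auto simp: is_loop_par)
    have Y: "Cl {y, f} (two_pointed_bases y f) (par x y M)" if "u \<in> lin (par x y M)" "u $ y \<noteq> u $ f" for u
      using that lin_par[OF par.hyps(2,3) False] par xy False fl
      by (intro two_pointed_par par.IH[of y u]) auto
    consider "e = x" | "e = y" | "e \<notin> {x, y}" by blast
    then show ?thesis
    proof cases
      case 1
      have "pv (swp x y) v \<in> lin (par x y M)"
        using par by (intro lin_relabel_self relabel_par_self) auto
      moreover have "pv (swp x y) v $ y \<noteq> pv (swp x y) v $ f"
        using par 1 xy by (simp add: Transposition.transpose_def)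
      ultimately show ?thesis
        using two_pointed_swap[OF Y relabel_par_self[OF par.hyps(2,3)]] 1 xy by simp
    next
      case 2 then show ?thesis using Y par by blast
    next
      case 3 then show ?thesis
        using par lin_par[OF par.hyps(2,3) False] fl by (intro Cl.par par.IH[of e v]) (auto simp: is_loop_par)
    qed
  qed
next
  case (ser M x y)
  have ne: "M \<noteq> {}" using Cl_nonempty[OF ser.hyps(1) pointed_bases_nonempty] .
  have xy: "x \<noteq> f" "y \<noteq> f" using ser by auto
  have fl: "\<not> is_loop M f" using ser ne xy by (auto simp: is_loop_ser)
  have Y: "Cl {y, f} (two_pointed_bases y f) (ser x y M)" if "u \<in> lin (ser x y M)" "u $ y \<noteq> u $ f" for u
  proof (cases "is_loop M y")
    case True then show ?thesis using ser xy fl by (intro two_pointed_ser0) auto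
  next
    case False
    then show ?thesis using that lin_ser_subset[OF ser.hyps(2)] ser xy fl
      by (intro two_pointed_ser ser.IH[of y u]) auto
  qed
  consider "e = x" | "e = y" | "e \<notin> {x, y}" by blast
  then show ?case
  proof cases
    case 1
    have "pv (swp x y) v \<in> lin (ser x y M)"
      using ser by (intro lin_relabel_self relabel_ser_self) auto
    moreover have "pv (swp x y) v $ y \<noteq> pv (swp x y) v $ f"
      using ser 1 xy by (simp add: Transposition.transpose_def)
    ultimately show ?thesis
      using two_pointed_swap[OF Y relabel_ser_self[OF ser.hyps(2,3)]] 1 xy by simp
  next
    case 2 then show ?thesis using Y ser by blast
  next
    case 3 then show ?thesis
      using ser lin_ser_subset[OF ser.hyps(2)] fl ne by (intro Cl.ser ser.IH[of e v]) (auto simp: is_loop_ser)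
  qed
qed

lemma sp_family_small:
  "sp_family {{e}}" "e \<noteq> g \<Longrightarrow> sp_family {{e}, {g}}"
  "e \<noteq> g \<Longrightarrow> e \<noteq> h \<Longrightarrow> g \<noteq> h \<Longrightarrow> sp_family {{e}, {g}, {h}}"
proof -
  have 0: "col e {{}} = {{e}}" by (auto simp: col_def)
  show 1: "sp_family {{e}}" using Cl.col[OF Cl.base, of "{{}}" "{{{}}}" e "{}"] 0 by (simp add: is_loop_def)
  have 2: "sp_family {{e}, {g}}" if "e \<noteq> g" for g
  proof -
    have "par g e {{e}} = {{e}, {g}}" by (auto simp: par_def)
    then show ?thesis using Cl.par[OF 1, of g e] that by (simp add: is_loop_def)
  qed
  then show "e \<noteq> g \<Longrightarrow> sp_family {{e}, {g}}" by blast
  assume a: "e \<noteq> g" "e \<noteq> h" "g \<noteq> h"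
  have "par h e {{e}, {g}} = {{e}, {g}, {h}}" using a by (auto simp: par_def)
  then show "sp_family {{e}, {g}, {h}}" using Cl.par[OF 2[OF a(1)], of h e] a by (simp add: is_loop_def)
qed

text \<open>\<open>ident e f\<close> commutes with all steps away from \<open>e\<close> and
  \<open>f\<close>, so it only has to be evaluated on the four two-pointed starting
  families.\<close>

lemma sp_family_ident:
  fixes M :: "'g::finite set set"
  assumes "sp_family M" "e \<noteq> f" "\<not> is_loop M e" "\<not> is_loop M f" "v \<in> lin M" "v $ e \<noteq> v $ f"
  shows "sp_family (ident e f M)"
proof (rule Cl_map[OF two_pointed[OF sp_family_pointed[OF assms(1)] assms(2-)], where X = "{}" and \<Theta> = "ident e f"])
  fix A assume "A \<in> two_pointed_bases e f"
  then show "sp_family (ident e f A)"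
  proof (cases rule: two_pointed_cases)
    case 1
    then have "ident e f A = {{e}}" using assms by (auto simp: ident_def)
    then show ?thesis by (simp add: sp_family_small)
  next
    case (2 g)
    then have "ident e f A = {{e}, {g}}" using assms by (auto simp: ident_def)
    then show ?thesis using 2 by (auto intro: sp_family_small)
  next
    case (3 h)
    then have "ident e f A = {{e}, {h}}" using assms by (auto simp: ident_def)
    then show ?thesis using 3 by (auto intro: sp_family_small)
  next
    \<comment> \<open>The parallel pairs \<open>e, g\<close> and \<open>f, h\<close> are glued at
      one element into a parallel class of three.\<close>
    case (4 g h)
    then have "ident e f A = {{e}, {h}, {g}}" using assms by (auto simp: ident_def)
    then show ?thesis using 4 by (auto intro: sp_family_small)
  qed
next
  fix M z assume "z \<notin> {e, f} \<union> {}" "is_loop M z"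
  then show "is_loop (ident e f M) z" by (auto simp: is_loop_def ident_def split: if_splits)
qed (auto simp: two_pointed_bases_nonempty ident_col ident_par ident_ser)

section \<open>Face counts with prescribed loops and coloops\<close>

datatype status = Ord | Loop | Coloop

definition stat :: "'g set set \<Rightarrow> 'g \<Rightarrow> status" where
  "stat G x = (if is_loop G x then Loop else if is_coloop G x then Coloop else Ord)"

text \<open>For a face \<open>G\<close> the vectors \<open>v\<close> with \<open>ini M v = G\<close>
  form a relatively open cone of dimension \<open>dim (lin G)\<close>. Counted are the cones inside
  the half-space \<open>v $ b \<le> v $ a\<close>, where \<open>a\<close> dominates
  \<open>b\<close>; \<open>fenum\<close> records their dimensions.\<close>

definition FS :: "'g::finite set set \<Rightarrow> 'g \<Rightarrow> 'g \<Rightarrow> ('g \<Rightarrow> status) \<Rightarrow> 'g set set set" where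
  "FS M a b \<sigma> = {G. (\<exists>v. ini M v = G) \<and> (\<forall>x. stat G x = \<sigma> x) \<and> (\<forall>v. ini M v = G \<longrightarrow> v $ b \<le> v $ a)}"

definition tt :: "int poly" where "tt = [:0, 1:]"

definition fenum :: "'g::finite set set \<Rightarrow> 'g \<Rightarrow> 'g \<Rightarrow> ('g \<Rightarrow> status) \<Rightarrow> int poly" where
  "fenum M a b \<sigma> = (\<Sum>G\<in>FS M a b \<sigma>. tt ^ dim (lin G))"

lemma wt_axis: "wt (axis x (1::real)) B = (if x \<in> B then 1 else 0)"
  unfolding wt_def by (simp add: axis_def if_distrib cong: if_cong)

lemma axis_lin_loop: "is_loop M x \<Longrightarrow> axis x 1 \<in> lin M"
  and axis_lin_coloop: "is_coloop M x \<Longrightarrow> axis x 1 \<in> lin M"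
  by (auto intro!: linI simp: wt_axis is_loop_def is_coloop_def)

lemma ini_move_axis: "axis x 1 \<in> lin M \<Longrightarrow> ini M (v + k *\<^sub>R axis x 1) = ini M v"
  by (intro ini_add_lin subspace_scale[OF subspace_lin])

lemma ini_raise_coloop:
  assumes "is_coloop (ini M v) x" "k \<ge> 0" shows "ini M (v + k *\<^sub>R axis x 1) = ini M v"
proof (cases "M = {}")
  case True then show ?thesis by (simp add: ini_def)
next
  case False
  then obtain B0 where B0: "B0 \<in> ini M v" using ini_nonempty by blast
  have "wt (v + k *\<^sub>R axis x 1) C \<le> wt (v + k *\<^sub>R axis x 1) B \<longleftrightarrow> wt v C \<le> wt v B"
    if "B \<in> ini M v" "C \<in> M" for B C
  proof -
    have "wt v C \<le> wt v B" "x \<in> B" using that assms by (auto simp: ini_def is_coloop_def)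
    then show ?thesis using assms by (auto simp: wt_axis)
  qed
  moreover have "B \<in> ini M v" if "B \<in> ini M (v + k *\<^sub>R axis x 1)" for B
  proof -
    have "wt (v + k *\<^sub>R axis x 1) B0 \<le> wt (v + k *\<^sub>R axis x 1) B"
      using that B0 by (auto simp: ini_def)
    moreover have "x \<in> B0" using B0 assms by (auto simp: is_coloop_def)
    ultimately have "wt v B0 \<le> wt v B" using assms by (auto simp: wt_axis split: if_splits)
    then show ?thesis using that B0 by (force simp: ini_def)
  qed
  ultimately show ?thesis unfolding ini_def by blast
qed

lemma ini_lower_loop:
  assumes "is_loop (ini M v) x" "k \<ge> 0" shows "ini M (v - k *\<^sub>R axis x 1) = ini M v"
proof (cases "M = {}")
  case True then show ?thesis by (simp add: ini_def)
next
  case False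
  then obtain B0 where B0: "B0 \<in> ini M v" using ini_nonempty by blast
  have "wt (v - k *\<^sub>R axis x 1) C \<le> wt (v - k *\<^sub>R axis x 1) B \<longleftrightarrow> wt v C \<le> wt v B"
    if "B \<in> ini M v" "C \<in> M" for B C
  proof -
    have "wt v C \<le> wt v B" "x \<notin> B" using that assms by (auto simp: ini_def is_loop_def)
    then show ?thesis using assms by (auto simp: wt_axis)
  qed
  moreover have "B \<in> ini M v" if "B \<in> ini M (v - k *\<^sub>R axis x 1)" for B
  proof -
    have "wt (v - k *\<^sub>R axis x 1) B0 \<le> wt (v - k *\<^sub>R axis x 1) B"
      using that B0 by (auto simp: ini_def)
    moreover have "x \<notin> B0" using B0 assms by (auto simp: is_loop_def)
    ultimately have "wt v B0 \<le> wt v B" using assms by (auto simp: wt_axis split: if_splits)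
    then show ?thesis using that B0 by (force simp: ini_def)
  qed
  ultimately show ?thesis unfolding ini_def by blast
qed

lemma fenum_empty: "FS M a b \<sigma> = {} \<Longrightarrow> fenum M a b \<sigma> = 0"
  by (simp add: fenum_def)

text \<open>A loop of a face can be lowered arbitrarily, and dually a coloop raised, without leaving
  the cone. So a dominating element is never a loop and a dominated one never a coloop.\<close>

lemma fenum_loop_left:
  assumes "\<sigma> a = Loop" "a \<noteq> b" shows "fenum M a b \<sigma> = 0"
proof (rule fenum_empty, rule ccontr)
  assume "FS M a b \<sigma> \<noteq> {}"
  then obtain v where v: "stat (ini M v) a = \<sigma> a" "\<And>u. ini M u = ini M v \<Longrightarrow> u $ b \<le> u $ a"
    unfolding FS_def by blast
  then have "is_loop (ini M v) a" using assms by (simp add: stat_def split: if_splits)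
  then have "ini M (v - (\<bar>v $ a - v $ b\<bar> + 1) *\<^sub>R axis a 1) = ini M v" by (intro ini_lower_loop) auto
  from v(2)[OF this] show False using assms by (simp add: axis_def)
qed

lemma fenum_coloop_right:
  assumes "\<sigma> b = Coloop" "a \<noteq> b" shows "fenum M a b \<sigma> = 0"
proof (rule fenum_empty, rule ccontr)
  assume "FS M a b \<sigma> \<noteq> {}"
  then obtain v where v: "stat (ini M v) b = \<sigma> b" "\<And>u. ini M u = ini M v \<Longrightarrow> u $ b \<le> u $ a"
    unfolding FS_def by blast
  then have "is_coloop (ini M v) b" using assms by (simp add: stat_def split: if_splits)
  then have "ini M (v + (\<bar>v $ a - v $ b\<bar> + 1) *\<^sub>R axis b 1) = ini M v" by (intro ini_raise_coloop) auto
  from v(2)[OF this] show False using assms by (simp add: axis_def)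
qed

lemma fenum_free:
  assumes "axis x 1 \<in> lin M" "x = a \<or> x = b" "a \<noteq> b" shows "fenum M a b \<sigma> = 0"
proof (rule fenum_empty, rule ccontr)
  assume "FS M a b \<sigma> \<noteq> {}"
  then obtain v where v: "\<And>u. ini M u = ini M v \<Longrightarrow> u $ b \<le> u $ a"
    unfolding FS_def by blast
  from v[OF ini_move_axis[OF assms(1), of v "\<bar>v $ a - v $ b\<bar> + 1"]]
    v[OF ini_move_axis[OF assms(1), of v "- (\<bar>v $ a - v $ b\<bar> + 1)"]]
  show False using assms by (auto simp: axis_def)
qed

lemma fenum_loop:
  assumes "is_loop M x" "\<sigma> x \<noteq> Loop" shows "fenum M a b \<sigma> = 0"
proof (rule fenum_empty, rule ccontr)
  assume "FS M a b \<sigma> \<noteq> {}"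
  then obtain v where "stat (ini M v) x = \<sigma> x" unfolding FS_def by blast
  then show False using is_loop_ini[OF assms(1), of v] assms by (simp add: stat_def)
qed

lemma stat_eq_iff:
  "stat G x = Loop \<longleftrightarrow> is_loop G x"
  "stat G x = Coloop \<longleftrightarrow> \<not> is_loop G x \<and> is_coloop G x"
  "stat G x = Ord \<longleftrightarrow> \<not> is_loop G x \<and> \<not> is_coloop G x"
  by (auto simp: stat_def)

lemma is_coloop_par: "is_loop G x \<Longrightarrow> x \<noteq> y \<Longrightarrow> G \<noteq> {} \<Longrightarrow>
  is_coloop (par x y G) z \<longleftrightarrow> is_coloop G z \<and> z \<noteq> x \<and> (z = y \<longrightarrow> is_loop G y)"
proof -
  assume a: "is_loop G x" "x \<noteq> y" "G \<noteq> {}"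
  have "(\<forall>C\<in>(if y \<in> B then {B, insert x (B - {y})} else {B}). z \<in> C) \<longleftrightarrow>
     z \<in> B \<and> z \<noteq> x \<and> (z = y \<longrightarrow> y \<notin> B)" if "B \<in> G" for B
    using a that by (auto simp: is_loop_def)
  then have "is_coloop (par x y G) z \<longleftrightarrow> (\<forall>B\<in>G. z \<in> B \<and> z \<noteq> x \<and> (z = y \<longrightarrow> y \<notin> B))"
    unfolding is_coloop_def par_def ball_UN by blast
  then show ?thesis using a unfolding is_coloop_def is_loop_def by (metis all_not_in_conv)
qed

lemma par_inj:
  assumes "is_loop G x" "is_loop G' x" "par x y G = par x y G'" shows "G = G'"
proof -
  have "G = {B\<in>par x y G. x \<notin> B}" if "is_loop G x" for G
    using that unfolding par_iff is_loop_def by blast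
  then show ?thesis using assms by metis
qed

lemma ini_par_cell:
  assumes "is_loop M x" "x \<noteq> y" "is_loop G x" "\<not> is_loop G y"
  shows "ini (par x y M) v = par x y G \<longleftrightarrow> v $ x = v $ y \<and> ini M v = G"
proof
  assume eq: "ini (par x y M) v = par x y G"
  have nl: "\<not> is_loop (par x y G) x" "\<not> is_loop (par x y G) y" using assms by (auto simp: is_loop_par)
  consider "v $ x = v $ y" | "v $ x < v $ y" | "v $ y < v $ x" by linarith
  then show "v $ x = v $ y \<and> ini M v = G"
  proof cases
    case 1
    then have "par x y (ini M v) = par x y G" using ini_par_eq[OF assms(1,2)] eq by simp
    then show ?thesis using par_inj[OF is_loop_ini[OF assms(1)] assms(3)] 1 by blast
  next
    case 2
    then show ?thesis using ini_par_less[OF assms(1,2)] is_loop_ini[OF assms(1), of v] eq nl by simp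
  next
    case 3
    have "is_loop (relabel (swp x y) (ini M (pv (swp x y) v))) (swp x y x)"
      by (intro is_loop_relabel is_loop_ini assms) simp
    then show ?thesis using ini_par_greater[OF assms(1,2) 3] eq nl by simp
  qed
qed (use assms ini_par_eq in blast)

lemma dim_lin_par:
  assumes "is_loop G x" "x \<noteq> y" "\<not> is_loop G y"
  shows "dim (lin G) = Suc (dim (lin (par x y G)))"
proof -
  have "linear (\<lambda>v :: real ^ 'a. v $ x - v $ y)" by (rule linearI) (auto simp: algebra_simps)
  then show ?thesis
    using dim_kernel[OF subspace_lin _ axis_lin_loop[OF assms(1)], of "\<lambda>v. v $ x - v $ y"] assms
    unfolding lin_par[OF assms] by (simp add: axis_def)
qed

text \<open>\<open>x\<close> and \<open>y\<close> are both ordinary only on faces with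
  \<open>v $ x = v $ y\<close>, and such a face is the parallel extension of a face of
  \<open>M\<close> in which \<open>y\<close> is not a loop. There \<open>y\<close> may be ordinary
  or a coloop, since a coloop with a parallel partner becomes ordinary. The factor \<open>tt\<close>
  accounts for the coordinate of \<open>x\<close>, which is free in \<open>M\<close>.\<close>

lemma fenum_par_ord:
  fixes M :: "'g::finite set set"
  assumes l: "is_loop M x" "x \<noteq> y" and ab: "a \<noteq> x" "b \<noteq> x" and "\<sigma> x = Ord" "\<sigma> y = Ord" and ne: "M \<noteq> {}"
  shows "tt * fenum (par x y M) a b \<sigma> = fenum M a b (\<sigma>(x := Loop)) + fenum M a b (\<sigma>(x := Loop, y := Coloop))"
proof -
  let ?F1 = "FS M a b (\<sigma>(x := Loop))" and ?F2 = "FS M a b (\<sigma>(x := Loop, y := Coloop))"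
  let ?F = "FS (par x y M) a b \<sigma>"
  have G0: "is_loop G x \<and> \<not> is_loop G y \<and> G \<noteq> {}" if G: "G \<in> ?F1 \<union> ?F2" for G
  proof -
    obtain v where v: "G = ini M v" using G unfolding FS_def by blast
    have "stat G y = Ord \<or> stat G y = Coloop" using G assms unfolding FS_def by auto
    then show ?thesis using v is_loop_ini[OF l(1), of v] ini_nonempty[OF ne, of v] by (auto simp: stat_eq_iff)
  qed
  have statp: "stat (par x y G) z = (if z = x \<or> z = y then Ord else stat G z)"
    if "is_loop G x" "\<not> is_loop G y" "G \<noteq> {}" for G z
    using that l by (auto simp: stat_def is_loop_par is_coloop_par)
  have bij: "bij_betw (par x y) (?F1 \<union> ?F2) ?F"
  proof (rule bij_betw_imageI[OF inj_onI set_eqI[OF iffI]])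
    fix G G' assume G: "G \<in> ?F1 \<union> ?F2" "G' \<in> ?F1 \<union> ?F2" and eq: "par x y G = par x y G'"
    show "G = G'" by (rule par_inj[OF _ _ eq]) (use G0[OF G(1)] G0[OF G(2)] in simp_all)
  next
    fix H assume "H \<in> par x y ` (?F1 \<union> ?F2)"
    then obtain G where G: "G \<in> ?F1 \<union> ?F2" and H: "H = par x y G" by blast
    note g = G0[OF G]
    obtain v where v: "ini M v = G" using G unfolding FS_def by blast
    have dom: "\<And>u. ini M u = G \<Longrightarrow> u $ b \<le> u $ a" using G unfolding FS_def by blast
    have st: "\<And>z. z \<noteq> x \<Longrightarrow> z \<noteq> y \<Longrightarrow> stat G z = \<sigma> z" using G unfolding FS_def by auto
    \<comment> \<open>As \<open>x\<close> is a loop of \<open>M\<close>, its coordinate can be moved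
      to that of \<open>y\<close> at no cost.\<close>
    let ?v = "v + (v $ y - v $ x) *\<^sub>R axis x 1"
    have "?v $ x = ?v $ y" using l by (simp add: axis_def)
    moreover have "ini M ?v = G" using ini_move_axis[OF axis_lin_loop[OF l(1)]] v by simp
    ultimately have "ini (par x y M) ?v = H"
      unfolding H using iffD2[OF ini_par_cell[OF l, of G ?v]] g by simp
    moreover have "\<forall>z. stat H z = \<sigma> z" unfolding H using statp g st assms by simp
    moreover have "u $ b \<le> u $ a" if "ini (par x y M) u = H" for u
    proof -
      have "ini M u = G" using iffD1[OF ini_par_cell[OF l, of G u]] g that unfolding H by simp
      then show ?thesis by (rule dom)
    qed
    ultimately show "H \<in> ?F" unfolding FS_def by blast
  next
    fix H assume H: "H \<in> ?F"
    then obtain v where v: "ini (par x y M) v = H" unfolding FS_def by blast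
    have st: "\<And>z. stat H z = \<sigma> z" and dom: "\<And>u. ini (par x y M) u = H \<Longrightarrow> u $ b \<le> u $ a"
      using H unfolding FS_def by blast+
    have nl: "\<not> is_loop H x" "\<not> is_loop H y" using st[of x] st[of y] assms by (auto simp: stat_eq_iff)
    have "\<not> v $ x < v $ y" using ini_par_less[OF l] is_loop_ini[OF l(1), of v] v nl by auto
    moreover have "\<not> v $ y < v $ x"
    proof
      assume *: "v $ y < v $ x"
      have "is_loop (relabel (swp x y) (ini M (pv (swp x y) v))) (swp x y x)"
        by (intro is_loop_relabel is_loop_ini l) simp
      then show False using ini_par_greater[OF l *] v nl by simp
    qed
    ultimately have vxy: "v $ x = v $ y" by simp
    define G where "G = ini M v"
    have HG: "H = par x y G" using ini_par_eq[OF l vxy] v by (simp add: G_def)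
    have g: "is_loop G x" "G \<noteq> {}" using is_loop_ini[OF l(1)] ini_nonempty[OF ne] by (auto simp: G_def)
    have ny: "\<not> is_loop G y" using nl g by (auto simp: HG par_loop)
    have domG: "u $ b \<le> u $ a" if u: "ini M u = G" for u
    proof -
      let ?u = "u + (u $ y - u $ x) *\<^sub>R axis x 1"
      have "?u $ x = ?u $ y" using l by (simp add: axis_def)
      moreover have "ini M ?u = G" using ini_move_axis[OF axis_lin_loop[OF l(1)]] u by simp
      ultimately have "ini (par x y M) ?u = H" unfolding HG using iffD2[OF ini_par_cell[OF l g(1) ny, of ?u]] by simp
      then show ?thesis using dom[of ?u] ab by (simp add: axis_def)
    qed
    have stG: "stat G z = \<sigma> z" if "z \<noteq> x" "z \<noteq> y" for z
      using st[of z] statp[OF g(1) ny g(2), of z] that by (simp add: HG)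
    have "stat G x = Loop" "stat G y = Ord \<or> stat G y = Coloop" using g ny by (auto simp: stat_def)
    then have "(\<forall>z. stat G z = (\<sigma>(x := Loop)) z) \<or> (\<forall>z. stat G z = (\<sigma>(x := Loop, y := Coloop)) z)"
      using stG assms by (metis fun_upd_other fun_upd_same)
    moreover have "\<exists>v. ini M v = G" using G_def by blast
    ultimately have "G \<in> ?F1 \<union> ?F2" using domG unfolding FS_def by blast
    then show "H \<in> par x y ` (?F1 \<union> ?F2)" using HG by blast
  qed
  have disj: "?F1 \<inter> ?F2 = {}"
  proof -
    have "stat G y = Ord" if "G \<in> ?F1" for G using that assms l unfolding FS_def by auto
    moreover have "stat G y = Coloop" if "G \<in> ?F2" for G using that assms l unfolding FS_def by auto
    ultimately show ?thesis by fastforce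
  qed
  have "fenum M a b (\<sigma>(x := Loop)) + fenum M a b (\<sigma>(x := Loop, y := Coloop)) =
    (\<Sum>G\<in>?F1 \<union> ?F2. tt ^ dim (lin G))"
    unfolding fenum_def using disj by (subst sum.union_disjoint) auto
  also have "\<dots> = (\<Sum>G\<in>?F1 \<union> ?F2. tt * tt ^ dim (lin (par x y G)))"
  proof (rule sum.cong[OF refl])
    fix G assume "G \<in> ?F1 \<union> ?F2"
    then have "is_loop G x" "\<not> is_loop G y" using G0 by blast+
    then show "tt ^ dim (lin G) = tt * tt ^ dim (lin (par x y G))" using dim_lin_par[of G x y] l by simp
  qed
  also have "\<dots> = tt * (\<Sum>G\<in>?F1 \<union> ?F2. tt ^ dim (lin (par x y G)))" by (simp add: sum_distrib_left)
  also have "(\<Sum>G\<in>?F1 \<union> ?F2. tt ^ dim (lin (par x y G))) = fenum (par x y M) a b \<sigma>"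
    unfolding fenum_def by (rule sum.reindex_bij_betw[OF bij])
  finally show ?thesis by (rule sym)
qed

lemma relabel_swp_id:
  assumes "is_loop G x" "is_loop G y" shows "relabel (swp x y) G = G"
proof -
  have "swp x y ` B = B" if "B \<in> G" for B using that assms by (auto simp: swp_image is_loop_def)
  then show ?thesis by (simp add: relabel_def)
qed

lemma ini_par_loop:
  assumes l: "is_loop M x" "x \<noteq> y" and G: "ini (par x y M) v = G" "is_loop G x"
  shows "(v $ x < v $ y \<or> is_loop G y \<and> v $ x = v $ y) \<and> ini M v = G \<or>
    v $ y < v $ x \<and> is_loop G y \<and> ini M (pv (swp x y) v) = G"
proof -
  consider "v $ x = v $ y" | "v $ x < v $ y" | "v $ y < v $ x" by linarith
  then show ?thesis
  proof cases
    case 1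
    then have *: "par x y (ini M v) = G" using ini_par_eq[OF l] G by simp
    then have "is_loop (ini M v) y" using G(2) l by (auto simp: is_loop_par)
    then show ?thesis using * 1 by (simp add: par_loop)
  next
    case 2 then show ?thesis using ini_par_less[OF l] G by simp
  next
    case 3
    define G' where "G' = ini M (pv (swp x y) v)"
    have *: "relabel (swp x y) G' = G" using ini_par_greater[OF l 3] G by (simp add: G'_def)
    have lx: "is_loop G' x" unfolding G'_def by (intro is_loop_ini l)
    have "is_loop (relabel (swp x y) G) (swp x y x)" by (intro is_loop_relabel G) simp
    moreover have "relabel (swp x y) G = G'"
      unfolding *[symmetric] by (simp add: relabel_def image_comp)
    ultimately have "is_loop G' y" by simp
    then show ?thesis using lx 3 * relabel_swp_id[of G' x y] by (simp add: G'_def)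
  qed
qed

lemma ini_par_lowered:
  assumes l: "is_loop M x" "x \<noteq> y" and "k < v $ y"
  shows "ini (par x y M) (v + (k - v $ x) *\<^sub>R axis x 1) = ini M v"
proof -
  let ?v = "v + (k - v $ x) *\<^sub>R axis x 1"
  have "?v $ x < ?v $ y" using assms by (simp add: axis_def)
  then show ?thesis using ini_par_less[OF l] ini_move_axis[OF axis_lin_loop[OF l(1)]] by metis
qed

text \<open>Placing \<open>x\<close> below \<open>y\<close> turns every cone of \<open>M\<close>
  into one of \<open>par x y M\<close> with \<open>x\<close> a loop, and the coordinate of
  \<open>x\<close> is not compared. The remaining part of the cone, where \<open>x\<close> lies
  above \<open>y\<close>, occurs only if \<open>y\<close> is a loop as well, and there both counts
  vanish if \<open>a = y\<close>.\<close>

lemma fenum_par_loop: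
  fixes M :: "'g::finite set set"
  assumes l: "is_loop M x" "x \<noteq> y" and ab: "a \<noteq> x" "b \<noteq> x" "a \<noteq> b" and s: "\<sigma> x = Loop"
  shows "fenum (par x y M) a b \<sigma> = fenum M a b \<sigma>"
proof (cases "a = y \<and> \<sigma> y = Loop")
  case True then show ?thesis using ab by (simp add: fenum_loop_left)
next
  case False
  have "FS (par x y M) a b \<sigma> = FS M a b \<sigma>"
  proof (intro equalityI subsetI)
    fix G assume "G \<in> FS (par x y M) a b \<sigma>"
    then obtain v where v: "ini (par x y M) v = G" and st: "\<And>z. stat G z = \<sigma> z"
      and dom: "\<And>u. ini (par x y M) u = G \<Longrightarrow> u $ b \<le> u $ a" unfolding FS_def by blast
    have "is_loop G x" using st s by (metis stat_eq_iff(1))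
    then obtain w where "ini M w = G" using ini_par_loop[OF l v] by blast
    moreover have "u $ b \<le> u $ a" if "ini M u = G" for u
      using dom[of "u + ((u $ y - 1) - u $ x) *\<^sub>R axis x 1"] ini_par_lowered[OF l, of "u $ y - 1" u] that ab
      by (simp add: axis_def)
    ultimately show "G \<in> FS M a b \<sigma>" using st unfolding FS_def by blast
  next
    fix G assume "G \<in> FS M a b \<sigma>"
    then obtain v where v: "ini M v = G" and st: "\<And>z. stat G z = \<sigma> z"
      and dom: "\<And>u. ini M u = G \<Longrightarrow> u $ b \<le> u $ a" unfolding FS_def by blast
    have lx: "is_loop G x" using st s by (metis stat_eq_iff(1))
    have "ini (par x y M) (v + ((v $ y - 1) - v $ x) *\<^sub>R axis x 1) = G"
      using ini_par_lowered[OF l, of "v $ y - 1" v] v by simp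
    moreover have "u $ b \<le> u $ a" if u: "ini (par x y M) u = G" for u
      using ini_par_loop[OF l u lx]
    proof (elim disjE conjE)
      assume *: "u $ y < u $ x" "is_loop G y" "ini M (pv (swp x y) u) = G"
      have "a \<noteq> y" using False * st by (metis stat_eq_iff(1))
      then show ?thesis using dom[OF *(3)] * ab
        by (cases "b = y") (auto simp: Transposition.transpose_def)
    qed (use dom in auto)
    ultimately show "G \<in> FS (par x y M) a b \<sigma>" using st unfolding FS_def by blast
  qed
  then show ?thesis by (simp add: fenum_def)
qed

text \<open>While \<open>y\<close> is not a loop, \<open>x\<close> ranges over all values below
  \<open>y\<close>, so \<open>a\<close> dominates \<open>x\<close> iff it dominates
  \<open>y\<close>.\<close>

lemma fenum_par_loop':
  fixes M :: "'g::finite set set"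
  assumes l: "is_loop M x" "x \<noteq> y" and ab: "a \<noteq> x" "a \<noteq> y" and s: "\<sigma> x = Loop" "\<sigma> y \<noteq> Loop"
  shows "fenum (par x y M) a x \<sigma> = fenum M a y \<sigma>"
proof -
  have "FS (par x y M) a x \<sigma> = FS M a y \<sigma>"
  proof (intro equalityI subsetI)
    fix G assume "G \<in> FS (par x y M) a x \<sigma>"
    then obtain v where v: "ini (par x y M) v = G" and st: "\<And>z. stat G z = \<sigma> z"
      and dom: "\<And>u. ini (par x y M) u = G \<Longrightarrow> u $ x \<le> u $ a" unfolding FS_def by blast
    have "is_loop G x" "\<not> is_loop G y" using st s by (metis stat_eq_iff(1))+
    then have "ini M v = G" using ini_par_loop[OF l v] by blast
    moreover have "u $ y \<le> u $ a" if "ini M u = G" for u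
    proof (rule ccontr)
      assume "\<not> u $ y \<le> u $ a"
      \<comment> \<open>The midpoint is a value for \<open>x\<close> that is still below
        \<open>u $ y\<close> but already above \<open>u $ a\<close>.\<close>
      then show False
        using dom[of "u + ((u $ a + u $ y) / 2 - u $ x) *\<^sub>R axis x 1"]
          ini_par_lowered[OF l, of "(u $ a + u $ y) / 2" u] that ab
        by (simp add: axis_def)
    qed
    ultimately show "G \<in> FS M a y \<sigma>" using st unfolding FS_def by blast
  next
    fix G assume "G \<in> FS M a y \<sigma>"
    then obtain v where v: "ini M v = G" and st: "\<And>z. stat G z = \<sigma> z"
      and dom: "\<And>u. ini M u = G \<Longrightarrow> u $ y \<le> u $ a" unfolding FS_def by blast
    have lx: "is_loop G x" "\<not> is_loop G y" using st s by (metis stat_eq_iff(1))+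
    have "ini (par x y M) (v + ((v $ y - 1) - v $ x) *\<^sub>R axis x 1) = G"
      using ini_par_lowered[OF l, of "v $ y - 1" v] v by simp
    moreover have "u $ x \<le> u $ a" if u: "ini (par x y M) u = G" for u
      using ini_par_loop[OF l u lx(1)] lx dom[of u] by auto
    ultimately show "G \<in> FS (par x y M) a x \<sigma>" using st unfolding FS_def by blast
  qed
  then show ?thesis by (simp add: fenum_def)
qed

lemma pv_swp_swp [simp]: "pv (swp x y) (pv (swp x y) v) = v"
  by (simp add: vec_eq_iff)

lemma relabel_swp_swp [simp]: "relabel (swp x y) (relabel (swp x y) G) = G"
  by (simp add: relabel_def image_comp)

lemma stat_relabel: "inj \<pi> \<Longrightarrow> stat (relabel \<pi> G) (\<pi> z) = stat G z"
  by (simp add: stat_def is_loop_def is_coloop_def relabel_def inj_image_mem_iff)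

lemma dim_lin_relabel: "dim (lin (relabel (swp x y) G)) = dim (lin G)"
proof -
  let ?f = "pv (swp x y) :: real ^ 'a \<Rightarrow> real ^ 'a"
  have "lin (relabel (swp x y) G) = ?f ` lin G"
  proof (intro equalityI subsetI)
    fix v assume v: "v \<in> lin (relabel (swp x y) G)"
    have "?f v \<in> lin G"
    proof (rule linI)
      fix B C assume "B \<in> G" "C \<in> G"
      then have "swp x y ` B \<in> relabel (swp x y) G" "swp x y ` C \<in> relabel (swp x y) G"
        unfolding relabel_def by blast+
      from linD[OF v this] show "wt (?f v) B = wt (?f v) C" by (simp only: wt_pv[OF inj_transpose])
    qed
    then show "v \<in> ?f ` lin G" by (rule image_eqI[rotated]) (simp only: pv_swp_swp)
  next
    fix v assume "v \<in> ?f ` lin G"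
    then obtain u where u: "u \<in> lin G" "v = ?f u" by blast
    have *: "wt v (swp x y ` B) = wt u B" for B unfolding u(2) by (simp only: wt_pv[OF inj_transpose] pv_swp_swp)
    show "v \<in> lin (relabel (swp x y) G)"
    proof (rule linI)
      fix B C assume "B \<in> relabel (swp x y) G" "C \<in> relabel (swp x y) G"
      then obtain B0 C0 where BC: "B0 \<in> G" "B = swp x y ` B0" "C0 \<in> G" "C = swp x y ` C0"
        unfolding relabel_def by blast
      show "wt v B = wt v C" unfolding BC * by (rule linD[OF u(1) BC(1,3)])
    qed
  qed
  moreover have "linear ?f" by (rule linearI) (auto simp: vec_eq_iff)
  moreover have "inj ?f" by (rule inj_on_inverseI[of _ ?f]) (simp only: pv_swp_swp)
  ultimately show ?thesis using dim_image_eq[of ?f "lin G"] by (simp add: inj_on_subset)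
qed

lemma fenum_swap:
  assumes R: "relabel (swp x y) M = M"
  shows "fenum M a b \<sigma> = fenum M (swp x y a) (swp x y b) (\<sigma> \<circ> swp x y)"
proof -
  let ?s = "swp x y"
  have ini: "ini M v = relabel ?s (ini M (pv ?s v))" for v
    using ini_relabel[of ?s M v] R by simp
  have sub: "relabel ?s G \<in> FS M (?s a) (?s b) (\<sigma> \<circ> ?s)" if "G \<in> FS M a b \<sigma>" for a b \<sigma> G
  proof -
    obtain v where v: "ini M v = G" and st: "\<And>z. stat G z = \<sigma> z"
      and dom: "\<And>u. ini M u = G \<Longrightarrow> u $ b \<le> u $ a" using \<open>G \<in> FS M a b \<sigma>\<close> unfolding FS_def by blast
    have "ini M (pv ?s v) = relabel ?s G" using ini[of "pv ?s v"] v by simp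
    moreover have "stat (relabel ?s G) z = (\<sigma> \<circ> ?s) z" for z
      using stat_relabel[of ?s G "?s z"] st by simp
    moreover have "u $ ?s b \<le> u $ ?s a" if u: "ini M u = relabel ?s G" for u
    proof -
      have "relabel ?s (relabel ?s (ini M (pv ?s u))) = relabel ?s (relabel ?s G)" using ini[of u] u by simp
      then have "ini M (pv ?s u) = G" by simp
      from dom[OF this] show ?thesis by simp
    qed
    ultimately show ?thesis unfolding FS_def by blast
  qed
  have "bij_betw (relabel ?s) (FS M a b \<sigma>) (FS M (?s a) (?s b) (\<sigma> \<circ> ?s))"
  proof (rule bij_betwI[of _ _ _ "relabel ?s"])
    show "relabel ?s \<in> FS M (?s a) (?s b) (\<sigma> \<circ> ?s) \<rightarrow> FS M a b \<sigma>"
    proof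
      fix G assume "G \<in> FS M (?s a) (?s b) (\<sigma> \<circ> ?s)"
      from sub[OF this] show "relabel ?s G \<in> FS M a b \<sigma>" by (simp add: comp_assoc)
    qed
  qed (use sub in auto)
  from sum.reindex_bij_betw[OF this, of "\<lambda>G. tt ^ dim (lin G)"]
  show ?thesis unfolding fenum_def by (simp add: dim_lin_relabel)
qed

lemma fenum_par_loop2:
  fixes M :: "'g::finite set set"
  assumes l: "is_loop M x" "x \<noteq> y" and ab: "a \<noteq> x" "b \<noteq> x" "a \<noteq> b" "a \<noteq> y" and s: "\<sigma> y = Loop" "\<sigma> x \<noteq> Loop"
  shows "fenum (par x y M) a b \<sigma> = fenum M a b (\<sigma>(x := Loop, y := \<sigma> x))"
proof -
  have \<sigma>: "\<sigma> \<circ> swp x y = \<sigma>(x := Loop, y := \<sigma> x)"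
    using s l by (auto simp: fun_eq_iff Transposition.transpose_def)
  have sa: "swp x y a = a" using ab by (simp add: Transposition.transpose_def)
  have "fenum (par x y M) a b \<sigma> = fenum (par x y M) a (swp x y b) (\<sigma>(x := Loop, y := \<sigma> x))"
    using fenum_swap[OF relabel_par_self[OF l], of a b \<sigma>] sa \<sigma> by simp
  also have "\<dots> = fenum M a b (\<sigma>(x := Loop, y := \<sigma> x))"
  proof (cases "b = y")
    case True then show ?thesis using fenum_par_loop'[OF l, of a "\<sigma>(x := Loop, y := \<sigma> x)"] ab s l by simp
  next
    case False
    then have "swp x y b = b" using ab by (simp add: Transposition.transpose_def)
    then show ?thesis using fenum_par_loop[OF l, of a b "\<sigma>(x := Loop, y := \<sigma> x)"] ab s l by simp
  qed
  finally show ?thesis .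
qed

text \<open>In a face where both parallel elements are nonloops, each can replace the other, so
  neither is a coloop.\<close>

lemma fenum_par_zero:
  fixes M :: "'g::finite set set"
  assumes l: "is_loop M x" "x \<noteq> y" "M \<noteq> {}"
    and s: "\<sigma> x = Coloop \<and> \<sigma> y \<noteq> Loop \<or> \<sigma> y = Coloop \<and> \<sigma> x \<noteq> Loop"
  shows "fenum (par x y M) a b \<sigma> = 0"
proof (rule fenum_empty, rule ccontr)
  assume "FS (par x y M) a b \<sigma> \<noteq> {}"
  then obtain v where st: "\<And>z. stat (ini (par x y M) v) z = \<sigma> z" unfolding FS_def by blast
  have nl: "\<not> is_loop (ini (par x y M) v) x" "\<not> is_loop (ini (par x y M) v) y"
    using st[of x] st[of y] s by (auto simp: stat_def)
  have "\<not> v $ x < v $ y" using ini_par_less[OF l(1,2)] is_loop_ini[OF l(1), of v] nl by auto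
  moreover have "\<not> v $ y < v $ x"
  proof
    assume *: "v $ y < v $ x"
    have "is_loop (relabel (swp x y) (ini M (pv (swp x y) v))) (swp x y x)"
      by (intro is_loop_relabel is_loop_ini l) simp
    then show False using ini_par_greater[OF l(1,2) *] nl by simp
  qed
  ultimately have eq: "ini (par x y M) v = par x y (ini M v)" using ini_par_eq[OF l(1,2)] by simp
  have "\<not> is_coloop (par x y (ini M v)) x \<and> \<not> is_coloop (par x y (ini M v)) y"
    using nl l unfolding eq
    by (auto simp: is_coloop_par[OF is_loop_ini[OF l(1)] l(2) ini_nonempty[OF l(3)]] par_loop is_loop_ini)
  then show False using s st[of x] st[of y] unfolding eq by (auto simp: stat_eq_iff)
qed

lemma fenum_col:
  fixes M :: "'g::finite set set"
  assumes l: "is_loop M x" "M \<noteq> {}" and s: "\<sigma> x = Coloop"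
  shows "fenum (col x M) a b \<sigma> = fenum M a b (\<sigma>(x := Loop))"
proof -
  have inj: "G = G'" if "is_loop G x" "is_loop G' x" "col x G = col x G'" for G G'
  proof -
    have *: "(\<lambda>B. B - {x}) ` col x G = G" if "is_loop G x" for G
    proof -
      have "(\<lambda>B. B - {x}) ` col x G = (\<lambda>B. insert x B - {x}) ` G" unfolding col_def by blast
      also have "\<dots> = (\<lambda>B. B) ` G" using that by (intro image_cong refl) (auto simp: is_loop_def)
      finally show ?thesis by simp
    qed
    show ?thesis
      using arg_cong[OF that(3), of "image (\<lambda>B. B - {x})"] unfolding *[OF that(1)] *[OF that(2)] .
  qed
  have st: "stat (col x G) z = (if z = x then Coloop else stat G z)" if "is_loop G x" "G \<noteq> {}" for G z
  proof -
    have "is_coloop (col x G) z \<longleftrightarrow> z = x \<or> is_coloop G z" unfolding is_coloop_def col_def by blast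
    then show ?thesis using that by (auto simp: stat_def is_loop_col)
  qed
  have cell: "ini (col x M) v = col x G \<longleftrightarrow> ini M v = G" if "is_loop G x" for v G
    using ini_col[OF l(1)] inj[OF is_loop_ini[OF l(1)] that] by metis
  have "bij_betw (col x) (FS M a b (\<sigma>(x := Loop))) (FS (col x M) a b \<sigma>)"
  proof (rule bij_betw_imageI[OF inj_onI set_eqI[OF iffI]])
    fix G G' assume G: "G \<in> FS M a b (\<sigma>(x := Loop))" "G' \<in> FS M a b (\<sigma>(x := Loop))" and eq: "col x G = col x G'"
    show "G = G'" by (rule inj[OF _ _ eq]) (use G is_loop_ini[OF l(1)] in \<open>auto simp: FS_def\<close>)
  next
    fix H assume "H \<in> col x ` FS M a b (\<sigma>(x := Loop))"
    then obtain v where H: "H = col x (ini M v)" and stG: "\<And>z. stat (ini M v) z = (\<sigma>(x := Loop)) z"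
      and dom: "\<And>u. ini M u = ini M v \<Longrightarrow> u $ b \<le> u $ a" unfolding FS_def by blast
    note g = is_loop_ini[OF l(1), of v] ini_nonempty[OF l(2), of v]
    have "ini (col x M) v = H" using H cell[OF g(1)] by blast
    moreover have "\<And>z. stat H z = \<sigma> z" using st[OF g] stG s by (simp add: H)
    moreover have "\<And>u. ini (col x M) u = H \<Longrightarrow> u $ b \<le> u $ a" using cell[OF g(1)] dom H by blast
    ultimately show "H \<in> FS (col x M) a b \<sigma>" unfolding FS_def by blast
  next
    fix H assume "H \<in> FS (col x M) a b \<sigma>"
    then obtain v where v: "ini (col x M) v = H" and stH: "\<And>z. stat H z = \<sigma> z"
      and dom: "\<And>u. ini (col x M) u = H \<Longrightarrow> u $ b \<le> u $ a" unfolding FS_def by blast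
    note g = is_loop_ini[OF l(1), of v] ini_nonempty[OF l(2), of v]
    have H: "H = col x (ini M v)" using v cell[OF g(1)] ini_col[OF l(1)] by metis
    have "stat (ini M v) z = (\<sigma>(x := Loop)) z" for z
      using st[OF g, of z] stH[of z] g(1) by (auto simp: H stat_eq_iff)
    moreover have "u $ b \<le> u $ a" if "ini M u = ini M v" for u
      using that dom cell[OF g(1)] H by blast
    ultimately have "ini M v \<in> FS M a b (\<sigma>(x := Loop))" unfolding FS_def by blast
    then show "H \<in> col x ` FS M a b (\<sigma>(x := Loop))" using H by blast
  qed
  from sum.reindex_bij_betw[OF this, of "\<lambda>G. tt ^ dim (lin G)"]
  have "fenum (col x M) a b \<sigma> = (\<Sum>G\<in>FS M a b (\<sigma>(x := Loop)). tt ^ dim (lin (col x G)))"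
    unfolding fenum_def by simp
  also have "\<dots> = fenum M a b (\<sigma>(x := Loop))" unfolding fenum_def
    using is_loop_ini[OF l(1)] by (intro sum.cong refl) (auto simp: FS_def lin_col)
  finally show ?thesis .
qed

lemma fenum_coloop:
  assumes "is_coloop M x" "M \<noteq> {}" "\<sigma> x \<noteq> Coloop" shows "fenum M a b \<sigma> = 0"
proof (rule fenum_empty, rule ccontr)
  assume "FS M a b \<sigma> \<noteq> {}"
  then obtain v where "stat (ini M v) x = \<sigma> x" unfolding FS_def by blast
  moreover have "is_coloop (ini M v) x" using assms(1) ini_subset[of M v] by (auto simp: is_coloop_def)
  moreover have "\<not> is_loop (ini M v) x"
    using ini_nonempty[OF assms(2), of v] \<open>is_coloop (ini M v) x\<close> by (auto simp: is_loop_def is_coloop_def)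
  ultimately show False using assms(3) by (simp add: stat_def)
qed

section \<open>Duality, turning parallel into series extensions\<close>

definition dual :: "'g set set \<Rightarrow> 'g set set" where
  "dual M = (\<Union>B\<in>M. {- B})"

fun dst :: "status \<Rightarrow> status" where
  "dst Ord = Ord" | "dst Loop = Coloop" | "dst Coloop = Loop"

lemma dst_dst [simp]: "dst (dst s) = s" by (cases s) auto

lemma dst_comp [simp]: "dst \<circ> (dst \<circ> \<sigma>) = \<sigma>" by (simp add: fun_eq_iff)

lemma dual_dual [simp]: "dual (dual M) = M" by (simp add: dual_def)

lemma dual_nonempty [simp]: "dual M = {} \<longleftrightarrow> M = {}" by (auto simp: dual_def)

lemma in_dual_iff: "B \<in> dual M \<longleftrightarrow> - B \<in> M"
proof -
  have "B \<in> dual M \<longleftrightarrow> (\<exists>C\<in>M. B = - C)" by (simp add: dual_def)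
  also have "\<dots> \<longleftrightarrow> - B \<in> M" by (metis double_complement)
  finally show ?thesis .
qed

lemma wt_Compl: "wt v (- B) = wt v UNIV - wt v (B :: 'g::finite set)"
  unfolding wt_def by (simp add: Compl_eq_Diff_UNIV sum_diff)

lemma ini_dual: "ini (dual M) v = dual (ini M (- v))"
proof (rule set_eqI)
  fix B
  have "B \<in> ini (dual M) v \<longleftrightarrow> - B \<in> M \<and> (\<forall>C. - C \<in> M \<longrightarrow> wt v C \<le> wt v B)"
    by (simp add: ini_def in_dual_iff Ball_def)
  also have "\<dots> \<longleftrightarrow> - B \<in> M \<and> (\<forall>C. C \<in> M \<longrightarrow> wt v (- C) \<le> wt v (- (- B)))"
    by (metis double_complement)
  also have "\<dots> \<longleftrightarrow> B \<in> dual (ini M (- v))"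
    unfolding in_dual_iff ini_def by (auto simp: wt_Compl algebra_simps)
  finally show "B \<in> ini (dual M) v \<longleftrightarrow> B \<in> dual (ini M (- v))" .
qed

lemma is_loop_dual: "is_loop (dual M) x \<longleftrightarrow> is_coloop M x"
  and is_coloop_dual: "is_coloop (dual M) x \<longleftrightarrow> is_loop M x"
  by (auto simp: is_loop_def is_coloop_def dual_def)

lemma stat_dual: "M \<noteq> {} \<Longrightarrow> stat (dual M) x = dst (stat M x)"
  unfolding stat_def is_loop_dual is_coloop_dual
  by (auto simp: is_loop_def is_coloop_def)

lemma lin_dual: "lin (dual M) = lin M"
proof -
  have "lin M \<subseteq> lin (dual M)" for M :: "'a set set"
  proof
    fix v assume v: "v \<in> lin M"
    show "v \<in> lin (dual M)"
    proof (rule linI)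
      fix B C assume "B \<in> dual M" "C \<in> dual M"
      then have "wt v (- B) = wt v (- C)" unfolding in_dual_iff by (rule linD[OF v])
      then show "wt v B = wt v C" by (simp add: wt_Compl)
    qed
  qed
  from this[of M] this[of "dual M"] show ?thesis by simp
qed

lemma fenum_dual:
  assumes ne: "M \<noteq> {}"
  shows "fenum (dual M) a b \<sigma> = fenum M b a (dst \<circ> \<sigma>)"
proof -
  have sub: "dual G \<in> FS (dual M) b a (dst \<circ> \<sigma>)" if G: "G \<in> FS M a b \<sigma>" and ne: "M \<noteq> {}" for M G and a b :: 'a and \<sigma>
  proof -
    obtain v where v: "ini M v = G" and st: "\<And>z. stat G z = \<sigma> z"
      and dom: "\<And>u. ini M u = G \<Longrightarrow> u $ b \<le> u $ a" using G unfolding FS_def by blast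
    have "ini (dual M) (- v) = dual G" using v by (simp add: ini_dual)
    moreover have "stat (dual G) z = (dst \<circ> \<sigma>) z" for z
      using stat_dual[of G z] st v ini_nonempty[OF ne, of v] by simp
    moreover have "u $ a \<le> u $ b" if u: "ini (dual M) u = dual G" for u
    proof -
      have "dual (dual (ini M (- u))) = dual (dual G)" using u by (simp only: ini_dual)
      then have "ini M (- u) = G" by simp
      from dom[OF this] show ?thesis by simp
    qed
    ultimately show ?thesis unfolding FS_def by blast
  qed
  have "bij_betw dual (FS M b a (dst \<circ> \<sigma>)) (FS (dual M) a b \<sigma>)"
  proof (rule bij_betwI[of _ _ _ dual])
    show "dual \<in> FS M b a (dst \<circ> \<sigma>) \<rightarrow> FS (dual M) a b \<sigma>"
      using sub[of _ M b a "dst \<circ> \<sigma>"] ne by simp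
    show "dual \<in> FS (dual M) a b \<sigma> \<rightarrow> FS M b a (dst \<circ> \<sigma>)"
      using sub[of _ "dual M" a b \<sigma>] ne by simp
  qed auto
  from sum.reindex_bij_betw[OF this, of "\<lambda>G. tt ^ dim (lin G)"]
  show ?thesis unfolding fenum_def by (simp add: lin_dual)
qed

text \<open>Dualizing \<open>M\<close> turns the loop \<open>x\<close> into a coloop. Deleting
  \<open>x\<close> from all members gives \<open>M'\<close>, in which \<open>x\<close> is a loop
  again, and the parallel extension of \<open>M'\<close> is dual to the series extension of
  \<open>M\<close>. The series counts below are translations of the parallel ones, with the
  direction of domination reversed.\<close>

lemma ser_dual:
  assumes l: "is_loop M x" "x \<noteq> y" and ne: "M \<noteq> {}"
  obtains M' where "is_loop M' x" "M' \<noteq> {}" "ser x y M = dual (par x y M')"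
    "\<And>a b \<rho>. \<rho> x = Loop \<Longrightarrow> fenum M' b a \<rho> = fenum M a b ((dst \<circ> \<rho>)(x := Loop))"
proof -
  define M' where "M' = (\<Union>B\<in>M. {- B - {x}})"
  have 1: "is_loop M' x" "M' \<noteq> {}" using ne by (auto simp: is_loop_def M'_def)
  have 2: "ser x y M = dual (par x y M')"
    unfolding ser_def dual_def par_def M'_def UN_UN_flatten
  proof (rule SUP_cong[OF refl])
    fix B assume "B \<in> M"
    then have x: "x \<notin> B" using l by (auto simp: is_loop_def)
    have "- (- B - {x}) = insert x B" by blast
    moreover have "- (insert x (- B - {x} - {y})) = insert y B" if "y \<notin> B" using x l by blast
    moreover have "y \<in> - B - {x} \<longleftrightarrow> y \<notin> B" using l by blast
    ultimately show "(if y \<in> B then {insert x B} else {insert x B, insert y B}) =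
      (\<Union>C\<in>{- B - {x}}. \<Union>D\<in>(if y \<in> C then {C, insert x (C - {y})} else {C}). {- D})"
      by (simp add: insert_commute)
  qed
  have 3: "dual M = col x M'"
    unfolding dual_def col_def M'_def UN_UN_flatten
  proof (rule SUP_cong[OF refl])
    fix B assume "B \<in> M"
    then have "x \<notin> B" using l by (auto simp: is_loop_def)
    then have "insert x (- B - {x}) = - B" by blast
    then show "{- B} = (\<Union>C\<in>{- B - {x}}. {insert x C})" by simp
  qed
  have 4: "fenum M' b a \<rho> = fenum M a b ((dst \<circ> \<rho>)(x := Loop))" if r: "\<rho> x = Loop" for a b \<rho>
  proof -
    have "dst \<circ> (dst \<circ> \<rho>)(x := Loop) = \<rho>(x := Coloop)" by (auto simp: fun_eq_iff)
    then have "fenum M a b ((dst \<circ> \<rho>)(x := Loop)) = fenum (dual M) b a (\<rho>(x := Coloop))"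
      using fenum_dual[of "dual M" a b "(dst \<circ> \<rho>)(x := Loop)"] ne by simp
    also have "\<dots> = fenum M' b a (\<rho>(x := Coloop, x := Loop))"
      unfolding 3 by (rule fenum_col[OF 1]) simp
    also have "\<rho>(x := Coloop, x := Loop) = \<rho>" using r by (simp add: fun_eq_iff)
    finally show ?thesis by (rule sym)
  qed
  show ?thesis by (rule that[OF 1 2 4])
qed

lemma fenum_ser_ord:
  fixes M :: "'g::finite set set"
  assumes l: "is_loop M x" "x \<noteq> y" and ab: "a \<noteq> x" "b \<noteq> x" and s: "\<sigma> x = Ord" "\<sigma> y = Ord" and ne: "M \<noteq> {}"
  shows "tt * fenum (ser x y M) a b \<sigma> = fenum M a b (\<sigma>(x := Loop)) + fenum M a b (\<sigma>(x := Loop, y := Loop))"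
proof -
  obtain M' where M': "is_loop M' x" "M' \<noteq> {}" "ser x y M = dual (par x y M')"
    and f: "\<And>a b \<rho>. \<rho> x = Loop \<Longrightarrow> fenum M' b a \<rho> = fenum M a b ((dst \<circ> \<rho>)(x := Loop))"
    using ser_dual[OF l ne] by metis
  have "fenum (ser x y M) a b \<sigma> = fenum (par x y M') b a (dst \<circ> \<sigma>)"
    unfolding M'(3) using M'(2) by (intro fenum_dual) simp
  then have "tt * fenum (ser x y M) a b \<sigma> = fenum M' b a ((dst \<circ> \<sigma>)(x := Loop)) +
     fenum M' b a ((dst \<circ> \<sigma>)(x := Loop, y := Coloop))"
    using fenum_par_ord[OF M'(1) l(2) ab(2,1) _ _ M'(2), of "dst \<circ> \<sigma>"] s by simp
  also have "fenum M' b a ((dst \<circ> \<sigma>)(x := Loop)) = fenum M a b (\<sigma>(x := Loop))"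
    by (subst f) (auto intro!: arg_cong[of _ _ "fenum M a b"] simp: fun_eq_iff)
  also have "fenum M' b a ((dst \<circ> \<sigma>)(x := Loop, y := Coloop)) = fenum M a b (\<sigma>(x := Loop, y := Loop))"
    using l by (subst f) (auto intro!: arg_cong[of _ _ "fenum M a b"] simp: fun_eq_iff)
  finally show ?thesis .
qed

lemma fenum_ser_coloop:
  fixes M :: "'g::finite set set"
  assumes l: "is_loop M x" "x \<noteq> y" and ab: "a \<noteq> x" "b \<noteq> x" "a \<noteq> b" and s: "\<sigma> x = Coloop" and ne: "M \<noteq> {}"
  shows "fenum (ser x y M) a b \<sigma> = fenum M a b (\<sigma>(x := Loop))"
proof -
  obtain M' where M': "is_loop M' x" "M' \<noteq> {}" "ser x y M = dual (par x y M')"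
    and f: "\<And>a b \<rho>. \<rho> x = Loop \<Longrightarrow> fenum M' b a \<rho> = fenum M a b ((dst \<circ> \<rho>)(x := Loop))"
    using ser_dual[OF l ne] by metis
  have "fenum (ser x y M) a b \<sigma> = fenum (par x y M') b a (dst \<circ> \<sigma>)"
    unfolding M'(3) using M'(2) by (intro fenum_dual) simp
  also have "\<dots> = fenum M' b a (dst \<circ> \<sigma>)"
    using fenum_par_loop[OF M'(1) l(2) ab(2,1), of "dst \<circ> \<sigma>"] ab s by simp
  also have "\<dots> = fenum M a b (\<sigma>(x := Loop))"
    using s by (subst f) (auto intro!: arg_cong[of _ _ "fenum M a b"] simp: fun_eq_iff)
  finally show ?thesis .
qed

lemma fenum_ser_coloop2:
  fixes M :: "'g::finite set set"
  assumes l: "is_loop M x" "x \<noteq> y" and ab: "a \<noteq> x" "b \<noteq> x" "a \<noteq> b" "b \<noteq> y"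
    and s: "\<sigma> y = Coloop" "\<sigma> x \<noteq> Coloop" and ne: "M \<noteq> {}"
  shows "fenum (ser x y M) a b \<sigma> = fenum M a b (\<sigma>(x := Loop, y := \<sigma> x))"
proof -
  obtain M' where M': "is_loop M' x" "M' \<noteq> {}" "ser x y M = dual (par x y M')"
    and f: "\<And>a b \<rho>. \<rho> x = Loop \<Longrightarrow> fenum M' b a \<rho> = fenum M a b ((dst \<circ> \<rho>)(x := Loop))"
    using ser_dual[OF l ne] by metis
  have s': "dst (\<sigma> x) \<noteq> Loop" using s by (cases "\<sigma> x") auto
  have "fenum (ser x y M) a b \<sigma> = fenum (par x y M') b a (dst \<circ> \<sigma>)"
    unfolding M'(3) using M'(2) by (intro fenum_dual) simp
  also have "\<dots> = fenum M' b a ((dst \<circ> \<sigma>)(x := Loop, y := dst (\<sigma> x)))"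
    using fenum_par_loop2[OF M'(1) l(2) ab(2,1) _ ab(4), of "dst \<circ> \<sigma>"] ab s s' by simp
  also have "\<dots> = fenum M a b (\<sigma>(x := Loop, y := \<sigma> x))"
    using l by (subst f) (auto intro!: arg_cong[of _ _ "fenum M a b"] simp: fun_eq_iff)
  finally show ?thesis .
qed

lemma fenum_ser_zero:
  fixes M :: "'g::finite set set"
  assumes l: "is_loop M x" "x \<noteq> y" and ne: "M \<noteq> {}"
    and s: "\<sigma> x = Loop \<and> \<sigma> y \<noteq> Coloop \<or> \<sigma> y = Loop \<and> \<sigma> x \<noteq> Coloop"
  shows "fenum (ser x y M) a b \<sigma> = 0"
proof -
  obtain M' where M': "is_loop M' x" "M' \<noteq> {}" "ser x y M = dual (par x y M')"
    using ser_dual[OF l ne] by metis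
  have "fenum (ser x y M) a b \<sigma> = fenum (par x y M') b a (dst \<circ> \<sigma>)"
    unfolding M'(3) using M'(2) by (intro fenum_dual) simp
  moreover have "(dst \<circ> \<sigma>) x = Coloop \<and> (dst \<circ> \<sigma>) y \<noteq> Loop \<or> (dst \<circ> \<sigma>) y = Coloop \<and> (dst \<circ> \<sigma>) x \<noteq> Loop"
    using s by (cases "\<sigma> x"; cases "\<sigma> y") auto
  ultimately show ?thesis using fenum_par_zero[OF M'(1) l(2) M'(2)] by metis
qed

section \<open>The two balance identities for dominating elements\<close>

text \<open>The first identity is what crossing a wall requires: if neither element is a loop,
  \<open>fenum_coloop_right\<close> leaves just these statuses. The second identity is the
  strengthening that carries the induction through a series extension at \<open>e\<close>. The
  values of \<open>\<sigma>\<close> at \<open>e\<close> and \<open>f\<close> are always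
  overwritten.\<close>

definition balanced :: "'g::finite set set \<Rightarrow> 'g \<Rightarrow> 'g \<Rightarrow> ('g \<Rightarrow> status) \<Rightarrow> bool" where
  "balanced M e f \<sigma> \<longleftrightarrow>
     fenum M e f (\<sigma>(e := Ord, f := Ord)) + fenum M e f (\<sigma>(e := Coloop, f := Ord)) =
       fenum M f e (\<sigma>(e := Ord, f := Ord)) + fenum M f e (\<sigma>(e := Ord, f := Coloop)) \<and>
     tt * fenum M e f (\<sigma>(e := Ord, f := Ord)) = fenum M e f (\<sigma>(e := Coloop, f := Ord)) +
       (fenum M f e (\<sigma>(e := Loop, f := Ord)) + fenum M f e (\<sigma>(e := Loop, f := Coloop)))"

lemma tt_nonzero [simp]: "tt \<noteq> 0" by (simp add: tt_def)

lemma balanced_zero: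
  assumes "\<And>s r. r \<noteq> Loop \<Longrightarrow> fenum M e f (\<sigma>(e := s, f := r)) = 0"
    "\<And>s r. r \<noteq> Loop \<Longrightarrow> fenum M f e (\<sigma>(e := s, f := r)) = 0"
  shows "balanced M e f \<sigma>"
  unfolding balanced_def using assms by simp

lemma balanced_eq:
  assumes "\<And>s r. fenum N e f (\<sigma>(e := s, f := r)) = fenum M e f (\<sigma>'(e := s, f := r))"
    "\<And>s r. fenum N f e (\<sigma>(e := s, f := r)) = fenum M f e (\<sigma>'(e := s, f := r))"
    "balanced M e f \<sigma>'"
  shows "balanced N e f \<sigma>"
  using assms(3) unfolding balanced_def assms(1,2) .

lemma balanced_sum:
  assumes "\<And>s r. tt * fenum N e f (\<sigma>(e := s, f := r)) = fenum M e f (\<rho>(e := s, f := r)) + fenum M e f (\<tau>(e := s, f := r))"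
    "\<And>s r. tt * fenum N f e (\<sigma>(e := s, f := r)) = fenum M f e (\<rho>(e := s, f := r)) + fenum M f e (\<tau>(e := s, f := r))"
    "balanced M e f \<rho>" "balanced M e f \<tau>"
  shows "balanced N e f \<sigma>"
proof -
  have cancel: "tt * X = tt * Y \<Longrightarrow> X = Y" for X Y by simp
  note b1 = conjunct1[OF assms(3)[unfolded balanced_def]] conjunct2[OF assms(3)[unfolded balanced_def]]
  note b2 = conjunct1[OF assms(4)[unfolded balanced_def]] conjunct2[OF assms(4)[unfolded balanced_def]]
  show ?thesis unfolding balanced_def
  proof (intro conjI; rule cancel)
    show "tt * (fenum N e f (\<sigma>(e := Ord, f := Ord)) + fenum N e f (\<sigma>(e := Coloop, f := Ord))) =
       tt * (fenum N f e (\<sigma>(e := Ord, f := Ord)) + fenum N f e (\<sigma>(e := Ord, f := Coloop)))"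
      unfolding distrib_left assms(1,2) using b1(1) b2(1) by (simp add: algebra_simps)
    show "tt * (tt * fenum N e f (\<sigma>(e := Ord, f := Ord))) = tt * (fenum N e f (\<sigma>(e := Coloop, f := Ord)) +
       (fenum N f e (\<sigma>(e := Loop, f := Ord)) + fenum N f e (\<sigma>(e := Loop, f := Coloop))))"
      unfolding distrib_left assms(1,2) using b1(2) b2(2) by (simp add: algebra_simps)
  qed
qed

lemma balanced_swap:
  assumes R: "relabel (swp x y) M = M" and f: "f \<notin> {x, y}" and b: "balanced M y f (\<sigma> \<circ> swp x y)"
  shows "balanced M x f \<sigma>"
proof -
  have [simp]: "swp x y f = f" using f by (simp add: Transposition.transpose_def)
  have *: "\<sigma>(x := s, f := r) \<circ> swp x y = (\<sigma> \<circ> swp x y)(y := s, f := r)" for s r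
    using f by (auto simp: fun_eq_iff Transposition.transpose_def)
  have "fenum M x f (\<sigma>(x := s, f := r)) = fenum M y f ((\<sigma> \<circ> swp x y)(y := s, f := r))"
    "fenum M f x (\<sigma>(x := s, f := r)) = fenum M f y ((\<sigma> \<circ> swp x y)(y := s, f := r))" for s r
    using fenum_swap[OF R, of x f "\<sigma>(x := s, f := r)"] fenum_swap[OF R, of f x "\<sigma>(x := s, f := r)"] by (simp_all add: *)
  then show ?thesis using b unfolding balanced_def by simp
qed

text \<open>The faces are the hyperplane \<open>v $ e = v $ f\<close>, on which each element
  dominates the other, and the two open half-spaces. The second identity says here that a half-space
  has one dimension more than the hyperplane.\<close>

lemma balanced_pair:
  assumes "e \<noteq> f" shows "balanced {{e}, {f}} e f \<sigma>"
proof (cases "\<exists>z. z \<notin> {e, f} \<and> \<sigma> z \<noteq> Loop")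
  case True
  then obtain z where z: "z \<notin> {e, f}" "\<sigma> z \<noteq> Loop" by blast
  then have "is_loop {{e}, {f}} z" by (auto simp: is_loop_def)
  then show ?thesis using z by (intro balanced_zero fenum_loop[of _ z]) auto
next
  case False
  let ?M = "{{e}, {f}}"
  have ini: "ini ?M v = (if v $ e = v $ f then ?M else if v $ f < v $ e then {{e}} else {{f}})" for v
    using assms by (auto simp: ini_def wt_def)
  have ne: "?M \<noteq> {{e}}" "?M \<noteq> {{f}}" "{{e}} \<noteq> {{f}}" using assms by auto
  define u :: "real ^ 'a" where "u = axis f 1"
  have u: "u $ e < u $ f" using assms by (simp add: u_def axis_def)
  have st: "stat ?M = (\<lambda>z. if z \<in> {e, f} then Ord else Loop)"
    "stat {{e}} = (\<lambda>z. if z = e then Coloop else Loop)" "stat {{f}} = (\<lambda>z. if z = f then Coloop else Loop)"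
    using assms by (auto simp: fun_eq_iff stat_def is_loop_def is_coloop_def)
  have \<sigma>: "\<sigma>(e := s, f := r) = (\<lambda>z. if z = e then s else if z = f then r else Loop)" for s r
    using False assms by (auto simp: fun_eq_iff)
  have range: "(\<exists>v. ini ?M v = G) \<Longrightarrow> G \<in> {?M, {{e}}, {{f}}}" for G
    unfolding ini by (elim exE) (simp split: if_splits)
  have rM: "ini ?M 0 = ?M" and rf: "ini ?M u = {{f}}" using u by (simp_all add: ini)
  have cM: "ini ?M v = ?M \<longleftrightarrow> v $ e = v $ f" and cf: "ini ?M v = {{f}} \<longleftrightarrow> v $ e < v $ f" for v
    using assms unfolding ini by (auto simp: doubleton_eq_iff)
  have F: "FS ?M e f (\<sigma>(e := Ord, f := Ord)) = {?M}" "FS ?M f e (\<sigma>(e := Ord, f := Ord)) = {?M}"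
    "FS ?M e f (\<sigma>(e := Coloop, f := Ord)) = {}" "FS ?M f e (\<sigma>(e := Ord, f := Coloop)) = {}"
    "FS ?M f e (\<sigma>(e := Loop, f := Ord)) = {}" "FS ?M f e (\<sigma>(e := Loop, f := Coloop)) = {{{f}}}"
  proof -
    have s1: "stat ?M e = Ord" "stat ?M f = Ord" "stat {{e}} e = Coloop" "stat {{e}} f = Loop"
      "stat {{f}} e = Loop" "stat {{f}} f = Coloop" using st assms by auto
    have M: "?M \<in> FS ?M a b (\<sigma>(e := Ord, f := Ord))" if "a \<in> {e, f}" "b \<in> {e, f}" for a b
      unfolding FS_def mem_Collect_eq
    proof (intro conjI allI impI)
      show "\<exists>v. ini ?M v = ?M" using rM by blast
      show "stat ?M z = (\<sigma>(e := Ord, f := Ord)) z" for z unfolding \<sigma> st(1) by simp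
      show "v $ b \<le> v $ a" if "ini ?M v = ?M" for v
        using that \<open>a \<in> {e, f}\<close> \<open>b \<in> {e, f}\<close> unfolding cM by auto
    qed
    have f: "{{f}} \<in> FS ?M f e (\<sigma>(e := Loop, f := Coloop))"
      unfolding FS_def mem_Collect_eq
    proof (intro conjI allI impI)
      show "\<exists>v. ini ?M v = {{f}}" using rf by blast
      show "stat {{f}} z = (\<sigma>(e := Loop, f := Coloop)) z" for z unfolding \<sigma> st(3) using assms by simp
      show "v $ e \<le> v $ f" if "ini ?M v = {{f}}" for v using that unfolding cf by simp
    qed
    have sub: "G = ?M \<and> s = Ord \<and> r = Ord \<or> G = {{f}} \<and> s = Loop \<and> r = Coloop \<or> G = {{e}} \<and> s = Coloop \<and> r = Loop"
      if G: "G \<in> FS ?M a b (\<sigma>(e := s, f := r))" for G a b s r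
    proof -
      have "stat G e = s" "stat G f = r" using G assms unfolding FS_def by auto
      moreover have "G = ?M \<or> G = {{e}} \<or> G = {{f}}" using range[of G] G unfolding FS_def by auto
      ultimately show ?thesis using s1 by metis
    qed
    show "FS ?M e f (\<sigma>(e := Ord, f := Ord)) = {?M}" using M[of e f] sub[of _ e f Ord Ord] by (intro equalityI subsetI) auto
    show "FS ?M f e (\<sigma>(e := Ord, f := Ord)) = {?M}" using M[of f e] sub[of _ f e Ord Ord] by (intro equalityI subsetI) auto
    show "FS ?M e f (\<sigma>(e := Coloop, f := Ord)) = {}" using sub[of _ e f Coloop Ord] by auto
    show "FS ?M f e (\<sigma>(e := Ord, f := Coloop)) = {}" using sub[of _ f e Ord Coloop] by auto
    show "FS ?M f e (\<sigma>(e := Loop, f := Ord)) = {}" using sub[of _ f e Loop Ord] by auto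
    show "FS ?M f e (\<sigma>(e := Loop, f := Coloop)) = {{{f}}}" using f sub[of _ f e Loop Coloop] by (intro equalityI subsetI) auto
  qed
  have "par e f {{f}} = ?M" by (auto simp: par_def)
  then have "dim (lin {{f}}) = Suc (dim (lin ?M))"
    using dim_lin_par[of "{{f}}" e f] assms by (simp add: is_loop_def)
  then show ?thesis unfolding balanced_def fenum_def F by simp
qed

text \<open>The construction never touches \<open>f\<close>. Steps away from \<open>e\<close>
  transport both identities linearly. The interesting steps are those at \<open>e = y\<close>, with
  \<open>e = x\<close> following by symmetry: there the parallel case needs only the first identity
  for \<open>M\<close>, while the series case combines both.\<close>

theorem balanced_pointed:
  fixes M :: "'g::finite set set"
  assumes "Cl {f} (pointed_bases f) M"
  shows "\<forall>e \<sigma>. e \<noteq> f \<longrightarrow> balanced M e f \<sigma>"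
  using assms
proof (induction rule: Cl.induct)
  case (base M)
  show ?case
  proof (intro allI impI)
  fix e \<sigma> assume ef: "e \<noteq> f"
  consider "M = {{}}" | "M = {{f}}" | g where "M = {{g}, {f}}" "g \<noteq> f"
    using base by (auto simp: pointed_bases_def)
  then show "balanced M e f \<sigma>"
  proof cases
    case 1
    then have "is_loop M f" by (simp add: is_loop_def)
    then show ?thesis by (intro balanced_zero fenum_loop[of _ f]) auto
  next
    case 2
    then have "is_loop M e" using ef by (simp add: is_loop_def)
    then show ?thesis using ef by (intro balanced_zero fenum_free[OF axis_lin_loop]) auto
  next
    case 3
    show ?thesis
    proof (cases "e = g")
      case True then show ?thesis using 3 balanced_pair by blast
    next
      case False
      then have "is_loop M e" using ef 3 by (simp add: is_loop_def)
      then show ?thesis using ef by (intro balanced_zero fenum_free[OF axis_lin_loop]) auto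
    qed
  qed
  qed
next
  case (col M x)
  have IH: "balanced M e f \<sigma>" if "e \<noteq> f" for e \<sigma> using col.IH that by blast
  have ne: "M \<noteq> {}" using Cl_nonempty[OF col.hyps(1) pointed_bases_nonempty] .
  have cl: "is_coloop (col x M) x" by (auto simp: is_coloop_def col_def)
  have xf: "x \<noteq> f" using col by simp
  show ?case
  proof (intro allI impI)
  fix e \<sigma> assume ef: "e \<noteq> f"
  show "balanced (col x M) e f \<sigma>"
  proof (cases "e = x")
    case True
    then show ?thesis using ef cl by (intro balanced_zero fenum_free[OF axis_lin_coloop]) auto
  next
    case False
    show ?thesis
    proof (cases "\<sigma> x = Coloop")
      case True
      have "fenum (col x M) a b (\<sigma>(e := s, f := r)) = fenum M a b ((\<sigma>(x := Loop))(e := s, f := r))" for a b s r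
        using fenum_col[OF col.hyps(2) ne, where \<sigma> = "\<sigma>(e := s, f := r)" and a = a and b = b] True False xf
        by (simp add: fun_upd_twist)
      then show ?thesis using balanced_eq[where N = "col x M" and e = e and f = f and \<sigma> = \<sigma> and M = M and \<sigma>' = "\<sigma>(x := Loop)"] IH[OF ef] by blast
    next
      case F: False
      show ?thesis using F False xf ne cl by (intro balanced_zero fenum_coloop[of _ x]) auto
    qed
  qed
  qed
next
  case (par M x y)
  have IH: "balanced M e f \<sigma>" if "e \<noteq> f" for e \<sigma> using par.IH that by blast
  have ne: "M \<noteq> {}" using Cl_nonempty[OF par.hyps(1) pointed_bases_nonempty] .
  have xf: "x \<noteq> f" "y \<noteq> f" using par by auto
  note l = par.hyps(2,3)
  have at_y: "balanced (par x y M) y f \<sigma>" for \<sigma>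
  proof (cases "\<sigma> x")
    case Loop
    have 1: "fenum (par x y M) y f (\<sigma>(y := s, f := r)) = fenum M y f (\<sigma>(y := s, f := r))"
      "fenum (par x y M) f y (\<sigma>(y := s, f := r)) = fenum M f y (\<sigma>(y := s, f := r))" for s r
      using Loop xf l by (auto intro!: fenum_par_loop)
    show ?thesis by (rule balanced_eq[OF 1 IH[OF xf(2)]])
  next
    case Coloop
    have z: "fenum (par x y M) a b (\<sigma>(y := s, f := r)) = 0" if "s \<noteq> Loop" for a b s r
      using Coloop xf l that by (intro fenum_par_zero ne) auto
    have "fenum (par x y M) f y (\<sigma>(y := Loop, f := r)) = fenum M f y (\<sigma>(y := Loop, f := r, x := Loop, y := Coloop))" for r
      using Coloop xf l fenum_par_loop2[OF l, of f y "\<sigma>(y := Loop, f := r)"] by simp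
    also have "fenum M f y (\<sigma>(y := Loop, f := r, x := Loop, y := Coloop)) = 0" for r
      using xf by (intro fenum_coloop_right) auto
    finally show ?thesis unfolding balanced_def using z by simp
  next
    case Ord
    let ?\<sigma> = "\<sigma>(x := Loop)"
    have p1: "tt * fenum (par x y M) a b (\<sigma>(y := Ord, f := r)) =
      fenum M a b (?\<sigma>(y := Ord, f := r)) + fenum M a b (?\<sigma>(y := Coloop, f := r))" if "a \<noteq> x" "b \<noteq> x" for a b r
    proof -
      have "\<sigma>(y := Ord, f := r, x := Loop) = ?\<sigma>(y := Ord, f := r)"
        "\<sigma>(y := Ord, f := r, x := Loop, y := Coloop) = ?\<sigma>(y := Coloop, f := r)"
        using xf l by (auto simp: fun_eq_iff)
      then show ?thesis using fenum_par_ord[OF l that, of "\<sigma>(y := Ord, f := r)"] Ord xf l ne by simp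
    qed
    have p0: "fenum (par x y M) a b (\<sigma>(y := Coloop, f := r)) = 0" for a b r
      using Ord xf l by (intro fenum_par_zero ne) auto
    have p3: "fenum (par x y M) f y (\<sigma>(y := Loop, f := r)) = fenum M f y (?\<sigma>(y := Ord, f := r))" for r
    proof -
      have "\<sigma>(y := Loop, f := r, x := Loop, y := Ord) = ?\<sigma>(y := Ord, f := r)"
        using xf l by (auto simp: fun_eq_iff)
      then show ?thesis using fenum_par_loop2[OF l, of f y "\<sigma>(y := Loop, f := r)"] Ord xf l by simp
    qed
    have z: "fenum M f y (?\<sigma>(y := Coloop, f := r)) = 0" for r
      using xf by (intro fenum_coloop_right) auto
    have H1: "fenum M y f (?\<sigma>(y := Ord, f := Ord)) + fenum M y f (?\<sigma>(y := Coloop, f := Ord)) =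
       fenum M f y (?\<sigma>(y := Ord, f := Ord)) + fenum M f y (?\<sigma>(y := Ord, f := Coloop))"
      using IH[OF xf(2), of ?\<sigma>] unfolding balanced_def by blast
    have U: "tt * fenum (par x y M) y f (\<sigma>(y := Ord, f := Ord)) =
       fenum M f y (?\<sigma>(y := Ord, f := Ord)) + fenum M f y (?\<sigma>(y := Ord, f := Coloop))"
      using p1[of y f Ord] H1 xf l by simp
    have L: "tt * (fenum (par x y M) f y (\<sigma>(y := Ord, f := Ord)) + fenum (par x y M) f y (\<sigma>(y := Ord, f := Coloop))) =
       fenum M f y (?\<sigma>(y := Ord, f := Ord)) + fenum M f y (?\<sigma>(y := Ord, f := Coloop))"
      unfolding distrib_left using p1[of f y Ord] p1[of f y Coloop] z xf l by simp
    have "fenum (par x y M) y f (\<sigma>(y := Ord, f := Ord)) =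
      fenum (par x y M) f y (\<sigma>(y := Ord, f := Ord)) + fenum (par x y M) f y (\<sigma>(y := Ord, f := Coloop))"
      using U L mult_left_cancel[OF tt_nonzero] by metis
    then show ?thesis unfolding balanced_def p0 p3 U by simp
  qed
  show ?case
  proof (intro allI impI)
  fix e \<sigma> assume ef: "e \<noteq> f"
  consider "e = x" | "e = y" | "e \<notin> {x, y}" by blast
  then show "balanced (par x y M) e f \<sigma>"
  proof cases
    case 1 then show ?thesis using balanced_swap[OF relabel_par_self[OF l] _ at_y] xf by blast
  next
    case 2 then show ?thesis using at_y by blast
  next
    case 3
    then have ex: "e \<noteq> x" "e \<noteq> y" "f \<noteq> x" "f \<noteq> y" using xf by auto
    have tw: "\<sigma>(e := s, f := r, x := p) = (\<sigma>(x := p))(e := s, f := r)"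
      "\<sigma>(e := s, f := r, x := p, y := q) = (\<sigma>(x := p, y := q))(e := s, f := r)" for s r p q
      using ex by (auto simp: fun_eq_iff)
    consider "\<sigma> x = Ord" "\<sigma> y = Ord" | "\<sigma> x = Loop" | "\<sigma> y = Loop" "\<sigma> x \<noteq> Loop"
      | "\<sigma> x = Coloop \<and> \<sigma> y \<noteq> Loop \<or> \<sigma> y = Coloop \<and> \<sigma> x \<noteq> Loop"
      by (cases "\<sigma> x"; cases "\<sigma> y") auto
    then show ?thesis
    proof cases
      case 1
      have "tt * fenum (par x y M) a b (\<sigma>(e := s, f := r)) = fenum M a b ((\<sigma>(x := Loop))(e := s, f := r)) +
          fenum M a b ((\<sigma>(x := Loop, y := Coloop))(e := s, f := r))" if "a \<noteq> x" "b \<noteq> x" for a b s r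
      proof -
        have "(\<sigma>(e := s, f := r)) x = Ord" "(\<sigma>(e := s, f := r)) y = Ord" using 1 ex by auto
        from fenum_par_ord[OF l that this ne] show ?thesis unfolding tw(2) unfolding tw(1) .
      qed
      then show ?thesis using ex IH[OF ef] by (intro balanced_sum[where N = "par x y M" and e = e and f = f and \<sigma> = \<sigma> and M = M and \<rho> = "\<sigma>(x := Loop)" and \<tau> = "\<sigma>(x := Loop, y := Coloop)"]) auto
    next
      case 2
      have "fenum (par x y M) a b (\<sigma>(e := s, f := r)) = fenum M a b (\<sigma>(e := s, f := r))"
        if "a \<noteq> x" "b \<noteq> x" "a \<noteq> b" for a b s r
        using fenum_par_loop[OF l that, of "\<sigma>(e := s, f := r)"] 2 ex by simp
      then show ?thesis using ex IH[OF ef] ef by (intro balanced_eq[where N = "par x y M" and e = e and f = f and \<sigma> = \<sigma> and M = M and \<sigma>' = "\<sigma>"]) auto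
    next
      case 3
      have "fenum (par x y M) a b (\<sigma>(e := s, f := r)) = fenum M a b ((\<sigma>(x := Loop, y := \<sigma> x))(e := s, f := r))"
        if "a \<noteq> x" "b \<noteq> x" "a \<noteq> b" "a \<noteq> y" for a b s r
      proof -
        have h: "(\<sigma>(e := s, f := r)) y = Loop" "(\<sigma>(e := s, f := r)) x \<noteq> Loop" "(\<sigma>(e := s, f := r)) x = \<sigma> x"
          using 3 ex by auto
        from fenum_par_loop2[OF l that h(1,2)] show ?thesis unfolding h(3) tw(2) .
      qed
      then show ?thesis using ex IH[OF ef] ef by (intro balanced_eq[where N = "par x y M" and e = e and f = f and \<sigma> = \<sigma> and M = M and \<sigma>' = "\<sigma>(x := Loop, y := \<sigma> x)"]) auto
    next
      case 4
      then show ?thesis using ex l ne by (intro balanced_zero fenum_par_zero) auto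
    qed
  qed
  qed
next
  case (ser M x y)
  have IH: "balanced M e f \<sigma>" if "e \<noteq> f" for e \<sigma> using ser.IH that by blast
  have ne: "M \<noteq> {}" using Cl_nonempty[OF ser.hyps(1) pointed_bases_nonempty] .
  have xf: "x \<noteq> f" "y \<noteq> f" using ser by auto
  note l = ser.hyps(2,3)
  have at_y: "balanced (ser x y M) y f \<sigma>" for \<sigma>
  proof (cases "\<sigma> x")
    case Coloop
    have 1: "fenum (ser x y M) y f (\<sigma>(y := s, f := r)) = fenum M y f ((\<sigma>(x := Loop))(y := s, f := r))"
      "fenum (ser x y M) f y (\<sigma>(y := s, f := r)) = fenum M f y ((\<sigma>(x := Loop))(y := s, f := r))" for s r
      using Coloop xf l ne fenum_ser_coloop[OF l, of y f "\<sigma>(y := s, f := r)"]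
        fenum_ser_coloop[OF l, of f y "\<sigma>(y := s, f := r)"] by (simp_all add: fun_upd_twist)
    show ?thesis by (rule balanced_eq[OF 1 IH[OF xf(2)]])
  next
    case Loop
    have z: "fenum (ser x y M) a b (\<sigma>(y := s, f := r)) = 0" if "s \<noteq> Coloop" for a b s r
      using Loop xf l that by (intro fenum_ser_zero ne) auto
    have "fenum (ser x y M) y f (\<sigma>(y := Coloop, f := r)) = fenum M y f (\<sigma>(y := Coloop, f := r, x := Loop, y := Loop))" for r
      using Loop xf l fenum_ser_coloop2[OF l, of y f "\<sigma>(y := Coloop, f := r)"] ne by simp
    also have "fenum M y f (\<sigma>(y := Coloop, f := r, x := Loop, y := Loop)) = 0" for r
      using xf by (intro fenum_loop_left) auto
    finally show ?thesis unfolding balanced_def using z by simp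
  next
    case Ord
    let ?\<sigma> = "\<sigma>(x := Loop)"
    have p1: "tt * fenum (ser x y M) a b (\<sigma>(y := Ord, f := r)) =
      fenum M a b (?\<sigma>(y := Ord, f := r)) + fenum M a b (?\<sigma>(y := Loop, f := r))" if "a \<noteq> x" "b \<noteq> x" for a b r
    proof -
      have "\<sigma>(y := Ord, f := r, x := Loop) = ?\<sigma>(y := Ord, f := r)"
        "\<sigma>(y := Ord, f := r, x := Loop, y := Loop) = ?\<sigma>(y := Loop, f := r)"
        using xf l by (auto simp: fun_eq_iff)
      then show ?thesis using fenum_ser_ord[OF l that, of "\<sigma>(y := Ord, f := r)"] Ord xf l ne by simp
    qed
    have p0: "fenum (ser x y M) a b (\<sigma>(y := Loop, f := r)) = 0" for a b r
      using Ord xf l by (intro fenum_ser_zero ne) auto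
    have p3: "fenum (ser x y M) y f (\<sigma>(y := Coloop, f := r)) = fenum M y f (?\<sigma>(y := Ord, f := r))" for r
    proof -
      have "\<sigma>(y := Coloop, f := r, x := Loop, y := Ord) = ?\<sigma>(y := Ord, f := r)"
        using xf l by (auto simp: fun_eq_iff)
      then show ?thesis using fenum_ser_coloop2[OF l, of y f "\<sigma>(y := Coloop, f := r)"] Ord xf l ne by simp
    qed
    have z: "fenum M y f (?\<sigma>(y := Loop, f := r)) = 0" for r
      using xf by (intro fenum_loop_left) auto
    have H1: "fenum M y f (?\<sigma>(y := Ord, f := Ord)) + fenum M y f (?\<sigma>(y := Coloop, f := Ord)) =
       fenum M f y (?\<sigma>(y := Ord, f := Ord)) + fenum M f y (?\<sigma>(y := Ord, f := Coloop))"
      and H2: "tt * fenum M y f (?\<sigma>(y := Ord, f := Ord)) = fenum M y f (?\<sigma>(y := Coloop, f := Ord)) +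
       (fenum M f y (?\<sigma>(y := Loop, f := Ord)) + fenum M f y (?\<sigma>(y := Loop, f := Coloop)))"
      using IH[OF xf(2), of ?\<sigma>] unfolding balanced_def by blast+
    have U: "tt * fenum (ser x y M) y f (\<sigma>(y := Ord, f := Ord)) = fenum M y f (?\<sigma>(y := Ord, f := Ord))"
      using p1[of y f Ord] z xf l by simp
    \<comment> \<open>Expanding the left side produces terms in which \<open>f\<close> dominates a
      loop \<open>y\<close> of \<open>M\<close>. Their sum is supplied by \<open>H2\<close>, and its
      coloop term cancels against the one from \<open>H1\<close>.\<close>
    have L: "tt * (fenum (ser x y M) f y (\<sigma>(y := Ord, f := Ord)) + fenum (ser x y M) f y (\<sigma>(y := Ord, f := Coloop))) =
       tt * (fenum (ser x y M) y f (\<sigma>(y := Ord, f := Ord)) + fenum (ser x y M) y f (\<sigma>(y := Coloop, f := Ord)))"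
      unfolding distrib_left U p3 using p1[of f y Ord] p1[of f y Coloop] H1 H2 xf l by (simp add: algebra_simps)
    have "fenum (ser x y M) f y (\<sigma>(y := Ord, f := Ord)) + fenum (ser x y M) f y (\<sigma>(y := Ord, f := Coloop)) =
       fenum (ser x y M) y f (\<sigma>(y := Ord, f := Ord)) + fenum (ser x y M) y f (\<sigma>(y := Coloop, f := Ord))"
      using L mult_left_cancel[OF tt_nonzero] by metis
    then show ?thesis unfolding balanced_def p0 p3 U by simp
  qed
  show ?case
  proof (intro allI impI)
  fix e \<sigma> assume ef: "e \<noteq> f"
  consider "e = x" | "e = y" | "e \<notin> {x, y}" by blast
  then show "balanced (ser x y M) e f \<sigma>"
  proof cases
    case 1 then show ?thesis using balanced_swap[OF relabel_ser_self[OF l] _ at_y] xf by blast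
  next
    case 2 then show ?thesis using at_y by blast
  next
    case 3
    then have ex: "e \<noteq> x" "e \<noteq> y" "f \<noteq> x" "f \<noteq> y" using xf by auto
    have tw: "\<sigma>(e := s, f := r, x := p) = (\<sigma>(x := p))(e := s, f := r)"
      "\<sigma>(e := s, f := r, x := p, y := q) = (\<sigma>(x := p, y := q))(e := s, f := r)" for s r p q
      using ex by (auto simp: fun_eq_iff)
    consider "\<sigma> x = Ord" "\<sigma> y = Ord" | "\<sigma> x = Coloop" | "\<sigma> y = Coloop" "\<sigma> x \<noteq> Coloop"
      | "\<sigma> x = Loop \<and> \<sigma> y \<noteq> Coloop \<or> \<sigma> y = Loop \<and> \<sigma> x \<noteq> Coloop"
      by (cases "\<sigma> x"; cases "\<sigma> y") auto
    then show ?thesis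
    proof cases
      case 1
      have "tt * fenum (ser x y M) a b (\<sigma>(e := s, f := r)) = fenum M a b ((\<sigma>(x := Loop))(e := s, f := r)) +
          fenum M a b ((\<sigma>(x := Loop, y := Loop))(e := s, f := r))" if "a \<noteq> x" "b \<noteq> x" for a b s r
      proof -
        have "(\<sigma>(e := s, f := r)) x = Ord" "(\<sigma>(e := s, f := r)) y = Ord" using 1 ex by auto
        from fenum_ser_ord[OF l that this ne] show ?thesis unfolding tw(2) unfolding tw(1) .
      qed
      then show ?thesis using ex IH[OF ef] by (intro balanced_sum[where N = "ser x y M" and e = e and f = f and \<sigma> = \<sigma> and M = M and \<rho> = "\<sigma>(x := Loop)" and \<tau> = "\<sigma>(x := Loop, y := Loop)"]) auto
    next
      case 2
      have "fenum (ser x y M) a b (\<sigma>(e := s, f := r)) = fenum M a b ((\<sigma>(x := Loop))(e := s, f := r))"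
        if "a \<noteq> x" "b \<noteq> x" "a \<noteq> b" for a b s r
      proof -
        have "(\<sigma>(e := s, f := r)) x = Coloop" using 2 ex by auto
        from fenum_ser_coloop[OF l that, of "\<sigma>(e := s, f := r)", OF this ne] show ?thesis unfolding tw(1) .
      qed
      then show ?thesis using ex IH[OF ef] ef by (intro balanced_eq[where N = "ser x y M" and e = e and f = f and \<sigma> = \<sigma> and M = M and \<sigma>' = "\<sigma>(x := Loop)"]) auto
    next
      case 3
      have "fenum (ser x y M) a b (\<sigma>(e := s, f := r)) = fenum M a b ((\<sigma>(x := Loop, y := \<sigma> x))(e := s, f := r))"
        if "a \<noteq> x" "b \<noteq> x" "a \<noteq> b" "b \<noteq> y" for a b s r
      proof -
        have h: "(\<sigma>(e := s, f := r)) y = Coloop" "(\<sigma>(e := s, f := r)) x \<noteq> Coloop" "(\<sigma>(e := s, f := r)) x = \<sigma> x"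
          using 3 ex by auto
        from fenum_ser_coloop2[OF l that, of "\<sigma>(e := s, f := r)", OF h(1,2) ne] show ?thesis unfolding h(3) tw(2) .
      qed
      then show ?thesis using ex IH[OF ef] ef by (intro balanced_eq[where N = "ser x y M" and e = e and f = f and \<sigma> = \<sigma> and M = M and \<sigma>' = "\<sigma>(x := Loop, y := \<sigma> x)"]) auto
    next
      case 4
      then show ?thesis using ex l ne by (intro balanced_zero fenum_ser_zero) auto
    qed
  qed
  qed
qed

lemma sp_family_balanced: "sp_family M \<Longrightarrow> e \<noteq> f \<Longrightarrow> balanced M e f \<sigma>"
  using balanced_pointed[OF sp_family_pointed] by blast

section \<open>Cycle matroids of series-parallel graphs\<close>

text \<open>A forest test by vertices of degree one. Unlike cycles given as lists, vertex degrees
  are easy to follow through subdividing and doubling an edge.\<close>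

definition leafy :: "('e \<Rightarrow> 'v set) \<Rightarrow> 'e set \<Rightarrow> bool" where
  "leafy ends A \<longleftrightarrow> (\<forall>C\<subseteq>A. C \<noteq> {} \<longrightarrow> (\<exists>v. card {x\<in>C. v \<in> ends x} = 1))"

lemma cycle_has_no_leaf:
  assumes cyc: "graph_cycle ends C" and two: "\<And>x. x \<in> C \<Longrightarrow> card (ends x) = 2" and "finite C"
  shows "C \<noteq> {}" "card {x\<in>C. v \<in> ends x} \<noteq> 1"
proof -
  obtain vs es where vs: "vs \<noteq> []" "length es = length vs" "distinct vs" "distinct es" "set es = C"
    and ends: "\<And>i. i < length vs \<Longrightarrow> ends (es ! i) = {vs ! i, vs ! ((i + 1) mod length vs)}"
    using cyc unfolding graph_cycle_def by blast
  let ?n = "length vs"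
  show "C \<noteq> {}" using vs by auto
  have n0: "?n > 0" using vs by simp
  have "?n \<noteq> 1"
  proof
    assume n: "?n = 1"
    have "es ! 0 \<in> C" using vs n by (metis nth_mem zero_less_one)
    then show False using two[of "es ! 0"] ends[of 0] n by simp
  qed
  then have n: "?n \<ge> 2" using n0 by linarith
  show "card {x\<in>C. v \<in> ends x} \<noteq> 1"
  proof
    assume c1: "card {x\<in>C. v \<in> ends x} = 1"
    then obtain x where x: "{x\<in>C. v \<in> ends x} = {x}" by (auto simp: card_1_singleton_iff)
    then obtain i where i: "i < ?n" "x = es ! i" using vs by (metis (no_types, lifting) in_set_conv_nth insertI1 mem_Collect_eq)
    have "v \<in> ends (es ! i)" using x i by blast
    then obtain j where j: "j < ?n" "v = vs ! j" using ends[OF i(1)] i n0 by (metis empty_iff insert_iff mod_less_divisor)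
    \<comment> \<open>The index of the edge that enters \<open>vs ! j\<close>; adding
      \<open>?n\<close> first keeps the subtraction from truncating at \<open>j = 0\<close>.\<close>
    define k where "k = (j + ?n - 1) mod ?n"
    have k: "k < ?n" using n0 by (simp add: k_def)
    have kj: "(k + 1) mod ?n = j"
    proof -
      have "(k + 1) mod ?n = (j + ?n - 1 + 1) mod ?n" unfolding k_def by (simp add: mod_simps)
      also have "j + ?n - 1 + 1 = j + ?n" using n by linarith
      also have "(j + ?n) mod ?n = j" using j by simp
      finally show ?thesis .
    qed
    have "v \<in> ends (es ! j)" "v \<in> ends (es ! k)" using ends[OF j(1)] ends[OF k] j kj by auto
    moreover have "es ! j \<in> C" "es ! k \<in> C" using vs j k by (metis nth_mem)+
    ultimately have "es ! j = x" "es ! k = x" using x by blast+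
    then have "j = k" using vs j k by (metis nth_eq_iff_index_eq)
    then have "(j + 1) mod ?n = j" using kj by simp
    then show False using j n by (cases "j + 1 = ?n") auto
  qed
qed

text \<open>Without leaves, a walk that has arrived along an edge can always leave along a different
  one. This gives an infinite walk without immediate reversal on finitely many vertices, and a
  shortest closed stretch of it is a cycle.\<close>

lemma leafless_has_cycle:
  fixes ends :: "'e \<Rightarrow> 'v set"
  assumes fin: "finite C" and ne: "C \<noteq> {}" and two: "\<And>x. x \<in> C \<Longrightarrow> card (ends x) = 2"
    and nl: "\<And>v. card {x\<in>C. v \<in> ends x} \<noteq> 1"
  shows "\<exists>D\<subseteq>C. graph_cycle ends D"
proof -
  define P where "P s \<longleftrightarrow> (case s of (v, e, v') \<Rightarrow> e \<in> C \<and> ends e = {v, v'} \<and> v \<noteq> v')" for s :: "'v \<times> 'e \<times> 'v"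
  define Q where "Q s s' \<longleftrightarrow> (case (s, s') of ((v, e, v'), (u, e', u')) \<Rightarrow> u = v' \<and> e' \<noteq> e)" for s s' :: "'v \<times> 'e \<times> 'v"
  have "\<exists>s. P s"
  proof -
    obtain x where "x \<in> C" using ne by blast
    then obtain a b where "ends x = {a, b}" "a \<noteq> b" using two by (meson card_2_iff)
    then have "P (a, x, b)" using \<open>x \<in> C\<close> by (simp add: P_def)
    then show ?thesis ..
  qed
  moreover have "\<exists>s'. P s' \<and> Q s s'" if s: "P s" for s
  proof -
    obtain v e v' where s': "s = (v, e, v')" by (cases s) auto
    have e: "e \<in> C" "v' \<in> ends e" using s by (auto simp: P_def s')
    have "{x\<in>C. v' \<in> ends x} \<noteq> {e}" using nl[of v'] by auto
    then obtain e' where e': "e' \<in> C" "v' \<in> ends e'" "e' \<noteq> e" using e by blast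
    obtain a b where ab: "ends e' = {a, b}" "a \<noteq> b" using two[OF e'(1)] by (meson card_2_iff)
    then consider "v' = a" | "v' = b" using e' by blast
    then show ?thesis
    proof cases
      case 1
      then have "P (v', e', b) \<and> Q s (v', e', b)" using ab e' by (simp add: P_def Q_def s')
      then show ?thesis ..
    next
      case 2
      then have "P (v', e', a) \<and> Q s (v', e', a)" using ab e' by (simp add: P_def Q_def s' insert_commute)
      then show ?thesis ..
    qed
  qed
  ultimately obtain g where g: "\<And>n. P (g n)" "\<And>n. Q (g n) (g (Suc n))"
    using dependent_nat_choice[of "\<lambda>_. P" "\<lambda>_. Q"] by metis
  define v where "v n = fst (g n)" for n
  define e where "e n = fst (snd (g n))" for n
  have eC: "e n \<in> C" and ends: "ends (e n) = {v n, v (Suc n)}" and vv: "v n \<noteq> v (Suc n)"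
    and ee: "e (Suc n) \<noteq> e n" for n
    using g(1)[of n] g(2)[of n] by (auto simp: P_def Q_def v_def e_def split: prod.splits)
  have "range v \<subseteq> (\<Union>x\<in>C. ends x)" using ends eC by blast
  moreover have "finite (\<Union>x\<in>C. ends x)" using fin two by (intro finite_UN_I) (auto intro: card_ge_0_finite)
  ultimately have "finite (range v)" by (rule finite_subset)
  then have "\<not> inj v" using finite_imageD infinite_UNIV_nat by blast
  then have "\<exists>l i. l > 0 \<and> v i = v (i + l)"
    unfolding inj_def by (metis add_diff_inverse_nat less_imp_le linorder_neqE_nat not_less zero_less_diff)
  \<comment> \<open>The minimum is over all starting points, so the vertices in every window of
    length \<open>l\<close> are distinct.\<close>
  define l where "l = (LEAST l. l > 0 \<and> (\<exists>i. v i = v (i + l)))"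
  have l: "l > 0 \<and> (\<exists>i. v i = v (i + l))"
    unfolding l_def by (rule LeastI_ex) (use \<open>\<exists>l i. l > 0 \<and> v i = v (i + l)\<close> in blast)
  then obtain i where i: "v i = v (i + l)" by blast
  have least: "v a \<noteq> v (a + m)" if "0 < m" "m < l" for a m
    using not_less_Least[of m "\<lambda>l. l > 0 \<and> (\<exists>i. v i = v (i + l))"] that unfolding l_def by blast
  have vd: "v a \<noteq> v b" if "a < b" "b < a + l" for a b
    using least[of "b - a" a] that by simp
  have ed: "e a \<noteq> e b" if "i \<le> a" "a < b" "b < i + l" for a b
  proof
    assume eq: "e a = e b"
    have "v a \<noteq> v b" using vd that by simp
    moreover have "{v a, v (Suc a)} = {v b, v (Suc b)}" using ends[of a] ends[of b] eq by simp
    \<comment> \<open>A repeated edge would be traversed backwards; by distinctness of the vertices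
      the two passages would be consecutive, which is an immediate reversal.\<close>
    ultimately have "v (Suc a) = v b" by (auto simp: doubleton_eq_iff)
    moreover have "b < Suc a + l" using that by linarith
    ultimately have "\<not> Suc a < b" using vd[of "Suc a" b] by blast
    then have "Suc a = b" using that by linarith
    then show False using ee[of a] eq by simp
  qed
  define vs where "vs = map v [i..<i + l]"
  define es where "es = map e [i..<i + l]"
  have "graph_cycle ends (set es)"
    unfolding graph_cycle_def
  proof (intro exI conjI allI impI)
    show "vs \<noteq> []" "length es = length vs" using l by (auto simp: vs_def es_def)
    show "distinct vs" unfolding vs_def distinct_map
    proof (intro conjI inj_onI)
      fix a b assume "a \<in> set [i..<i + l]" "b \<in> set [i..<i + l]" "v a = v b"
      then show "a = b" using vd[of a b] vd[of b a] by (cases a b rule: linorder_cases) auto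
    qed simp
    show "distinct es" unfolding es_def distinct_map
    proof (intro conjI inj_onI)
      fix a b assume "a \<in> set [i..<i + l]" "b \<in> set [i..<i + l]" "e a = e b"
      then show "a = b" using ed[of a b] ed[of b a] by (cases a b rule: linorder_cases) auto
    qed simp
    show "set es = set es" ..
    fix k assume k: "k < length vs"
    then have kl: "k < l" by (simp add: vs_def)
    show "ends (es ! k) = {vs ! k, vs ! ((k + 1) mod length vs)}"
    proof (cases "k + 1 = l")
      case True
      then have "i + l = Suc (i + k)" by simp
      then have "v i = v (Suc (i + k))" using i by simp
      then have "vs ! ((k + 1) mod length vs) = v (Suc (i + k))" using True l by (simp add: vs_def)
      then show ?thesis using ends[of "i + k"] kl by (simp add: vs_def es_def)
    next
      case False
      then have "vs ! ((k + 1) mod length vs) = v (Suc (i + k))" using kl by (simp add: vs_def)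
      then show ?thesis using ends[of "i + k"] kl by (simp add: vs_def es_def)
    qed
  qed
  moreover have "set es \<subseteq> C" using eC by (auto simp: es_def)
  ultimately show ?thesis by blast
qed

lemma forest_iff_leafy:
  assumes "finite A" "\<And>x. x \<in> A \<Longrightarrow> card (ends x) = 2"
  shows "graph_forest ends A \<longleftrightarrow> leafy ends A"
proof
  assume f: "graph_forest ends A"
  show "leafy ends A" unfolding leafy_def
  proof (intro allI impI, rule ccontr)
    fix C assume C: "C \<subseteq> A" "C \<noteq> {}" "\<nexists>v. card {x\<in>C. v \<in> ends x} = 1"
    then have "\<exists>D\<subseteq>C. graph_cycle ends D"
      using assms finite_subset by (intro leafless_has_cycle) blast+
    then show False using f C unfolding graph_forest_def by blast
  qed
next
  assume l: "leafy ends A"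
  show "graph_forest ends A" unfolding graph_forest_def
  proof (intro allI impI notI)
    fix C assume C: "C \<subseteq> A" "graph_cycle ends C"
    have "finite C" "\<And>x. x \<in> C \<Longrightarrow> card (ends x) = 2" using C assms finite_subset by blast+
    then show False using cycle_has_no_leaf[OF C(2)] l C unfolding leafy_def by blast
  qed
qed

lemma leafy_subset: "leafy ends A \<Longrightarrow> B \<subseteq> A \<Longrightarrow> leafy ends B"
  unfolding leafy_def by blast

lemma leafy_cong: "(\<And>x. x \<in> A \<Longrightarrow> ends x = ends' x) \<Longrightarrow> leafy ends A \<longleftrightarrow> leafy ends' A"
proof -
  assume *: "\<And>x. x \<in> A \<Longrightarrow> ends x = ends' x"
  have "{x\<in>C. v \<in> ends x} = {x\<in>C. v \<in> ends' x}" if "C \<subseteq> A" for C v using that * by blast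
  then show ?thesis unfolding leafy_def by (intro all_cong1 imp_cong refl) simp
qed

lemma cycle_bases_iff:
  assumes "finite E" "\<And>x. x \<in> E \<Longrightarrow> card (ends x) = 2"
  shows "B \<in> cycle_matroid_bases E ends \<longleftrightarrow> B \<subseteq> E \<and> leafy ends B \<and> (\<forall>x\<in>E - B. \<not> leafy ends (insert x B))"
proof -
  have f: "graph_forest ends A \<longleftrightarrow> leafy ends A" if "A \<subseteq> E" for A
    using that assms finite_subset by (intro forest_iff_leafy) blast+
  show ?thesis
  proof
    assume B: "B \<in> cycle_matroid_bases E ends"
    then have "\<not> leafy ends (insert x B)" if "x \<in> E - B" for x
      using that f[of "insert x B"] unfolding cycle_matroid_bases_def by blast
    then show "B \<subseteq> E \<and> leafy ends B \<and> (\<forall>x\<in>E - B. \<not> leafy ends (insert x B))"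
      using B f[of B] unfolding cycle_matroid_bases_def by blast
  next
    assume B: "B \<subseteq> E \<and> leafy ends B \<and> (\<forall>x\<in>E - B. \<not> leafy ends (insert x B))"
    have "\<not> graph_forest ends A" if A: "B \<subset> A" "A \<subseteq> E" for A
    proof
      assume "graph_forest ends A"
      then have "leafy ends A" using f A by blast
      moreover obtain x where "x \<in> A - B" using A by blast
      ultimately show False using B A leafy_subset[of ends A "insert x B"] by blast
    qed
    then show "B \<in> cycle_matroid_bases E ends" using B f[of B] unfolding cycle_matroid_bases_def by blast
  qed
qed

text \<open>If an edge set contains just one half of the subdivided edge, then \<open>w\<close> is a
  leaf. If it contains both, \<open>w\<close> has degree two and all other degrees are those
  obtained with the undivided edge.\<close>

lemma leafy_series:
  fixes E :: "'e::finite set"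
  assumes V: "\<And>x. x \<in> E \<Longrightarrow> ends x \<subseteq> V" and e: "e \<in> E" "ends e = {u, v}" "u \<noteq> v" and w: "w \<notin> V" and f: "f \<notin> E"
    and A: "A \<subseteq> insert f E"
  shows "leafy (ends(e := {u, w}, f := {w, v})) A \<longleftrightarrow>
    (if e \<in> A \<and> f \<in> A then leafy ends (A - {f}) else leafy ends (A - {e, f}))"
proof -
  let ?ends = "ends(e := {u, w}, f := {w, v})"
  have ef: "e \<noteq> f" using e f by blast
  have uvw: "u \<noteq> w" "v \<noteq> w" using e w V by blast+
  have wC: "{x\<in>C. w \<in> ?ends x} = C \<inter> {e, f}" if "C \<subseteq> A" for C
    using that A V w ef by auto
  have w1: "card {x\<in>C. w \<in> ?ends x} = 1" if "C \<subseteq> A" "C \<inter> {e, f} \<noteq> {}" "\<not> {e, f} \<subseteq> C" for C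
  proof -
    have "C \<inter> {e, f} = {e} \<or> C \<inter> {e, f} = {f}" using that by blast
    then show ?thesis unfolding wC[OF that(1)] by auto
  qed
  have eq: "card {x\<in>C. z \<in> ?ends x} = card {x\<in>C - {f}. z \<in> ends x}"
    if C: "C \<subseteq> A" "{e, f} \<subseteq> C" and z: "z \<noteq> w" for C z
  proof -
    define D where "D = {x\<in>C - {e, f}. z \<in> ends x}"
    have 1: "{x\<in>C. z \<in> ?ends x} = D \<union> ((if z = u then {e} else {}) \<union> (if z = v then {f} else {}))"
      using C z ef uvw by (auto simp: D_def)
    have 2: "{x\<in>C - {f}. z \<in> ends x} = D \<union> (if z = u \<or> z = v then {e} else {})"
      using C z ef e by (auto simp: D_def)
    have "e \<notin> D" "f \<notin> D" by (auto simp: D_def)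
    then show ?thesis unfolding 1 2 using ef e(3) by auto
  qed
  have same: "{x\<in>C. z \<in> ?ends x} = {x\<in>C. z \<in> ends x}" if "C \<inter> {e, f} = {}" for C z using that by auto
  show ?thesis
  proof (cases "e \<in> A \<and> f \<in> A")
    case True
    have "leafy ?ends A \<longleftrightarrow> leafy ends (A - {f})"
    proof
      assume l: "leafy ?ends A"
      show "leafy ends (A - {f})" unfolding leafy_def
      proof (intro allI impI)
        fix C assume C: "C \<subseteq> A - {f}" "C \<noteq> {}"
        show "\<exists>z. card {x\<in>C. z \<in> ends x} = 1"
        proof (cases "e \<in> C")
          case eC: True
          have sub: "insert f C \<subseteq> A" using C True by blast
          then obtain z where z: "card {x\<in>insert f C. z \<in> ?ends x} = 1" using l unfolding leafy_def by blast
          have zw: "z \<noteq> w"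
          proof
            assume "z = w"
            moreover have "insert f C \<inter> {e, f} = {e, f}" using eC by blast
            ultimately show False using z wC[OF sub] ef by simp
          qed
          have "insert f C - {f} = C" using C by blast
          then have "card {x\<in>C. z \<in> ends x} = 1" using z eq[OF sub _ zw] eC by simp
          then show ?thesis ..
        next
          case False
          then have d: "C \<inter> {e, f} = {}" "C \<subseteq> A" using C by blast+
          then have "\<exists>z. card {x\<in>C. z \<in> ?ends x} = 1" using l C(2) unfolding leafy_def by blast
          then show ?thesis unfolding same[OF d(1)] .
        qed
      qed
    next
      assume l: "leafy ends (A - {f})"
      show "leafy ?ends A" unfolding leafy_def
      proof (intro allI impI)
        fix C assume C: "C \<subseteq> A" "C \<noteq> {}"
        consider "{e, f} \<subseteq> C" | "C \<inter> {e, f} \<noteq> {}" "\<not> {e, f} \<subseteq> C" | "C \<inter> {e, f} = {}" by blast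
        then show "\<exists>z. card {x\<in>C. z \<in> ?ends x} = 1"
        proof cases
          case 1
          have "C - {f} \<subseteq> A - {f}" "C - {f} \<noteq> {}" using 1 C ef by blast+
          then obtain z where z: "card {x\<in>C - {f}. z \<in> ends x} = 1" using l unfolding leafy_def by blast
          then have "{x\<in>C - {f}. z \<in> ends x} \<noteq> {}" by (metis card.empty zero_neq_one)
          then have "z \<noteq> w" using C A V w by blast
          from eq[OF C(1) 1 this] z have "card {x\<in>C. z \<in> ?ends x} = 1" by simp
          then show ?thesis ..
        next
          case 2 then show ?thesis using w1 C by blast
        next
          case 3
          then have "C \<subseteq> A - {f}" using C by blast
          then have "\<exists>z. card {x\<in>C. z \<in> ends x} = 1" using l C(2) unfolding leafy_def by blast
          then show ?thesis unfolding same[OF 3] .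
        qed
      qed
    qed
    then show ?thesis unfolding if_P[OF True] .
  next
    case False
    have "leafy ?ends A \<longleftrightarrow> leafy ends (A - {e, f})"
    proof
      assume "leafy ?ends A"
      then have "leafy ?ends (A - {e, f})" by (rule leafy_subset) blast
      then show "leafy ends (A - {e, f})" using leafy_cong[of "A - {e, f}" ?ends ends] by simp
    next
      assume l: "leafy ends (A - {e, f})"
      show "leafy ?ends A" unfolding leafy_def
      proof (intro allI impI)
        fix C assume C: "C \<subseteq> A" "C \<noteq> {}"
        show "\<exists>z. card {x\<in>C. z \<in> ?ends x} = 1"
        proof (cases "C \<inter> {e, f} = {}")
          case True
          then have "C \<subseteq> A - {e, f}" using C by blast
          then have "\<exists>z. card {x\<in>C. z \<in> ends x} = 1" using l C(2) unfolding leafy_def by blast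
          then show ?thesis unfolding same[OF True] .
        next
          case F: False
          then show ?thesis using w1[OF C(1)] C False by blast
        qed
      qed
    qed
    then show ?thesis unfolding if_not_P[OF False] .
  qed
qed

text \<open>\<open>e\<close> and \<open>f\<close> together form a leafless pair. Without
  \<open>e\<close>, the edge \<open>f\<close> has the same ends and simply plays the part of
  \<open>e\<close>.\<close>

lemma leafy_parallel:
  fixes E :: "'e::finite set"
  assumes e: "e \<in> E" "card (ends e) = 2" and f: "f \<notin> E"
  shows "leafy (ends(f := ends e)) A \<longleftrightarrow> (if f \<in> A then e \<notin> A \<and> leafy ends (insert e (A - {f})) else leafy ends A)"
proof -
  let ?ends = "ends(f := ends e)"
  have ef: "e \<noteq> f" using e f by blast
  show ?thesis
  proof (cases "f \<in> A")
    case False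
    then have "?ends x = ends x" if "x \<in> A" for x using that by auto
    then show ?thesis using leafy_cong[of A ?ends ends] False by simp
  next
    case fA: True
    show ?thesis
    proof (cases "e \<in> A")
      case True
      have "card {x\<in>{e, f}. z \<in> ?ends x} \<noteq> 1" for z
      proof (cases "z \<in> ends e")
        case True
        then have "{x\<in>{e, f}. z \<in> ?ends x} = {e, f}" by auto
        then show ?thesis using ef by simp
      next
        case False
        then have "{x\<in>{e, f}. z \<in> ?ends x} = {}" by auto
        then show ?thesis by (metis card.empty zero_neq_one)
      qed
      moreover have "{e, f} \<subseteq> A" "{e, f} \<noteq> {}" using True fA by auto
      ultimately have "\<not> leafy ?ends A" unfolding leafy_def by blast
      then show ?thesis using True fA by simp
    next
      case False
      have s: "inj_on (swp e f) X" for X by simp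
      have img: "{x\<in>swp e f ` C. z \<in> ends x} = swp e f ` {x\<in>C. z \<in> ?ends x}" if "e \<notin> C" for C z
      proof -
        have "z \<in> ends (swp e f x) \<longleftrightarrow> z \<in> ?ends x" if "x \<in> C" for x
          using that \<open>e \<notin> C\<close> by (auto simp: Transposition.transpose_def)
        then show ?thesis by blast
      qed
      have cd: "card {x\<in>swp e f ` C. z \<in> ends x} = card {x\<in>C. z \<in> ?ends x}" if "e \<notin> C" for C z
        unfolding img[OF that] by (rule card_image[OF s])
      have iA: "insert e (A - {f}) = swp e f ` A" using fA False by (simp add: swp_image)
      have "leafy ?ends A \<longleftrightarrow> leafy ends (swp e f ` A)"
      proof
        assume l: "leafy ?ends A"
        show "leafy ends (swp e f ` A)" unfolding leafy_def
        proof (intro allI impI)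
          fix C assume "C \<subseteq> swp e f ` A" "C \<noteq> {}"
          then obtain C0 where C0: "C0 \<subseteq> A" "C = swp e f ` C0" "C0 \<noteq> {}" by (metis image_empty subset_imageE)
          then have e0: "e \<notin> C0" using False by blast
          have "\<exists>z. card {x\<in>C0. z \<in> ?ends x} = 1" using l C0(1,3) unfolding leafy_def by blast
          then show "\<exists>z. card {x\<in>C. z \<in> ends x} = 1" unfolding C0(2) cd[OF e0] .
        qed
      next
        assume l: "leafy ends (swp e f ` A)"
        show "leafy ?ends A" unfolding leafy_def
        proof (intro allI impI)
          fix C assume C: "C \<subseteq> A" "C \<noteq> {}"
          then have e0: "e \<notin> C" using False by blast
          have "swp e f ` C \<subseteq> swp e f ` A" "swp e f ` C \<noteq> {}" using C by blast+
          then have "\<exists>z. card {x\<in>swp e f ` C. z \<in> ends x} = 1" using l unfolding leafy_def by blast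
          then show "\<exists>z. card {x\<in>C. z \<in> ?ends x} = 1" unfolding cd[OF e0] .
        qed
      qed
      then show ?thesis using fA False iA by simp
    qed
  qed
qed

lemma sp_graph_wf:
  assumes "series_parallel_graph V E ends"
  shows "\<forall>x\<in>E. ends x \<subseteq> V \<and> card (ends x) = 2"
  using assms
proof (induction rule: series_parallel_graph.induct)
  case (single_edge u v ends e) then show ?case by simp
next
  case (series_extension V E ends e u v w f)
  have "ends e \<subseteq> V" using series_extension by blast
  then have "u \<noteq> w" "v \<noteq> w" "u \<in> V" "v \<in> V" using series_extension by auto
  then show ?case using series_extension by auto
next
  case (parallel_extension V E ends e f) then show ?case by auto
qed

text \<open>The bases after an extension are determined through \<open>leafy\<close> and turn out to
  be \<open>ser f e\<close> or \<open>par f e\<close> of the old bases, in which the new edge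
  \<open>f\<close>, not yet in use, is a loop.\<close>

lemma sp_graph_bases:
  fixes E :: "'e::finite set"
  assumes "series_parallel_graph V E ends"
  shows "sp_family (cycle_matroid_bases E ends)"
  using assms
proof (induction rule: series_parallel_graph.induct)
  case (single_edge u v ends e)
  have "card (ends e) = 2" using single_edge by simp
  then have iff: "B \<in> cycle_matroid_bases {e} ends \<longleftrightarrow> B \<subseteq> {e} \<and> leafy ends B \<and> (\<forall>x\<in>{e} - B. \<not> leafy ends (insert x B))" for B
    by (intro cycle_bases_iff) auto
  have "{x\<in>C. u \<in> ends x} = {e}" if "C = {e}" for C using that single_edge by auto
  then have l: "leafy ends {e}" unfolding leafy_def by (metis card_1_singleton_iff subset_singletonD One_nat_def)
  have "cycle_matroid_bases {e} ends = {{e}}"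
  proof (rule set_eqI)
    fix B
    show "B \<in> cycle_matroid_bases {e} ends \<longleftrightarrow> B \<in> {{e}}"
      unfolding iff using l by (cases "B = {e}") (auto simp: subset_singleton_iff)
  qed
  then show ?case by (simp add: sp_family_small)
next
  case (series_extension V E ends e u v w f)
  let ?ends = "ends(e := {u, w}, f := {w, v})" and ?M = "cycle_matroid_bases E ends"
  have wf: "\<And>x. x \<in> E \<Longrightarrow> ends x \<subseteq> V" "\<And>x. x \<in> E \<Longrightarrow> card (ends x) = 2"
    using sp_graph_wf[OF series_extension.hyps(1)] by blast+
  have wf2: "\<And>x. x \<in> insert f E \<Longrightarrow> card (?ends x) = 2"
    using sp_graph_wf[OF series_parallel_graph.series_extension[OF series_extension.hyps]] by blast
  have uv: "u \<noteq> v" using wf(2)[OF series_extension.hyps(2)] series_extension.hyps by auto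
  have lf: "leafy ?ends A \<longleftrightarrow> (if e \<in> A \<and> f \<in> A then leafy ends (A - {f}) else leafy ends (A - {e, f}))"
    if "A \<subseteq> insert f E" for A
    using that wf(1) series_extension.hyps uv by (intro leafy_series[of E ends V]) auto
  have ef: "e \<noteq> f" using series_extension by blast
  have iff: "B \<in> ?M \<longleftrightarrow> B \<subseteq> E \<and> leafy ends B \<and> (\<forall>x\<in>E - B. \<not> leafy ends (insert x B))" for B
    by (rule cycle_bases_iff[OF _ wf(2)]) auto
  have iff2: "B \<in> cycle_matroid_bases (insert f E) ?ends \<longleftrightarrow>
     B \<subseteq> insert f E \<and> leafy ?ends B \<and> (\<forall>x\<in>insert f E - B. \<not> leafy ?ends (insert x B))" for B
    by (rule cycle_bases_iff[OF _ wf2]) auto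
  have lp: "is_loop ?M f" unfolding is_loop_def using iff series_extension by blast
  have "cycle_matroid_bases (insert f E) ?ends = ser f e ?M"
  proof (rule set_eqI)
    fix B
    have ser: "B \<in> ser f e ?M \<longleftrightarrow> (if f \<in> B then B - {f} \<in> ?M else e \<in> B \<and> B - {e} \<in> ?M)"
    proof (cases "f \<in> B")
      case True
      have "B = insert f B0 \<or> e \<notin> B0 \<and> B = insert e B0 \<longleftrightarrow> B - {f} = B0" if "B0 \<in> ?M" for B0
        using that lp True ef by (auto simp: is_loop_def)
      then show ?thesis unfolding ser_iff using True by auto
    next
      case False
      have "B = insert f B0 \<or> e \<notin> B0 \<and> B = insert e B0 \<longleftrightarrow> e \<in> B \<and> B - {e} = B0" if "B0 \<in> ?M" for B0
        using that lp False ef by (auto simp: is_loop_def)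
      then show ?thesis unfolding ser_iff using False by auto
    qed
    show "B \<in> cycle_matroid_bases (insert f E) ?ends \<longleftrightarrow> B \<in> ser f e ?M"
    proof (cases "B \<subseteq> insert f E")
      case False
      then have "B \<notin> ser f e ?M" unfolding ser iff using series_extension.hyps(2) by auto
      then show ?thesis unfolding iff2 using False by blast
    next
      case BE: True
      have insE: "insert x B \<subseteq> insert f E" if "x \<in> insert f E" for x using that BE by blast
      show ?thesis
      proof (cases "f \<in> B")
        case fB: True
        have 1: "leafy ?ends B \<longleftrightarrow> leafy ends (B - {f})"
        proof -
          have "B - {e, f} = B - {f}" if "e \<notin> B" using that by blast
          then show ?thesis using lf[OF BE] fB by (cases "e \<in> B") simp_all
        qed
        have 2: "leafy ?ends (insert x B) \<longleftrightarrow> leafy ends (insert x (B - {f}))" if x: "x \<in> E - (B - {f})" for x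
        proof -
          have "x \<noteq> f" using x series_extension.hyps by blast
          then have "insert x B - {f} = insert x (B - {f})" by blast
          moreover have "insert x B - {e, f} = insert x (B - {f})" if "\<not> e \<in> insert x B" using that \<open>x \<noteq> f\<close> by blast
          moreover have "leafy ?ends (insert x B) \<longleftrightarrow> (if e \<in> insert x B \<and> f \<in> insert x B
              then leafy ends (insert x B - {f}) else leafy ends (insert x B - {e, f}))"
            using x by (intro lf insE) blast
          ultimately show ?thesis using fB by (cases "e \<in> insert x B") auto
        qed
        have 3: "insert f E - B = E - (B - {f})" using fB series_extension.hyps by blast
        have 4: "B - {f} \<subseteq> E" using BE by blast
        show ?thesis unfolding iff2 ser iff 3 using fB BE 1 2 4 by auto
      next
        case fB: False
        show ?thesis
        proof (cases "e \<in> B")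
          case eB: True
          have 1: "leafy ?ends B \<longleftrightarrow> leafy ends (B - {e})" 
          proof -
            have "B - {e, f} = B - {e}" using fB by blast
            then show ?thesis using lf[OF BE] fB by simp
          qed
          have 2: "leafy ?ends (insert x B) \<longleftrightarrow> leafy ends (insert x (B - {e}))" if x: "x \<in> E - B" for x
          proof -
            have "x \<noteq> f" "x \<noteq> e" using x series_extension.hyps eB by blast+
            then have "insert x B - {e, f} = insert x (B - {e})" using fB by blast
            moreover have "leafy ?ends (insert x B) \<longleftrightarrow> (if e \<in> insert x B \<and> f \<in> insert x B
              then leafy ends (insert x B - {f}) else leafy ends (insert x B - {e, f}))"
              using x by (intro lf insE) blast
            ultimately show ?thesis using fB \<open>x \<noteq> f\<close> by auto
          qed
          have 3: "leafy ?ends (insert f B) \<longleftrightarrow> leafy ends (insert e (B - {e}))"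
          proof -
            have "insert f B - {f} = insert e (B - {e})" using fB eB by blast
            moreover have "leafy ?ends (insert f B) \<longleftrightarrow> (if e \<in> insert f B \<and> f \<in> insert f B
              then leafy ends (insert f B - {f}) else leafy ends (insert f B - {e, f}))"
              by (intro lf insE) blast
            ultimately show ?thesis using eB by simp
          qed
          have 4: "insert f E - B = insert f (E - B)" "E - (B - {e}) = insert e (E - B)" "B - {e} \<subseteq> E"
            using fB eB BE series_extension.hyps by blast+
          show ?thesis unfolding iff2 ser iff 4 using fB eB BE 1 2 3 4 by auto
        next
          case eB: False
          \<comment> \<open>A set that contains neither half of the edge stays leafy when
            \<open>f\<close> is added, so it is never maximal.\<close>
          have "leafy ?ends B \<longleftrightarrow> leafy ends B" 
          proof -
            have "B - {e, f} = B" using fB eB by blast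
            then show ?thesis using lf[OF BE] fB by simp
          qed
          moreover have "leafy ?ends (insert f B) \<longleftrightarrow> leafy ends B"
          proof -
            have "insert f B - {e, f} = B" using fB eB by blast
            moreover have "leafy ?ends (insert f B) \<longleftrightarrow> (if e \<in> insert f B \<and> f \<in> insert f B
              then leafy ends (insert f B - {f}) else leafy ends (insert f B - {e, f}))"
              by (intro lf insE) blast
            ultimately show ?thesis using eB ef by simp
          qed
          ultimately show ?thesis unfolding iff2 ser using fB eB by auto
        qed
      qed
    qed
  qed
  note eq = this
  have "sp_family (ser f e ?M)" by (rule Cl.ser[OF series_extension.IH lp]) (use ef in auto)
  then show ?case unfolding eq[symmetric] .
next
  case (parallel_extension V E ends e f)
  let ?ends = "ends(f := ends e)" and ?M = "cycle_matroid_bases E ends"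
  have wf: "\<And>x. x \<in> E \<Longrightarrow> card (ends x) = 2"
    using sp_graph_wf[OF parallel_extension.hyps(1)] by blast
  have wf2: "\<And>x. x \<in> insert f E \<Longrightarrow> card (?ends x) = 2"
    using sp_graph_wf[OF series_parallel_graph.parallel_extension[OF parallel_extension.hyps]] by blast
  note lf = leafy_parallel[where ends = ends, OF parallel_extension.hyps(2) wf[OF parallel_extension.hyps(2)] parallel_extension.hyps(3)]
  have ef: "e \<noteq> f" using parallel_extension by blast
  have iff: "B \<in> ?M \<longleftrightarrow> B \<subseteq> E \<and> leafy ends B \<and> (\<forall>x\<in>E - B. \<not> leafy ends (insert x B))" for B
    by (rule cycle_bases_iff[OF _ wf]) auto
  have iff2: "B \<in> cycle_matroid_bases (insert f E) ?ends \<longleftrightarrow>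
     B \<subseteq> insert f E \<and> leafy ?ends B \<and> (\<forall>x\<in>insert f E - B. \<not> leafy ?ends (insert x B))" for B
    by (rule cycle_bases_iff[OF _ wf2]) auto
  have lp: "is_loop ?M f" unfolding is_loop_def using iff parallel_extension by blast
  have "cycle_matroid_bases (insert f E) ?ends = par f e ?M"
  proof (rule set_eqI)
    fix B
    have par: "B \<in> par f e ?M \<longleftrightarrow> (if f \<in> B then e \<notin> B \<and> insert e (B - {f}) \<in> ?M else B \<in> ?M)"
    proof (cases "f \<in> B")
      case True
      have "B = B0 \<or> e \<in> B0 \<and> B = insert f (B0 - {e}) \<longleftrightarrow> e \<notin> B \<and> insert e (B - {f}) = B0" if "B0 \<in> ?M" for B0
        using that lp True ef by (auto simp: is_loop_def)
      then show ?thesis unfolding par_iff using True by auto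
    next
      case False
      then show ?thesis unfolding par_iff by auto
    qed
    show "B \<in> cycle_matroid_bases (insert f E) ?ends \<longleftrightarrow> B \<in> par f e ?M"
    proof (cases "f \<in> B")
      case fB: True
      have 2: "leafy ?ends (insert x B) \<longleftrightarrow> e \<notin> insert x B \<and> leafy ends (insert x (insert e (B - {f})))" if x: "x \<in> E - B" for x
      proof -
        have "x \<noteq> f" using x parallel_extension.hyps by blast
        then have "insert e (insert x B - {f}) = insert x (insert e (B - {f}))" by blast
        then show ?thesis unfolding lf using fB by simp
      qed
      have 3: "insert f E - B = E - B" using fB by blast
      have 4: "E - insert e (B - {f}) = E - B - {e}" using parallel_extension.hyps fB by blast
      have 5: "insert e (B - {f}) \<subseteq> E \<longleftrightarrow> B \<subseteq> insert f E" using parallel_extension.hyps by blast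
      show ?thesis unfolding iff2 par iff 3 4 5 lf[of B] using fB 2 by auto
    next
      case fB: False
      have 2: "leafy ?ends (insert x B) \<longleftrightarrow> leafy ends (insert x B)" if x: "x \<in> E" for x
      proof -
        have "f \<notin> insert x B" using x fB parallel_extension.hyps by blast
        then show ?thesis unfolding lf by simp
      qed
      have 3: "insert f E - B = insert f (E - B)" "B \<subseteq> insert f E \<longleftrightarrow> B \<subseteq> E" using fB by blast+
      have "insert e (insert f B - {f}) = insert e B" using fB by blast
      then have 4: "leafy ?ends (insert f B) \<longleftrightarrow> e \<notin> B \<and> leafy ends (insert e B)"
        unfolding lf using ef by simp
      show ?thesis unfolding iff2 par iff 3 lf[of B] using fB 2 4 parallel_extension.hyps(2) by auto
    qed
  qed
  note eq = this
  have "sp_family (par f e ?M)" by (rule Cl.par[OF parallel_extension.IH lp]) (use ef in auto)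
  then show ?case unfolding eq[symmetric] .
qed

lemma series_parallel_matroid_sp_family: "series_parallel_matroid \<B> \<Longrightarrow> sp_family \<B>"
  unfolding series_parallel_matroid_def using sp_graph_bases by blast

section \<open>Cells of the regular subdivision as optimal families\<close>

lemma minimizers_eq_opt: "minimizers d p w = opt {I. card I = d} p w"
  by (auto simp: minimizers_def opt_def wt_def)

lemma inner_indicator_vec: "c \<bullet> indicator_vec I = wt c I"
  by (simp add: indicator_vec_def wt_def inner_sum_right inner_axis)

text \<open>A convex combination lying on the supporting hyperplane gives no weight to points
  strictly above it.\<close>

lemma convex_hull_Int_supporting:
  fixes S :: "'a::real_inner set"
  assumes fin: "finite S" and b: "\<And>s. s \<in> S \<Longrightarrow> b \<le> c \<bullet> s"
  shows "{z\<in>convex hull S. c \<bullet> z = b} = convex hull {s\<in>S. c \<bullet> s = b}"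
proof (rule set_eqI, rule iffI)
  fix z assume "z \<in> {z\<in>convex hull S. c \<bullet> z = b}"
  then obtain u where u: "\<And>x. x \<in> S \<Longrightarrow> 0 \<le> u x" "sum u S = 1" "(\<Sum>x\<in>S. u x *\<^sub>R x) = z" and z: "c \<bullet> z = b"
    unfolding convex_hull_finite[OF fin] by blast
  let ?T = "{s\<in>S. c \<bullet> s = b}"
  have "(\<Sum>x\<in>S. u x * (c \<bullet> x - b)) = c \<bullet> z - b * sum u S"
    unfolding u(3)[symmetric] by (simp add: inner_sum_right sum_subtractf right_diff_distrib sum_distrib_left mult.commute)
  also have "\<dots> = 0" using u z by simp
  finally have "u x * (c \<bullet> x - b) = 0" if "x \<in> S" for x
    using that fin u(1) b by (subst (asm) sum_nonneg_eq_0_iff) auto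
  then have 0: "u x = 0" if "x \<in> S - ?T" for x using that by auto
  have "sum u ?T = 1" using sum.mono_neutral_right[OF fin, of ?T u] 0 u(2) by auto
  moreover have "(\<Sum>x\<in>?T. u x *\<^sub>R x) = z" using sum.mono_neutral_right[OF fin, of ?T "\<lambda>x. u x *\<^sub>R x"] 0 u(3) by auto
  moreover have "finite ?T" using fin by simp
  ultimately show "z \<in> convex hull ?T" unfolding convex_hull_finite[OF \<open>finite ?T\<close>] using u(1) by blast
next
  fix z assume z: "z \<in> convex hull {s\<in>S. c \<bullet> s = b}"
  then have "z \<in> convex hull S" using hull_mono[of "{s\<in>S. c \<bullet> s = b}" S convex] by blast
  moreover have "convex hull {s\<in>S. c \<bullet> s = b} \<subseteq> {x. c \<bullet> x = b}"
    by (rule hull_minimal) (auto simp: convex_hyperplane)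
  ultimately show "z \<in> {z\<in>convex hull S. c \<bullet> z = b}" using z by blast
qed

text \<open>The inner normal \<open>(c, 1)\<close> evaluates a lifted vertex to
  \<open>p I + wt c I\<close>, so a lower face picks out the minimizers for the weight
  \<open>- c\<close>.\<close>

lemma lower_face_cell:
  fixes p :: "'n::finite set \<Rightarrow> real"
  assumes ne: "{I :: 'n set. card I = d} \<noteq> {}"
  shows "regular_subdivision d p = range (\<lambda>w. basis_polytope (minimizers d p w))"
proof -
  let ?S = "{(indicator_vec I, p I) | I. card I = d}"
  let ?\<B> = "{I :: 'n set. card I = d}"
  have S: "?S = (\<lambda>I. (indicator_vec I, p I)) ` ?\<B>" by blast
  have fin: "finite ?S" unfolding S by simp
  have val: "(c, 1) \<bullet> (indicator_vec I, p I) = p I - wt (- c) I" for c I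
    by (simp add: inner_indicator_vec)
  have cell: "fst ` {z\<in>convex hull ?S. (c, 1) \<bullet> z = b} = basis_polytope (minimizers d p (- c))"
    if b: "\<And>I. card I = d \<Longrightarrow> b \<le> p I - wt (- c) I" and J: "card J = d" "p J - wt (- c) J = b" for c b J
  proof -
    have "b \<le> (c, 1) \<bullet> s" if s: "s \<in> ?S" for s
    proof -
      obtain I where "s = (indicator_vec I, p I)" "card I = d" using s by blast
      then show ?thesis using b[of I] val[of c I] by simp
    qed
    then have "{z\<in>convex hull ?S. (c, 1) \<bullet> z = b} = convex hull {s\<in>?S. (c, 1) \<bullet> s = b}"
      by (rule convex_hull_Int_supporting[OF fin])
    moreover have "{s\<in>?S. (c, 1) \<bullet> s = b} = (\<lambda>I. (indicator_vec I, p I)) ` minimizers d p (- c)"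
    proof -
      have "minimizers d p (- c) = {I. card I = d \<and> p I - wt (- c) I = b}"
        unfolding minimizers_eq_opt opt_def using b J by (auto intro: antisym)
      then show ?thesis unfolding S by (auto simp: val simp del: inner_Pair)
    qed
    ultimately show ?thesis
      unfolding basis_polytope_def by (simp add: convex_hull_linear_image[OF linear_fst] image_image)
  qed
  show ?thesis
  proof (intro equalityI subsetI)
    fix C assume "C \<in> regular_subdivision d p"
    then obtain F where F: "F \<in> lower_faces (convex hull ?S)" and C: "C = fst ` F"
      unfolding regular_subdivision_def by blast
    obtain c b where Fne: "F \<noteq> {}" and cb: "\<And>z. z \<in> convex hull ?S \<Longrightarrow> b \<le> (c, 1) \<bullet> z"
      and Feq: "F = {z\<in>convex hull ?S. (c, 1) \<bullet> z = b}"
      using F unfolding lower_faces_def by blast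
    have sb: "b \<le> (c, 1) \<bullet> s" if "s \<in> ?S" for s using cb hull_inc[OF that] by blast
    have b: "b \<le> p I - wt (- c) I" if "card I = d" for I
      using sb[of "(indicator_vec I, p I)"] that val[of c I] by (simp del: inner_Pair) blast
    have "F = convex hull {s\<in>?S. (c, 1) \<bullet> s = b}"
      unfolding Feq by (rule convex_hull_Int_supporting[OF fin sb])
    then have "convex hull {s\<in>?S. (c, 1) \<bullet> s = b} \<noteq> {}" using Fne by simp
    then have "{s\<in>?S. (c, 1) \<bullet> s = b} \<noteq> {}" by force
    then obtain J where "card J = d" "p J - wt (- c) J = b" unfolding S by (auto simp: val simp del: inner_Pair)
    then show "C \<in> range (\<lambda>w. basis_polytope (minimizers d p w))" unfolding C Feq using cell[OF b] by blast
  next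
    fix C assume "C \<in> range (\<lambda>w. basis_polytope (minimizers d p w))"
    then obtain w where C: "C = basis_polytope (minimizers d p w)" by blast
    obtain J where J: "J \<in> opt ?\<B> p w" using opt_nonempty[OF ne] by blast
    define b where "b = p J - wt w J"
    have b: "b \<le> p I - wt (- (- w)) I" if "card I = d" for I using J that by (simp add: b_def opt_def)
    have Jd: "card J = d" "p J - wt (- (- w)) J = b" using J by (auto simp: b_def opt_def)
    let ?F = "{z\<in>convex hull ?S. (- w, 1) \<bullet> z = b}"
    have CF: "C = fst ` ?F" using cell[OF b Jd] C by simp
    have "(indicator_vec J, p J) \<in> convex hull ?S" using Jd(1) by (intro hull_inc) blast
    then have "(indicator_vec J, p J) \<in> ?F" using Jd(2) by (simp add: val del: inner_Pair)
    moreover have "b \<le> (- w, 1) \<bullet> z" if "z \<in> convex hull ?S" for z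
    proof -
      have "convex hull ?S \<subseteq> {z. (- w, 1) \<bullet> z \<ge> b}"
        unfolding S using b by (intro hull_minimal) (auto simp: convex_halfspace_ge val simp del: inner_Pair)
      then show ?thesis using that by blast
    qed
    ultimately have "?F \<in> lower_faces (convex hull ?S)" unfolding lower_faces_def by blast
    then show "C \<in> regular_subdivision d p" unfolding regular_subdivision_def CF by blast
  qed
qed

text \<open>The functional \<open>a\<close>, with entry \<open>1\<close> on \<open>I\<close> and
  \<open>- 1\<close> elsewhere, takes the value \<open>card I\<close> at the vertex of
  \<open>I\<close> and at most \<open>card I - 1\<close> at every other vertex.\<close>

lemma indicator_vec_in_polytope:
  fixes I :: "'n::finite set"
  assumes "indicator_vec I \<in> basis_polytope \<B>"
  shows "I \<in> \<B>"
proof (rule ccontr)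
  assume I: "I \<notin> \<B>"
  define a :: "real ^ 'n" where "a = (\<chi> i. if i \<in> I then 1 else - 1)"
  have aB: "wt a B = real (card (B \<inter> I)) - real (card (B - I))" for B
  proof -
    have "wt a B = wt a (B \<inter> I) + wt a (B - I)" by (subst wt_Un[symmetric]) (auto simp: Int_Diff_Un)
    also have "wt a (B \<inter> I) = real (card (B \<inter> I))" by (simp add: wt_def a_def)
    also have "wt a (B - I) = - real (card (B - I))" by (simp add: wt_def a_def)
    finally show ?thesis by simp
  qed
  have "wt a B \<le> real (card I) - 1" if "B \<in> \<B>" for B
  proof -
    have "B \<noteq> I" using that I by blast
    then consider "B - I \<noteq> {}" | "B \<subset> I" by blast
    then show ?thesis
    proof cases
      case 1
      then have "card (B - I) \<ge> 1" by (simp add: Suc_leI card_gt_0_iff)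
      moreover have "card (B \<inter> I) \<le> card I" by (simp add: card_mono)
      ultimately show ?thesis unfolding aB by linarith
    next
      case 2
      then have "card (B \<inter> I) < card I" by (simp add: psubset_card_mono inf.absorb1 less_imp_le)
      then show ?thesis unfolding aB by linarith
    qed
  qed
  then have "basis_polytope \<B> \<subseteq> {x. a \<bullet> x \<le> real (card I) - 1}"
    unfolding basis_polytope_def by (intro hull_minimal) (auto simp: convex_halfspace_le inner_indicator_vec)
  then have "a \<bullet> indicator_vec I \<le> real (card I) - 1" using assms by blast
  then show False unfolding inner_indicator_vec aB by simp
qed

lemma basis_polytope_mono_iff: "basis_polytope A \<subseteq> basis_polytope B \<longleftrightarrow> A \<subseteq> B"
proof
  assume *: "basis_polytope A \<subseteq> basis_polytope B"
  show "A \<subseteq> B"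
  proof
    fix I assume "I \<in> A"
    then have "indicator_vec I \<in> basis_polytope A" unfolding basis_polytope_def by (auto intro: hull_inc)
    then show "I \<in> B" using * indicator_vec_in_polytope by blast
  qed
next
  assume "A \<subseteq> B" then show "basis_polytope A \<subseteq> basis_polytope B"
    unfolding basis_polytope_def by (intro hull_mono image_mono)
qed

text \<open>Every cell lies in a maximal one, and by \<open>opt_refine\<close> its family is an
  initial family of the maximal one. Series-parallel families are closed under passing to initial
  families.\<close>

lemma series_parallel_tropical_minimizers:
  fixes p :: "'n::finite set \<Rightarrow> real"
  assumes sp: "series_parallel_tropical d p" and ne: "{I :: 'n set. card I = d} \<noteq> {}"
  shows "sp_family (minimizers d p w)"
proof -
  let ?R = "regular_subdivision d p"
  have R: "?R = range (\<lambda>w. basis_polytope (minimizers d p w))" by (rule lower_face_cell[OF ne])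
  have "?R \<subseteq> basis_polytope ` UNIV" unfolding R by blast
  then have fin: "finite ?R" by (rule finite_subset) simp
  have "basis_polytope (minimizers d p w) \<in> ?R" unfolding R by blast
  from finite_has_maximal2[OF fin this] obtain C where C: "C \<in> ?R" "basis_polytope (minimizers d p w) \<subseteq> C"
    and max: "\<forall>C'\<in>?R. C \<subseteq> C' \<longrightarrow> C = C'" by metis
  obtain w1 where w1: "C = basis_polytope (minimizers d p w1)" using C(1) unfolding R by (elim rangeE)
  have "C \<in> maximal_cells ?R" unfolding maximal_cells_def using C(1) max by (simp add: eq_commute)
  then obtain \<B> where \<B>: "series_parallel_matroid \<B>" "C = basis_polytope \<B>"
    using sp unfolding series_parallel_tropical_def by blast
  have "minimizers d p w1 = \<B>"
    using basis_polytope_mono_iff[of "minimizers d p w1" \<B>] basis_polytope_mono_iff[of \<B> "minimizers d p w1"]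
    unfolding w1[symmetric] \<B>(2)[symmetric] by simp
  then have 1: "sp_family (minimizers d p w1)" using \<B>(1) series_parallel_matroid_sp_family by blast
  have "minimizers d p w \<subseteq> minimizers d p w1" using C(2) unfolding w1 basis_polytope_mono_iff .
  then have "minimizers d p w = ini (minimizers d p w1) (w - w1)"
    unfolding minimizers_eq_opt by (rule opt_refine[OF _ ne])
  then show ?thesis using sp_family_ini[OF 1] by simp
qed

section \<open>Loops, coloops and lineality after one identification\<close>

lemma ident_iff:
  "J \<in> ident e f M \<longleftrightarrow> (\<exists>B\<in>M. (e \<in> B \<and> f \<in> B \<and> J = B - {f}) \<or> ((e \<in> B) \<noteq> (f \<in> B) \<and> J = B - {e, f}))"
proof -
  have "J \<in> (if e \<in> B \<and> f \<in> B then {B - {f}} else if e \<in> B \<or> f \<in> B then {B - {e, f}} else {}) \<longleftrightarrow>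
    (e \<in> B \<and> f \<in> B \<and> J = B - {f}) \<or> ((e \<in> B) \<noteq> (f \<in> B) \<and> J = B - {e, f})" for B by auto
  then show ?thesis unfolding ident_def by (simp only: UN_iff)
qed

context
  fixes M :: "'g::finite set set" and e f :: 'g and v0 :: "real ^ 'g"
  assumes sp: "sp_family M" and ef: "e \<noteq> f" and nl: "\<not> is_loop M e" "\<not> is_loop M f"
    and v0: "v0 \<in> lin M" "v0 $ e \<noteq> v0 $ f"
begin

lemma ident_split:
  obtains S Be Bf where "e \<in> S" "f \<notin> S" "Be \<in> M" "Bf \<in> M" "e \<in> Be" "f \<in> Bf"
    "\<And>B C. B \<in> M \<Longrightarrow> C \<in> M \<Longrightarrow> (B \<inter> S) \<union> (C - S) \<in> M"
proof -
  obtain S where "e \<in> S" "f \<notin> S" "\<And>B C. B \<in> M \<Longrightarrow> C \<in> M \<Longrightarrow> (B \<inter> S) \<union> (C - S) \<in> M"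
    using sp_family_split[OF sp v0] by blast
  moreover obtain Be Bf where "Be \<in> M" "Bf \<in> M" "e \<in> Be" "f \<in> Bf" using nl by (auto simp: is_loop_def)
  ultimately show ?thesis using that[of S Be Bf] by blast
qed

text \<open>A member containing \<open>x\<close> may miss both \<open>e\<close> and \<open>f\<close>
  and so be lost. Recombining it across the separation with a member containing \<open>e\<close> or
  \<open>f\<close> keeps \<open>x\<close> and yields a member that survives.\<close>

lemma is_loop_ident: "is_loop (ident e f M) x \<longleftrightarrow> x = f \<or> is_loop M x"
proof
  assume l: "is_loop (ident e f M) x"
  show "x = f \<or> is_loop M x"
  proof (rule ccontr)
    assume "\<not> (x = f \<or> is_loop M x)"
    then obtain B where B: "B \<in> M" "x \<in> B" "x \<noteq> f" by (auto simp: is_loop_def)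
    obtain S Be Bf where S: "e \<in> S" "f \<notin> S" "Be \<in> M" "Bf \<in> M" "e \<in> Be" "f \<in> Bf"
      "\<And>B C. B \<in> M \<Longrightarrow> C \<in> M \<Longrightarrow> (B \<inter> S) \<union> (C - S) \<in> M" using ident_split by blast
    have "\<exists>D\<in>M. x \<in> D \<and> (f \<in> D \<or> e \<in> D \<and> x \<noteq> e)"
    proof (cases "x \<in> S")
      case True
      show ?thesis by (rule bexI[OF _ S(7)[OF B(1) S(4)]]) (use True B S(2,6) in auto)
    next
      case False
      show ?thesis by (rule bexI[OF _ S(7)[OF S(3) B(1)]]) (use False B S(1,5) in auto)
    qed
    then obtain D where D: "D \<in> M" "x \<in> D" "f \<in> D \<or> e \<in> D \<and> x \<noteq> e" by blast
    show False
    proof (cases "e \<in> D \<and> f \<in> D")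
      case True
      then have "D - {f} \<in> ident e f M" using D unfolding ident_iff by blast
      then show False using l D B by (auto simp: is_loop_def)
    next
      case False
      then have "D - {e, f} \<in> ident e f M" using D unfolding ident_iff by blast
      then show False using l D B False by (auto simp: is_loop_def)
    qed
  qed
next
  assume "x = f \<or> is_loop M x"
  note l = this
  have "x \<notin> J" if J: "J \<in> ident e f M" for J
  proof -
    obtain B where B: "B \<in> M" "J = B - {f} \<or> J = B - {e, f}" using J unfolding ident_iff by blast
    then have "x = f \<or> x \<notin> B" using l by (auto simp: is_loop_def)
    then show ?thesis using B(2) by auto
  qed
  then show "is_loop (ident e f M) x" by (simp add: is_loop_def)
qed

lemma is_coloop_ident:
  assumes "x \<noteq> f"
  shows "is_coloop (ident e f M) x \<longleftrightarrow> is_coloop M x \<and> (x = e \<longrightarrow> is_coloop M f)"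
proof
  assume c: "is_coloop (ident e f M) x"
  obtain S Be Bf where S: "e \<in> S" "f \<notin> S" "Be \<in> M" "Bf \<in> M" "e \<in> Be" "f \<in> Bf"
    "\<And>B C. B \<in> M \<Longrightarrow> C \<in> M \<Longrightarrow> (B \<inter> S) \<union> (C - S) \<in> M" using ident_split by blast
  have meet: "x \<in> D \<and> (x = e \<longrightarrow> f \<in> D)" if D: "D \<in> M" "e \<in> D \<or> f \<in> D" for D
  proof (cases "e \<in> D \<and> f \<in> D")
    case True
    then have "D - {f} \<in> ident e f M" using D unfolding ident_iff by blast
    then show ?thesis using c True by (auto simp: is_coloop_def)
  next
    case False
    then have "D - {e, f} \<in> ident e f M" using D unfolding ident_iff by blast
    then show ?thesis using c by (auto simp: is_coloop_def)
  qed
  show "is_coloop M x \<and> (x = e \<longrightarrow> is_coloop M f)"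
    unfolding is_coloop_def
  proof (intro conjI ballI impI)
    fix B assume B: "B \<in> M"
    have D1: "(B \<inter> S) \<union> (Bf - S) \<in> M" by (rule S(7)[OF B S(4)])
    have D2: "(Be \<inter> S) \<union> (B - S) \<in> M" by (rule S(7)[OF S(3) B])
    have D3: "f \<in> (B \<inter> S) \<union> (Bf - S)" "e \<in> (Be \<inter> S) \<union> (B - S)" using S(1-6) by auto
    show "x \<in> B" using meet[OF D1] meet[OF D2] D3 by (cases "x \<in> S") auto
    show "f \<in> B" if "x = e" using meet[OF D2] D3 S(2) that by auto
  qed
next
  assume "is_coloop M x \<and> (x = e \<longrightarrow> is_coloop M f)"
  note c = this
  have "x \<in> J" if J: "J \<in> ident e f M" for J
  proof -
    obtain B where B: "B \<in> M" "f \<in> B \<and> J = B - {f} \<or> (e \<in> B) \<noteq> (f \<in> B) \<and> J = B - {e, f}"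
      using J unfolding ident_iff by blast
    then have "x \<in> B" "x = e \<longrightarrow> f \<in> B" using c by (auto simp: is_coloop_def)
    then show ?thesis using B(2) assms by auto
  qed
  then show "is_coloop (ident e f M) x" by (simp add: is_coloop_def)
qed

text \<open>Members lost by the identification impose no further linear condition: the two sides of
  such a member each occur in a surviving recombination, and weights add over the two sides.\<close>

lemma lin_ident: "v \<in> lin (ident e f M) \<longleftrightarrow> (\<chi> i. if i = f then v $ e else v $ i) \<in> lin M"
proof -
  define u where "u = (\<chi> i. if i = f then v $ e else v $ i)"
  have uwt: "wt u A = wt v A" if "f \<notin> A" for A using that by (intro wt_cong) (auto simp: u_def)
  have both: "wt u D = wt v (D - {f}) + v $ e" if "f \<in> D" for D
  proof -
    have "wt u D = wt u (D - {f}) + u $ f" using that by (simp add: wt_remove)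
    then show ?thesis using uwt[of "D - {f}"] by (simp add: u_def)
  qed
  have one: "wt u D = wt v (D - {e, f}) + v $ e" if "(e \<in> D) \<noteq> (f \<in> D)" for D
  proof (cases "f \<in> D")
    case True
    then have "D - {f} = D - {e, f}" using that by blast
    then show ?thesis using both[OF True] by simp
  next
    case False
    then have "e \<in> D" "D - {e} = D - {e, f}" using that by blast+
    then have "wt u D = wt u (D - {e, f}) + u $ e" using wt_remove[of e D u] by simp
    then show ?thesis using uwt[of "D - {e, f}"] ef by (simp add: u_def)
  qed
  have key: "\<exists>J\<in>ident e f M. wt u D = wt v J + v $ e" if D: "D \<in> M" "e \<in> D \<or> f \<in> D" for D
  proof (cases "e \<in> D \<and> f \<in> D")
    case True
    then have "D - {f} \<in> ident e f M" using D unfolding ident_iff by blast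
    then show ?thesis using both True by blast
  next
    case False
    then have "D - {e, f} \<in> ident e f M" "(e \<in> D) \<noteq> (f \<in> D)" using D unfolding ident_iff by blast+
    then show ?thesis using one by blast
  qed
  have "v \<in> lin (ident e f M) \<longleftrightarrow> u \<in> lin M"
  proof
    assume v: "v \<in> lin (ident e f M)"
    obtain S Be Bf where S: "e \<in> S" "f \<notin> S" "Be \<in> M" "Bf \<in> M" "e \<in> Be" "f \<in> Bf"
      "\<And>B C. B \<in> M \<Longrightarrow> C \<in> M \<Longrightarrow> (B \<inter> S) \<union> (C - S) \<in> M" using ident_split by blast
    have const: "wt u D = wt u D'" if D: "D \<in> M" "e \<in> D \<or> f \<in> D" "D' \<in> M" "e \<in> D' \<or> f \<in> D'" for D D'
    proof -
      obtain J J' where J: "J \<in> ident e f M" "wt u D = wt v J + v $ e" "J' \<in> ident e f M" "wt u D' = wt v J' + v $ e"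
        using key[OF D(1,2)] key[OF D(3,4)] by blast
      then show ?thesis using linD[OF v J(1) J(3)] by simp
    qed
    have mixwt: "wt u ((X \<inter> S) \<union> (Y - S)) = wt u (X \<inter> S) + wt u (Y - S)" for X Y by (rule wt_Un) blast
    have split: "wt u X = wt u (X \<inter> S) + wt u (X - S)" for X
      using mixwt[of X X] by (simp add: Int_Diff_Un)
    let ?D3 = "(Be \<inter> S) \<union> (Bf - S)"
    have D3: "?D3 \<in> M" by (rule S(7)[OF S(3,4)])
    have eD3: "e \<in> ?D3" using S(1,5) by blast
    have "wt u B = wt u ?D3" if B: "B \<in> M" for B
    proof -
      \<comment> \<open>\<open>?D1\<close> keeps \<open>B\<close> on the side of \<open>e\<close>
        and gains \<open>f\<close>; \<open>?D2\<close> keeps \<open>B\<close> on the side of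
        \<open>f\<close> and gains \<open>e\<close>. Together they determine the weight of
        \<open>B\<close>.\<close>
      let ?D1 = "(B \<inter> S) \<union> (Bf - S)" and ?D2 = "(Be \<inter> S) \<union> (B - S)"
      have D: "?D1 \<in> M" "?D2 \<in> M" by (rule S(7)[OF B S(4)], rule S(7)[OF S(3) B])
      have D': "f \<in> ?D1" "e \<in> ?D2" using S(1-6) by blast+
      have "wt u ?D1 = wt u ?D3" by (rule const[OF D(1) disjI2[OF D'(1)] D3 disjI1[OF eD3]])
      moreover have "wt u ?D2 = wt u ?D3" by (rule const[OF D(2) disjI1[OF D'(2)] D3 disjI1[OF eD3]])
      ultimately have "wt u ?D1 = wt u ?D3" "wt u ?D2 = wt u ?D3" by simp_all
      then show ?thesis using split[of B] unfolding mixwt by simp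
    qed
    note B3 = this
    show "u \<in> lin M" by (rule linI) (simp only: B3)
  next
    assume u: "u \<in> lin M"
    show "v \<in> lin (ident e f M)"
    proof (rule linI)
      have *: "\<exists>D\<in>M. wt u D = wt v J + v $ e" if J: "J \<in> ident e f M" for J
      proof -
        obtain D where "D \<in> M" "(e \<in> D \<and> f \<in> D \<and> J = D - {f}) \<or> ((e \<in> D) \<noteq> (f \<in> D) \<and> J = D - {e, f})"
          using J unfolding ident_iff by blast
        then show ?thesis using both[of D] one[of D] by (intro bexI[of _ D]) auto
      qed
      fix J J' assume J: "J \<in> ident e f M" "J' \<in> ident e f M"
      obtain D D' where D: "D \<in> M" "D' \<in> M" "wt u D = wt v J + v $ e" "wt u D' = wt v J' + v $ e"
        using *[OF J(1)] *[OF J(2)] by blast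
      then show "wt v J = wt v J'" using linD[OF u D(1,2)] by simp
    qed
  qed
  then show ?thesis by (simp add: u_def)
qed

end

section \<open>Gluing the twin pairs of a set\<close>

definition covers :: "'n set \<Rightarrow> ('n + 'n) set \<Rightarrow> bool" where
  "covers T B \<longleftrightarrow> (\<forall>i\<in>T. Inl i \<in> B \<or> Inr i \<in> B)"

text \<open>All identifications over \<open>T\<close> at once: the merged element is
  \<open>Inl i\<close> and survives iff both copies are present.\<close>

definition glue :: "'n set \<Rightarrow> ('n + 'n) set \<Rightarrow> ('n + 'n) set" where
  "glue T B = {z\<in>B. case z of Inl i \<Rightarrow> i \<in> T \<longrightarrow> Inr i \<in> B | Inr i \<Rightarrow> i \<notin> T}"

definition Id :: "'n set \<Rightarrow> ('n + 'n) set set \<Rightarrow> ('n + 'n) set set" where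
  "Id T M = glue T ` {B\<in>M. covers T B}"

text \<open>Projection onto the vectors that give both copies of each \<open>i \<in> T\<close> the
  same value; these are the vectors that the glued family can see.\<close>

definition hat :: "'n set \<Rightarrow> real ^ ('n::finite + 'n) \<Rightarrow> real ^ ('n + 'n)" where
  "hat T v = (\<chi> z. case z of Inl i \<Rightarrow> v $ Inl i | Inr i \<Rightarrow> if i \<in> T then v $ Inl i else v $ Inr i)"

text \<open>Transversality to the diagonal of the pairs in \<open>T\<close>: moving in
  \<open>S\<close> can change the differences of these pairs arbitrarily.\<close>

definition fills :: "'n set \<Rightarrow> (real ^ ('n::finite + 'n)) set \<Rightarrow> bool" where
  "fills T S \<longleftrightarrow> (\<forall>z::'n \<Rightarrow> real. \<exists>v\<in>S. \<forall>i\<in>T. v $ Inl i - v $ Inr i = z i)"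

lemma mem_glue [simp]:
  "Inl i \<in> glue T B \<longleftrightarrow> Inl i \<in> B \<and> (i \<in> T \<longrightarrow> Inr i \<in> B)"
  "Inr i \<in> glue T B \<longleftrightarrow> Inr i \<in> B \<and> i \<notin> T"
  by (auto simp: glue_def)

lemma hat_nth [simp]: "hat T v $ Inl i = v $ Inl i" "hat T v $ Inr i = (if i \<in> T then v $ Inl i else v $ Inr i)"
  by (simp_all add: hat_def)

lemma sum_set_eqI: "(\<And>i. Inl i \<in> A \<longleftrightarrow> Inl i \<in> B) \<Longrightarrow> (\<And>i. Inr i \<in> A \<longleftrightarrow> Inr i \<in> B) \<Longrightarrow> A = B"
  by (rule set_eqI, case_tac x) auto

lemma sum_vec_eqI:
  fixes v w :: "real ^ ('n::finite + 'n)"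
  shows "(\<And>i. v $ Inl i = w $ Inl i) \<Longrightarrow> (\<And>i. v $ Inr i = w $ Inr i) \<Longrightarrow> v = w"
  by (simp add: vec_eq_iff split_sum_all)

lemma fills_mono: "fills T S \<Longrightarrow> S \<subseteq> S' \<Longrightarrow> fills T S'"
  unfolding fills_def by blast

lemma Id_empty: "Id {} M = M"
proof -
  have "glue {} B = B" for B :: "('a + 'a) set" by (rule sum_set_eqI) auto
  then show ?thesis by (simp add: Id_def covers_def)
qed

lemma Id_insert:
  assumes "j \<notin> T" shows "Id (insert j T) M = ident (Inl j) (Inr j) (Id T M)"
proof (rule set_eqI)
  fix J
  have 1: "glue (insert j T) B = glue T B - {Inr j}" if "Inl j \<in> B" "Inr j \<in> B" for B
    using that assms by (intro sum_set_eqI) auto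
  have 2: "glue (insert j T) B = glue T B - {Inl j, Inr j}" if "(Inl j \<in> B) \<noteq> (Inr j \<in> B)" for B
    using that assms by (intro sum_set_eqI) auto
  have "J \<in> Id (insert j T) M \<longleftrightarrow> (\<exists>B\<in>M. covers T B \<and> (Inl j \<in> B \<or> Inr j \<in> B) \<and> J = glue (insert j T) B)"
    by (auto simp: Id_def covers_def)
  also have "\<dots> \<longleftrightarrow> (\<exists>B\<in>M. covers T B \<and> ((Inl j \<in> B \<and> Inr j \<in> B \<and> J = glue T B - {Inr j}) \<or>
      ((Inl j \<in> B) \<noteq> (Inr j \<in> B) \<and> J = glue T B - {Inl j, Inr j})))"
    using 1 2 by metis
  also have "\<dots> \<longleftrightarrow> J \<in> ident (Inl j) (Inr j) (Id T M)"
    unfolding ident_iff Id_def using assms by (simp add: Bex_def)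
  finally show "J \<in> Id (insert j T) M \<longleftrightarrow> J \<in> ident (Inl j) (Inr j) (Id T M)" .
qed

text \<open>The pairs are glued one at a time. Since \<open>fills\<close> refers to \<open>M\<close>
  itself, it provides at every stage a lineality vector that is already diagonal on the glued pairs
  and separates the next one, as \<open>sp_family_ident\<close> demands.\<close>

lemma Id_main:
  fixes M :: "('n::finite + 'n) set set"
  assumes sp: "sp_family M" and nl: "\<And>x. \<not> is_loop M x" and fl: "fills T (lin M)"
  shows "sp_family (Id T M) \<and> (\<forall>x. is_loop (Id T M) x \<longleftrightarrow> x \<in> Inr ` T) \<and>
    (\<forall>i. is_coloop (Id T M) (Inl i) \<longleftrightarrow> is_coloop M (Inl i) \<and> (i \<in> T \<longrightarrow> is_coloop M (Inr i))) \<and>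
    (\<forall>i. i \<notin> T \<longrightarrow> is_coloop (Id T M) (Inr i) = is_coloop M (Inr i)) \<and>
    (\<forall>v. v \<in> lin (Id T M) \<longleftrightarrow> hat T v \<in> lin M) \<and> dim (lin (Id T M)) = dim (lin M)"
  using finite[of T] fl
proof (induction T rule: finite_induct)
  case empty
  have "hat {} v = v" for v :: "real ^ ('n + 'n)" by (rule sum_vec_eqI) auto
  then show ?case using sp nl by (simp add: Id_empty)
next
  case (insert j T)
  let ?e = "Inl j :: 'n + 'n" and ?f = "Inr j :: 'n + 'n"
  define M1 where "M1 = Id T M"
  have "fills T (lin M)" using insert.prems unfolding fills_def by blast
  note IH = insert.IH[OF this, folded M1_def]
  have sp1: "sp_family M1" and l1: "\<And>x. is_loop M1 x \<longleftrightarrow> x \<in> Inr ` T"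
    and cl: "\<And>i. is_coloop M1 (Inl i) \<longleftrightarrow> is_coloop M (Inl i) \<and> (i \<in> T \<longrightarrow> is_coloop M (Inr i))"
    and cr: "\<And>i. i \<notin> T \<Longrightarrow> is_coloop M1 (Inr i) = is_coloop M (Inr i)"
    and lin1: "\<And>v. v \<in> lin M1 \<longleftrightarrow> hat T v \<in> lin M" and dim1: "dim (lin M1) = dim (lin M)"
    using IH by blast+
  have ef: "?e \<noteq> ?f" by simp
  have nle: "\<not> is_loop M1 ?e" "\<not> is_loop M1 ?f" using l1 insert.hyps by auto
  \<comment> \<open>Being diagonal on \<open>T\<close>, this vector is its own \<open>hat T\<close>
    and hence also a lineality vector of the partially glued family.\<close>
  obtain v0 where v0: "v0 \<in> lin M" "\<And>i. i \<in> insert j T \<Longrightarrow> v0 $ Inl i - v0 $ Inr i = (if i = j then 1 else 0)"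
    using insert.prems[unfolded fills_def, rule_format, of "\<lambda>i. if i = j then 1 else 0"] by blast
  have "hat T v0 = v0"
  proof (rule sum_vec_eqI)
    fix i
    have "i \<noteq> j" if "i \<in> T" using that insert.hyps by blast
    then show "hat T v0 $ Inr i = v0 $ Inr i" using v0(2)[of i] by auto
  qed simp
  then have v0': "v0 \<in> lin M1" "v0 $ ?e \<noteq> v0 $ ?f" using lin1 v0(1) v0(2)[of j] by auto
  note id = Id_insert[OF insert.hyps(2), of M, folded M1_def]
  note ctx = sp1 ef nle v0'
  have 1: "sp_family (Id (insert j T) M)" unfolding id by (rule sp_family_ident[OF ctx])
  have 2: "is_loop (Id (insert j T) M) x \<longleftrightarrow> x \<in> Inr ` insert j T" for x
    unfolding id is_loop_ident[OF ctx] l1 by auto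
  have 3: "is_coloop (Id (insert j T) M) (Inl i) \<longleftrightarrow> is_coloop M (Inl i) \<and> (i \<in> insert j T \<longrightarrow> is_coloop M (Inr i))" for i
    unfolding id using is_coloop_ident[OF ctx, of "Inl i"] cl[of i] cr[of j] insert.hyps by auto
  have 4: "is_coloop (Id (insert j T) M) (Inr i) = is_coloop M (Inr i)" if "i \<notin> insert j T" for i
    unfolding id using is_coloop_ident[OF ctx, of "Inr i"] cr[of i] that by simp
  have 5: "v \<in> lin (Id (insert j T) M) \<longleftrightarrow> hat (insert j T) v \<in> lin M" for v
  proof -
    have "hat T (\<chi> i. if i = ?f then v $ ?e else v $ i) = hat (insert j T) v"
      by (rule sum_vec_eqI) auto
    then show ?thesis unfolding id lin_ident[OF ctx] lin1 by simp
  qed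
  \<comment> \<open>Gluing adds the equation that the two copies agree and frees the coordinate of
    the new loop \<open>?f\<close>. Both changes are by one dimension and cancel.\<close>
  have 6: "dim (lin (Id (insert j T) M)) = dim (lin M)"
  proof -
    have L: "linear (\<lambda>v :: real ^ ('n + 'n). v $ ?e - v $ ?f)" by (rule linearI) (auto simp: algebra_simps)
    have "is_loop (Id (insert j T) M) ?f" using 2 by simp
    then have ax: "axis ?f 1 \<in> lin (Id (insert j T) M)" by (rule axis_lin_loop)
    have "dim (lin (Id (insert j T) M)) = Suc (dim {v\<in>lin (Id (insert j T) M). v $ ?e - v $ ?f = 0})"
      by (rule dim_kernel[OF subspace_lin L ax]) (simp add: axis_def)
    also have "{v\<in>lin (Id (insert j T) M). v $ ?e - v $ ?f = 0} = {v\<in>lin M1. v $ ?e - v $ ?f = 0}"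
    proof -
      have "(\<chi> i. if i = ?f then v $ ?e else v $ i) = v" if "v $ ?e - v $ ?f = 0" for v :: "real ^ ('n + 'n)"
        using that by (auto simp: vec_eq_iff)
      then have "v \<in> lin (ident ?e ?f M1) \<longleftrightarrow> v \<in> lin M1" if "v $ ?e - v $ ?f = 0" for v :: "real ^ ('n + 'n)"
        using that lin_ident[OF ctx, of v] by simp
      then show ?thesis unfolding id by blast
    qed
    also have "Suc (dim {v\<in>lin M1. v $ ?e - v $ ?f = 0}) = dim (lin M1)"
      using dim_kernel[OF subspace_lin L v0'(1)] v0'(2) by simp
    finally show ?thesis using dim1 by simp
  qed
  show ?case using 1 2 3 4 5 6 by blast
qed

text \<open>Gluing removes exactly one copy from each pair of \<open>T\<close> that \<open>B\<close>
  covers, and under \<open>hat T\<close> both copies have weight \<open>v $ Inl i\<close>.\<close>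

lemma wt_glue:
  fixes v :: "real ^ ('n::finite + 'n)"
  assumes "covers T B"
  shows "wt v (glue T B) = wt (hat T v) B - (\<Sum>i\<in>T. v $ Inl i)"
proof -
  \<comment> \<open>The copy of \<open>i\<close> that gluing removes.\<close>
  define g where "g i = (if Inr i \<in> B then Inr i else Inl i :: 'n + 'n)" for i
  have inj: "inj_on g T" by (rule inj_onI) (auto simp: g_def split: if_splits)
  have B: "B = glue T B \<union> g ` T"
  proof (rule sum_set_eqI)
    fix i
    show "Inl i \<in> B \<longleftrightarrow> Inl i \<in> glue T B \<union> g ` T" using assms by (auto simp: g_def covers_def split: if_splits)
    show "Inr i \<in> B \<longleftrightarrow> Inr i \<in> glue T B \<union> g ` T" by (auto simp: g_def split: if_splits)
  qed
  have disj: "glue T B \<inter> g ` T = {}" by (auto simp: g_def)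
  have "wt (hat T v) B = wt (hat T v) (glue T B) + wt (hat T v) (g ` T)"
    using wt_Un[OF disj, of "hat T v"] B by simp
  also have "wt (hat T v) (glue T B) = wt v (glue T B)"
  proof (rule wt_cong)
    fix z assume "z \<in> glue T B" then show "hat T v $ z = v $ z" by (cases z) auto
  qed
  also have "wt (hat T v) (g ` T) = (\<Sum>i\<in>T. v $ Inl i)"
    unfolding wt_def sum.reindex[OF inj] by (intro sum.cong) (auto simp: g_def)
  finally show ?thesis by simp
qed

lemma hat_hat [simp]: "hat T (hat T v) = hat T v"
  by (rule sum_vec_eqI) auto

lemma ini_Id_hat: "ini (Id T M) (hat T v) = ini (Id T M) v"
proof -
  have "wt (hat T v) J = wt v J" if J: "J \<in> Id T M" for J
  proof (rule wt_cong)
    fix z assume z: "z \<in> J"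
    obtain B where "J = glue T B" using J by (auto simp: Id_def)
    then show "hat T v $ z = v $ z" using z by (cases z) auto
  qed
  then show ?thesis unfolding ini_def by auto
qed

text \<open>For diagonal \<open>v\<close> all covering members lose the same weight when glued. As
  soon as one heaviest member of \<open>M\<close> is covering, the heaviest glued members come
  precisely from the heaviest covering ones.\<close>

lemma ini_Id:
  fixes M :: "('n::finite + 'n) set set"
  assumes v: "hat T v = v" and ne: "Id T (ini M v) \<noteq> {}"
  shows "ini (Id T M) v = Id T (ini M v)"
proof -
  let ?K = "\<Sum>i\<in>T. v $ Inl i"
  have w: "wt v (glue T B) = wt v B - ?K" if "covers T B" for B using wt_glue[OF that, of v] v by simp
  obtain B0 where B0: "B0 \<in> ini M v" "covers T B0" using ne by (auto simp: Id_def)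
  show ?thesis
  proof (rule set_eqI)
    fix J
    show "J \<in> ini (Id T M) v \<longleftrightarrow> J \<in> Id T (ini M v)"
    proof
      assume J: "J \<in> ini (Id T M) v"
      then obtain B where B: "B \<in> M" "covers T B" "J = glue T B" by (auto simp: ini_def Id_def)
      have "glue T B0 \<in> Id T M" using B0 by (auto simp: Id_def ini_def)
      then have "wt v (glue T B0) \<le> wt v J" using J by (auto simp: ini_def)
      then have "wt v B0 \<le> wt v B" using w B0 B by simp
      then have "B \<in> ini M v" using B0 B by (auto simp: ini_def intro: order_trans)
      then show "J \<in> Id T (ini M v)" using B by (auto simp: Id_def)
    next
      assume "J \<in> Id T (ini M v)"
      then obtain B where B: "B \<in> ini M v" "covers T B" "J = glue T B" by (auto simp: Id_def)
      have "wt v J' \<le> wt v J" if "J' \<in> Id T M" for J'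
        using that B w by (auto simp: Id_def ini_def)
      moreover have "J \<in> Id T M" using B by (auto simp: Id_def ini_def)
      ultimately show "J \<in> ini (Id T M) v" by (simp add: ini_def)
    qed
  qed
qed

lemma Id_nonempty:
  fixes M :: "('n::finite + 'n) set set"
  assumes "sp_family M" "\<And>x. \<not> is_loop M x" "fills T (lin M)"
  shows "Id T M \<noteq> {}"
proof -
  have "sp_family (Id T M)" using Id_main[OF assms] by (rule conjunct1)
  then show ?thesis by (rule sp_family_nonempty)
qed

text \<open>Covering members pass from one face to the other by comparing glued weights. The
  remaining ones follow because \<open>u - v\<close> is a lineality vector of the glued family and
  thus, by \<open>Id_main\<close>, of the whole face.\<close>

lemma Id_inj_aux:
  fixes M :: "('n::finite + 'n) set set"
  assumes v: "hat T v = v" "hat T u = u"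
    and G: "sp_family (ini M v)" "\<And>x. \<not> is_loop (ini M v) x" "fills T (lin (ini M v))"
    and eq: "Id T (ini M v) = Id T (ini M u)"
  shows "ini M v \<subseteq> ini M u"
proof -
  have w: "wt x (glue T B) = wt x B - (\<Sum>i\<in>T. x $ Inl i)" if "covers T B" "hat T x = x" for B and x :: "real ^ ('n + 'n)"
    using wt_glue[OF that(1), of x] that(2) by simp
  have cov: "B \<in> ini M u" if B: "B \<in> ini M v" "covers T B" for B
  proof -
    have "glue T B \<in> Id T (ini M u)" using B eq[symmetric] by (auto simp: Id_def)
    then obtain C where C: "C \<in> ini M u" "covers T C" "glue T B = glue T C" by (auto simp: Id_def)
    then have "wt u B = wt u C" using w[OF B(2) v(2)] w[OF C(2) v(2)] by simp
    then show ?thesis using C(1) B(1) by (auto simp: ini_def)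
  qed
  have Gne: "Id T (ini M v) \<noteq> {}" by (rule Id_nonempty[OF G])
  obtain B0 where B0: "B0 \<in> ini M v" "covers T B0" using Gne by (auto simp: Id_def)
  have vv: "wt v B = wt v C" if "B \<in> ini M v" "C \<in> ini M v" for B C
    using that by (auto simp: ini_def intro: antisym)
  have uu: "wt u B = wt u C" if "B \<in> ini M u" "C \<in> ini M u" for B C
    using that by (auto simp: ini_def intro: antisym)
  have hx: "hat T (u - v) = u - v"
  proof -
    have "hat T (u - v) = hat T u - hat T v" by (rule sum_vec_eqI) auto
    then show ?thesis using v by simp
  qed
  have "u - v \<in> lin (Id T (ini M v))"
  proof (rule linI)
    fix J J' assume "J \<in> Id T (ini M v)" "J' \<in> Id T (ini M v)"
    then obtain B B' where B: "B \<in> ini M v" "covers T B" "J = glue T B" "B' \<in> ini M v" "covers T B'" "J' = glue T B'"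
      by (auto simp: Id_def)
    have "wt (u - v) B = wt (u - v) B'" using vv[OF B(1,4)] uu[OF cov[OF B(1,2)] cov[OF B(4,5)]] by simp
    then show "wt (u - v) J = wt (u - v) J'" unfolding B(3,6) w[OF B(2) hx] w[OF B(5) hx] by simp
  qed
  then have lin: "u - v \<in> lin (ini M v)" using Id_main[OF G] hx by metis
  show ?thesis
  proof
    fix B assume B: "B \<in> ini M v"
    have "wt (u - v) B = wt (u - v) B0" by (rule linD[OF lin B B0(1)])
    then have "wt u B = wt u B0" using vv[OF B B0(1)] by simp
    then show "B \<in> ini M u" using cov[OF B0] B by (auto simp: ini_def)
  qed
qed

definition exchangeable :: "'g set set \<Rightarrow> bool" where
  "exchangeable M \<longleftrightarrow> (\<forall>B\<in>M. \<forall>C\<in>M. \<forall>x\<in>B - C. \<exists>y\<in>C - B. insert y (B - {x}) \<in> M \<and> insert x (C - {y}) \<in> M)"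

text \<open>If \<open>x\<close> lay in no heaviest member of \<open>M\<close>, exchanging it out of
  a member \<open>B\<close> with optimal gluing would give a strictly heavier member that still
  covers \<open>T\<close>.\<close>

lemma loop_transfer:
  fixes M :: "('n::finite + 'n) set set"
  assumes ex: "exchangeable M" and ne: "M \<noteq> {}" and v: "hat T v = v"
    and nl: "\<And>z. z \<notin> Inr ` T \<Longrightarrow> \<not> is_loop (ini (Id T M) v) z"
  shows "\<not> is_loop (ini M v) x"
proof
  assume l: "is_loop (ini M v) x"
  \<comment> \<open>The element that represents \<open>x\<close> after gluing.\<close>
  define z where "z = (case x of Inl i \<Rightarrow> Inl i | Inr i \<Rightarrow> if i \<in> T then Inl i else Inr i)"
  have "z \<notin> Inr ` T" by (auto simp: z_def split: sum.splits if_splits)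
  from nl[OF this] obtain J where J: "J \<in> ini (Id T M) v" "z \<in> J" by (auto simp: is_loop_def)
  then obtain B where B: "B \<in> M" "covers T B" "J = glue T B" by (auto simp: ini_def Id_def)
  have xB: "x \<in> B" "\<And>i. i \<in> T \<Longrightarrow> x = Inl i \<or> x = Inr i \<Longrightarrow> Inl i \<in> B \<and> Inr i \<in> B"
    using J(2) unfolding B(3) z_def by (auto split: sum.splits if_splits)
  obtain C where C: "C \<in> ini M v" using ini_nonempty[OF ne] by blast
  have "x \<in> B - C" using xB l C by (auto simp: is_loop_def)
  moreover have CM: "C \<in> M" using C by (simp add: ini_def)
  ultimately obtain y where y: "y \<in> C - B" "insert y (B - {x}) \<in> M" "insert x (C - {y}) \<in> M"
    using ex B(1) unfolding exchangeable_def by blast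
  have "insert x (C - {y}) \<notin> ini M v" using l by (auto simp: is_loop_def)
  then have "wt v (insert x (C - {y})) < wt v C" using y(3) C by (force simp: ini_def)
  moreover have "wt v (insert x (C - {y})) = wt v C - v $ y + v $ x"
    using y \<open>x \<in> B - C\<close> by (intro wt_exchange) auto
  ultimately have lt: "v $ x < v $ y" by simp
  let ?B = "insert y (B - {x})"
  \<comment> \<open>If the index of \<open>x\<close> is in \<open>T\<close>, its twin is in
    \<open>B\<close> as well, because \<open>z\<close> survived the gluing. Hence \<open>x\<close>
    may be removed.\<close>
  have cov: "covers T ?B" using B(2) xB(2) unfolding covers_def by blast
  have "wt v ?B = wt v B - v $ x + v $ y" using y xB by (intro wt_exchange) auto
  then have "wt v (glue T ?B) > wt v J" using lt wt_glue[OF cov, of v] wt_glue[OF B(2), of v] v B(3) by simp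
  moreover have "glue T ?B \<in> Id T M" using cov y(2) by (auto simp: Id_def)
  ultimately show False using J(1) by (force simp: ini_def)
qed

text \<open>For the family of a pair \<open>(w, w - a)\<close>, having no loops places the two
  points on their tropical linear spaces, and an element that is a coloop on both sides would be a
  direction in which the cell is unbounded.\<close>

definition good :: "('n + 'n) set set \<Rightarrow> bool" where
  "good M \<longleftrightarrow> (\<forall>x. \<not> is_loop M x) \<and> (\<forall>i. \<not> (is_coloop M (Inl i) \<and> is_coloop M (Inr i)))"

text \<open>The faces of \<open>M\<close> along the diagonal of all pairs but the one
  indexed by \<open>i\<^sub>0\<close> are the faces of the family obtained by gluing these pairs.\<close>

lemma local_balance_aux:
  fixes M :: "('n::finite + 'n) set set" and i0 :: 'n
  assumes sp: "sp_family M" and nl: "\<And>x. \<not> is_loop M x" and ex: "exchangeable M"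
    and T: "T = - {i0}" and fl: "fills T (lin M)" and ab: "{a, b} = {Inl i0, Inr i0}"
  shows "(\<Sum>G | good G \<and> (\<exists>v. hat T v = v \<and> ini M v = G) \<and> (\<forall>v. hat T v = v \<longrightarrow> ini M v = G \<longrightarrow> v $ b \<le> v $ a). tt ^ dim (lin G))
    = fenum (Id T M) a b ((\<lambda>z. if z \<in> Inr ` T then Loop else Ord)(a := Ord, b := Ord)) +
      fenum (Id T M) a b ((\<lambda>z. if z \<in> Inr ` T then Loop else Ord)(a := Coloop, b := Ord))"
proof -
  let ?\<sigma> = "\<lambda>z :: 'n + 'n. if z \<in> Inr ` T then Loop else Ord"
  let ?K = "Id T M"
  define \<G> where "\<G> = {G. good G \<and> (\<exists>v. hat T v = v \<and> ini M v = G) \<and> (\<forall>v. hat T v = v \<longrightarrow> ini M v = G \<longrightarrow> v $ b \<le> v $ a)}"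
  define \<F>1 where "\<F>1 = FS ?K a b (?\<sigma>(a := Ord, b := Ord))"
  define \<F>2 where "\<F>2 = FS ?K a b (?\<sigma>(a := Coloop, b := Ord))"
  have ne: "M \<noteq> {}" using sp by (rule sp_family_nonempty)
  have abne: "a \<noteq> b" using ab by (auto simp: doubleton_eq_iff)
  have abT: "a \<notin> Inr ` T" "b \<notin> Inr ` T" "a \<in> {Inl i0, Inr i0}" "b \<in> {Inl i0, Inr i0}"
    using ab T by auto
  have hat_ab: "hat T v $ a = v $ a" "hat T v $ b = v $ b" for v
    using abT(3,4) unfolding T by auto
  have face: "sp_family (ini M v)" "fills T (lin (ini M v))" for v
    by (rule sp_family_ini[OF sp], rule fills_mono[OF fl lin_antimono[OF ini_subset]])
  have st: "stat (Id T G) z = (if z \<in> Inr ` T then Loop else if z \<in> {a, b} then stat G z else Ord)"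
    if v: "G = ini M v" and g: "good G" for G v z
  proof -
    have nlG: "\<And>x. \<not> is_loop G x" using g by (simp add: good_def)
    note m = Id_main[OF face(1)[of v, folded v] nlG face(2)[of v, folded v]]
    have l: "is_loop (Id T G) z \<longleftrightarrow> z \<in> Inr ` T" using m by blast
    have c1: "is_coloop (Id T G) (Inl i) \<longleftrightarrow> is_coloop G (Inl i) \<and> (i \<in> T \<longrightarrow> is_coloop G (Inr i))" for i using m by blast
    have c2: "i \<notin> T \<Longrightarrow> is_coloop (Id T G) (Inr i) = is_coloop G (Inr i)" for i using m by blast
    show ?thesis
    proof (cases z)
      case (Inl i)
      then have "z \<in> {a, b} \<longleftrightarrow> i \<notin> T" using ab T by auto
      then show ?thesis using Inl l c1[of i] nlG g by (auto simp: stat_def good_def)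
    next
      case (Inr i)
      show ?thesis
      proof (cases "i \<in> T")
        case True then show ?thesis using Inr l by (simp add: stat_def)
      next
        case False
        then have "z \<in> {a, b}" "z \<notin> Inr ` T" using Inr ab T by auto
        then show ?thesis using Inr l c2[OF False] nlG by (simp add: stat_def)
      qed
    qed
  qed
  have lift: "good' \<and> ini ?K u = Id T (ini M (hat T u))"
    if u: "\<And>z. z \<notin> Inr ` T \<Longrightarrow> \<not> is_loop (ini ?K u) z" and good': "good' = (\<forall>x. \<not> is_loop (ini M (hat T u)) x)" for u good'
  proof -
    have "\<not> is_loop (ini M (hat T u)) x" for x
      by (rule loop_transfer[OF ex ne hat_hat]) (use u in \<open>simp add: ini_Id_hat\<close>)
    moreover from this have "Id T (ini M (hat T u)) \<noteq> {}" by (intro Id_nonempty face)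
    ultimately show ?thesis using ini_Id[OF hat_hat, of T M u] good' by (simp add: ini_Id_hat)
  qed
  have inj: "ini M v = ini M u" if "hat T v = v" "hat T u = u" "\<And>x. \<not> is_loop (ini M v) x" "\<And>x. \<not> is_loop (ini M u) x"
    "Id T (ini M v) = Id T (ini M u)" for u v
  proof
    show "ini M v \<subseteq> ini M u" by (rule Id_inj_aux[OF that(1,2) face(1) that(3) face(2) that(5)])
    show "ini M u \<subseteq> ini M v" by (rule Id_inj_aux[OF that(2,1) face(1) that(4) face(2) that(5)[symmetric]])
  qed
  have bij: "bij_betw (Id T) \<G> (\<F>1 \<union> \<F>2)"
  proof (rule bij_betw_imageI[OF inj_onI set_eqI[OF iffI]])
    fix G G' assume G: "G \<in> \<G>" "G' \<in> \<G>" and eq: "Id T G = Id T G'"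
    obtain v u where vu: "hat T v = v" "ini M v = G" "hat T u = u" "ini M u = G'" using G unfolding \<G>_def by blast
    have "good G" "good G'" using G unfolding \<G>_def by blast+
    then have "\<And>x. \<not> is_loop (ini M v) x" "\<And>x. \<not> is_loop (ini M u) x" unfolding vu by (auto simp: good_def)
    from inj[OF vu(1,3) this] eq show "G = G'" unfolding vu by simp
  next
    fix H assume "H \<in> Id T ` \<G>"
    then obtain G where G: "G \<in> \<G>" and H: "H = Id T G" by blast
    obtain v where v: "hat T v = v" "ini M v = G" using G unfolding \<G>_def by blast
    have gd: "good G" and dom: "\<And>u. hat T u = u \<Longrightarrow> ini M u = G \<Longrightarrow> u $ b \<le> u $ a"
      using G unfolding \<G>_def by blast+
    have nlG: "\<And>x. \<not> is_loop G x" using gd by (simp add: good_def)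
    note stH = st[OF v(2)[symmetric] gd, folded H]
    have "Id T (ini M v) \<noteq> {}" by (intro Id_nonempty face) (simp add: v nlG)
    then have iH: "ini ?K v = H" using ini_Id[OF v(1), of M] v H by simp
    have nlH: "\<not> is_loop H z" if "z \<notin> Inr ` T" for z
      using stH[of z] that nlG by (auto simp: stat_def split: if_splits)
    have domH: "u $ b \<le> u $ a" if u: "ini ?K u = H" for u
    proof -
      have "\<And>z. z \<notin> Inr ` T \<Longrightarrow> \<not> is_loop (ini ?K u) z" using nlH u by simp
      from lift[OF this refl] have *: "\<And>x. \<not> is_loop (ini M (hat T u)) x" "H = Id T (ini M (hat T u))"
        using u by blast+
      have "ini M v = ini M (hat T u)"
        by (rule inj[OF v(1) hat_hat]) (use * nlG v H in auto)
      then show ?thesis using dom[OF hat_hat, of u] v hat_ab by simp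
    qed
    \<comment> \<open>Raising a coloop \<open>b\<close> keeps the face and, since the index
      \<open>i0\<close> is outside \<open>T\<close>, also keeps the vector diagonal; it would break
      the domination by \<open>a\<close>.\<close>
    have bnc: "\<not> is_coloop G b"
    proof
      assume "is_coloop G b"
      then have i: "ini M (v + (\<bar>v $ a - v $ b\<bar> + 1) *\<^sub>R axis b 1) = G" using ini_raise_coloop[of M v b] v by simp
      have "hat T (v + (\<bar>v $ a - v $ b\<bar> + 1) *\<^sub>R axis b 1) = v + (\<bar>v $ a - v $ b\<bar> + 1) *\<^sub>R axis b 1"
      proof (rule sum_vec_eqI)
        fix i
        have "v $ Inr i = v $ Inl i" if "i \<in> T" using arg_cong[OF v(1), of "\<lambda>x. x $ Inr i"] that by simp
        then show "hat T (v + (\<bar>v $ a - v $ b\<bar> + 1) *\<^sub>R axis b 1) $ Inr i = (v + (\<bar>v $ a - v $ b\<bar> + 1) *\<^sub>R axis b 1) $ Inr i"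
          using abT T by (auto simp: axis_def)
      qed simp
      from dom[OF this i] show False using abne by (simp add: axis_def)
    qed
    have sb: "stat G b = Ord" using bnc nlG by (simp add: stat_def)
    have sa: "stat G a = Ord \<or> stat G a = Coloop" using nlG by (simp add: stat_def)
    have "(\<forall>z. stat H z = (?\<sigma>(a := Ord, b := Ord)) z) \<or> (\<forall>z. stat H z = (?\<sigma>(a := Coloop, b := Ord)) z)"
      using sa
    proof
      assume "stat G a = Ord" then show ?thesis using sb stH abT abne by (intro disjI1 allI) auto
    next
      assume "stat G a = Coloop" then show ?thesis using sb stH abT abne by (intro disjI2 allI) auto
    qed
    then show "H \<in> \<F>1 \<union> \<F>2" using iH domH unfolding \<F>1_def \<F>2_def FS_def by blast
  next
    fix H assume H: "H \<in> \<F>1 \<union> \<F>2"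
    then obtain u where u: "ini ?K u = H" unfolding \<F>1_def \<F>2_def FS_def by blast
    have domH: "\<And>u. ini ?K u = H \<Longrightarrow> u $ b \<le> u $ a" using H unfolding \<F>1_def \<F>2_def FS_def by blast
    have sH: "stat H z = (if z \<in> Inr ` T then Loop else Ord)" if "z \<noteq> a" "z \<noteq> b" for z
      using H that unfolding \<F>1_def \<F>2_def FS_def by auto
    have sb: "stat H b = Ord" and sa: "stat H a \<noteq> Loop"
      using H abne unfolding \<F>1_def \<F>2_def FS_def by auto
    have nlH: "\<not> is_loop H z" if "z \<notin> Inr ` T" for z
      using that sH[of z] sb sa by (cases "z = a"; cases "z = b") (auto simp: stat_def split: if_splits)
    define G where "G = ini M (hat T u)"
    have "\<And>z. z \<notin> Inr ` T \<Longrightarrow> \<not> is_loop (ini ?K u) z" using nlH u by simp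
    from lift[OF this refl] have nlG: "\<And>x. \<not> is_loop G x" and HG: "H = Id T G" using u unfolding G_def by blast+
    note m = Id_main[OF face(1)[of "hat T u", folded G_def] nlG face(2)[of "hat T u", folded G_def], folded HG]
    have c1: "is_coloop H (Inl i) \<longleftrightarrow> is_coloop G (Inl i) \<and> (i \<in> T \<longrightarrow> is_coloop G (Inr i))" for i using m by blast
    have c2: "i \<notin> T \<Longrightarrow> is_coloop H (Inr i) = is_coloop G (Inr i)" for i using m by blast
    have gd: "good G" unfolding good_def
    proof (intro conjI allI notI)
      fix x assume "is_loop G x" then show False using nlG by blast
    next
      fix i assume c: "is_coloop G (Inl i) \<and> is_coloop G (Inr i)"
      show False
      proof (cases "i \<in> T")
        case True
        then have "is_coloop H (Inl i)" using c c1 by blast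
        moreover have "Inl i \<noteq> a" "Inl i \<noteq> b" using True abT(3,4) unfolding T by auto
        ultimately show False using sH[of "Inl i"] by (auto simp: stat_def split: if_splits)
      next
        case False
        then have "b = Inl i \<or> b = Inr i" using abT(4) unfolding T by auto
        then have "is_coloop H b" using c c1[of i] c2[of i] False by auto
        then show False using sb by (simp add: stat_def split: if_splits)
      qed
    qed
    have "w $ b \<le> w $ a" if w: "hat T w = w" "ini M w = G" for w
    proof -
      have "Id T (ini M w) \<noteq> {}" by (intro Id_nonempty face) (simp add: w nlG)
      then have "ini ?K w = H" using ini_Id[OF w(1), of M] w HG by simp
      then show ?thesis by (rule domH)
    qed
    then have "G \<in> \<G>" unfolding \<G>_def using gd G_def hat_hat by blast
    then show "H \<in> Id T ` \<G>" using HG by blast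
  qed
  have disj: "\<F>1 \<inter> \<F>2 = {}"
  proof -
    have "stat G a = Ord" if "G \<in> \<F>1" for G using that abne unfolding \<F>1_def FS_def by auto
    moreover have "stat G a = Coloop" if "G \<in> \<F>2" for G using that abne unfolding \<F>2_def FS_def by auto
    ultimately show ?thesis by fastforce
  qed
  have "(\<Sum>G\<in>\<G>. tt ^ dim (lin G)) = (\<Sum>G\<in>\<G>. tt ^ dim (lin (Id T G)))"
  proof (rule sum.cong[OF refl])
    fix G assume "G \<in> \<G>"
    then obtain v where v: "G = ini M v" and g: "good G" unfolding \<G>_def by blast
    have "\<And>x. \<not> is_loop G x" using g by (simp add: good_def)
    from Id_main[OF face(1)[of v, folded v] this face(2)[of v, folded v]]
    have "dim (lin (Id T G)) = dim (lin G)" by blast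
    then show "tt ^ dim (lin G) = tt ^ dim (lin (Id T G))" by simp
  qed
  also have "\<dots> = (\<Sum>H\<in>\<F>1 \<union> \<F>2. tt ^ dim (lin H))" by (rule sum.reindex_bij_betw[OF bij])
  also have "\<dots> = fenum ?K a b (?\<sigma>(a := Ord, b := Ord)) + fenum ?K a b (?\<sigma>(a := Coloop, b := Ord))"
    unfolding fenum_def \<F>1_def[symmetric] \<F>2_def[symmetric] using disj by (intro sum.union_disjoint) auto
  finally show ?thesis unfolding \<G>_def .
qed

text \<open>By \<open>local_balance_aux\<close>, used in both directions, the two sums are the two
  sides of the first identity in \<open>balanced\<close> for the glued family.\<close>

lemma local_balance:
  fixes M :: "('n::finite + 'n) set set" and i0 :: 'n
  assumes sp: "sp_family M" and nl: "\<And>x. \<not> is_loop M x" and ex: "exchangeable M"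
    and T: "T = - {i0}" and fl: "fills T (lin M)"
  shows "(\<Sum>G | good G \<and> (\<exists>v. hat T v = v \<and> ini M v = G) \<and>
      (\<forall>v. hat T v = v \<longrightarrow> ini M v = G \<longrightarrow> v $ Inr i0 \<le> v $ Inl i0). tt ^ dim (lin G))
    = (\<Sum>G | good G \<and> (\<exists>v. hat T v = v \<and> ini M v = G) \<and>
      (\<forall>v. hat T v = v \<longrightarrow> ini M v = G \<longrightarrow> v $ Inl i0 \<le> v $ Inr i0). tt ^ dim (lin G))"
proof -
  let ?\<sigma> = "\<lambda>z :: 'n + 'n. if z \<in> Inr ` T then Loop else Ord"
  let ?e = "Inl i0 :: 'n + 'n" and ?f = "Inr i0 :: 'n + 'n"
  have "sp_family (Id T M)" using Id_main[OF sp nl fl] by (rule conjunct1)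
  then have "balanced (Id T M) ?e ?f ?\<sigma>" by (rule sp_family_balanced) simp
  then have "fenum (Id T M) ?e ?f (?\<sigma>(?e := Ord, ?f := Ord)) + fenum (Id T M) ?e ?f (?\<sigma>(?e := Coloop, ?f := Ord)) =
       fenum (Id T M) ?f ?e (?\<sigma>(?e := Ord, ?f := Ord)) + fenum (Id T M) ?f ?e (?\<sigma>(?e := Ord, ?f := Coloop))"
    unfolding balanced_def by (rule conjunct1)
  moreover have "?\<sigma>(?f := x, ?e := y) = ?\<sigma>(?e := y, ?f := x)" for x y by (rule fun_upd_twist) simp
  moreover have "{?f, ?e} = {Inl i0, Inr i0}" by (rule insert_commute)
  ultimately show ?thesis
    using local_balance_aux[OF assms, of ?e ?f] local_balance_aux[OF assms, of ?f ?e] by simp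
qed

section \<open>Cancellation over a poset, and ends of intervals\<close>

text \<open>Every \<open>M\<close> is assigned the least \<open>\<mu> M\<close> in \<open>Z\<close>
  containing it, so \<open>M \<subseteq> M0\<close> depends on \<open>\<mu> M\<close> only. The
  hypothesis then compares sums over whole groups, and induction on the size of \<open>M0\<close>
  isolates the group of \<open>M0\<close> itself.\<close>

lemma mobius_cancel:
  fixes Z X Y :: "'a set set" and h :: "'a set \<Rightarrow> 'b::ab_group_add"
  assumes fin: "finite Z" "finite X" "finite Y" "\<And>M. M \<in> Z \<Longrightarrow> finite M"
    and least: "\<And>M. M \<in> X \<union> Y \<Longrightarrow> \<exists>M1\<in>Z. M \<subseteq> M1 \<and> (\<forall>M0\<in>Z. M \<subseteq> M0 \<longrightarrow> M1 \<subseteq> M0)"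
    and eq: "\<And>M0. M0 \<in> Z \<Longrightarrow> sum h {M\<in>X. M \<subseteq> M0} = sum h {M\<in>Y. M \<subseteq> M0}"
  shows "sum h X = sum h Y"
proof -
  obtain \<mu> where \<mu>: "\<And>M. M \<in> X \<union> Y \<Longrightarrow> \<mu> M \<in> Z \<and> M \<subseteq> \<mu> M \<and> (\<forall>M0\<in>Z. M \<subseteq> M0 \<longrightarrow> \<mu> M \<subseteq> M0)"
    using least by metis
  have sub: "M \<subseteq> M0 \<longleftrightarrow> \<mu> M \<subseteq> M0" if "M \<in> X \<union> Y" "M0 \<in> Z" for M M0
    using \<mu>[OF that(1)] that(2) by blast
  have grp: "sum h {M\<in>W. M \<subseteq> M0} = (\<Sum>M1\<in>{M1\<in>Z. M1 \<subseteq> M0}. sum h {M\<in>W. \<mu> M = M1})"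
    if W: "W = X \<or> W = Y" and M0: "M0 \<in> Z" for W M0
  proof -
    have WXY: "W \<subseteq> X \<union> Y" "finite W" using W fin by auto
    have "(\<Sum>M1\<in>{M1\<in>Z. M1 \<subseteq> M0}. sum h {M\<in>{M\<in>W. M \<subseteq> M0}. \<mu> M = M1}) = sum h {M\<in>W. M \<subseteq> M0}"
    proof (rule sum.group)
      show "\<mu> ` {M\<in>W. M \<subseteq> M0} \<subseteq> {M1\<in>Z. M1 \<subseteq> M0}"
      proof (rule image_subsetI)
        fix M assume M: "M \<in> {M\<in>W. M \<subseteq> M0}"
        then have MXY: "M \<in> X \<union> Y" using WXY by blast
        show "\<mu> M \<in> {M1\<in>Z. M1 \<subseteq> M0}" using \<mu>[OF MXY] M M0 by simp
      qed
    qed (use fin WXY in auto)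
    moreover have "{M\<in>{M\<in>W. M \<subseteq> M0}. \<mu> M = M1} = {M\<in>W. \<mu> M = M1}" if "M1 \<in> {M1\<in>Z. M1 \<subseteq> M0}" for M1
      using that WXY sub M0 by auto
    ultimately show ?thesis by simp
  qed
  have part: "sum h {M\<in>X. \<mu> M = M0} = sum h {M\<in>Y. \<mu> M = M0}" if "M0 \<in> Z" for M0
    using that
  proof (induction "card M0" arbitrary: M0 rule: less_induct)
    case less
    let ?S = "{M1\<in>Z. M1 \<subseteq> M0}"
    have S: "?S = insert M0 (?S - {M0})" "finite (?S - {M0})" using less.prems fin by auto
    have rest: "(\<Sum>M1\<in>?S - {M0}. sum h {M\<in>X. \<mu> M = M1}) = (\<Sum>M1\<in>?S - {M0}. sum h {M\<in>Y. \<mu> M = M1})"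
    proof (rule sum.cong[OF refl])
      fix M1 assume M1: "M1 \<in> ?S - {M0}"
      then have "card M1 < card M0" using fin(4)[OF less.prems] by (intro psubset_card_mono) auto
      then show "sum h {M\<in>X. \<mu> M = M1} = sum h {M\<in>Y. \<mu> M = M1}" using less.hyps M1 by blast
    qed
    have split: "(\<Sum>M1\<in>?S. g M1) = g M0 + (\<Sum>M1\<in>?S - {M0}. g M1)" for g :: "'a set \<Rightarrow> 'b"
      by (subst S(1), subst sum.insert) (use S(2) in auto)
    have "(\<Sum>M1\<in>?S. sum h {M\<in>X. \<mu> M = M1}) = (\<Sum>M1\<in>?S. sum h {M\<in>Y. \<mu> M = M1})"
      using eq[OF less.prems] grp[of X M0] grp[of Y M0] less.prems by simp
    then show ?case unfolding split rest by simp
  qed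
  have tot: "sum h W = (\<Sum>M1\<in>Z. sum h {M\<in>W. \<mu> M = M1})" if W: "W = X \<or> W = Y" for W
    using W fin \<mu> by (intro sum.group[symmetric]) auto
  show ?thesis using tot[of X] tot[of Y] part by simp
qed

text \<open>The left end is \<open>Inf I\<close>. It is in \<open>R\<close> because
  \<open>closure I \<subseteq> R\<close>, and it is not \<open>s1\<close> because \<open>I\<close>
  is open. It lies above \<open>s2\<close>, since a point of \<open>I\<close> on the other side
  would put \<open>s2\<close> on a segment inside \<open>I\<close>.\<close>

lemma lower_end:
  fixes I R :: "real set"
  assumes A: "\<And>s r c. s \<in> I \<Longrightarrow> r \<in> R \<Longrightarrow> 0 < c \<Longrightarrow> c < 1 \<Longrightarrow> r + c * (s - r) \<in> I"
    and IR: "I \<subseteq> R" and B: "open I" and D: "closure I \<subseteq> R" and s: "s1 \<in> I" "s2 \<notin> R" "s2 < s1"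
  shows "\<exists>z. s2 < z \<and> z < s1 \<and> z \<in> R \<and> (\<forall>s\<in>I. z \<le> s)"
proof -
  have lb: "s2 \<le> s" if sI: "s \<in> I" for s
  proof (rule ccontr)
    assume "\<not> s2 \<le> s"
    then have lt: "s < s2" by simp
    let ?c = "(s2 - s) / (s1 - s)"
    have "0 < ?c" "?c < 1" using lt s by (auto simp: field_simps)
    then have "s + ?c * (s1 - s) \<in> I" using A[OF s(1)] sI IR by blast
    moreover have "s + ?c * (s1 - s) = s2" using lt s by (simp add: field_simps)
    ultimately show False using s IR by auto
  qed
  define z where "z = Inf I"
  have bb: "bdd_below I" using lb by (auto simp: bdd_below_def)
  have zI: "z \<in> closure I" unfolding z_def using s bb by (intro closure_contains_Inf) auto
  have zR: "z \<in> R" using zI D by blast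
  have zle: "\<forall>s\<in>I. z \<le> s" unfolding z_def using bb by (auto intro: cInf_lower)
  have "s2 \<le> z" unfolding z_def using s lb by (intro cInf_greatest) auto
  moreover have "z \<noteq> s2" using zR s by blast
  moreover have "z \<noteq> s1"
  proof
    assume "z = s1"
    then obtain e where "e > 0" "ball s1 e \<subseteq> I" using B s openE by blast
    moreover have "s1 - e / 2 \<in> ball s1 e" using \<open>e > 0\<close> by (simp add: dist_real_def)
    ultimately have "z \<le> s1 - e / 2" using zle by blast
    then show False using \<open>z = s1\<close> \<open>e > 0\<close> by simp
  qed
  moreover have "z \<le> s1" using zle s by blast
  ultimately show ?thesis using zR zle by force
qed

lemma upper_end:
  fixes I R :: "real set"
  assumes A: "\<And>s r c. s \<in> I \<Longrightarrow> r \<in> R \<Longrightarrow> 0 < c \<Longrightarrow> c < 1 \<Longrightarrow> r + c * (s - r) \<in> I"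
    and IR: "I \<subseteq> R" and B: "open I" and D: "closure I \<subseteq> R" and s: "s1 \<in> I" "s2 \<notin> R" "s1 < s2"
  shows "\<exists>z. s1 < z \<and> z < s2 \<and> z \<in> R \<and> (\<forall>s\<in>I. s \<le> z)"
proof -
  have "\<exists>z. - s2 < z \<and> z < - s1 \<and> z \<in> uminus ` R \<and> (\<forall>s\<in>uminus ` I. z \<le> s)"
  proof (rule lower_end)
    show "r + c * (s - r) \<in> uminus ` I" if "s \<in> uminus ` I" "r \<in> uminus ` R" "0 < c" "c < 1" for s r c
    proof -
      have "- r + c * (- s - (- r)) \<in> I" using that by (intro A) auto
      then have "- (- r + c * (- s - (- r))) \<in> uminus ` I" by (rule imageI)
      then show ?thesis by (simp add: algebra_simps)
    qed
    show "open (uminus ` I)" using B by (rule open_negations)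
    show "closure (uminus ` I) \<subseteq> uminus ` R"
    proof -
      have "uminus ` closure I = closure (uminus ` I)"
        by (rule closure_injective_linear_image) (auto simp: linear_uminus)
      then show ?thesis using image_mono[OF D, of uminus] by simp
    qed
  qed (use IR s in auto)
  then obtain z where "- s2 < z" "z < - s1" "z \<in> uminus ` R" "\<forall>s\<in>uminus ` I. z \<le> s" by blast
  then show ?thesis by (intro exI[of _ "- z"]) auto
qed

section \<open>Cells over a moving translation vector\<close>

text \<open>A vector on the doubled ground set is a pair of points, and \<open>df\<close> is the
  translation separating them. The fibre of \<open>df\<close> over \<open>a\<close> is the affine
  space of all \<open>(w, w - a)\<close>.\<close>

definition df :: "real ^ ('n::finite + 'n) \<Rightarrow> real ^ 'n" where
  "df w = (\<chi> i. w $ Inl i - w $ Inr i)"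

lemma df_nth [simp]: "df w $ i = w $ Inl i - w $ Inr i"
  by (simp add: df_def)

lemma linear_df: "linear df"
  by (rule linearI) (auto simp: vec_eq_iff algebra_simps)

lemma df_simps: "df (v + w) = df v + df w" "df (v - w) = df v - df w" "df (c *\<^sub>R v) = c *\<^sub>R df v"
  by (auto simp: vec_eq_iff algebra_simps)

lemma hat_eq_iff: "hat T v = v \<longleftrightarrow> (\<forall>i\<in>T. df v $ i = 0)"
proof
  assume h: "hat T v = v"
  show "\<forall>i\<in>T. df v $ i = 0"
  proof
    fix i assume "i \<in> T" then show "df v $ i = 0" using arg_cong[OF h, of "\<lambda>x. x $ Inr i"] by simp
  qed
qed (auto intro!: sum_vec_eqI)

text \<open>The pair of tropical linear spaces enters only through its direct sum. The last
  assumption bounds good cells over bounded translations up to a common shift and provides the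
  compactness used for limits of cells.\<close>

locale wall =
  fixes \<B> :: "('n::finite + 'n) set set" and P :: "('n + 'n) set \<Rightarrow> real" and m :: nat
  assumes ne: "\<B> \<noteq> {}"
    and exch: "\<And>B C x. B \<in> \<B> \<Longrightarrow> C \<in> \<B> \<Longrightarrow> x \<in> B - C \<Longrightarrow>
      \<exists>y\<in>C - B. insert y (B - {x}) \<in> \<B> \<and> insert x (C - {y}) \<in> \<B> \<and>
        P (insert y (B - {x})) + P (insert x (C - {y})) \<le> P B + P C"
    and sp: "\<And>w. sp_family (opt \<B> P w)"
    and card_eq: "\<And>B. B \<in> \<B> \<Longrightarrow> card B = m"
    and bounded_cells: "\<And>r. \<exists>K. \<forall>w. good (opt \<B> P w) \<longrightarrow> (\<forall>i. \<bar>df w $ i\<bar> \<le> r) \<longrightarrow> (\<forall>i j. \<bar>w $ Inl i - w $ Inl j\<bar> \<le> K)"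
begin

abbreviation "OP \<equiv> opt \<B> P"

definition "cellat c M \<longleftrightarrow> (\<exists>w. df w = c \<and> OP w = M)"
text \<open>For a realized family \<open>M\<close> this says that the closure of its cell meets the
  fibre over \<open>c\<close>.\<close>

definition "near c M \<longleftrightarrow> (\<exists>w. df w = c \<and> M \<subseteq> OP w)"
definition "cnt c = (\<Sum>M | good M \<and> cellat c M. tt ^ dim (lin M))"
definition "transv c \<longleftrightarrow> (\<forall>w. df w = c \<longrightarrow> (\<forall>x. \<not> is_loop (OP w) x) \<longrightarrow> fills UNIV (lin (OP w)))"
text \<open>Unlike \<open>transv\<close>, this constrains only the coordinates in \<open>T\<close>
  and asks for freedom at points with loops too; \<open>gen UNIV c\<close> implies
  \<open>transv c\<close>.\<close>

definition "gen T c \<longleftrightarrow> (\<forall>w. (\<forall>i\<in>T. df w $ i = c $ i) \<longrightarrow> fills T (lin (OP w)))"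

lemma exchangeable_O: "exchangeable (OP w)"
  unfolding exchangeable_def
proof (intro ballI)
  fix B C x assume B: "B \<in> OP w" and C: "C \<in> OP w" and x: "x \<in> B - C"
  have BC: "B \<in> \<B>" "C \<in> \<B>" using B C opt_subset by blast+
  obtain y where y: "y \<in> C - B" "insert y (B - {x}) \<in> \<B>" "insert x (C - {y}) \<in> \<B>"
    "P (insert y (B - {x})) + P (insert x (C - {y})) \<le> P B + P C"
    using exch[OF BC x] by blast
  have w: "wt w (insert y (B - {x})) = wt w B - w $ x + w $ y" "wt w (insert x (C - {y})) = wt w C - w $ y + w $ x"
    using x y by (auto intro: wt_exchange)
  have 1: "P B - wt w B \<le> P D - wt w D" "P C - wt w C \<le> P D - wt w D" if "D \<in> \<B>" for D
    using B C that by (auto simp: opt_def)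
  have "P (insert y (B - {x})) - wt w (insert y (B - {x})) = P B - wt w B"
    "P (insert x (C - {y})) - wt w (insert x (C - {y})) = P C - wt w C"
    using 1[OF y(2)] 1[OF y(3)] y(4) w by linarith+
  then have "insert y (B - {x}) \<in> OP w" "insert x (C - {y}) \<in> OP w"
    using y(2,3) 1 by (auto simp: opt_def)
  then show "\<exists>y\<in>C - B. insert y (B - {x}) \<in> OP w \<and> insert x (C - {y}) \<in> OP w" using y(1) by blast
qed

text \<open>The direction from \<open>w1\<close> into the cell of \<open>M\<close> is corrected by a
  lineality vector at \<open>w1\<close> so that it stays in the fibre. The initial family does not
  notice the correction.\<close>

lemma near_cell:
  assumes w1: "df w1 = c" "M \<subseteq> OP w1" and M: "M = OP w2" and fl: "fills UNIV (lin (OP w1))"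
  shows "cellat c M"
proof -
  have r: "M = ini (OP w1) (w2 - w1)" unfolding M using w1(2) M by (intro opt_refine ne) simp
  obtain u where u: "u \<in> lin (OP w1)" "\<forall>i\<in>UNIV. u $ Inl i - u $ Inr i = - (df (w2 - w1) $ i)"
    using fl[unfolded fills_def, rule_format, of "\<lambda>i. - (df (w2 - w1) $ i)"] by blast
  have "df (w2 - w1 + u) = 0" unfolding vec_eq_iff
  proof
    fix i show "df (w2 - w1 + u) $ i = 0 $ i" using u(2)[rule_format, of i] by simp
  qed
  moreover obtain \<delta> where "\<delta> > 0" "OP (w1 + \<delta> *\<^sub>R (w2 - w1 + u)) = ini (OP w1) (w2 - w1 + u)"
    using opt_perturb_ray[OF ne] by blast
  moreover have "ini (OP w1) (w2 - w1 + u) = M" using ini_add_lin[OF u(1)] r by simp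
  ultimately show ?thesis unfolding cellat_def using w1(1)
    by (intro exI[of _ "w1 + \<delta> *\<^sub>R (w2 - w1 + u)"]) (simp add: df_simps)
qed

lemma O_shift: "OP (w + (\<chi> i. t)) = OP w"
proof -
  have "wt (\<chi> i. t) B = t * m" if "B \<in> \<B>" for B using card_eq[OF that] by (simp add: wt_def)
  then show ?thesis by (auto simp: opt_def)
qed

lemma closed_near: "closed {w. M \<subseteq> OP w}"
proof (cases "M \<subseteq> \<B>")
  case True
  have "{w. M \<subseteq> OP w} = (\<Inter>B\<in>M. \<Inter>C\<in>\<B>. {w. P B - wt w B \<le> P C - wt w C})"
    using True by (auto simp: opt_def)
  moreover have "closed {w. P B - wt w B \<le> P C - wt w C}" for B C
    unfolding wt_def by (intro closed_Collect_le continuous_intros)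
  ultimately show ?thesis by (auto intro!: closed_INT)
next
  case False
  then have "{w. M \<subseteq> OP w} = {}" using opt_subset by blast
  then show ?thesis by simp
qed

text \<open>Modulo a common shift the cell of a good family is bounded over bounded translations.
  The corresponding part of its closure thus has a compact image under \<open>df\<close>, which must
  contain limits of translations.\<close>

lemma closure_near:
  assumes M: "good M" and c: "c \<in> closure {df w | w. OP w = M \<and> (\<forall>i. \<bar>df w $ i\<bar> \<le> r)}"
  shows "near c M"
proof -
  obtain K where K: "\<And>w. good (OP w) \<Longrightarrow> (\<forall>i. \<bar>df w $ i\<bar> \<le> r) \<Longrightarrow> (\<forall>i j. \<bar>w $ Inl i - w $ Inl j\<bar> \<le> K)"
    using bounded_cells[of r] by blast
  let ?X = "cbox (\<chi> z. - (\<bar>K\<bar> + \<bar>r\<bar>)) (\<chi> z. \<bar>K\<bar> + \<bar>r\<bar>) \<inter> {w. M \<subseteq> OP w}"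
  have "compact ?X" by (intro compact_Int_closed compact_cbox closed_near)
  then have "compact (df ` ?X)"
    using linear_continuous_on[of df] linear_df linear_conv_bounded_linear by (blast intro: compact_continuous_image)
  then have "closed (df ` ?X)" by (rule compact_imp_closed)
  moreover have "{df w | w. OP w = M \<and> (\<forall>i. \<bar>df w $ i\<bar> \<le> r)} \<subseteq> df ` ?X"
  proof
    fix y assume "y \<in> {df w | w. OP w = M \<and> (\<forall>i. \<bar>df w $ i\<bar> \<le> r)}"
    then obtain w where w: "y = df w" "OP w = M" "\<forall>i. \<bar>df w $ i\<bar> \<le> r" by blast
    obtain j :: 'n where True by blast
    let ?w = "w + (\<chi> i. - (w $ Inl j))"
    have b: "\<bar>?w $ Inl i\<bar> \<le> \<bar>K\<bar>" for i 
    proof -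
      have "\<bar>w $ Inl i - w $ Inl j\<bar> \<le> K" using K[of w] w M by blast
      then show ?thesis by simp
    qed
    have "\<bar>?w $ z\<bar> \<le> \<bar>K\<bar> + \<bar>r\<bar>" for z
    proof (cases z)
      case (Inl i) then show ?thesis using b[of i] by simp
    next
      case (Inr i)
      have "\<bar>w $ Inl i - w $ Inr i\<bar> \<le> r" using w(3) by simp
      then show ?thesis using b[of i] Inr by simp
    qed
    then have "?w \<in> ?X" using w O_shift[of w "- (w $ Inl j)"] by (auto simp: mem_box_cart abs_le_iff) (smt (verit))+
    moreover have "df ?w = y" using w by (auto simp: vec_eq_iff)
    ultimately show "y \<in> df ` ?X" by blast
  qed
  ultimately have "c \<in> df ` ?X" using c closure_minimal by blast
  then show ?thesis unfolding near_def by blast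
qed

text \<open>Lineality vectors \<open>v i\<close> with \<open>df (v i)\<close> the
  \<open>i\<close>-th unit vector allow the point to follow any small change of the translation
  without leaving its cell.\<close>

lemma cell_open:
  assumes w: "df w = c" "OP w = M" and fl: "fills UNIV (lin M)"
  shows "\<exists>\<epsilon>>0. \<forall>c'. dist c' c < \<epsilon> \<longrightarrow> cellat c' M"
proof -
  obtain \<epsilon> where e: "\<epsilon> > 0" "\<And>v. norm v < \<epsilon> \<Longrightarrow> OP (w + v) = ini (OP w) v" using opt_perturb[OF ne] by metis
  have "\<exists>v. \<forall>i. v i \<in> lin M \<and> (\<forall>j. df (v i) $ j = (if j = i then 1 else 0))"
  proof (rule choice, rule allI)
    fix i show "\<exists>u. u \<in> lin M \<and> (\<forall>j. df u $ j = (if j = i then 1 else 0))"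
    proof -
      obtain u where "u \<in> lin M" "\<forall>j\<in>UNIV. u $ Inl j - u $ Inr j = (if j = i then 1 else 0)"
        using fl[unfolded fills_def, rule_format, of "\<lambda>j. if j = i then 1 else 0"] by blast
      then show ?thesis by (intro exI[of _ u] conjI allI) (simp_all only: df_nth UNIV_I ball_UNIV)
    qed
  qed
  then obtain v where v: "\<And>i. v i \<in> lin M" "\<And>i j. df (v i) $ j = (if j = i then 1 else 0)" by blast
  define K where "K = (\<Sum>i\<in>UNIV. norm (v i)) + 1"
  have K: "K > 0" unfolding K_def by (intro add_nonneg_pos sum_nonneg) auto
  have "cellat c' M" if c': "dist c' c < \<epsilon> / K" for c'
  proof -
    define u where "u = (\<Sum>i\<in>UNIV. (c' - c) $ i *\<^sub>R v i)"
    have uM: "u \<in> lin M" unfolding u_def using v(1) by (intro subspace_sum subspace_scale subspace_lin)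
    have "norm u \<le> (\<Sum>i\<in>UNIV. norm (c' - c) * norm (v i))"
      unfolding u_def by (rule order_trans[OF norm_sum]) (use component_le_norm_cart[of "c' - c"] in \<open>auto intro!: sum_mono mult_right_mono\<close>)
    also have "\<dots> \<le> dist c' c * K" unfolding K_def sum_distrib_left[symmetric] dist_norm by (intro mult_left_mono) auto
    also have "\<dots> < \<epsilon>" using c' K by (simp add: pos_less_divide_eq)
    finally have "OP (w + u) = M" using e(2)[of u] ini_lin[of u M] uM w by simp
    moreover have "df u = c' - c"
    proof -
      have "df u = (\<Sum>i\<in>UNIV. (c' - c) $ i *\<^sub>R df (v i))" unfolding u_def
        by (simp add: linear_sum[OF linear_df] df_simps)
      also have "\<dots> = c' - c" unfolding vec_eq_iff
        by (simp add: v(2) if_distrib del: df_nth cong: if_cong)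
      finally show ?thesis .
    qed
    ultimately show ?thesis unfolding cellat_def using w by (intro exI[of _ "w + u"]) (simp add: df_simps)
  qed
  then show ?thesis using e(1) K by (intro exI[of _ "\<epsilon> / K"]) auto
qed

lemma near_limit:
  assumes M: "good M" and near: "\<And>\<epsilon>. \<epsilon> > 0 \<Longrightarrow> \<exists>c'. dist c' c < \<epsilon> \<and> cellat c' M"
  shows "near c M"
proof -
  define r where "r = norm c + 1"
  have "c \<in> closure {df w | w. OP w = M \<and> (\<forall>i. \<bar>df w $ i\<bar> \<le> r)}"
    unfolding closure_approachable
  proof (intro allI impI)
    fix \<epsilon> :: real assume "\<epsilon> > 0"
    then obtain c' where c': "dist c' c < min \<epsilon> 1" "cellat c' M" using near[of "min \<epsilon> 1"] by auto
    then obtain w where w: "df w = c'" "OP w = M" unfolding cellat_def by blast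
    have "\<bar>df w $ i\<bar> \<le> r" for i
    proof -
      have "\<bar>df w $ i\<bar> \<le> norm c'" unfolding w by (rule component_le_norm_cart)
      also have "norm c' \<le> norm c + dist c' c" unfolding dist_norm by norm
      finally show ?thesis using c' by (simp add: r_def)
    qed
    then have "df w \<in> {df w | w. OP w = M \<and> (\<forall>i. \<bar>df w $ i\<bar> \<le> r)}" using w by blast
    then show "\<exists>y\<in>{df w | w. OP w = M \<and> (\<forall>i. \<bar>df w $ i\<bar> \<le> r)}. dist y c < \<epsilon>"
        by (rule bexI[rotated]) (use c'(1) w in simp)
  qed
  from closure_near[OF M this] show ?thesis .
qed

text \<open>Good cells present at \<open>c\<close> persist by \<open>cell_open\<close>. One absent
  at \<open>c\<close> cannot occur arbitrarily close by, since its limit would be near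
  \<open>c\<close>, and transversality would turn this into presence by
  \<open>near_cell\<close>.\<close>

lemma cnt_perturb:
  assumes tr: "transv c"
  shows "\<exists>\<epsilon>>0. \<forall>c'. dist c' c < \<epsilon> \<longrightarrow> cnt c' = cnt c"
proof -
  have "\<exists>\<epsilon>>0. \<forall>c'. dist c' c < \<epsilon> \<longrightarrow> (good M \<and> cellat c' M \<longleftrightarrow> good M \<and> cellat c M)" for M
  proof (cases "good M")
    case False then show ?thesis by (intro exI[of _ 1]) auto
  next
    case M: True
    show ?thesis
    proof (cases "cellat c M")
      case True
      then obtain w where w: "df w = c" "OP w = M" unfolding cellat_def by blast
      have "fills UNIV (lin M)" using tr w M unfolding transv_def good_def by blast
      from cell_open[OF w this] show ?thesis using True by blast
    next
      case False
      show ?thesis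
      proof (rule ccontr)
        assume no: "\<not> ?thesis"
        have near: "\<And>\<epsilon>. \<epsilon> > 0 \<Longrightarrow> \<exists>c'. dist c' c < \<epsilon> \<and> cellat c' M" using no False by blast
        from near_limit[OF M near] obtain w1 where w1: "df w1 = c" "M \<subseteq> OP w1" unfolding near_def by blast
        have "\<And>x. \<not> is_loop (OP w1) x" using M is_loop_mono[OF _ w1(2)] unfolding good_def by blast
        then have "fills UNIV (lin (OP w1))" using tr w1 unfolding transv_def by blast
        moreover obtain w2 where "M = OP w2" using near[of 1] unfolding cellat_def by auto
        ultimately show False using near_cell[OF w1] False by blast
      qed
    qed
  qed
  then obtain \<epsilon> where e: "\<And>M. \<epsilon> M > 0" "\<And>M c'. dist c' c < \<epsilon> M \<Longrightarrow> good M \<and> cellat c' M \<longleftrightarrow> good M \<and> cellat c M" by metis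
  define e0 where "e0 = Min (range \<epsilon>)"
  have "e0 \<in> range \<epsilon>" unfolding e0_def by (intro Min_in) auto
  then have "e0 > 0" using e(1) by auto
  moreover have "cnt c' = cnt c" if "dist c' c < e0" for c'
  proof -
    have "dist c' c < \<epsilon> M" for M using that Min_le[of "range \<epsilon>" "\<epsilon> M"] by (auto simp: e0_def)
    then show ?thesis unfolding cnt_def using e(2) by simp
  qed
  ultimately show ?thesis by blast
qed

section \<open>Births and deaths of cells along a coordinate line\<close>

definition "cs c i0 s = (\<chi> i. if i = i0 then s else c $ i)"
text \<open>With the other coordinates of \<open>df\<close> fixed, a rigid cell is present for at
  most one value of the moving coordinate.\<close>

definition "rigid i0 M \<longleftrightarrow> (\<forall>v\<in>lin M. (\<forall>i. i \<noteq> i0 \<longrightarrow> df v $ i = 0) \<longrightarrow> df v $ i0 = 0)"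
definition "stays c i0 s M \<longleftrightarrow> cellat (cs c i0 s) M"
definition "limits c i0 s M \<longleftrightarrow> near (cs c i0 s) M"
text \<open>A cell that is not rigid is present on an open interval of parameters; \<open>z\<close>
  is its left end, and for \<open>dies\<close> its right end.\<close>

definition "born c i0 z = {M. good M \<and> \<not> rigid i0 M \<and> limits c i0 z M \<and> (\<exists>s. stays c i0 s M) \<and> (\<forall>s. stays c i0 s M \<longrightarrow> z \<le> s)}"
definition "dies c i0 z = {M. good M \<and> \<not> rigid i0 M \<and> limits c i0 z M \<and> (\<exists>s. stays c i0 s M) \<and> (\<forall>s. stays c i0 s M \<longrightarrow> s \<le> z)}"

lemma cs_nth [simp]: "cs c i0 s $ i = (if i = i0 then s else c $ i)"
  by (simp add: cs_def)

lemma stays_limits: "stays c i0 s M \<Longrightarrow> limits c i0 s M"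
  unfolding stays_def limits_def cellat_def near_def by blast

lemma stays_segment:
  assumes s: "stays c i0 s M" and r: "limits c i0 r M" and l: "0 < l" "l < 1"
  shows "stays c i0 (r + l * (s - r)) M"
proof -
  obtain w where w: "df w = cs c i0 s" "OP w = M" using s unfolding stays_def cellat_def by blast
  obtain w' where w': "df w' = cs c i0 r" "M \<subseteq> OP w'" using r unfolding limits_def near_def by blast
  have "M \<noteq> {}" using w opt_nonempty[OF ne] by blast
  then have ne2: "OP w' \<inter> OP w \<noteq> {}" using w w' by blast
  have "OP (w' + l *\<^sub>R (w - w')) = M" unfolding opt_segment[OF ne2 l] w(2) using w'(2) by (rule Int_absorb1)
  moreover have "df (w' + l *\<^sub>R (w - w')) = cs c i0 (r + l * (s - r))"
    unfolding df_simps w w' by (simp add: vec_eq_iff)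
  ultimately show ?thesis unfolding stays_def cellat_def by blast
qed

lemma stays_open:
  assumes "\<not> rigid i0 M"
  shows "open {s. stays c i0 s M}"
  unfolding open_contains_ball
proof
  fix s assume "s \<in> {s. stays c i0 s M}"
  then obtain w where w: "df w = cs c i0 s" "OP w = M" unfolding stays_def cellat_def by blast
  obtain v where v: "v \<in> lin M" "\<And>i. i \<noteq> i0 \<Longrightarrow> df v $ i = 0" "df v $ i0 \<noteq> 0" using assms unfolding rigid_def by blast
  obtain \<epsilon> where e: "\<epsilon> > 0" "\<And>v. norm v < \<epsilon> \<Longrightarrow> OP (w + v) = ini (OP w) v" using opt_perturb[OF ne] by metis
  define t where "t = df v $ i0"
  have t: "t \<noteq> 0" using v(3) t_def by simp
  have v0: "v \<noteq> 0" using v(3) by auto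
  have "stays c i0 s' M" if d: "dist s s' < \<epsilon> * \<bar>t\<bar> / norm v" for s'
  proof -
    let ?u = "((s' - s) / t) *\<^sub>R v"
    have "norm ?u < \<epsilon>" using d t v0 by (simp add: dist_real_def field_simps abs_minus_commute)
    moreover have "?u \<in> lin M" using v(1) by (intro subspace_scale subspace_lin)
    ultimately have "OP (w + ?u) = M" using e(2)[of ?u] ini_lin[of ?u M] w by simp
    moreover have "df (w + ?u) = cs c i0 s'"
    proof -
      have "df v $ i = (if i = i0 then t else 0)" for i using v(2) t_def by simp
      then show ?thesis unfolding df_simps w using t by (simp add: vec_eq_iff del: df_nth)
    qed
    ultimately show ?thesis unfolding stays_def cellat_def by blast
  qed
  then show "\<exists>e>0. ball s e \<subseteq> {s. stays c i0 s M}"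
    using e(1) t v0 by (intro exI[of _ "\<epsilon> * \<bar>t\<bar> / norm v"]) auto
qed

lemma stays_closure:
  assumes M: "good M"
  shows "closure {s. stays c i0 s M} \<subseteq> {s. limits c i0 s M}"
proof
  fix z assume z: "z \<in> closure {s. stays c i0 s M}"
  have "near (cs c i0 z) M"
  proof (rule near_limit[OF M])
    fix \<epsilon> :: real assume "\<epsilon> > 0"
    then obtain s where s: "stays c i0 s M" "dist s z < \<epsilon>" using z unfolding closure_approachable by blast
    have "cs c i0 s - cs c i0 z = (s - z) *\<^sub>R axis i0 1" by (simp add: vec_eq_iff axis_def)
    then have "dist (cs c i0 s) (cs c i0 z) < \<epsilon>" using s(2) by (simp add: dist_norm dist_real_def)
    then show "\<exists>c'. dist c' (cs c i0 z) < \<epsilon> \<and> cellat c' M" using s(1) unfolding stays_def by blast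
  qed
  then show "z \<in> {s. limits c i0 s M}" unfolding limits_def by simp
qed

lemma gen_limits_stays:
  assumes g: "gen UNIV (cs c i0 s)" and l: "limits c i0 s M" and M: "stays c i0 s1 M"
  shows "stays c i0 s M"
proof -
  obtain w2 where w2: "M = OP w2" using M unfolding stays_def cellat_def by blast
  obtain w1 where w1: "df w1 = cs c i0 s" "M \<subseteq> OP w1" using l unfolding limits_def near_def by blast
  have "fills UNIV (lin (OP w1))" using g[unfolded gen_def, rule_format, of w1] w1(1) by simp
  then show ?thesis unfolding stays_def using near_cell[OF w1 w2] by blast
qed

lemma gen_stays_not_rigid:
  assumes g: "gen UNIV (cs c i0 s)" and M: "stays c i0 s M"
  shows "\<not> rigid i0 M"
proof
  assume r: "rigid i0 M"
  obtain w where w: "df w = cs c i0 s" "OP w = M" using M unfolding stays_def cellat_def by blast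
  have fl: "fills UNIV (lin M)" using g[unfolded gen_def, rule_format, of w] w by simp
  obtain v where v: "v \<in> lin M" "\<forall>j\<in>UNIV. v $ Inl j - v $ Inr j = (if j = i0 then 1 else 0)"
    using fl[unfolded fills_def, rule_format, of "\<lambda>j. if j = i0 then 1 else 0"] by blast
  have d: "df v $ i = (if i = i0 then 1 else 0)" for i using v(2) by simp
  have "df v $ i0 = 0" using r[unfolded rigid_def, rule_format, OF v(1)] by (simp add: d del: df_nth)
  then show False by (simp add: d del: df_nth)
qed

lemma between_in:
  fixes I R :: "real set"
  assumes A: "\<And>s r c. s \<in> I \<Longrightarrow> r \<in> R \<Longrightarrow> 0 < c \<Longrightarrow> c < 1 \<Longrightarrow> r + c * (s - r) \<in> I"
    and "s \<in> I" "r \<in> R" "r < x \<and> x < s \<or> s < x \<and> x < r"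
  shows "x \<in> I"
proof -
  have "0 < (x - r) / (s - r)" "(x - r) / (s - r) < 1" using assms(4)
    by (auto simp: divide_simps)
  from A[OF assms(2,3) this] show ?thesis using assms(4) by (auto simp: divide_simps split: if_splits)
qed

lemma stays_between:
  assumes "stays c i0 s M" "limits c i0 r M" "r < x \<and> x < s \<or> s < x \<and> x < r"
  shows "stays c i0 x M"
  using between_in[of "{s. stays c i0 s M}" "{s. limits c i0 s M}" s r x] stays_segment assms by blast

lemma born_unique:
  assumes "M \<in> born c i0 z" "M \<in> born c i0 z'" shows "z = z'"
proof -
  have False if b: "M \<in> born c i0 z" "M \<in> born c i0 z'" "z < z'" for z z'
  proof -
    obtain s where s: "stays c i0 s M" "z' \<le> s" using b(2) unfolding born_def by blast
    have "stays c i0 ((z + z') / 2) M" using b s by (intro stays_between[OF s(1), of z]) (auto simp: born_def)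
    then have "z' \<le> (z + z') / 2" using b(2) unfolding born_def by blast
    then show False using b(3) by simp
  qed
  then show ?thesis using assms by (meson linorder_neqE_linordered_idom)
qed

lemma dies_unique:
  assumes "M \<in> dies c i0 z" "M \<in> dies c i0 z'" shows "z = z'"
proof -
  have False if b: "M \<in> dies c i0 z" "M \<in> dies c i0 z'" "z < z'" for z z'
  proof -
    obtain s where s: "stays c i0 s M" "s \<le> z" using b(1) unfolding dies_def by blast
    have "stays c i0 ((z + z') / 2) M" using b s by (intro stays_between[OF s(1), of z']) (auto simp: dies_def)
    then have "(z + z') / 2 \<le> z" using b(1) unfolding dies_def by blast
    then show False using b(3) by simp
  qed
  then show ?thesis using assms by (meson linorder_neqE_linordered_idom)
qed

text \<open>The midpoint of two such points has the intersection of their families as its optimal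
  family, so a family of smallest size is contained in all others.\<close>

lemma least_cell:
  assumes "near c M" "M \<noteq> {}"
  shows "\<exists>w1. df w1 = c \<and> M \<subseteq> OP w1 \<and> (\<forall>w. df w = c \<longrightarrow> M \<subseteq> OP w \<longrightarrow> OP w1 \<subseteq> OP w)"
proof -
  let ?P = "\<lambda>w. df w = c \<and> M \<subseteq> OP w"
  obtain w0 where "?P w0" using assms(1) unfolding near_def by blast
  then obtain w1 where w1: "?P w1" "\<And>w. ?P w \<Longrightarrow> card (OP w1) \<le> card (OP w)"
    using ex_has_least_nat[of ?P w0 "\<lambda>w. card (OP w)"] by blast
  have "OP w1 \<subseteq> OP w" if w: "df w = c" "M \<subseteq> OP w" for w
  proof -
    have n: "OP w \<inter> OP w1 \<noteq> {}" using w w1 assms(2) by blast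
    let ?w = "w + (1/2) *\<^sub>R (w1 - w)"
    have o: "OP ?w = OP w \<inter> OP w1" by (rule opt_segment[OF n]) auto
    have "df ?w = c" unfolding df_simps using w w1 by simp
    then have "?P ?w" unfolding o using w w1 by blast
    then have "card (OP w1) \<le> card (OP w \<inter> OP w1)" using w1(2)[of ?w] unfolding o by blast
    then have "OP w \<inter> OP w1 = OP w1" by (intro card_seteq) auto
    then show ?thesis by blast
  qed
  then show ?thesis using w1(1) by blast
qed

text \<open>Cells over the line that reach \<open>w0\<close> are the initial families of
  \<open>OP w0\<close> in directions diagonal off \<open>i0\<close>, and the sign of
  \<open>df v $ i0\<close> tells on which side of the wall they lie. In \<open>local_balance\<close>
  the rigid cells occur on both sides, and what remains are births and deaths.\<close>

lemma local_jump:
  assumes g: "gen (- {i0}) c" and w0: "df w0 = cs c i0 z" and nl: "\<And>x. \<not> is_loop (OP w0) x"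
  shows "(\<Sum>M | M \<in> born c i0 z \<and> M \<subseteq> OP w0. tt ^ dim (lin M)) = (\<Sum>M | M \<in> dies c i0 z \<and> M \<subseteq> OP w0. tt ^ dim (lin M))"
proof -
  let ?T = "- {i0}" and ?M = "OP w0"
  have "df w0 $ i = c $ i" if "i \<in> ?T" for i using w0 that by simp
  then have fl: "fills ?T (lin ?M)" using g unfolding gen_def by blast
  define E1 where "E1 = {G. good G \<and> (\<exists>v. hat ?T v = v \<and> ini ?M v = G) \<and> (\<forall>v. hat ?T v = v \<longrightarrow> ini ?M v = G \<longrightarrow> v $ Inr i0 \<le> v $ Inl i0)}"
  define E2 where "E2 = {G. good G \<and> (\<exists>v. hat ?T v = v \<and> ini ?M v = G) \<and> (\<forall>v. hat ?T v = v \<longrightarrow> ini ?M v = G \<longrightarrow> v $ Inl i0 \<le> v $ Inr i0)}"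
  have bal: "(\<Sum>G\<in>E1. tt ^ dim (lin G)) = (\<Sum>G\<in>E2. tt ^ dim (lin G))"
    unfolding E1_def E2_def by (rule local_balance[OF sp nl exchangeable_O refl fl])
  have hat: "hat ?T v = v \<longleftrightarrow> (\<forall>i. i \<noteq> i0 \<longrightarrow> df v $ i = 0)" for v unfolding hat_eq_iff by auto
  have fwd: "\<exists>\<delta>>0. stays c i0 (z + \<delta> * (df v $ i0)) G" if v: "hat ?T v = v" "ini ?M v = G" for v G
  proof -
    obtain \<delta> where d: "\<delta> > 0" "OP (w0 + \<delta> *\<^sub>R v) = ini ?M v" using opt_perturb_ray[OF ne] by blast
    have "df (w0 + \<delta> *\<^sub>R v) = cs c i0 (z + \<delta> * (df v $ i0))"
      unfolding df_simps w0 using v(1)[unfolded hat] by (simp add: vec_eq_iff del: df_nth)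
    then show ?thesis unfolding stays_def cellat_def using d v(2) by blast
  qed
  have bwd: "\<exists>v. hat ?T v = v \<and> ini ?M v = G \<and> df v $ i0 = s - z" if s: "stays c i0 s G" "G \<subseteq> ?M" for s G
  proof -
    obtain w where w: "df w = cs c i0 s" "OP w = G" using s unfolding stays_def cellat_def by blast
    have d: "df (w - w0) = cs c i0 s - cs c i0 z" unfolding df_simps w w0 ..
    have "OP w = ini ?M (w - w0)" using s(2) w by (intro opt_refine ne) simp
    moreover have "hat ?T (w - w0) = w - w0" unfolding hat d by simp
    moreover have "df (w - w0) $ i0 = s - z" unfolding d by simp
    ultimately show ?thesis using w by blast
  qed
  \<comment> \<open>\<open>v\<close> and its double have the same initial family \<open>G\<close>,
    so their difference \<open>v\<close> is a lineality vector of \<open>G\<close>, to which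
    rigidity applies.\<close>
  have rg: "df v $ i0 = 0" if v: "hat ?T v = v" "ini ?M v = G" and r: "rigid i0 G" for v G
  proof -
    have "ini ?M (2 *\<^sub>R v) = ini ?M v" by (rule ini_scaleR) simp
    then have "2 *\<^sub>R v - v \<in> lin (ini ?M v)" unfolding ini_eq_opt by (rule opt_same_diff_lin)
    then have "v \<in> lin G" using v by (simp add: scaleR_2)
    then show ?thesis using r v(1)[unfolded hat] unfolding rigid_def by blast
  qed
  have I: "E1 \<inter> {G. rigid i0 G} = E2 \<inter> {G. rigid i0 G}"
  proof (rule set_eqI)
    fix G
    have "rigid i0 G \<Longrightarrow> G \<in> E1 \<longleftrightarrow> G \<in> E2" unfolding E1_def E2_def mem_Collect_eq
      using rg[of _ G] by (auto simp: eq_iff)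
    then show "G \<in> E1 \<inter> {G. rigid i0 G} \<longleftrightarrow> G \<in> E2 \<inter> {G. rigid i0 G}" by blast
  qed
  have lim: "limits c i0 z G" if "G \<subseteq> ?M" for G unfolding limits_def near_def using w0 that by blast
  have common: "(\<exists>v. hat ?T v = v \<and> ini ?M v = G) \<longleftrightarrow> G \<subseteq> ?M \<and> limits c i0 z G \<and> (\<exists>s. stays c i0 s G)" for G
    using fwd[of _ G] bwd[of _ G] lim[of G] ini_subset[of ?M] by blast
  have sg1: "(\<forall>v. hat ?T v = v \<longrightarrow> ini ?M v = G \<longrightarrow> v $ Inr i0 \<le> v $ Inl i0) \<longleftrightarrow> (\<forall>s. stays c i0 s G \<longrightarrow> z \<le> s)"
    (is "?L \<longleftrightarrow> ?R") if G: "G \<subseteq> ?M" for G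
  proof
    assume L: ?L
    show ?R
    proof (intro allI impI)
      fix s assume "stays c i0 s G"
      from bwd[OF this G] obtain v where "hat ?T v = v" "ini ?M v = G" "df v $ i0 = s - z" by blast
      then show "z \<le> s" using L[rule_format, of v] by simp
    qed
  next
    assume R: ?R
    show ?L
    proof (intro allI impI)
      fix v assume "hat ?T v = v" "ini ?M v = G"
      from fwd[OF this] obtain \<delta> where d: "\<delta> > 0" "stays c i0 (z + \<delta> * (df v $ i0)) G" by blast
      then have "0 \<le> \<delta> * (df v $ i0)" using R[rule_format, OF d(2)] by simp
      then show "v $ Inr i0 \<le> v $ Inl i0" using d(1) by (simp add: zero_le_mult_iff)
    qed
  qed
  have sg2: "(\<forall>v. hat ?T v = v \<longrightarrow> ini ?M v = G \<longrightarrow> v $ Inl i0 \<le> v $ Inr i0) \<longleftrightarrow> (\<forall>s. stays c i0 s G \<longrightarrow> s \<le> z)"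
    (is "?L \<longleftrightarrow> ?R") if G: "G \<subseteq> ?M" for G
  proof
    assume L: ?L
    show ?R
    proof (intro allI impI)
      fix s assume "stays c i0 s G"
      from bwd[OF this G] obtain v where "hat ?T v = v" "ini ?M v = G" "df v $ i0 = s - z" by blast
      then show "s \<le> z" using L[rule_format, of v] by simp
    qed
  next
    assume R: ?R
    show ?L
    proof (intro allI impI)
      fix v assume "hat ?T v = v" "ini ?M v = G"
      from fwd[OF this] obtain \<delta> where d: "\<delta> > 0" "stays c i0 (z + \<delta> * (df v $ i0)) G" by blast
      then have "\<delta> * (df v $ i0) \<le> 0" using R[rule_format, OF d(2)] by simp
      then show "v $ Inl i0 \<le> v $ Inr i0" using d(1) by (simp add: mult_le_0_iff)
    qed
  qed
  have D1: "E1 - {G. rigid i0 G} = {M. M \<in> born c i0 z \<and> M \<subseteq> ?M}"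
  proof (rule set_eqI)
    fix G
    show "G \<in> E1 - {G. rigid i0 G} \<longleftrightarrow> G \<in> {M. M \<in> born c i0 z \<and> M \<subseteq> ?M}"
    proof (cases "G \<subseteq> ?M")
      case True
      show ?thesis unfolding E1_def born_def mem_Collect_eq Diff_iff common sg1[OF True] using True by argo
    next
      case False
      then show ?thesis unfolding E1_def mem_Collect_eq Diff_iff common by argo
    qed
  qed
  have D2: "E2 - {G. rigid i0 G} = {M. M \<in> dies c i0 z \<and> M \<subseteq> ?M}"
  proof (rule set_eqI)
    fix G
    show "G \<in> E2 - {G. rigid i0 G} \<longleftrightarrow> G \<in> {M. M \<in> dies c i0 z \<and> M \<subseteq> ?M}"
    proof (cases "G \<subseteq> ?M")
      case True
      show ?thesis unfolding E2_def dies_def mem_Collect_eq Diff_iff common sg2[OF True] using True by argo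
    next
      case False
      then show ?thesis unfolding E2_def mem_Collect_eq Diff_iff common by argo
    qed
  qed
  have "(\<Sum>G\<in>E1 \<inter> {G. rigid i0 G}. tt ^ dim (lin G)) + (\<Sum>G\<in>E1 - {G. rigid i0 G}. tt ^ dim (lin G)) =
    (\<Sum>G\<in>E2 \<inter> {G. rigid i0 G}. tt ^ dim (lin G)) + (\<Sum>G\<in>E2 - {G. rigid i0 G}. tt ^ dim (lin G))"
    using bal sum.Int_Diff[of E1 "\<lambda>G. tt ^ dim (lin G)" "{G. rigid i0 G}"] sum.Int_Diff[of E2 "\<lambda>G. tt ^ dim (lin G)" "{G. rigid i0 G}"]
    by simp
  then show ?thesis unfolding I D1 D2 by simp
qed

text \<open>A cell may reach the wall at several points, so the identities of
  \<open>local_jump\<close> overlap. \<open>mobius_cancel\<close> separates them, with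
  \<open>least_cell\<close> giving the least family over the wall that contains a given
  cell.\<close>

lemma jump:
  assumes g: "gen (- {i0}) c"
  shows "(\<Sum>M\<in>born c i0 z. tt ^ dim (lin M)) = (\<Sum>M\<in>dies c i0 z. tt ^ dim (lin M))"
proof (rule mobius_cancel[where Z = "{OP w | w. df w = cs c i0 z \<and> (\<forall>x. \<not> is_loop (OP w) x)}"])
  fix M assume "M \<in> born c i0 z \<union> dies c i0 z"
  then have M: "good M" "near (cs c i0 z) M" "\<exists>s. stays c i0 s M" unfolding born_def dies_def limits_def by blast+
  have "M \<noteq> {}" using M(3) opt_nonempty[OF ne] unfolding stays_def cellat_def by blast
  from least_cell[OF M(2) this] obtain w1 where w1: "df w1 = cs c i0 z" "M \<subseteq> OP w1"
    "\<And>w. df w = cs c i0 z \<Longrightarrow> M \<subseteq> OP w \<Longrightarrow> OP w1 \<subseteq> OP w" by blast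
  have nl1: "\<not> is_loop (OP w1) x" for x using M(1) is_loop_mono[OF _ w1(2), of x] unfolding good_def by blast
  show "\<exists>M1\<in>{OP w | w. df w = cs c i0 z \<and> (\<forall>x. \<not> is_loop (OP w) x)}. M \<subseteq> M1 \<and>
      (\<forall>M0\<in>{OP w | w. df w = cs c i0 z \<and> (\<forall>x. \<not> is_loop (OP w) x)}. M \<subseteq> M0 \<longrightarrow> M1 \<subseteq> M0)"
  proof (rule bexI[of _ "OP w1"], intro conjI ballI impI)
    show "M \<subseteq> OP w1" by (rule w1(2))
    fix M0 assume M0: "M0 \<in> {OP w | w. df w = cs c i0 z \<and> (\<forall>x. \<not> is_loop (OP w) x)}" "M \<subseteq> M0"
    from M0(1) obtain w where "df w = cs c i0 z" "M0 = OP w" by blast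
    with M0(2) show "OP w1 \<subseteq> M0" using w1(3)[of w] by simp
  next
    show "OP w1 \<in> {OP w | w. df w = cs c i0 z \<and> (\<forall>x. \<not> is_loop (OP w) x)}" using w1(1) nl1 by blast
  qed
next
  fix M0 assume "M0 \<in> {OP w | w. df w = cs c i0 z \<and> (\<forall>x. \<not> is_loop (OP w) x)}"
  then obtain w0 where w0: "df w0 = cs c i0 z" "\<And>x. \<not> is_loop (OP w0) x" "M0 = OP w0" by blast
  show "(\<Sum>M | M \<in> born c i0 z \<and> M \<subseteq> M0. tt ^ dim (lin M)) = (\<Sum>M | M \<in> dies c i0 z \<and> M \<subseteq> M0. tt ^ dim (lin M))"
    unfolding w0(3) by (rule local_jump[OF g w0(1,2)])
qed auto

text \<open>The difference of the two counts is the number of births minus the number of deaths in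
  between, weighted by dimension, and these agree at every single parameter by
  \<open>jump\<close>.\<close>

lemma step_less:
  assumes g: "gen (- {i0}) c" and g1: "gen UNIV (cs c i0 s)" and g2: "gen UNIV (cs c i0 s')" and ss: "s < s'"
  shows "cnt (cs c i0 s) = cnt (cs c i0 s')"
proof -
  let ?h = "\<lambda>M. tt ^ dim (lin M)"
  define \<M> where "\<M> = {M. good M \<and> \<not> rigid i0 M \<and> (\<exists>s. stays c i0 s M)}"
  define \<L> where "\<L> = {M. \<exists>z. s < z \<and> z < s' \<and> M \<in> born c i0 z}"
  define \<U> where "\<U> = {M. \<exists>z. s < z \<and> z < s' \<and> M \<in> dies c i0 z}"
  \<comment> \<open>The account of a single cell: it is present on one open interval, and since both
    ends of the segment are generic, an end of the interval never falls on them.\<close>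
  have key: "(if stays c i0 s' M then ?h M else 0) + (if M \<in> \<U> then ?h M else 0) =
     (if stays c i0 s M then ?h M else 0) + (if M \<in> \<L> then ?h M else 0)" if M: "M \<in> \<M>" for M
  proof -
    let ?I = "{s. stays c i0 s M}" and ?R = "{s. limits c i0 s M}"
    have IR: "?I \<subseteq> ?R" using stays_limits by blast
    have A: "r + l * (s - r) \<in> ?I" if "s \<in> ?I" "r \<in> ?R" "0 < l" "l < 1" for s r l
      using that stays_segment by blast
    have op: "open ?I" and cl: "closure ?I \<subseteq> ?R" using M stays_open stays_closure unfolding \<M>_def by blast+
    obtain s0 where s0: "stays c i0 s0 M" using M unfolding \<M>_def by blast
    have R1: "stays c i0 s M \<longleftrightarrow> limits c i0 s M" using gen_limits_stays[OF g1 _ s0] stays_limits by blast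
    have R2: "stays c i0 s' M \<longleftrightarrow> limits c i0 s' M" using gen_limits_stays[OF g2 _ s0] stays_limits by blast
    have up: "\<exists>z. s1 < z \<and> z < s2 \<and> M \<in> dies c i0 z" if "stays c i0 s1 M" "\<not> limits c i0 s2 M" "s1 < s2" for s1 s2
      using upper_end[OF A IR op cl, of s1 s2] that M unfolding dies_def \<M>_def by blast
    have lo: "\<exists>z. s2 < z \<and> z < s1 \<and> M \<in> born c i0 z" if "stays c i0 s1 M" "\<not> limits c i0 s2 M" "s2 < s1" for s1 s2
      using lower_end[OF A IR op cl, of s1 s2] that M unfolding born_def \<M>_def by blast
    have noL: "M \<notin> \<L>" if "stays c i0 s M"
    proof
      assume "M \<in> \<L>"
      then obtain z where "s < z" "M \<in> born c i0 z" unfolding \<L>_def by blast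
      then have "z \<le> s" using that unfolding born_def by blast
      then show False using \<open>s < z\<close> by simp
    qed
    have noU: "M \<notin> \<U>" if "stays c i0 s' M"
    proof
      assume "M \<in> \<U>"
      then obtain z where "z < s'" "M \<in> dies c i0 z" unfolding \<U>_def by blast
      then have "s' \<le> z" using that unfolding dies_def by blast
      then show False using \<open>z < s'\<close> by simp
    qed
    consider "stays c i0 s M" "stays c i0 s' M" | "stays c i0 s M" "\<not> stays c i0 s' M"
      | "\<not> stays c i0 s M" "stays c i0 s' M" | "\<not> stays c i0 s M" "\<not> stays c i0 s' M" by blast
    then show ?thesis
    proof cases
      case 1 then show ?thesis using noL noU by simp
    next
      case 2
      then have "M \<in> \<U>" unfolding \<U>_def using up[of s s'] ss R2 by blast
      then show ?thesis using 2 noL by simp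
    next
      case 3
      then have "M \<in> \<L>" unfolding \<L>_def using lo[of s' s] ss R1 by blast
      then show ?thesis using 3 noU by simp
    next
      case 4
      have "M \<in> \<L> \<longleftrightarrow> M \<in> \<U>"
      proof
        assume "M \<in> \<L>"
        then obtain z where z: "s < z" "z < s'" "M \<in> born c i0 z" unfolding \<L>_def by blast
        have zl: "limits c i0 z M" "z \<le> s0" using z(3) s0 unfolding born_def by blast+
        have "\<not> s' < s0" using stays_between[OF s0 zl(1), of s'] z 4 by blast
        then have lt: "s0 < s'" using s0 4 by (cases "s0 = s'") auto
        from up[OF s0 _ this] obtain z' where z': "s0 < z'" "z' < s'" "M \<in> dies c i0 z'" using R2 4 by blast
        moreover have "s < z'" using z zl z' by linarith
        ultimately show "M \<in> \<U>" unfolding \<U>_def by blast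
      next
        assume "M \<in> \<U>"
        then obtain z where z: "s < z" "z < s'" "M \<in> dies c i0 z" unfolding \<U>_def by blast
        have zl: "limits c i0 z M" "s0 \<le> z" using z(3) s0 unfolding dies_def by blast+
        have "\<not> s0 < s" using stays_between[OF s0 zl(1), of s] z 4 by blast
        then have lt: "s < s0" using s0 4 by (cases "s0 = s") auto
        from lo[OF s0 _ this] obtain z' where z': "s < z'" "z' < s0" "M \<in> born c i0 z'" using R1 4 by blast
        moreover have "z' < s'" using z zl z' by linarith
        ultimately show "M \<in> \<L>" unfolding \<L>_def by blast
      qed
      then show ?thesis using 4 by simp
    qed
  qed
  \<comment> \<open>At a generic parameter every cell present can move in direction
    \<open>i0\<close>, so no rigid cell contributes.\<close>
  have cntM: "cnt (cs c i0 r) = (\<Sum>M\<in>\<M>. if stays c i0 r M then ?h M else 0)" if "gen UNIV (cs c i0 r)" for r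
  proof -
    have "{M. good M \<and> cellat (cs c i0 r) M} = \<M> \<inter> {M. stays c i0 r M}"
      unfolding \<M>_def using gen_stays_not_rigid[OF that] unfolding stays_def by blast
    then show ?thesis unfolding cnt_def by (simp add: sum.inter_restrict)
  qed
  have LM: "\<L> \<subseteq> \<M>" "\<U> \<subseteq> \<M>" unfolding \<L>_def \<U>_def \<M>_def born_def dies_def by blast+
  have sub: "(\<Sum>M\<in>\<M>. if M \<in> A then ?h M else 0) = sum ?h A" if "A \<subseteq> \<M>" for A
  proof -
    have "\<M> \<inter> A = A" using that by blast
    then show ?thesis using sum.inter_restrict[of \<M> ?h A] by simp
  qed
  \<comment> \<open>Each of the finitely many families has at most one birth and one death, so only
    finitely many parameters matter.\<close>
  define Zs where "Zs = {z. s < z \<and> z < s' \<and> (born c i0 z \<noteq> {} \<or> dies c i0 z \<noteq> {})}"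
  have finZ: "finite Zs"
  proof (rule finite_subset)
    show "Zs \<subseteq> range (\<lambda>M. THE z. M \<in> born c i0 z) \<union> range (\<lambda>M. THE z. M \<in> dies c i0 z)"
    proof
      fix z assume "z \<in> Zs"
      then consider M where "M \<in> born c i0 z" | M where "M \<in> dies c i0 z" unfolding Zs_def by blast
      then show "z \<in> range (\<lambda>M. THE z. M \<in> born c i0 z) \<union> range (\<lambda>M. THE z. M \<in> dies c i0 z)"
      proof cases
        case (1 M)
        have "(THE z. M \<in> born c i0 z) = z" by (rule the_equality) (use 1 born_unique in blast)+
        then show ?thesis by blast
      next
        case (2 M)
        have "(THE z. M \<in> dies c i0 z) = z" by (rule the_equality) (use 2 dies_unique in blast)+
        then show ?thesis by blast
      qed
    qed
  qed simp
  have "\<L> = (\<Union>z\<in>Zs. born c i0 z)" unfolding \<L>_def Zs_def by blast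
  then have "sum ?h \<L> = (\<Sum>z\<in>Zs. sum ?h (born c i0 z))"
    by (simp only:) (rule sum.UNION_disjoint[OF finZ], use born_unique in auto)
  also have "\<dots> = (\<Sum>z\<in>Zs. sum ?h (dies c i0 z))" by (rule sum.cong[OF refl]) (rule jump[OF g])
  also have "\<dots> = sum ?h \<U>"
  proof -
    have "\<U> = (\<Union>z\<in>Zs. dies c i0 z)" unfolding \<U>_def Zs_def by blast
    then show ?thesis
      by (simp only:) (rule sum.UNION_disjoint[OF finZ, symmetric], use dies_unique in auto)
  qed
  finally have LU: "sum ?h \<L> = sum ?h \<U>" .
  have "cnt (cs c i0 s') + sum ?h \<U> = cnt (cs c i0 s) + sum ?h \<L>"
    unfolding cntM[OF g1] cntM[OF g2] sub[OF LM(1), symmetric] sub[OF LM(2), symmetric] sum.distrib[symmetric]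
    by (rule sum.cong[OF refl]) (rule key)
  then show ?thesis unfolding LU by simp
qed

lemma step:
  assumes "gen (- {i0}) c" "gen UNIV c" "gen UNIV c'" "\<And>i. i \<noteq> i0 \<Longrightarrow> c' $ i = c $ i"
  shows "cnt c = cnt c'"
proof -
  have c: "cs c i0 (c $ i0) = c" "cs c i0 (c' $ i0) = c'" using assms(4) by (auto simp: vec_eq_iff)
  show ?thesis
  proof (cases "c $ i0" "c' $ i0" rule: linorder_cases)
    case less
    from step_less[OF assms(1), of "c $ i0" "c' $ i0", unfolded c, OF assms(2,3) less] show ?thesis .
  next
    case equal
    then have "c = c'" using c by metis
    then show ?thesis by simp
  next
    case greater
    from step_less[OF assms(1), of "c' $ i0" "c $ i0", unfolded c, OF assms(3,2) greater] show ?thesis by (rule sym)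
  qed
qed

section \<open>Generic translations and invariance of the count\<close>

text \<open>If \<open>lin M\<close> does not fill \<open>T\<close>, the differences of points of the
  cell, restricted to \<open>T\<close>, lie in a translate of a proper subspace. A normal vector of
  that subspace gives one hyperplane containing every \<open>c\<close> at which this cell obstructs
  genericity, and there are finitely many pairs of \<open>T\<close> and \<open>M\<close>.\<close>

lemma walls_exist:
  "\<exists>H. finite H \<and> (\<forall>(\<sigma>, z)\<in>H. \<sigma> \<noteq> (0 :: real ^ 'n)) \<and> (\<forall>T c. (\<forall>(\<sigma>, z)\<in>H. \<sigma> \<bullet> c \<noteq> (z::real)) \<longrightarrow> gen T c)"
proof -
  define Q where "Q T M \<sigma> z \<longleftrightarrow> \<sigma> \<noteq> (0 :: real ^ 'n) \<and> (\<forall>w c. OP w = M \<longrightarrow> (\<forall>i\<in>T. df w $ i = c $ i) \<longrightarrow> \<sigma> \<bullet> c = (z :: real))" for T M \<sigma> z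
  have ex: "\<exists>x. Q T M (fst x) (snd x)" if nf: "\<not> fills T (lin M)" for T M
  proof -
    define re where "re v = (\<chi> i. if i \<in> T then df v $ i else 0)" for v :: "real ^ ('n + 'n)"
    have lre: "linear re" by (rule linearI) (auto simp: re_def vec_eq_iff algebra_simps)
    let ?S = "re ` lin M" and ?E = "{x :: real ^ 'n. \<forall>i. i \<notin> T \<longrightarrow> x $ i = 0}"
    have sS: "subspace ?S" using lre subspace_lin by (rule linear_subspace_image)
    have sE: "subspace ?E" by (auto simp: subspace_def)
    have "?S \<subseteq> ?E" by (auto simp: re_def)
    moreover have "?S \<noteq> ?E"
    proof
      assume SE: "?S = ?E"
      have "fills T (lin M)" unfolding fills_def
      proof
        fix y :: "'n \<Rightarrow> real"
        have "(\<chi> i. if i \<in> T then y i else 0) \<in> ?E" by simp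
        then obtain v where v: "v \<in> lin M" "(\<chi> i. if i \<in> T then y i else 0) = re v" unfolding SE[symmetric] by blast
        have "v $ Inl i - v $ Inr i = y i" if "i \<in> T" for i
          using arg_cong[OF v(2), of "\<lambda>x. x $ i"] that by (simp add: re_def)
        then show "\<exists>v\<in>lin M. \<forall>i\<in>T. v $ Inl i - v $ Inr i = y i" using v(1) by blast
      qed
      then show False using nf by blast
    qed
    ultimately have "span ?S \<subset> span ?E" using sS sE by (simp add: span_eq_iff[THEN iffD2] psubset_eq)
    \<comment> \<open>The normal vector is taken inside \<open>?E\<close>, so that its product with
      \<open>c\<close> only depends on the coordinates in \<open>T\<close>.\<close>
    then obtain \<sigma> where \<sigma>: "\<sigma> \<noteq> 0" "\<sigma> \<in> span ?E" "\<And>y. y \<in> span ?S \<Longrightarrow> orthogonal \<sigma> y"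
      using orthogonal_to_subspace_exists_gen by blast
    have supp: "\<sigma> $ i = 0" if "i \<notin> T" for i using \<sigma>(2) sE that by (simp add: span_eq_iff[THEN iffD2])
    have re\<sigma>: "\<sigma> \<bullet> re v = \<sigma> \<bullet> x" if "\<forall>i\<in>T. df v $ i = x $ i" for v x
      unfolding inner_vec_def using that supp by (intro sum.cong) (auto simp: re_def)
    have dep: "\<sigma> \<bullet> re w = \<sigma> \<bullet> re w'" if w: "OP w = M" "OP w' = M" for w w'
    proof -
      have "w - w' \<in> lin M" using opt_same_diff_lin[of \<B> P w w'] w by simp
      then have "re (w - w') \<in> span ?S" by (intro span_base imageI)
      then have "\<sigma> \<bullet> re (w - w') = 0" using \<sigma>(3) by (simp add: orthogonal_def)
      then show ?thesis using linear_diff[OF lre] by (simp add: inner_diff_right)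
    qed
    have "Q T M \<sigma> (\<sigma> \<bullet> re (SOME w. OP w = M))" unfolding Q_def
    proof (intro conjI allI impI \<sigma>(1))
      fix w c assume w: "OP w = M" "\<forall>i\<in>T. df w $ i = c $ i"
      have "OP (SOME w. OP w = M) = M" using w(1) by (rule someI)
      then show "\<sigma> \<bullet> c = \<sigma> \<bullet> re (SOME w. OP w = M)" using dep[OF w(1)] re\<sigma>[OF w(2)] by simp
    qed
    then show ?thesis by (intro exI[of _ "(\<sigma>, \<sigma> \<bullet> re (SOME w. OP w = M))"]) simp
  qed
  define X :: "('n set \<times> ('n + 'n) set set) set" where "X = {(T, M). \<not> fills T (lin M)}"
  obtain f where f: "\<And>T M. \<not> fills T (lin M) \<Longrightarrow> Q T M (fst (f T M)) (snd (f T M))" using ex by metis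
  let ?H = "(\<lambda>(T, M). f T M) ` X"
  have "gen T c" if c: "\<forall>(\<sigma>, z)\<in>?H. \<sigma> \<bullet> c \<noteq> z" for T c
    unfolding gen_def
  proof (intro allI impI, rule ccontr)
    fix w assume w: "\<forall>i\<in>T. df w $ i = c $ i" and nf: "\<not> fills T (lin (OP w))"
    have "(T, OP w) \<in> X" unfolding X_def using nf by simp
    then have "f T (OP w) \<in> ?H" by (rule image_eqI[rotated]) simp
    then have "fst (f T (OP w)) \<bullet> c \<noteq> snd (f T (OP w))" using c by (auto simp: case_prod_beta)
    then show False using f[OF nf] w unfolding Q_def by blast
  qed
  moreover have "\<forall>(\<sigma>, z)\<in>?H. \<sigma> \<noteq> 0"
  proof
    fix y assume "y \<in> ?H"
    then obtain T M where "\<not> fills T (lin M)" "y = f T M" unfolding X_def by auto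
    then show "case y of (\<sigma>, z) \<Rightarrow> \<sigma> \<noteq> 0" using f[of T M] unfolding Q_def by (simp add: case_prod_beta)
  qed
  moreover have "finite ?H" by (intro finite_imageI) simp
  ultimately show ?thesis by blast
qed

text \<open>The two points are first perturbed so that all mixtures of their coordinates are
  generic. Then one coordinate after another is switched from the first point to the second, each
  switch being a \<open>step\<close>.\<close>

theorem cnt_invariant:
  assumes "transv a" "transv b"
  shows "cnt a = cnt b"
proof -
  obtain ea where ea: "ea > 0" "\<And>c. dist c a < ea \<Longrightarrow> cnt c = cnt a" using cnt_perturb[OF assms(1)] by metis
  obtain eb where eb: "eb > 0" "\<And>c. dist c b < eb \<Longrightarrow> cnt c = cnt b" using cnt_perturb[OF assms(2)] by metis
  obtain H :: "((real ^ 'n) \<times> real) set" where H1: "finite H" and H2': "\<forall>(\<sigma>, z)\<in>H. \<sigma> \<noteq> 0"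
    and H3': "\<forall>T c. (\<forall>(\<sigma>, z)\<in>H. \<sigma> \<bullet> c \<noteq> z) \<longrightarrow> gen T c" using walls_exist by blast
  have H2: "\<sigma> \<noteq> 0" if "(\<sigma>, z) \<in> H" for \<sigma> z using bspec[OF H2' that] by simp
  have H3: "gen T c" if nz: "\<And>\<sigma> z. (\<sigma>, z) \<in> H \<Longrightarrow> \<sigma> \<bullet> c \<noteq> z" for T c
  proof (rule H3'[THEN spec, THEN spec, THEN mp], rule ballI)
    fix y assume "y \<in> H" then show "case y of (\<sigma>, z) \<Rightarrow> \<sigma> \<bullet> c \<noteq> z" using nz by (cases y) simp
  qed
  define mix :: "(real ^ 'n) \<times> (real ^ 'n) \<Rightarrow> 'n set \<Rightarrow> real ^ 'n" where
    "mix x S = (\<chi> i. if i \<in> S then snd x $ i else fst x $ i)" for x S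
  \<comment> \<open>The wall equation for the mixture \<open>mix x S\<close> is a linear equation
    for the pair \<open>x\<close>, with this normal vector. The bad pairs thus lie in finitely many
    hyperplanes, a negligible set.\<close>
  define nv :: "real ^ 'n \<Rightarrow> 'n set \<Rightarrow> (real ^ 'n) \<times> (real ^ 'n)" where
    "nv \<sigma> S = (\<chi> i. if i \<in> S then 0 else \<sigma> $ i, \<chi> i. if i \<in> S then \<sigma> $ i else 0)" for \<sigma> S
  have inner: "nv \<sigma> S \<bullet> x = \<sigma> \<bullet> mix x S" for \<sigma> S x
    unfolding nv_def mix_def inner_prod_def inner_vec_def by (simp add: sum.distrib[symmetric] if_distrib cong: if_cong) (rule sum.cong; simp)
  have nz: "nv \<sigma> S \<noteq> 0" if "\<sigma> \<noteq> 0" for \<sigma> S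
  proof
    assume "nv \<sigma> S = 0"
    then have "\<sigma> $ i = 0" for i unfolding nv_def by (cases "i \<in> S") (auto simp: vec_eq_iff zero_prod_def dest: spec[of _ i])
    then show False using that by (simp add: vec_eq_iff)
  qed
  let ?bad = "\<Union>((\<lambda>(S, \<sigma>, z). {x. nv \<sigma> S \<bullet> x = z}) ` (UNIV \<times> H))"
  have "negligible ?bad"
  proof (intro negligible_Union finite_imageI finite_cartesian_product H1)
    fix t assume "t \<in> (\<lambda>(S, \<sigma>, z). {x. nv \<sigma> S \<bullet> x = z}) ` (UNIV \<times> H)"
    then obtain S \<sigma> z where t: "t = {x. nv \<sigma> S \<bullet> x = z}" "(\<sigma>, z) \<in> H" by auto
    show "negligible t" unfolding t(1) using nz[OF H2[OF t(2)]] by (intro negligible_hyperplane) blast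
  qed simp
  moreover have "\<not> negligible (ball a ea \<times> ball b eb)"
    using ea(1) eb(1) by (intro open_not_negligible open_Times) auto
  ultimately have "\<not> ball a ea \<times> ball b eb \<subseteq> ?bad" using negligible_subset by blast
  then obtain x where x: "x \<in> ball a ea \<times> ball b eb" "x \<notin> ?bad" by blast
  have g: "gen T (mix x S)" for T S
  proof (rule H3)
    fix \<sigma> z assume h: "(\<sigma>, z) \<in> H"
    have "x \<notin> {x. nv \<sigma> S \<bullet> x = z}"
    proof
      assume "x \<in> {x. nv \<sigma> S \<bullet> x = z}"
      then have "x \<in> (\<lambda>(S, \<sigma>, z). {x. nv \<sigma> S \<bullet> x = z}) (S, \<sigma>, z)" by simp
      then have "x \<in> ?bad" by (rule UN_I[rotated]) (use h in simp)
      then show False using x(2) by blast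
    qed
    then show "\<sigma> \<bullet> mix x S \<noteq> z" unfolding inner[symmetric] by simp
  qed
  have "cnt (mix x S) = cnt (mix x {})" for S :: "'n set"
    using finite[of S]
  proof (induction S rule: finite_induct)
    case (insert i S)
    have "cnt (mix x S) = cnt (mix x (insert i S))" by (rule step[OF g g g, of i]) (simp add: mix_def)
    then show ?case using insert.IH by simp
  qed simp
  moreover have "mix x UNIV = snd x" "mix x {} = fst x" unfolding mix_def by (simp_all add: vec_eq_iff)
  ultimately have "cnt (snd x) = cnt (fst x)" by metis
  moreover have "cnt (fst x) = cnt a" "cnt (snd x) = cnt b"
    using x(1) ea(2) eb(2) by (auto simp: dist_commute)
  ultimately show ?thesis by simp
qed

end

section \<open>Direct sums on the doubled ground set\<close>

definition jn :: "'a set \<Rightarrow> 'b set \<Rightarrow> ('a + 'b) set" where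
  "jn I K = Inl ` I \<union> Inr ` K"

definition dirsum :: "'a set set \<Rightarrow> 'b set set \<Rightarrow> ('a + 'b) set set" where
  "dirsum M N = (\<Union>I\<in>M. \<Union>K\<in>N. {jn I K})"

lemma mem_jn [simp]: "Inl i \<in> jn I K \<longleftrightarrow> i \<in> I" "Inr k \<in> jn I K \<longleftrightarrow> k \<in> K"
  by (auto simp: jn_def)

lemma vimage_jn [simp]: "Inl -` jn I K = I" "Inr -` jn I K = K"
  by auto

lemma jn_vimage: "jn (Inl -` B) (Inr -` B) = B"
  by (rule set_eqI, case_tac x) auto

lemma mem_dirsum: "B \<in> dirsum M N \<longleftrightarrow> Inl -` B \<in> M \<and> Inr -` B \<in> N"
proof
  assume "B \<in> dirsum M N"
  then obtain I K where "I \<in> M" "K \<in> N" "B = jn I K" unfolding dirsum_def by blast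
  then show "Inl -` B \<in> M \<and> Inr -` B \<in> N" by simp
next
  assume "Inl -` B \<in> M \<and> Inr -` B \<in> N"
  then have "jn (Inl -` B) (Inr -` B) \<in> dirsum M N" unfolding dirsum_def by blast
  then show "B \<in> dirsum M N" unfolding jn_vimage .
qed

lemma jn_insert: "jn (insert x I) K = insert (Inl x) (jn I K)" "jn I (insert y K) = insert (Inr y) (jn I K)"
  "jn (I - {x}) K = jn I K - {Inl x}" "jn I (K - {y}) = jn I K - {Inr y}"
  by (auto simp: jn_def)

lemma is_loop_dirsum: "is_loop M x \<Longrightarrow> is_loop (dirsum M N) (Inl x)" "is_loop N y \<Longrightarrow> is_loop (dirsum M N) (Inr y)"
  by (auto simp: is_loop_def mem_dirsum)

lemma dirsum_left:
  "dirsum (col x M) N = col (Inl x) (dirsum M N)"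
  "dirsum (par x y M) N = par (Inl x) (Inl y) (dirsum M N)"
  "dirsum (ser x y M) N = ser (Inl x) (Inl y) (dirsum M N)"
proof -
  show "dirsum (col x M) N = col (Inl x) (dirsum M N)"
    unfolding dirsum_def col_def by (simp add: jn_insert)
  show "dirsum (par x y M) N = par (Inl x) (Inl y) (dirsum M N)"
    unfolding dirsum_def par_def UN_UN_flatten
    by (intro SUP_cong[OF refl]) (auto simp: jn_insert)
  show "dirsum (ser x y M) N = ser (Inl x) (Inl y) (dirsum M N)"
    unfolding dirsum_def ser_def UN_UN_flatten
    by (intro SUP_cong[OF refl]) (auto simp: jn_insert)
qed

lemma dirsum_right:
  "dirsum M (col x N) = col (Inr x) (dirsum M N)"
  "dirsum M (par x y N) = par (Inr x) (Inr y) (dirsum M N)"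
  "dirsum M (ser x y N) = ser (Inr x) (Inr y) (dirsum M N)"
proof -
  show "dirsum M (col x N) = col (Inr x) (dirsum M N)"
    unfolding dirsum_def col_def by (simp add: jn_insert)
  show "dirsum M (par x y N) = par (Inr x) (Inr y) (dirsum M N)"
    unfolding dirsum_def par_def UN_UN_flatten
    by (intro SUP_cong[OF refl]) (auto simp: jn_insert)
  show "dirsum M (ser x y N) = ser (Inr x) (Inr y) (dirsum M N)"
    unfolding dirsum_def ser_def UN_UN_flatten
    by (intro SUP_cong[OF refl]) (auto simp: jn_insert)
qed

text \<open>The construction of \<open>M\<close> is run on the left copies alone, and then the
  construction of \<open>N\<close> on the right copies, starting from the result.\<close>

lemma sp_family_dirsum:
  assumes "sp_family M" "sp_family N"
  shows "sp_family (dirsum M N)"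
proof -
  have 0: "dirsum {{}} {{}} = {{}}" by (auto simp: dirsum_def jn_def)
  have "sp_family (dirsum M {{}})"
    using assms(1)
  proof (induction rule: Cl.induct)
    case (base M) then show ?case by (intro Cl.base) (simp add: 0)
  next
    case (col M x) then show ?case unfolding dirsum_left by (intro Cl.col) (auto intro: is_loop_dirsum)
  next
    case (par M x y) then show ?case unfolding dirsum_left by (intro Cl.par) (auto intro: is_loop_dirsum)
  next
    case (ser M x y) then show ?case unfolding dirsum_left by (intro Cl.ser) (auto intro: is_loop_dirsum)
  qed
  note left = this
  show ?thesis using assms(2)
  proof (induction rule: Cl.induct)
    case (base N) then show ?case using left by simp
  next
    case (col N x) then show ?case unfolding dirsum_right by (intro Cl.col) (auto intro: is_loop_dirsum)
  next
    case (par N x y) then show ?case unfolding dirsum_right by (intro Cl.par) (auto intro: is_loop_dirsum)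
  next
    case (ser N x y) then show ?case unfolding dirsum_right by (intro Cl.ser) (auto intro: is_loop_dirsum)
  qed
qed

definition lft :: "real ^ ('n::finite + 'n) \<Rightarrow> real ^ 'n" where "lft w = (\<chi> i. w $ Inl i)"
definition rgt :: "real ^ ('n::finite + 'n) \<Rightarrow> real ^ 'n" where "rgt w = (\<chi> i. w $ Inr i)"

lemma lft_rgt_nth [simp]: "lft w $ i = w $ Inl i" "rgt w $ i = w $ Inr i"
  by (simp_all add: lft_def rgt_def)

lemma wt_jn: "wt w (jn I K) = wt (lft w) I + wt (rgt w) K"
proof -
  have "wt w (jn I K) = wt w (Inl ` I) + wt w (Inr ` K)" unfolding jn_def by (rule wt_Un) auto
  then show ?thesis by (simp add: wt_def sum.reindex)
qed

lemma wt_sum_split: "wt w B = wt (lft w) (Inl -` B) + wt (rgt w) (Inr -` B)"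
  using wt_jn[of w "Inl -` B" "Inr -` B"] by (simp add: jn_vimage)

lemma opt_dirsum:
  fixes \<B> \<B>' :: "'n::finite set set"
  assumes "\<B> \<noteq> {}" "\<B>' \<noteq> {}"
  shows "opt (dirsum \<B> \<B>') (\<lambda>B. P (Inl -` B) + P' (Inr -` B)) w = dirsum (opt \<B> P (lft w)) (opt \<B>' P' (rgt w))"
proof (rule set_eqI)
  fix B :: "('n + 'n) set"
  let ?I = "Inl -` B" and ?K = "Inr -` B"
  let ?f = "\<lambda>I. P I - wt (lft w) I" and ?g = "\<lambda>K. P' K - wt (rgt w) K"
  have val: "P (Inl -` C) + P' (Inr -` C) - wt w C = ?f (Inl -` C) + ?g (Inr -` C)" for C :: "('n + 'n) set"
    unfolding wt_sum_split[of w C] by simp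
  have all: "(\<forall>C\<in>dirsum \<B> \<B>'. ?f ?I + ?g ?K \<le> ?f (Inl -` C) + ?g (Inr -` C)) \<longleftrightarrow>
      (\<forall>I\<in>\<B>. ?f ?I \<le> ?f I) \<and> (\<forall>K\<in>\<B>'. ?g ?K \<le> ?g K)" if B: "?I \<in> \<B>" "?K \<in> \<B>'"
  proof
    assume L: "\<forall>C\<in>dirsum \<B> \<B>'. ?f ?I + ?g ?K \<le> ?f (Inl -` C) + ?g (Inr -` C)"
    have "?f ?I \<le> ?f I" if "I \<in> \<B>" for I
      using L[rule_format, of "jn I ?K"] that B by (simp add: mem_dirsum)
    moreover have "?g ?K \<le> ?g K" if "K \<in> \<B>'" for K
      using L[rule_format, of "jn ?I K"] that B by (simp add: mem_dirsum)
    ultimately show "(\<forall>I\<in>\<B>. ?f ?I \<le> ?f I) \<and> (\<forall>K\<in>\<B>'. ?g ?K \<le> ?g K)" by blast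
  next
    assume "(\<forall>I\<in>\<B>. ?f ?I \<le> ?f I) \<and> (\<forall>K\<in>\<B>'. ?g ?K \<le> ?g K)"
    then show "\<forall>C\<in>dirsum \<B> \<B>'. ?f ?I + ?g ?K \<le> ?f (Inl -` C) + ?g (Inr -` C)"
      by (intro ballI add_mono) (simp_all add: mem_dirsum)
  qed
  show "B \<in> opt (dirsum \<B> \<B>') (\<lambda>B. P (Inl -` B) + P' (Inr -` B)) w \<longleftrightarrow> B \<in> dirsum (opt \<B> P (lft w)) (opt \<B>' P' (rgt w))"
    unfolding opt_def mem_Collect_eq val mem_dirsum[of B] using all by argo
qed

section \<open>Boundedness from gaps between coordinates\<close>

text \<open>Exchanging an element outside \<open>H\<close> for one inside gains more weight than
  \<open>p\<close> can cost, so every optimal set is comparable with \<open>H\<close>. One of them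
  contains \<open>j\<close> and hence properly contains \<open>H\<close>; having equal sizes, all of
  them contain \<open>H\<close>.\<close>

lemma gap_coloops:
  fixes p :: "'n::finite set \<Rightarrow> real"
  assumes C: "\<And>I. \<bar>p I\<bar> \<le> C" and gap: "\<And>h e. h \<in> H \<Longrightarrow> e \<notin> H \<Longrightarrow> x $ h - x $ e > 2 * C"
    and j: "j \<notin> H" "\<not> is_loop (minimizers d p x) j" and i: "i \<in> H"
  shows "is_coloop (minimizers d p x) i"
proof -
  let ?M = "opt {I. card I = d} p x"
  have dich: "H \<subseteq> I \<or> I \<subseteq> H" if I: "I \<in> ?M" for I
  proof (rule ccontr)
    assume "\<not> (H \<subseteq> I \<or> I \<subseteq> H)"
    then obtain h e where he: "h \<in> H" "h \<notin> I" "e \<in> I" "e \<notin> H" by blast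
    let ?K = "insert h (I - {e})"
    have cI: "card I = d" using I unfolding opt_def by simp
    have "card ?K = Suc (card (I - {e}))" using he by (intro card_insert_disjoint) auto
    also have "\<dots> = card I" using he by (intro card.remove[symmetric]) auto
    finally have "card ?K = d" using cI by simp
    then have "p I - wt x I \<le> p ?K - wt x ?K" using I unfolding opt_def by blast
    moreover have "wt x ?K = wt x I - x $ e + x $ h" using he by (intro wt_exchange) auto
    ultimately show False using gap[OF he(1,4)] C[of I] C[of ?K] by linarith
  qed
  obtain I0 where I0: "I0 \<in> ?M" "j \<in> I0" using j(2) unfolding is_loop_def minimizers_eq_opt by blast
  have "H \<subseteq> I0" using dich[OF I0(1)] I0(2) j(1) by blast
  then have "H \<subset> I0" using I0(2) j(1) by blast
  then have lt: "card H < card I0" by (intro psubset_card_mono) auto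
  have "i \<in> I" if I: "I \<in> ?M" for I
  proof (rule ccontr)
    assume "i \<notin> I"
    then have "I \<subseteq> H" using dich[OF I] i by blast
    then have "card I \<le> card H" by (intro card_mono) auto
    moreover have "card I = card I0" using I I0(1) unfolding opt_def by simp
    ultimately show False using lt by simp
  qed
  then show ?thesis unfolding is_coloop_def minimizers_eq_opt by blast
qed

text \<open>Pigeonhole: between the two coordinates there are \<open>CARD('n)\<close> half-open
  intervals of length \<open>g\<close>, and the elements other than \<open>j\<close> are too few to
  meet all of them. Cutting at an empty interval gives \<open>H\<close>.\<close>

lemma find_gap:
  fixes x :: "real ^ 'n::finite"
  assumes g: "g > 0" and ij: "x $ i - x $ j > real CARD('n) * g"
  shows "\<exists>H. i \<in> H \<and> j \<notin> H \<and> (\<forall>h\<in>H. \<forall>e. e \<notin> H \<longrightarrow> x $ h - x $ e > g)"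
proof -
  \<comment> \<open>The number of the interval, open on the left, that contains
    \<open>x $ k\<close>. The shift by one gives \<open>j\<close> itself the number
    \<open>-1\<close>, so that it occupies no interval.\<close>
  define f where "f k = \<lceil>(x $ k - x $ j) / g\<rceil> - 1" for k
  have "f j = -1" by (simp add: f_def)
  have "\<not> {0..<int CARD('n)} \<subseteq> f ` UNIV"
  proof
    assume "{0..<int CARD('n)} \<subseteq> f ` UNIV"
    moreover have "f ` UNIV = insert (f j) (f ` (UNIV - {j}))" by blast
    ultimately have sub: "{0..<int CARD('n)} \<subseteq> f ` (UNIV - {j})" using \<open>f j = -1\<close> by auto
    have "CARD('n) = card {0..<int CARD('n)}" by simp
    also have "\<dots> \<le> card (f ` (UNIV - {j}))" using sub by (intro card_mono) auto
    also have "\<dots> \<le> card (UNIV - {j})" by (rule card_image_le) simp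
    also have "\<dots> < CARD('n)" by (intro psubset_card_mono) auto
    finally show False by simp
  qed
  then obtain m where m': "m \<in> {0..<int CARD('n)}" "m \<notin> range f" by blast
  then have m: "0 \<le> m" "m < int CARD('n)" "m \<notin> range f" by simp_all
  define t where "t = x $ j + of_int m * g"
  have no: "x $ k \<le> t \<or> x $ k > t + g" for k
  proof (rule ccontr)
    assume "\<not> (x $ k \<le> t \<or> x $ k > t + g)"
    then have "of_int m < (x $ k - x $ j) / g" "(x $ k - x $ j) / g \<le> of_int m + 1"
      using g by (auto simp: t_def field_simps)
    then have "\<lceil>(x $ k - x $ j) / g\<rceil> = m + 1" by (simp add: ceiling_eq_iff)
    then have "f k = m" by (simp add: f_def)
    then show False using m(3) by blast
  qed
  have "real_of_int m + 1 \<le> real CARD('n)" using m(2) by linarith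
  then have "(real_of_int m + 1) * g \<le> real CARD('n) * g" using g by (intro mult_right_mono) auto
  then have "x $ i > t + g" using ij by (simp add: t_def algebra_simps)
  moreover have "x $ j \<le> t" using m(1) g by (simp add: t_def)
  moreover have "x $ h - x $ e > g" if "x $ h > t + g" "\<not> x $ e > t + g" for h e
    using no[of e] that by linarith
  ultimately show ?thesis using g by (intro exI[of _ "{k. x $ k > t + g}"]) auto
qed

section \<open>Affine hull, dimension and relative interior of a cell\<close>

context
  fixes \<B> :: "'g::finite set set" and P :: "'g set \<Rightarrow> real" and w :: "real ^ 'g"
  assumes ne: "\<B> \<noteq> {}"
begin

private abbreviation "X \<equiv> {u. opt \<B> P u = opt \<B> P w}"

lemma affine_hull_cell: "affine hull X = {u. u - w \<in> lin (opt \<B> P w)}"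
proof
  have "affine {u. u - w \<in> lin (opt \<B> P w)}"
  proof -
    have "{u. u - w \<in> lin (opt \<B> P w)} = (+) w ` lin (opt \<B> P w)"
      by (auto simp: image_iff) (metis add_diff_cancel_left' diff_add_cancel add.commute)
    then show ?thesis using subspace_imp_affine[OF subspace_lin] affine_translation by metis
  qed
  then show "affine hull X \<subseteq> {u. u - w \<in> lin (opt \<B> P w)}"
    using opt_same_diff_lin by (intro hull_minimal) blast+
  show "{u. u - w \<in> lin (opt \<B> P w)} \<subseteq> affine hull X"
  proof
    fix u assume "u \<in> {u. u - w \<in> lin (opt \<B> P w)}"
    then have v: "u - w \<in> lin (opt \<B> P w)" by simp
    obtain \<delta> where d: "\<delta> > 0" "opt \<B> P (w + \<delta> *\<^sub>R (u - w)) = ini (opt \<B> P w) (u - w)"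
      using opt_perturb_ray[OF ne] by blast
    then have "w + \<delta> *\<^sub>R (u - w) \<in> X" using ini_lin[OF v] by simp
    then have 1: "w + \<delta> *\<^sub>R (u - w) \<in> affine hull X" by (rule hull_inc)
    have 2: "w \<in> affine hull X" by (rule hull_inc) simp
    \<comment> \<open>The small step by \<open>\<delta>\<close> that stays in the cell is extended
      back to full length by an affine combination.\<close>
    have "(1 - 1 / \<delta>) *\<^sub>R w + (1 / \<delta>) *\<^sub>R (w + \<delta> *\<^sub>R (u - w)) \<in> affine hull X"
      by (rule mem_affine[OF affine_affine_hull 2 1]) simp
    then show "u \<in> affine hull X" using d(1) by (simp add: algebra_simps)
  qed
qed

text \<open>The cell is convex by \<open>opt_segment\<close> and open in its affine hull by
  \<open>opt_perturb\<close>, so it can be recovered from its closure. This makes faces and optimal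
  families correspond one to one.\<close>

lemma rel_interior_cell: "rel_interior (closure X) = X"
proof -
  have cv: "convex X"
  proof (rule convexI)
    fix x y and s t :: real assume xy: "x \<in> X" "y \<in> X" and st: "0 \<le> s" "0 \<le> t" "s + t = 1"
    show "s *\<^sub>R x + t *\<^sub>R y \<in> X"
    proof (cases "0 < t \<and> t < 1")
      case True
      have "opt \<B> P x \<inter> opt \<B> P y \<noteq> {}" using xy opt_nonempty[OF ne] by simp
      from opt_segment[OF this, of t] have "opt \<B> P (x + t *\<^sub>R (y - x)) = opt \<B> P w" using True xy by simp
      moreover have "x + t *\<^sub>R (y - x) = s *\<^sub>R x + t *\<^sub>R y"
      proof -
        have s: "s = 1 - t" using st by simp
        show ?thesis unfolding s by (simp add: algebra_simps)
      qed
      ultimately show ?thesis by simp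
    next
      case False
      then have "t = 0 \<and> s = 1 \<or> t = 1 \<and> s = 0" using st by linarith
      then show ?thesis using xy by auto
    qed
  qed
  have "X \<subseteq> rel_interior X"
  proof
    fix x assume x: "x \<in> X"
    obtain \<epsilon> where e: "\<epsilon> > 0" "\<And>v. norm v < \<epsilon> \<Longrightarrow> opt \<B> P (x + v) = ini (opt \<B> P x) v"
      using opt_perturb[OF ne] by metis
    have "ball x \<epsilon> \<inter> affine hull X \<subseteq> X"
    proof
      fix u assume u: "u \<in> ball x \<epsilon> \<inter> affine hull X"
      then have "u - w \<in> lin (opt \<B> P w)" unfolding affine_hull_cell by simp
      moreover have "x - w \<in> lin (opt \<B> P w)" using x opt_same_diff_lin by blast
      ultimately have "(u - w) - (x - w) \<in> lin (opt \<B> P w)" by (rule subspace_diff[OF subspace_lin])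
      then have "u - x \<in> lin (opt \<B> P x)" using x by simp
      then have "ini (opt \<B> P x) (u - x) = opt \<B> P x" by (rule ini_lin)
      moreover have "norm (u - x) < \<epsilon>" using u by (simp add: dist_norm norm_minus_commute)
      ultimately show "u \<in> X" using e(2)[of "u - x"] x by simp
    qed
    then show "x \<in> rel_interior X" using x e(1) unfolding rel_interior_ball by blast
  qed
  then have "rel_interior X = X" using rel_interior_subset by blast
  then show ?thesis using convex_rel_interior_closure[OF cv] by simp
qed

lemma aff_dim_cell: "aff_dim (closure X) = int (dim (lin (opt \<B> P w)))"
proof -
  have "{u. u - w \<in> lin (opt \<B> P w)} = (+) w ` lin (opt \<B> P w)"
    by (auto simp: image_iff) (metis add_diff_cancel_left' diff_add_cancel add.commute)
  then have "aff_dim (affine hull X) = aff_dim (lin (opt \<B> P w))"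
    unfolding affine_hull_cell by (simp only: aff_dim_translation_eq)
  moreover have "aff_dim (closure X) = aff_dim (affine hull X)"
    using aff_dim_affine_hull[of "closure X"] unfolding closure_same_affine_hull by (rule sym)
  ultimately show ?thesis by (simp only: aff_dim_subspace[OF subspace_lin])
qed

lemma direction_space_cell: "direction_space (closure X) = lin (opt \<B> P w)"
proof
  have h: "affine hull (closure X) = {u. u - w \<in> lin (opt \<B> P w)}"
    unfolding closure_same_affine_hull affine_hull_cell ..
  show "direction_space (closure X) \<subseteq> lin (opt \<B> P w)"
  proof
    fix z assume "z \<in> direction_space (closure X)"
    then obtain x y where xy: "z = x - y" "x - w \<in> lin (opt \<B> P w)" "y - w \<in> lin (opt \<B> P w)"
      unfolding direction_space_def h by blast
    have "(x - w) - (y - w) \<in> lin (opt \<B> P w)" by (rule subspace_diff[OF subspace_lin xy(2,3)])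
    then show "z \<in> lin (opt \<B> P w)" using xy(1) by simp
  qed
  show "lin (opt \<B> P w) \<subseteq> direction_space (closure X)"
  proof
    fix v assume "v \<in> lin (opt \<B> P w)"
    then show "v \<in> direction_space (closure X)" unfolding direction_space_def h
      by (intro CollectI exI[of _ "w + v"] exI[of _ w]) (simp add: subspace_0[OF subspace_lin])
  qed
qed

end

lemma cell_determined_by_closure:
  assumes "\<B> \<noteq> {}" "closure {u. opt \<B> P u = opt \<B> P w} = closure {u. opt \<B> P u = opt \<B> P w'}"
  shows "opt \<B> P w = opt \<B> P w'"
proof -
  have "{u. opt \<B> P u = opt \<B> P w} = {u. opt \<B> P u = opt \<B> P w'}"
    using arg_cong[OF assms(2), of rel_interior] unfolding rel_interior_cell[OF assms(1)] .
  then have "w \<in> {u. opt \<B> P u = opt \<B> P w'}" by blast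
  then show ?thesis by simp
qed

section \<open>Exchange arguments for points of tropical linear spaces\<close>

definition vex :: "nat \<Rightarrow> ('n set \<Rightarrow> real) \<Rightarrow> bool" where
  "vex d f \<longleftrightarrow> (\<forall>I K x. card I = d \<longrightarrow> card K = d \<longrightarrow> x \<in> I - K \<longrightarrow>
     (\<exists>y\<in>K - I. f (insert y (I - {x})) + f (insert x (K - {y})) \<le> f I + f K))"

lemma vexD: "vex d f \<Longrightarrow> card I = d \<Longrightarrow> card K = d \<Longrightarrow> x \<in> I - K \<Longrightarrow>
     \<exists>y\<in>K - I. f (insert y (I - {x})) + f (insert x (K - {y})) \<le> f I + f K"
  unfolding vex_def by blast

lemma vex_minus_wt:
  fixes p :: "'n::finite set \<Rightarrow> real"
  assumes "tropical_pluecker d p"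
  shows "vex d (\<lambda>I. p I - wt w I)"
  unfolding vex_def
proof (intro allI impI)
  fix I K :: "'n set" and x assume IK: "card I = d" "card K = d" and x: "x \<in> I - K"
  obtain y where y: "y \<in> K - I" "p (insert y (I - {x})) + p (insert x (K - {y})) \<le> p I + p K"
    using valuated_exchange[OF assms IK x] by blast
  have "wt w (insert y (I - {x})) = wt w I - w $ x + w $ y" "wt w (insert x (K - {y})) = wt w K - w $ y + w $ x"
    using x y by (auto intro: wt_exchange)
  then have "p (insert y (I - {x})) - wt w (insert y (I - {x})) + (p (insert x (K - {y})) - wt w (insert x (K - {y}))) \<le>
      p I - wt w I + (p K - wt w K)" using y(2) by linarith
  then show "\<exists>y\<in>K - I. p (insert y (I - {x})) - wt w (insert y (I - {x})) + (p (insert x (K - {y})) - wt w (insert x (K - {y}))) \<le>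
      p I - wt w I + (p K - wt w K)" using y(1) by blast
qed

lemma card_swap: "finite I \<Longrightarrow> x \<in> I \<Longrightarrow> y \<notin> I \<Longrightarrow> card (insert y (I - {x})) = card I"
  by (metis Diff_iff card_Suc_Diff1 card_insert_disjoint finite_Diff)

text \<open>If \<open>j0\<close> attains the minimum over \<open>J\<close>, some minimizer
  \<open>K\<close> contains \<open>j0\<close>. Exchanging \<open>j0\<close> between \<open>K\<close>
  and \<open>J - {j0}\<close> costs nothing on the side of \<open>K\<close> and so yields a second
  element of \<open>J\<close> attaining the minimum.\<close>

lemma tropical_linear_space_if_loopfree:
  fixes p :: "'n::finite set \<Rightarrow> real"
  assumes vx: "vex d (\<lambda>I. p I - wt w I)" and nl: "\<And>x. \<not> is_loop (minimizers d p w) x"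
  shows "w \<in> tropical_linear_space d p"
  unfolding tropical_linear_space_def mem_Collect_eq
proof (intro allI impI)
  fix J :: "'n set" assume J: "card J = d + 1"
  let ?f = "\<lambda>j. p (J - {j}) + w $ j"
  have Jne: "J \<noteq> {}" using J by auto
  have "Min (?f ` J) \<in> ?f ` J" using Jne by (intro Min_in) auto
  then obtain j0 where j0: "j0 \<in> J" "?f j0 = Min (?f ` J)" by auto
  have min: "?f j0 \<le> ?f k" if "k \<in> J" for k unfolding j0(2) using that by (intro Min_le) auto
  obtain K where K: "K \<in> minimizers d p w" "j0 \<in> K" using nl unfolding is_loop_def by blast
  have K': "card K = d" "\<And>I. card I = d \<Longrightarrow> p K - wt w K \<le> p I - wt w I"
    using K(1) unfolding minimizers_eq_opt opt_def by auto
  have cJ: "card (J - {j}) = d" if "j \<in> J" for j using that J by simp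
  have "j0 \<in> K - (J - {j0})" using K by simp
  from vexD[OF vx K'(1) cJ[OF j0(1)] this]
  obtain j where j: "j \<in> J - {j0} - K" "p (insert j (K - {j0})) - wt w (insert j (K - {j0})) +
     (p (insert j0 (J - {j0} - {j})) - wt w (insert j0 (J - {j0} - {j}))) \<le> p K - wt w K + (p (J - {j0}) - wt w (J - {j0}))"
    by blast
  have "insert j0 (J - {j0} - {j}) = J - {j}" using j j0 by auto
  moreover have "card (insert j (K - {j0})) = d" using card_swap[of K j0 j] K K' j by simp
  ultimately have "p (J - {j}) - wt w (J - {j}) \<le> p (J - {j0}) - wt w (J - {j0})"
    using j(2) K'(2)[of "insert j (K - {j0})"] by simp
  then have "?f j \<le> ?f j0" using j j0 by (simp add: wt_remove)
  then have "?f j = ?f j0" using min[of j] j by simp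
  then show "min_attained_twice J ?f" unfolding min_attained_twice_def using j j0 min
    by (intro bexI[of _ j0] bexI[of _ j]) auto
qed

text \<open>Let \<open>B\<close> be a minimizer without \<open>x\<close>. The minimum over
  \<open>insert x B\<close> is attained at some \<open>j\<close> other than \<open>x\<close>, and
  removing that \<open>j\<close> gives a minimizer containing \<open>x\<close>.\<close>

lemma loopfree_if_tropical_linear_space:
  fixes p :: "'n::finite set \<Rightarrow> real"
  assumes w: "w \<in> tropical_linear_space d p" and ne: "minimizers d p w \<noteq> {}"
  shows "\<not> is_loop (minimizers d p w) x"
proof
  assume l: "is_loop (minimizers d p w) x"
  obtain B where B: "B \<in> minimizers d p w" using ne by blast
  then have B': "card B = d" "\<And>I. card I = d \<Longrightarrow> p B - wt w B \<le> p I - wt w I" "x \<notin> B"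
    using l unfolding minimizers_eq_opt opt_def is_loop_def by auto
  let ?J = "insert x B"
  let ?f = "\<lambda>j. p (?J - {j}) + w $ j"
  have cJ: "card ?J = d + 1" using B' by simp
  then have "min_attained_twice ?J ?f" using w unfolding tropical_linear_space_def by blast
  obtain j where j: "j \<in> ?J" "j \<noteq> x" "\<forall>k\<in>?J. ?f j \<le> ?f k"
  proof -
    from \<open>min_attained_twice ?J ?f\<close> obtain j k where jk: "j \<in> ?J" "k \<in> ?J" "j \<noteq> k" "?f j = ?f k" "\<forall>l\<in>?J. ?f j \<le> ?f l"
      unfolding min_attained_twice_def by blast
    show ?thesis
    proof (cases "j = x")
      case True
      show ?thesis by (rule that[of k]) (use True jk(2,3) jk(5)[unfolded jk(4)] in blast)+
    next
      case False
      show ?thesis by (rule that[OF jk(1) False jk(5)])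
    qed
  qed
  have v: "?f k = p (?J - {k}) - wt w (?J - {k}) + wt w ?J" if "k \<in> ?J" for k
    using that by (simp only: wt_remove)
  have "?J - {x} = B" using B'(3) by auto
  then have vx: "?f x = p B - wt w B + wt w ?J" using v[of x] by simp
  have "?f j \<le> ?f x" using j(3) by blast
  then have le: "p (?J - {j}) - wt w (?J - {j}) \<le> p B - wt w B" unfolding vx v[OF j(1)] by simp
  have cj: "card (?J - {j}) = d" using cJ j(1) by (simp only: card_Diff_singleton)
  have "p (?J - {j}) - wt w (?J - {j}) \<le> p I - wt w I" if "card I = d" for I
    using le B'(2)[OF that] by linarith
  then have mem: "?J - {j} \<in> minimizers d p w"
    unfolding minimizers_eq_opt opt_def mem_Collect_eq using cj by blast
  have "x \<in> ?J - {j}" using j(2) by blast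
  with bspec[OF l[unfolded is_loop_def] mem] show False by (rule notE)
qed

text \<open>Measuring progress against a fixed optimal pair \<open>I1, K1\<close> makes the alternating sequence of
  exchanges terminate.\<close>

lemma exchange_chain:
  fixes f f' :: "'n::finite set \<Rightarrow> real"
  assumes "vex d f" "vex d' f'" "card I1 = d" "card K1 = d'"
    and "\<And>I. card I = d \<Longrightarrow> f I1 \<le> f I" "\<And>K. card K = d' \<Longrightarrow> f' K1 \<le> f' K" "I1 \<union> K1 = UNIV"
    and "card I = d" "card K = d'" "u \<in> I1 - I" "- (I \<union> K) \<subseteq> {u}" "u \<in> K \<Longrightarrow> u \<in> K1"
  shows "\<exists>R R' y. R \<union> R' = UNIV \<and> card R = d \<and> card R' = d' \<and> f R + f' R' \<le> f I + f' K \<and>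
    y \<in> I \<inter> K \<and> y \<notin> I1 \<inter> K1 \<and> R \<inter> R' = (I \<inter> K - {y}) \<union> ({u} \<inter> K)"
  using assms
proof (induction "card (I - I1) + card (K - K1)" arbitrary: f f' d d' I1 K1 I K u rule: less_induct)
  case less
  note vf = less.prems(1) and vf' = less.prems(2) and c1 = less.prems(3,4) and opt1 = less.prems(5,6)
    and cov1 = less.prems(7) and c = less.prems(8,9) and u = less.prems(10) and cov = less.prems(11) and uK = less.prems(12)
  obtain y where y: "y \<in> I - I1" "f (insert y (I1 - {u})) + f (insert u (I - {y})) \<le> f I1 + f I"
    using vexD[OF vf c1(1) c(1) u] by blast
  let ?I = "insert u (I - {y})"
  have cI: "card ?I = d" using card_swap[of I y u] u y c by simp
  have "card (insert y (I1 - {u})) = d" using card_swap[of I1 u y] u y c1 by simp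
  then have le: "f ?I \<le> f I" using opt1(1)[of "insert y (I1 - {u})"] y(2) by simp
  show ?case
  proof (cases "y \<in> K")
    case True
    show ?thesis
    proof (intro exI conjI)
      show "?I \<union> K = UNIV" using cov True by blast
      show "?I \<inter> K = (I \<inter> K - {y}) \<union> ({u} \<inter> K)" by blast
      show "card ?I = d" by (rule cI)
      show "card K = d'" by (rule c(2))
      show "f ?I + f' K \<le> f I + f' K" using le by simp
      show "y \<in> I \<inter> K" "y \<notin> I1 \<inter> K1" using y(1) True by blast+
    qed
  next
    case False
    have yu: "y \<noteq> u" using y u by blast
    have yK1: "y \<in> K1" using cov1 y by blast
    have "?I - I1 = (I - I1) - {y}" using u by blast
    moreover have "card ((I - I1) - {y}) < card (I - I1)" using y(1) by (intro card_Diff1_less) auto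
    ultimately have lt: "card (K - K1) + card (?I - I1) < card (I - I1) + card (K - K1)" by simp
    have covn: "- (K \<union> ?I) \<subseteq> {y}" using cov by blast
    have cov1': "K1 \<union> I1 = UNIV" using cov1 by blast
    have yK: "y \<in> K1 - K" using yK1 False by blast
    have ynI: "y \<in> ?I \<Longrightarrow> y \<in> I1" using yu by blast
    \<comment> \<open>The removed \<open>y\<close> is now uncovered, and it is the turn of
      \<open>K\<close> to take it in. The two sides change roles with \<open>y\<close> as the
      missing element, while \<open>I\<close> has come closer to \<open>I1\<close>.\<close>
    have "\<exists>R R' z. R \<union> R' = UNIV \<and> card R = d' \<and> card R' = d \<and> f' R + f R' \<le> f' K + f ?I \<and>
      z \<in> K \<inter> ?I \<and> z \<notin> K1 \<inter> I1 \<and> R \<inter> R' = (K \<inter> ?I - {z}) \<union> ({y} \<inter> ?I)"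
      by (rule less.hyps[OF lt vf' vf c1(2,1) opt1(2,1) cov1' c(2) cI yK covn ynI])
    then obtain R R' z where R: "R \<union> R' = UNIV" "card R = d'" "card R' = d" "f' R + f R' \<le> f' K + f ?I"
      "z \<in> K \<inter> ?I" "z \<notin> K1 \<inter> I1" "R \<inter> R' = (K \<inter> ?I - {z}) \<union> ({y} \<inter> ?I)"
      by (elim exE conjE)
    have zu: "z \<noteq> u" using R(5,6) u uK by blast
    show ?thesis
    proof (intro exI conjI)
      show "R' \<union> R = UNIV" using R(1) by (simp only: Un_commute)
      show "R' \<inter> R = (I \<inter> K - {z}) \<union> ({u} \<inter> K)"
      proof -
        have "(K \<inter> ?I - {z}) \<union> ({y} \<inter> ?I) = (I \<inter> K - {z}) \<union> ({u} \<inter> K)" using False yu zu by blast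
        then show ?thesis using R(7) by (simp only: Int_commute)
      qed
      show "card R' = d" "card R = d'" by (rule R)+
      show "f R' + f' R \<le> f I + f' K" using R(4) le by linarith
      show "z \<in> I \<inter> K" "z \<notin> I1 \<inter> K1" using R(5,6) zu by blast+
    qed
  qed
qed

lemma opt_raise_coloop:
  fixes \<B> :: "'a::finite set set"
  assumes "is_coloop (opt \<B> P w) x" "t \<ge> 0" "\<B> \<noteq> {}"
  shows "opt \<B> P (w + t *\<^sub>R axis x 1) = opt \<B> P w"
proof -
  have "wt (axis x 1) B = (if x \<in> B then 1 else 0)" for B :: "'a set"
    by (simp add: wt_def axis_def)
  then have ax: "wt (w + t *\<^sub>R axis x 1) B = wt w B + (if x \<in> B then t else 0)" for B
    by simp
  obtain B0 where B0: "B0 \<in> opt \<B> P w" using opt_nonempty[OF assms(3)] by blast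
  have xB: "x \<in> B" if "B \<in> opt \<B> P w" for B using assms(1) that unfolding is_coloop_def by blast
  show ?thesis
  proof (rule set_eqI)
    fix C
    show "C \<in> opt \<B> P (w + t *\<^sub>R axis x 1) \<longleftrightarrow> C \<in> opt \<B> P w"
    proof
      assume C: "C \<in> opt \<B> P (w + t *\<^sub>R axis x 1)"
      have "B0 \<in> \<B>" using B0 opt_subset by blast
      then have "P C - wt (w + t *\<^sub>R axis x 1) C \<le> P B0 - wt (w + t *\<^sub>R axis x 1) B0"
        using C unfolding opt_def by blast
      then have le: "P C - wt w C \<le> P B0 - wt w B0" unfolding ax using xB[OF B0] assms(2) by (simp split: if_splits)
      have "C \<in> \<B>" using C opt_subset by blast
      moreover have "P C - wt w C \<le> P D - wt w D" if "D \<in> \<B>" for D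
        using le B0 that unfolding opt_def by (auto intro: order_trans)
      ultimately show "C \<in> opt \<B> P w" unfolding opt_def by blast
    next
      assume C: "C \<in> opt \<B> P w"
      have "P C - wt (w + t *\<^sub>R axis x 1) C \<le> P D - wt (w + t *\<^sub>R axis x 1) D" if D: "D \<in> \<B>" for D
      proof -
        have "P C - wt w C \<le> P D - wt w D" using C D unfolding opt_def by blast
        then show ?thesis unfolding ax using xB[OF C] assms(2) by simp
      qed
      moreover have "C \<in> \<B>" using C opt_subset by blast
      ultimately show "C \<in> opt \<B> P (w + t *\<^sub>R axis x 1)" unfolding opt_def by blast
    qed
  qed
qed

text \<open>With \<open>infdist_le_abs_diff\<close> this translates boundedness modulo the all-ones
  line into a bound on coordinate differences.\<close>

lemma abs_diff_le_infdist:
  fixes x :: "real ^ 'n::finite"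
  shows "\<bar>x $ i - x $ j\<bar> \<le> 2 * infdist x (span {1})"
proof -
  have "\<bar>x $ i - x $ j\<bar> / 2 \<le> infdist x (span {1 :: real ^ 'n})"
  proof (subst infdist_notempty)
    show "span {1 :: real ^ 'n} \<noteq> {}" using span_zero by blast
    show "\<bar>x $ i - x $ j\<bar> / 2 \<le> (INF a\<in>span {1 :: real ^ 'n}. dist x a)"
    proof (rule cINF_greatest)
      show "span {1 :: real ^ 'n} \<noteq> {}" using span_zero by blast
      fix y :: "real ^ 'n" assume "y \<in> span {1}"
      then obtain c where y: "y = c *\<^sub>R 1" unfolding span_singleton by blast
      have "\<bar>x $ i - c\<bar> \<le> dist x y" "\<bar>x $ j - c\<bar> \<le> dist x y"
        using component_le_norm_cart[of "x - y" i] component_le_norm_cart[of "x - y" j] by (simp_all add: y dist_norm)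
      moreover have "\<bar>x $ i - x $ j\<bar> \<le> \<bar>x $ i - c\<bar> + \<bar>x $ j - c\<bar>"
        using abs_triangle_ineq4[of "x $ i - c" "x $ j - c"] by simp
      ultimately have "\<bar>x $ i - x $ j\<bar> \<le> 2 * dist x y" by (smt (verit))
      then show "\<bar>x $ i - x $ j\<bar> / 2 \<le> dist x y" by simp
    qed
  qed
  then show ?thesis by simp
qed

lemma infdist_le_abs_diff:
  fixes x :: "real ^ 'n::finite"
  assumes "\<And>i j. \<bar>x $ i - x $ j\<bar> \<le> K"
  shows "infdist x (span {1}) \<le> real CARD('n) * K"
proof -
  obtain j :: 'n where True by blast
  have "infdist x (span {1}) \<le> dist x ((x $ j) *\<^sub>R 1)" by (intro infdist_le span_scale span_base) simp
  also have "\<dots> \<le> (\<Sum>i\<in>UNIV. \<bar>(x - (x $ j) *\<^sub>R 1) $ i\<bar>)" unfolding dist_norm by (rule norm_le_l1_cart)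
  also have "\<dots> \<le> (\<Sum>i\<in>(UNIV :: 'n set). K)" using assms by (intro sum_mono) simp
  finally show ?thesis by simp
qed

lemma vimage_swap:
  "Inl -` insert (Inl a) (S - {Inl b}) = insert a (Inl -` S - {b})" "Inr -` insert (Inl a) (S - {Inl b}) = Inr -` S"
  "Inr -` insert (Inr a) (S - {Inr b}) = insert a (Inr -` S - {b})" "Inl -` insert (Inr a) (S - {Inr b}) = Inl -` S"
  by auto

lemma mem_minimizers:
  "I \<in> minimizers d p w \<longleftrightarrow> card I = d \<and> (\<forall>K. card K = d \<longrightarrow> p I - wt w I \<le> p K - wt w K)"
  unfolding minimizers_def wt_def by simp

text \<open>Since \<open>u\<close> is also in \<open>K\<close>, it may leave \<open>I\<close>
  without destroying the covering, so by optimality the set obtained from \<open>I\<close> is no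
  better than \<open>I\<close>. The exchange inequality then makes the set obtained from
  \<open>K1\<close>, which gains \<open>u\<close>, no worse than \<open>K1\<close>.\<close>

lemma element_of_optimal_pair:
  fixes f :: "'n::finite set \<Rightarrow> real"
  assumes vx: "vex d f" and I: "card I = d" "I \<union> K = UNIV" "u \<in> I \<inter> K"
    and opt: "\<And>R. card R = d \<Longrightarrow> R \<union> K = UNIV \<Longrightarrow> f I \<le> f R" and K1: "card K1 = d"
  shows "\<exists>R. card R = d \<and> u \<in> R \<and> f R \<le> f K1"
proof (cases "u \<in> K1")
  case True then show ?thesis using K1 by blast
next
  case False
  then have "u \<in> I - K1" using I(3) by blast
  from vexD[OF vx I(1) K1 this] obtain y where y: "y \<in> K1 - I"
    "f (insert y (I - {u})) + f (insert u (K1 - {y})) \<le> f I + f K1" by blast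
  have "card (insert y (I - {u})) = d" using card_swap[of I u y] I y by simp
  moreover have "insert y (I - {u}) \<union> K = UNIV" using I(2,3) by blast
  ultimately have "f I \<le> f (insert y (I - {u}))" by (rule opt)
  moreover have "card (insert u (K1 - {y})) = d" using card_swap[of K1 y u] K1 y False by simp
  ultimately show ?thesis using y(2) by (intro exI[of _ "insert u (K1 - {y})"]) auto
qed

section \<open>The pair of tropical linear spaces\<close>

definition emb :: "real ^ 'n::finite \<Rightarrow> real ^ 'n \<Rightarrow> real ^ ('n + 'n)" where
  "emb a w = (\<chi> z. case z of Inl i \<Rightarrow> w $ i | Inr i \<Rightarrow> w $ i - a $ i)"

lemma emb_nth [simp]: "emb a w $ Inl i = w $ i" "emb a w $ Inr i = w $ i - a $ i"
  by (simp_all add: emb_def)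

lemma emb_simps: "lft (emb a w) = w" "rgt (emb a w) = w - a" "df (emb a w) = a" "hat UNIV (emb 0 w) = emb 0 w"
  by (simp_all add: vec_eq_iff split_sum_all)

lemma emb_lft: "df w = a \<Longrightarrow> emb a (lft w) = w"
  by (drule sym) (simp add: vec_eq_iff split_sum_all)

lemma emb_add: "emb a (w + u) = emb a w + emb 0 u"
  by (simp add: vec_eq_iff split_sum_all)

lemma minimizers_translate: "minimizers d (translate_pluecker a p) w = minimizers d p (w - a)"
  unfolding minimizers_eq_opt opt_def translate_pluecker_def wt_def[symmetric] by (simp add: algebra_simps)

locale pair =
  fixes p p' :: "'n::finite set \<Rightarrow> real" and d d' e :: nat
  assumes tp: "tropical_pluecker d p" and sp1: "series_parallel_tropical d p"
    and tp': "tropical_pluecker d' p'" and sp2: "series_parallel_tropical d' p'"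
    and ge: "CARD('n) \<le> d + d'" and e_def: "e = d + d' - CARD('n)"
begin

abbreviation "\<U> \<equiv> {I :: 'n set. card I = d}"
abbreviation "\<U>' \<equiv> {I :: 'n set. card I = d'}"
definition "bases = dirsum \<U> \<U>'"
definition "height = (\<lambda>B :: ('n + 'n) set. p (Inl -` B) + p' (Inr -` B))"

lemma dle: "d \<le> CARD('n)" "d' \<le> CARD('n)"
  using tp tp' unfolding tropical_pluecker_def by blast+

lemma U_ne: "\<U> \<noteq> {}" "\<U>' \<noteq> {}"
  using dle obtain_subset_with_card_n[of d "UNIV :: 'n set"] obtain_subset_with_card_n[of d' "UNIV :: 'n set"] by blast+

lemma opt_bases: "opt bases height w = dirsum (minimizers d p (lft w)) (minimizers d' p' (rgt w))"
  unfolding bases_def height_def minimizers_eq_opt by (rule opt_dirsum[OF U_ne])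

lemma mem_bases: "B \<in> bases \<longleftrightarrow> card (Inl -` B) = d \<and> card (Inr -` B) = d'"
  unfolding bases_def mem_dirsum by simp

lemma bases_exchange:
  assumes B: "B \<in> bases" and C: "C \<in> bases" and x: "x \<in> B - C"
  shows "\<exists>y\<in>C - B. insert y (B - {x}) \<in> bases \<and> insert x (C - {y}) \<in> bases \<and>
        height (insert y (B - {x})) + height (insert x (C - {y})) \<le> height B + height C"
proof -
  have c: "card (Inl -` B) = d" "card (Inr -` B) = d'" "card (Inl -` C) = d" "card (Inr -` C) = d'"
    using B C unfolding mem_bases by simp_all
  show ?thesis
  proof (cases x)
    case (Inl x0)
    then have e: "x0 \<in> Inl -` B - Inl -` C" using x by simp
    from valuated_exchange[OF tp c(1,3) e] obtain j where j: "j \<in> Inl -` C - Inl -` B"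
      "p (insert j (Inl -` B - {x0})) + p (insert x0 (Inl -` C - {j})) \<le> p (Inl -` B) + p (Inl -` C)" by blast
    have cc: "card (insert j (Inl -` B - {x0})) = d" "card (insert x0 (Inl -` C - {j})) = d"
      using card_swap[of "Inl -` B" x0 j] card_swap[of "Inl -` C" j x0] e j(1) c by simp_all
    show ?thesis unfolding Inl
      by (rule bexI[of _ "Inl j"]) (unfold mem_bases height_def vimage_swap, use cc c j in simp_all)
  next
    case (Inr x0)
    then have e: "x0 \<in> Inr -` B - Inr -` C" using x by simp
    from valuated_exchange[OF tp' c(2,4) e] obtain j where j: "j \<in> Inr -` C - Inr -` B"
      "p' (insert j (Inr -` B - {x0})) + p' (insert x0 (Inr -` C - {j})) \<le> p' (Inr -` B) + p' (Inr -` C)" by blast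
    have cc: "card (insert j (Inr -` B - {x0})) = d'" "card (insert x0 (Inr -` C - {j})) = d'"
      using card_swap[of "Inr -` B" x0 j] card_swap[of "Inr -` C" j x0] e j(1) c by simp_all
    show ?thesis unfolding Inr
      by (rule bexI[of _ "Inr j"]) (unfold mem_bases height_def vimage_swap, use cc c j in simp_all)
  qed
qed

text \<open>A large coordinate difference opens a gap around some \<open>H\<close>, and a bounded
  translation cannot close it. By \<open>gap_coloops\<close> the element \<open>i\<close> is then a
  coloop on both sides, which a good family excludes.\<close>

lemma bases_bounded:
  "\<exists>K. \<forall>w. good (opt bases height w) \<longrightarrow> (\<forall>i. \<bar>df w $ i\<bar> \<le> r) \<longrightarrow> (\<forall>i j. \<bar>w $ Inl i - w $ Inl j\<bar> \<le> K)"
proof -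
  define C where "C = (\<Sum>I\<in>UNIV. \<bar>p I\<bar>) + (\<Sum>I\<in>UNIV. \<bar>p' I\<bar>)"
  have s1: "\<bar>p I\<bar> \<le> (\<Sum>I\<in>UNIV. \<bar>p I\<bar>)" "\<bar>p' I\<bar> \<le> (\<Sum>I\<in>UNIV. \<bar>p' I\<bar>)" for I
    by (intro member_le_sum; simp)+
  have s2: "0 \<le> (\<Sum>I\<in>UNIV. \<bar>p I\<bar>)" "0 \<le> (\<Sum>I\<in>UNIV. \<bar>p' I\<bar>)" by (simp_all add: sum_nonneg)
  have C: "\<bar>p I\<bar> \<le> C" "\<bar>p' I\<bar> \<le> C" "0 \<le> C" for I
    unfolding C_def using s1[of I] s2 by (simp_all add: add_increasing add_increasing2)
  \<comment> \<open>\<open>2 * C\<close> is what \<open>gap_coloops\<close> needs,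
    \<open>2 * \<bar>r\<bar>\<close> is lost in passing from the first point to the second, and
    \<open>1\<close> makes \<open>g\<close> positive.\<close>
  define g where "g = 2 * C + 2 * \<bar>r\<bar> + 1"
  have g: "g > 0" using C(3) by (simp add: g_def)
  have aux: "w $ Inl i - w $ Inl j \<le> real CARD('n) * g"
    if gd: "good (opt bases height w)" and r: "\<forall>i. \<bar>df w $ i\<bar> \<le> r" for w i j
  proof (rule ccontr)
    assume "\<not> ?thesis"
    then have "lft w $ i - lft w $ j > real CARD('n) * g" by simp
    from find_gap[OF g this] obtain H where H: "i \<in> H" "j \<notin> H"
      "\<And>h e. h \<in> H \<Longrightarrow> e \<notin> H \<Longrightarrow> lft w $ h - lft w $ e > g" by blast
    let ?M = "minimizers d p (lft w)" and ?M' = "minimizers d' p' (rgt w)"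
    have nl: "\<not> is_loop ?M j" "\<not> is_loop ?M' j"
      using gd is_loop_dirsum[of ?M j ?M'] is_loop_dirsum(2)[of ?M' j ?M] unfolding good_def opt_bases by blast+
    have c1: "is_coloop ?M i"
    proof (rule gap_coloops[OF C(1) _ H(2) nl(1) H(1)])
      fix h e assume "h \<in> H" "e \<notin> H"
      from H(3)[OF this] show "lft w $ h - lft w $ e > 2 * C" unfolding g_def by linarith
    qed
    have c2: "is_coloop ?M' i"
    proof (rule gap_coloops[OF C(2) _ H(2) nl(2) H(1)])
      fix h e assume he: "h \<in> H" "e \<notin> H"
      have "\<bar>w $ Inl h - w $ Inr h\<bar> \<le> r" "\<bar>w $ Inl e - w $ Inr e\<bar> \<le> r" using r by simp_all
      then show "rgt w $ h - rgt w $ e > 2 * C" using H(3)[OF he] unfolding g_def lft_rgt_nth by linarith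
    qed
    have "Inl i \<in> B" "Inr i \<in> B" if "B \<in> dirsum ?M ?M'" for B
      using that[unfolded mem_dirsum] c1 c2 unfolding is_coloop_def by blast+
    then have "is_coloop (dirsum ?M ?M') (Inl i)" "is_coloop (dirsum ?M ?M') (Inr i)"
      unfolding is_coloop_def by blast+
    then show False using gd unfolding good_def opt_bases by blast
  qed
  have "\<bar>w $ Inl i - w $ Inl j\<bar> \<le> real CARD('n) * g"
    if gd: "good (opt bases height w)" and r: "\<forall>i. \<bar>df w $ i\<bar> \<le> r" for w i j
    using aux[OF gd r, of i j] aux[OF gd r, of j i] by linarith
  then show ?thesis by blast
qed

sublocale wall bases height "d + d'"
proof
  obtain I K :: "'n set" where "card I = d" "card K = d'" using U_ne by blast
  then have "jn I K \<in> bases" unfolding mem_bases by simp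
  then show "bases \<noteq> {}" by blast
  show "sp_family (opt bases height w)" for w unfolding opt_bases
    by (intro sp_family_dirsum series_parallel_tropical_minimizers sp1 sp2 U_ne)
  show "card B = d + d'" if B: "B \<in> bases" for B
  proof -
    have "card (jn I K) = card I + card K" for I K :: "'n set"
      unfolding jn_def by (subst card_Un_disjoint) (auto simp: card_image)
    from this[of "Inl -` B" "Inr -` B"] show ?thesis using B unfolding jn_vimage mem_bases by simp
  qed
qed (use bases_exchange bases_bounded in blast)+

abbreviation "M1 w \<equiv> minimizers d p w"
abbreviation "M2 a w \<equiv> minimizers d' p' (w - a)"
abbreviation "Mh a w \<equiv> OP (emb a w)"
abbreviation "q a \<equiv> intersection_pluecker d p d' (translate_pluecker a p')"
abbreviation "N a w \<equiv> minimizers e (q a) w"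
abbreviation "loopfree M \<equiv> \<forall>x. \<not> is_loop M x"
abbreviation "f w \<equiv> \<lambda>I. p I - wt w I"
abbreviation "f' a w \<equiv> \<lambda>K. p' K - wt (w - a) K"

lemma Mh_eq: "Mh a w = dirsum (M1 w) (M2 a w)"
  unfolding opt_bases emb_simps ..

lemma cellat_iff: "cellat a M \<longleftrightarrow> (\<exists>w. Mh a w = M)"
proof
  assume "cellat a M"
  then obtain w where "df w = a" "OP w = M" unfolding cellat_def by blast
  then have "Mh a (lft w) = M" by (simp only: emb_lft)
  then show "\<exists>w. Mh a w = M" by (rule exI)
next
  assume "\<exists>w. Mh a w = M"
  then obtain w where "Mh a w = M" by (rule exE)
  then show "cellat a M" unfolding cellat_def by (intro exI[of _ "emb a w"] conjI emb_simps(3))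
qed

lemma loopfree_Mh: "loopfree (Mh a w) \<longleftrightarrow> loopfree (M1 w) \<and> loopfree (M2 a w)"
proof
  assume L: "loopfree (Mh a w)"
  have "\<not> is_loop (M1 w) x" for x using L[unfolded Mh_eq, rule_format, of "Inl x"] by (rule contrapos_nn) (rule is_loop_dirsum)
  moreover have "\<not> is_loop (M2 a w) x" for x using L[unfolded Mh_eq, rule_format, of "Inr x"] by (rule contrapos_nn) (rule is_loop_dirsum)
  ultimately show "loopfree (M1 w) \<and> loopfree (M2 a w)" by simp
next
  assume L: "loopfree (M1 w) \<and> loopfree (M2 a w)"
  have "\<not> is_loop (dirsum (M1 w) (M2 a w)) x" for x
  proof (cases x)
    case (Inl i)
    obtain I where "I \<in> M1 w" "i \<in> I" using L unfolding is_loop_def by blast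
    moreover obtain K where "K \<in> M2 a w" using L unfolding is_loop_def by blast
    ultimately have "jn I K \<in> dirsum (M1 w) (M2 a w)" "Inl i \<in> jn I K" unfolding mem_dirsum by simp_all
    then show ?thesis unfolding is_loop_def Inl by blast
  next
    case (Inr i)
    obtain K where "K \<in> M2 a w" "i \<in> K" using L unfolding is_loop_def by blast
    moreover obtain I where "I \<in> M1 w" using L unfolding is_loop_def by blast
    ultimately have "jn I K \<in> dirsum (M1 w) (M2 a w)" "Inr i \<in> jn I K" unfolding mem_dirsum by simp_all
    then show ?thesis unfolding is_loop_def Inr by blast
  qed
  then show "loopfree (Mh a w)" unfolding Mh_eq by (rule allI)
qed

lemma vex_f: "vex d (f w)" "vex d' (f' a w)"
  by (rule vex_minus_wt[OF tp], rule vex_minus_wt[OF tp'])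

lemma translate_value: "translate_pluecker a p' K - wt w K = f' a w K"
  unfolding translate_pluecker_def wt_def[symmetric] by simp

lemma face_of_loopfree:
  assumes vx: "\<And>w. vex k (\<lambda>I. r I - wt w I)" and nl: "loopfree (minimizers k r x)"
  shows "closure {u. minimizers k r u = minimizers k r x} \<in> tropical_faces k r"
proof -
  have "{u. minimizers k r u = minimizers k r x} \<subseteq> tropical_linear_space k r"
  proof
    fix u assume "u \<in> {u. minimizers k r u = minimizers k r x}"
    then have "minimizers k r u = minimizers k r x" by simp
    then have "loopfree (minimizers k r u)" using nl by simp
    then show "u \<in> tropical_linear_space k r" using tropical_linear_space_if_loopfree[OF vx] by blast
  qed
  moreover have "x \<in> {u. minimizers k r u = minimizers k r x}" by simp
  ultimately show ?thesis unfolding tropical_faces_def by blast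
qed

text \<open>Without loops both points lie in relative interiors of faces, whose direction spaces are
  the two lineality spaces. That these span everything means precisely that the lineality space of
  the direct sum realizes all differences.\<close>

lemma meet_transversely_transv:
  assumes mt: "meet_transversely d p d' (translate_pluecker a p')"
  shows "transv a"
  unfolding transv_def
proof (intro allI impI)
  fix w assume w: "df w = a" and nl: "loopfree (OP w)"
  define x where "x = lft w"
  have wx: "w = emb a x" unfolding x_def using emb_lft[OF w] by simp
  have nl12: "loopfree (M1 x)" "loopfree (M2 a x)" using nl unfolding wx loopfree_Mh by blast+
  let ?t = "translate_pluecker a p'"
  have F: "closure {u. M1 u = M1 x} \<in> tropical_faces d p"
    by (rule face_of_loopfree[OF vex_f(1) nl12(1)])
  have F': "closure {u. minimizers d' ?t u = minimizers d' ?t x} \<in> tropical_faces d' ?t"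
  proof (rule face_of_loopfree)
    show "vex d' (\<lambda>I. ?t I - wt v I)" for v unfolding translate_value by (rule vex_f(2))
    show "loopfree (minimizers d' ?t x)" unfolding minimizers_translate by (rule nl12(2))
  qed
  have ri: "x \<in> rel_interior (closure {u. M1 u = M1 x})" "x \<in> rel_interior (closure {u. minimizers d' ?t u = minimizers d' ?t x})"
    unfolding minimizers_eq_opt rel_interior_cell[OF U_ne(1)] rel_interior_cell[OF U_ne(2)] by simp_all
  have "span (direction_space (closure {u. M1 u = M1 x}) \<union> direction_space (closure {u. minimizers d' ?t u = minimizers d' ?t x})) = UNIV"
    using mt F F' ri unfolding meet_transversely_def by blast
  moreover have "direction_space (closure {u. M1 u = M1 x}) = lin (M1 x)"
    unfolding minimizers_eq_opt by (rule direction_space_cell[OF U_ne(1)])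
  moreover have "direction_space (closure {u. minimizers d' ?t u = minimizers d' ?t x}) = lin (minimizers d' ?t x)"
    unfolding minimizers_eq_opt by (rule direction_space_cell[OF U_ne(2)])
  moreover have "minimizers d' ?t x = M2 a x" by (rule minimizers_translate)
  ultimately have sU: "span (lin (M1 x) \<union> lin (M2 a x)) = UNIV" by simp
  show "fills UNIV (lin (OP w))" unfolding fills_def
  proof
    fix z :: "'n \<Rightarrow> real"
    have "(\<chi> i. z i) \<in> span (lin (M1 x) \<union> lin (M2 a x))" unfolding sU by simp
    then obtain u u' where u: "(\<chi> i. z i) = u + u'" "u \<in> span (lin (M1 x))" "u' \<in> span (lin (M2 a x))"
      unfolding span_Un by blast
    have uu: "u \<in> lin (M1 x)" "u' \<in> lin (M2 a x)"
      using u(2,3) subspace_lin[of "M1 x"] subspace_lin[of "M2 a x"] span_eq_iff by metis+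
    \<comment> \<open>The sign turns the sum \<open>u + u'\<close> into a difference of the two
      copies.\<close>
    define v :: "real ^ ('n + 'n)" where "v = (\<chi> s. case s of Inl i \<Rightarrow> u $ i | Inr i \<Rightarrow> - u' $ i)"
    have lr: "lft v = u" "rgt v = - u'" unfolding v_def by (simp_all add: vec_eq_iff)
    have "v \<in> lin (OP w)"
    proof (rule linI)
      fix B C assume "B \<in> OP w" "C \<in> OP w"
      then have BC: "Inl -` B \<in> M1 x" "Inr -` B \<in> M2 a x" "Inl -` C \<in> M1 x" "Inr -` C \<in> M2 a x"
        unfolding wx Mh_eq mem_dirsum by simp_all
      show "wt v B = wt v C" unfolding wt_sum_split[of v B] wt_sum_split[of v C] lr
        using linD[OF uu(1) BC(1,3)] linD[OF uu(2) BC(2,4)] by simp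
    qed
    moreover have "v $ Inl i - v $ Inr i = z i" for i using arg_cong[OF u(1), of "\<lambda>x. x $ i"] by (simp add: v_def)
    ultimately show "\<exists>v\<in>lin (OP w). \<forall>i\<in>UNIV. v $ Inl i - v $ Inr i = z i" by blast
  qed
qed

lemma card_Int_covering:
  assumes "card I = d" "card K = d'" "I \<union> K = (UNIV :: 'n set)"
  shows "card (I \<inter> K) = e"
  using card_Un_Int[of I K] assms unfolding e_def by simp

lemma covering_if_card_Int:
  fixes I K :: "'n set"
  assumes "card I = d" "card K = d'" "card (I \<inter> K) = e"
  shows "I \<union> K = UNIV"
proof -
  have "card (I \<union> K) = CARD('n)" using card_Un_Int[of I K] assms ge unfolding e_def by simp
  then show ?thesis by (intro card_eq_UNIV_imp_eq_UNIV) auto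
qed

text \<open>For a covering pair the weights of union and intersection add up, so subtracting the
  weight of the intersection splits into the two separate objectives, up to a constant.\<close>

lemma covering_value:
  assumes "I \<union> K = UNIV"
  shows "p I + translate_pluecker a p' K - wt w (I \<inter> K) = f w I + f' a w K + wt w UNIV"
proof -
  have "wt w UNIV + wt w (I \<inter> K) = wt w I + wt w K"
    using sum.union_inter[of I K "\<lambda>i. w $ i"] unfolding assms wt_def by simp
  then show ?thesis using translate_value[of a K w] by linarith
qed

lemma q_set_image:
  "{p I + r K | I K. card I = d \<and> card K = d' \<and> I \<inter> K = J} = (\<lambda>(I, K). p I + r K) ` {(I, K). card I = d \<and> card K = d' \<and> I \<inter> K = J}"
  by auto

lemma q_le:
  assumes "card I = d" "card K = d'" "I \<union> K = UNIV"
  shows "q a (I \<inter> K) - wt w (I \<inter> K) \<le> f w I + f' a w K + wt w UNIV"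
proof -
  have "q a (I \<inter> K) \<le> p I + translate_pluecker a p' K"
    unfolding intersection_pluecker_def q_set_image
    by (rule Min_le) (use assms in \<open>auto intro!: image_eqI[of _ _ "(I, K)"]\<close>)
  then show ?thesis using covering_value[OF assms(3), of a w] by linarith
qed

lemma q_attained:
  assumes "card J = e"
  obtains I K where "card I = d" "card K = d'" "I \<union> K = UNIV" "I \<inter> K = J" "q a J = p I + translate_pluecker a p' K"
proof -
  let ?S = "{(I, K). card I = d \<and> card K = d' \<and> I \<inter> K = J}"
  have cC: "card (- S) = CARD('n) - card S" for S :: "'n set" by (simp add: Compl_eq_Diff_UNIV card_Diff_subset)
  have "CARD('n) - d \<le> card (- J)" using assms dle ge unfolding e_def by (simp add: cC)
  then obtain A where A: "A \<subseteq> - J" "card A = CARD('n) - d" using obtain_subset_with_card_n by metis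
  have "card (- A) = d" using A dle by (simp add: cC)
  moreover have "card (J \<union> A) = d'" using A assms dle ge unfolding e_def by (subst card_Un_disjoint) auto
  moreover have "(- A) \<inter> (J \<union> A) = J" using A by blast
  ultimately have "(- A, J \<union> A) \<in> ?S" by simp
  then have "?S \<noteq> {}" by blast
  then have "q a J \<in> (\<lambda>(I, K). p I + translate_pluecker a p' K) ` ?S"
    unfolding intersection_pluecker_def q_set_image by (intro Min_in) auto
  then obtain I K where IK: "card I = d" "card K = d'" "I \<inter> K = J" "q a J = p I + translate_pluecker a p' K" by auto
  moreover have "I \<union> K = UNIV" using covering_if_card_Int[OF IK(1,2)] IK(3) assms by simp
  ultimately show ?thesis using that by blast
qed

text \<open>Once some covering pair consists of minimizers, the minimum over covering pairs equals
  the sum of the two separate minima. Hence all optimal covering pairs consist of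
  minimizers.\<close>

lemma mem_N_iff:
  assumes cov: "I0 \<in> M1 w" "K0 \<in> M2 a w" "I0 \<union> K0 = UNIV"
  shows "J \<in> N a w \<longleftrightarrow> (\<exists>I\<in>M1 w. \<exists>K\<in>M2 a w. I \<union> K = UNIV \<and> J = I \<inter> K)"
proof
  have c0: "card I0 = d" "card K0 = d'" and m0: "\<And>I. card I = d \<Longrightarrow> f w I0 \<le> f w I" "\<And>K. card K = d' \<Longrightarrow> f' a w K0 \<le> f' a w K"
    using cov(1,2) unfolding mem_minimizers by blast+
  {
    assume J: "J \<in> N a w"
    then have cJ: "card J = e" and Jm: "\<And>L. card L = e \<Longrightarrow> q a J - wt w J \<le> q a L - wt w L"
      unfolding mem_minimizers by blast+
    from q_attained[OF cJ, of a] obtain I K where IK: "card I = d" "card K = d'" "I \<union> K = UNIV" "I \<inter> K = J"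
      "q a J = p I + translate_pluecker a p' K" by blast
    have "f w I + f' a w K + wt w UNIV \<le> f w I0 + f' a w K0 + wt w UNIV"
      using covering_value[OF IK(3), of a w] Jm[OF card_Int_covering[OF c0 cov(3)]] q_le[OF c0 cov(3), of a w] IK(4,5) by simp
    then have eq: "f w I \<le> f w I0" "f' a w K \<le> f' a w K0" using m0(1)[OF IK(1)] m0(2)[OF IK(2)] by linarith+
    have "I \<in> M1 w" unfolding mem_minimizers using IK(1) order_trans[OF eq(1) m0(1)] by blast
    moreover have "K \<in> M2 a w" unfolding mem_minimizers using IK(2) order_trans[OF eq(2) m0(2)] by blast
    ultimately show "\<exists>I\<in>M1 w. \<exists>K\<in>M2 a w. I \<union> K = UNIV \<and> J = I \<inter> K" using IK(3,4) by blast
  }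
  {
    assume "\<exists>I\<in>M1 w. \<exists>K\<in>M2 a w. I \<union> K = UNIV \<and> J = I \<inter> K"
    then obtain I K where IK: "I \<in> M1 w" "K \<in> M2 a w" "I \<union> K = UNIV" "J = I \<inter> K" by blast
    have c: "card I = d" "card K = d'" and m: "\<And>R. card R = d \<Longrightarrow> f w I \<le> f w R" "\<And>R. card R = d' \<Longrightarrow> f' a w K \<le> f' a w R"
      using IK(1,2) unfolding mem_minimizers by blast+
    have "q a J - wt w J \<le> q a L - wt w L" if L: "card L = e" for L
    proof -
      from q_attained[OF L, of a] obtain R S where RS: "card R = d" "card S = d'" "R \<union> S = UNIV" "R \<inter> S = L"
        "q a L = p R + translate_pluecker a p' S" by blast
      show ?thesis using covering_value[OF RS(3), of a w] q_le[OF c IK(3), of a w] m(1)[OF RS(1)] m(2)[OF RS(2)]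
        unfolding RS(4,5) IK(4) by linarith
    qed
    then show "J \<in> N a w" unfolding mem_minimizers using card_Int_covering[OF c IK(3)] IK(4) by blast
  }
qed

text \<open>No covering pair of minimizers is available here. The pair behind \<open>J\<close> is
  optimal only among covering pairs, but \<open>element_of_optimal_pair\<close> still places
  \<open>u\<close> in a minimizer on each side.\<close>

lemma N_nonloop:
  assumes "\<not> is_loop (N a w) u"
  shows "\<not> is_loop (M1 w) u" "\<not> is_loop (M2 a w) u"
proof -
  obtain J where J: "J \<in> N a w" "u \<in> J" using assms unfolding is_loop_def by blast
  have cJ: "card J = e" and Jm: "\<And>L. card L = e \<Longrightarrow> q a J - wt w J \<le> q a L - wt w L"
    using J(1) unfolding mem_minimizers by blast+
  from q_attained[OF cJ, of a] obtain I K where IK: "card I = d" "card K = d'" "I \<union> K = UNIV" "I \<inter> K = J"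
    "q a J = p I + translate_pluecker a p' K" by blast
  have best: "f w I + f' a w K \<le> f w R + f' a w S" if RS: "card R = d" "card S = d'" "R \<union> S = UNIV" for R S
    using covering_value[OF IK(3), of a w] Jm[OF card_Int_covering[OF RS]] q_le[OF RS, of a w] IK(4,5) by simp
  have u: "u \<in> I \<inter> K" "u \<in> K \<inter> I" using J(2) IK(4) by blast+
  have KI: "K \<union> I = UNIV" using IK(3) by blast
  obtain K1 where K1: "K1 \<in> M1 w" using opt_nonempty[OF U_ne(1)] unfolding minimizers_eq_opt by blast
  then have K1': "card K1 = d" "\<And>R. card R = d \<Longrightarrow> f w K1 \<le> f w R" unfolding mem_minimizers by blast+
  have "\<exists>R. card R = d \<and> u \<in> R \<and> f w R \<le> f w K1"
  proof (rule element_of_optimal_pair[OF vex_f(1) IK(1,3) u(1) _ K1'(1)])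
    show "f w I \<le> f w R" if "card R = d" "R \<union> K = UNIV" for R using best[OF that(1) IK(2) that(2)] by simp
  qed
  then obtain R where R: "card R = d" "u \<in> R" "f w R \<le> f w K1" by blast
  have "R \<in> M1 w" unfolding mem_minimizers using R(1) order_trans[OF R(3) K1'(2)] by blast
  then show "\<not> is_loop (M1 w) u" using R(2) unfolding is_loop_def by blast
  obtain K2 where K2: "K2 \<in> M2 a w" using opt_nonempty[OF U_ne(2)] unfolding minimizers_eq_opt by blast
  then have K2': "card K2 = d'" "\<And>R. card R = d' \<Longrightarrow> f' a w K2 \<le> f' a w R" unfolding mem_minimizers by blast+
  have "\<exists>R. card R = d' \<and> u \<in> R \<and> f' a w R \<le> f' a w K2"
  proof (rule element_of_optimal_pair[OF vex_f(2) IK(2) KI u(2) _ K2'(1)])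
    show "f' a w K \<le> f' a w R" if R: "card R = d'" "R \<union> I = UNIV" for R
    proof -
      have "I \<union> R = UNIV" using R(2) by blast
      from best[OF IK(1) R(1) this] show ?thesis by simp
    qed
  qed
  then obtain R where R: "card R = d'" "u \<in> R" "f' a w R \<le> f' a w K2" by blast
  have "R \<in> M2 a w" unfolding mem_minimizers using R(1) order_trans[OF R(3) K2'(2)] by blast
  then show "\<not> is_loop (M2 a w) u" using R(2) unfolding is_loop_def by blast
qed

lemma N_loopfree_Mh: "loopfree (N a w) \<Longrightarrow> loopfree (Mh a w)"
  unfolding loopfree_Mh using N_nonloop by blast

lemma N_nonempty: "N a w \<noteq> {}"
proof -
  have "e \<le> CARD('n)" using dle unfolding e_def by simp
  then obtain J :: "'n set" where "card J = e" using obtain_subset_with_card_n[of e UNIV] by metis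
  then have "{J :: 'n set. card J = e} \<noteq> {}" by blast
  from opt_nonempty[OF this] show ?thesis unfolding minimizers_eq_opt .
qed

lemma e_ne: "{J :: 'n set. card J = e} \<noteq> {}"
  using N_nonempty[of 0 0] unfolding mem_minimizers[abs_def] minimizers_def by blast

section \<open>Faces of the transverse intersection as cells of the pair\<close>

context
  fixes a assumes tr: "transv a"
begin

lemma Mh_Id:
  assumes nl: "loopfree (Mh a w)"
  shows "\<And>x. is_loop (Id UNIV (Mh a w)) x \<longleftrightarrow> x \<in> range Inr"
    "\<And>v. v \<in> lin (Id UNIV (Mh a w)) \<longleftrightarrow> hat UNIV v \<in> lin (Mh a w)"
    "dim (lin (Id UNIV (Mh a w))) = dim (lin (Mh a w))"
    "Id UNIV (Mh a w) \<noteq> {}"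
proof -
  have nl': "\<not> is_loop (Mh a w) x" for x using nl by blast
  have fl: "fills UNIV (lin (Mh a w))" using tr[unfolded transv_def, rule_format, OF emb_simps(3)] nl' by blast
  note I = Id_main[OF sp nl' fl]
  show "\<And>x. is_loop (Id UNIV (Mh a w)) x \<longleftrightarrow> x \<in> range Inr"
    "\<And>v. v \<in> lin (Id UNIV (Mh a w)) \<longleftrightarrow> hat UNIV v \<in> lin (Mh a w)"
    "dim (lin (Id UNIV (Mh a w))) = dim (lin (Mh a w))" using I by blast+
  show "Id UNIV (Mh a w) \<noteq> {}" by (rule Id_nonempty[OF sp nl' fl])
qed

text \<open>Gluing all twin pairs is the combinatorial form of intersecting: covering members are
  covering pairs, and gluing takes their intersection.\<close>

lemma mem_Id_Mh:
  "J \<in> Id UNIV (Mh a w) \<longleftrightarrow> (\<exists>I\<in>M1 w. \<exists>K\<in>M2 a w. I \<union> K = UNIV \<and> J = Inl ` (I \<inter> K))"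
proof
  assume "J \<in> Id UNIV (Mh a w)"
  then obtain B where B: "B \<in> Mh a w" "covers UNIV B" "J = glue UNIV B" unfolding Id_def by blast
  have "Inl -` B \<union> Inr -` B = UNIV" using B(2) unfolding covers_def by blast
  moreover have "J = Inl ` (Inl -` B \<inter> Inr -` B)" unfolding B(3) by (rule sum_set_eqI) auto
  moreover have "Inl -` B \<in> M1 w" "Inr -` B \<in> M2 a w" using B(1) unfolding Mh_eq mem_dirsum by blast+
  ultimately show "\<exists>I\<in>M1 w. \<exists>K\<in>M2 a w. I \<union> K = UNIV \<and> J = Inl ` (I \<inter> K)" by blast
next
  assume "\<exists>I\<in>M1 w. \<exists>K\<in>M2 a w. I \<union> K = UNIV \<and> J = Inl ` (I \<inter> K)"
  then obtain I K where IK: "I \<in> M1 w" "K \<in> M2 a w" "I \<union> K = UNIV" "J = Inl ` (I \<inter> K)" by blast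
  have "jn I K \<in> Mh a w" unfolding Mh_eq mem_dirsum using IK by simp
  moreover have "covers UNIV (jn I K)" unfolding covers_def using IK(3) by auto
  moreover have "J = glue UNIV (jn I K)" unfolding IK(4) by (rule sum_set_eqI) auto
  ultimately show "J \<in> Id UNIV (Mh a w)" unfolding Id_def by blast
qed

lemma N_iff:
  assumes nl: "loopfree (Mh a w)"
  shows "J \<in> N a w \<longleftrightarrow> (\<exists>I\<in>M1 w. \<exists>K\<in>M2 a w. I \<union> K = UNIV \<and> J = I \<inter> K)"
proof -
  obtain J0 where "J0 \<in> Id UNIV (Mh a w)" using Mh_Id(4)[OF nl] by blast
  then obtain I0 K0 where "I0 \<in> M1 w" "K0 \<in> M2 a w" "I0 \<union> K0 = UNIV" unfolding mem_Id_Mh by blast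
  then show ?thesis by (rule mem_N_iff)
qed

lemma Mh_covering_pair:
  assumes nl: "loopfree (Mh a w)"
  obtains I K where "I \<in> M1 w" "K \<in> M2 a w" "I \<union> K = UNIV" "x \<in> I \<inter> K"
proof -
  have "\<not> is_loop (Id UNIV (Mh a w)) (Inl x)" unfolding Mh_Id(1)[OF nl] by blast
  then obtain J where J: "J \<in> Id UNIV (Mh a w)" "Inl x \<in> J" unfolding is_loop_def by blast
  from J(1)[unfolded mem_Id_Mh] obtain I K where IK: "I \<in> M1 w" "K \<in> M2 a w" "I \<union> K = UNIV" "J = Inl ` (I \<inter> K)" by blast
  have "x \<in> I \<inter> K" using J(2) unfolding IK(4) by blast
  with IK(1-3) show ?thesis by (rule that)
qed

lemma Mh_loopfree_N:
  assumes nl: "loopfree (Mh a w)"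
  shows "loopfree (N a w)"
proof
  fix x
  obtain I K where IK: "I \<in> M1 w" "K \<in> M2 a w" "I \<union> K = UNIV" "x \<in> I \<inter> K" using Mh_covering_pair[OF nl] by blast
  then have "I \<inter> K \<in> N a w" unfolding N_iff[OF nl] by blast
  then show "\<not> is_loop (N a w) x" using IK(4) unfolding is_loop_def by blast
qed

text \<open>The exchange property of \<open>q a\<close> itself is bypassed. A covering pair behind
  the minimal \<open>J - {x}\<close> is improved by \<open>exchange_chain\<close> against a covering
  pair of minimizers containing \<open>x\<close>. The result is a pair for some
  \<open>J - {y}\<close> that is no worse, so the minimum is attained again at
  \<open>y\<close>.\<close>

lemma Mh_loopfree_space:
  assumes nl: "loopfree (Mh a w)"
  shows "w \<in> tropical_linear_space e (q a)"
  unfolding tropical_linear_space_def mem_Collect_eq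
proof (intro allI impI)
  fix J :: "'n set" assume J: "card J = e + 1"
  let ?g = "\<lambda>j. q a (J - {j}) + w $ j"
  have Jne: "J \<noteq> {}" using J by auto
  have "Min (?g ` J) \<in> ?g ` J" using Jne by (intro Min_in) auto
  then obtain x where x: "x \<in> J" "?g x = Min (?g ` J)" by auto
  have min: "?g x \<le> ?g k" if "k \<in> J" for k unfolding x(2) using that by (intro Min_le) auto
  have gv: "?g j = q a (J - {j}) - wt w (J - {j}) + wt w J" if "j \<in> J" for j using that by (simp add: wt_remove)
  let ?A = "J - {x}"
  have cA: "card ?A = e" using J x(1) by simp
  from q_attained[OF cA, of a] obtain I2 K2 where P2: "card I2 = d" "card K2 = d'" "I2 \<union> K2 = UNIV" "I2 \<inter> K2 = ?A"
    "q a ?A = p I2 + translate_pluecker a p' K2" by blast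
  obtain I1 K1 where P1: "I1 \<in> M1 w" "K1 \<in> M2 a w" "I1 \<union> K1 = UNIV" "x \<in> I1 \<inter> K1" using Mh_covering_pair[OF nl] by blast
  have c1: "card I1 = d" "card K1 = d'" and m1: "\<And>I. card I = d \<Longrightarrow> f w I1 \<le> f w I" "\<And>K. card K = d' \<Longrightarrow> f' a w K1 \<le> f' a w K"
    using P1(1,2) unfolding mem_minimizers by blast+
  have "\<exists>R R' y. R \<union> R' = UNIV \<and> card R = d \<and> card R' = d' \<and> f w R + f' a w R' \<le> f w I2 + f' a w K2 \<and>
    y \<in> ?A \<and> R \<inter> R' = J - {y}"
  \<comment> \<open>As \<open>x\<close> is not in the intersection but the pair covers everything,
    \<open>x\<close> is in exactly one of the two sets. The chain starts with the set that lacks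
    it.\<close>
  proof (cases "x \<in> I2")
    case False
    then have xK: "x \<in> K2" using P2(3) by blast
    have "\<exists>R R' y. R \<union> R' = UNIV \<and> card R = d \<and> card R' = d' \<and> f w R + f' a w R' \<le> f w I2 + f' a w K2 \<and>
      y \<in> I2 \<inter> K2 \<and> y \<notin> I1 \<inter> K1 \<and> R \<inter> R' = (I2 \<inter> K2 - {y}) \<union> ({x} \<inter> K2)"
      by (rule exchange_chain[OF vex_f(1) vex_f(2) c1 m1 P1(3) P2(1,2)]) (use P1(4) P2(3) False in blast)+
    then obtain R R' y where R: "R \<union> R' = UNIV" "card R = d" "card R' = d'" "f w R + f' a w R' \<le> f w I2 + f' a w K2"
      "y \<in> I2 \<inter> K2" "R \<inter> R' = (I2 \<inter> K2 - {y}) \<union> ({x} \<inter> K2)" by (elim exE conjE)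
    have "R \<inter> R' = J - {y}" using R(5,6) x(1) xK unfolding P2(4) by blast
    with R(1-4) R(5)[unfolded P2(4)] show ?thesis by (intro exI conjI)
  next
    case True
    have xA: "x \<notin> K2" using P2(4) True by blast
    have cov': "K1 \<union> I1 = UNIV" using P1(3) by blast
    have "\<exists>R R' y. R \<union> R' = UNIV \<and> card R = d' \<and> card R' = d \<and> f' a w R + f w R' \<le> f' a w K2 + f w I2 \<and>
      y \<in> K2 \<inter> I2 \<and> y \<notin> K1 \<inter> I1 \<and> R \<inter> R' = (K2 \<inter> I2 - {y}) \<union> ({x} \<inter> I2)"
      by (rule exchange_chain[OF vex_f(2) vex_f(1) c1(2,1) m1(2,1) cov' P2(2,1)]) (use P1(4) P2(3) xA in blast)+
    then obtain R R' y where R: "R \<union> R' = UNIV" "card R = d'" "card R' = d" "f' a w R + f w R' \<le> f' a w K2 + f w I2"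
      "y \<in> K2 \<inter> I2" "R \<inter> R' = (K2 \<inter> I2 - {y}) \<union> ({x} \<inter> I2)" by (elim exE conjE)
    have KI: "K2 \<inter> I2 = ?A" using P2(4) by blast
    have 1: "R' \<inter> R = J - {y}" using R(5,6) x(1) True unfolding KI by blast
    have 2: "R' \<union> R = UNIV" using R(1) by blast
    have 3: "f w R' + f' a w R \<le> f w I2 + f' a w K2" using R(4) by linarith
    from 2 R(3,2) 3 R(5)[unfolded KI] 1 show ?thesis by (intro exI conjI)
  qed
  then obtain R R' y where R: "R \<union> R' = UNIV" "card R = d" "card R' = d'" "f w R + f' a w R' \<le> f w I2 + f' a w K2"
    "y \<in> ?A" "R \<inter> R' = J - {y}" by (elim exE conjE)
  have y: "y \<in> J" "y \<noteq> x" using R(5) by blast+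
  have "?g y \<le> ?g x" unfolding gv[OF y(1)] gv[OF x(1)]
    using q_le[OF R(2,3,1), of a w] covering_value[OF P2(3), of a w] R(4) unfolding R(6) P2(4,5) by linarith
  then have gxy: "?g x = ?g y" using min[OF y(1)] by simp
  show "min_attained_twice J ?g" unfolding min_attained_twice_def
  proof (rule bexI[OF bexI[OF _ y(1)] x(1)], intro conjI ballI)
    show "x \<noteq> y" using y(2) by blast
    show "?g x = ?g y" by (rule gxy)
    fix k assume "k \<in> J" then show "?g x \<le> ?g k" by (rule min)
  qed
qed

lemma space_iff: "w \<in> tropical_linear_space e (q a) \<longleftrightarrow> loopfree (Mh a w)"
proof
  assume w: "w \<in> tropical_linear_space e (q a)"
  have "loopfree (N a w)" using loopfree_if_tropical_linear_space[OF w N_nonempty] by blast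
  then show "loopfree (Mh a w)" by (rule N_loopfree_Mh)
qed (rule Mh_loopfree_space)

lemma lin_N_iff:
  assumes nl: "loopfree (Mh a w)"
  shows "lft v \<in> lin (N a w) \<longleftrightarrow> v \<in> lin (Id UNIV (Mh a w))"
proof -
  have wtv: "wt v (Inl ` J) = wt (lft v) J" for J by (simp add: wt_def sum.reindex)
  have img: "J \<in> N a w \<Longrightarrow> Inl ` J \<in> Id UNIV (Mh a w)" for J unfolding N_iff[OF nl] mem_Id_Mh by blast
  have img': "\<exists>J'\<in>N a w. J = Inl ` J'" if J: "J \<in> Id UNIV (Mh a w)" for J
  proof -
    from J[unfolded mem_Id_Mh] obtain I K where IK: "I \<in> M1 w" "K \<in> M2 a w" "I \<union> K = UNIV" "J = Inl ` (I \<inter> K)" by blast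
    have "I \<inter> K \<in> N a w" unfolding N_iff[OF nl] using IK(1-3) by blast
    with IK(4) show ?thesis by (rule bexI)
  qed
  show ?thesis
  proof
    assume L: "lft v \<in> lin (N a w)"
    show "v \<in> lin (Id UNIV (Mh a w))"
    proof (rule linI)
      fix B C assume B: "B \<in> Id UNIV (Mh a w)" and C: "C \<in> Id UNIV (Mh a w)"
      obtain B' where B': "B' \<in> N a w" "B = Inl ` B'" using img'[OF B] by (rule bexE)
      obtain C' where C': "C' \<in> N a w" "C = Inl ` C'" using img'[OF C] by (rule bexE)
      note BC = B' C'
      show "wt v B = wt v C" unfolding BC(2,4) wtv by (rule linD[OF L BC(1,3)])
    qed
  next
    assume L: "v \<in> lin (Id UNIV (Mh a w))"
    show "lft v \<in> lin (N a w)"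
    proof (rule linI)
      fix B C assume BC: "B \<in> N a w" "C \<in> N a w"
      show "wt (lft v) B = wt (lft v) C" unfolding wtv[symmetric] by (rule linD[OF L img[OF BC(1)] img[OF BC(2)]])
    qed
  qed
qed

text \<open>After gluing all pairs, the right copies are loops and their coordinates are free. They
  contribute the summand \<open>CARD('n)\<close>, while gluing itself preserves the
  dimension.\<close>

lemma dim_lin_Mh:
  assumes nl: "loopfree (Mh a w)"
  shows "dim (lin (Mh a w)) = dim (lin (N a w)) + CARD('n)"
proof -
  define h :: "(real ^ 'n) \<times> (real ^ 'n) \<Rightarrow> real ^ ('n + 'n)" where
    "h x = (\<chi> s. case s of Inl i \<Rightarrow> fst x $ i | Inr i \<Rightarrow> snd x $ i)" for x
  have lr: "lft (h x) = fst x" "rgt (h x) = snd x" for x by (simp_all add: h_def vec_eq_iff)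
  have hl: "h (lft v, rgt v) = v" for v by (simp add: h_def vec_eq_iff split_sum_all)
  have lin: "linear h" by (rule linearI) (simp_all add: h_def vec_eq_iff split_sum_all)
  have inj: "inj h"
  proof (rule injI)
    fix x y assume "h x = h y"
    then have "fst x = fst y" "snd x = snd y" using lr by metis+
    then show "x = y" by (rule prod_eqI)
  qed
  have "lin (Id UNIV (Mh a w)) = h ` (lin (N a w) \<times> UNIV)"
  proof
    show "lin (Id UNIV (Mh a w)) \<subseteq> h ` (lin (N a w) \<times> UNIV)"
    proof
      fix v assume "v \<in> lin (Id UNIV (Mh a w))"
      then have "(lft v, rgt v) \<in> lin (N a w) \<times> UNIV" unfolding lin_N_iff[OF nl, symmetric] by simp
      then show "v \<in> h ` (lin (N a w) \<times> UNIV)" using hl[of v] by (metis imageI)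
    qed
    show "h ` (lin (N a w) \<times> UNIV) \<subseteq> lin (Id UNIV (Mh a w))"
    proof (rule image_subsetI)
      fix x assume "x \<in> lin (N a w) \<times> (UNIV :: (real ^ 'n) set)"
      then show "h x \<in> lin (Id UNIV (Mh a w))" unfolding lin_N_iff[OF nl, symmetric] lr by auto
    qed
  qed
  then have "dim (lin (Id UNIV (Mh a w))) = dim (lin (N a w) \<times> (UNIV :: (real ^ 'n) set))"
    using dim_image_eq[OF lin inj_on_subset[OF inj subset_UNIV]] by simp
  also have "\<dots> = dim (lin (N a w)) + CARD('n)" by (simp add: dim_Times subspace_lin)
  finally show ?thesis unfolding Mh_Id(3)[OF nl] .
qed

lemma covering_pair_value:
  assumes I: "I \<in> M1 w" and K: "K \<in> M2 a w" and cov: "I \<union> K = UNIV"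
  shows "q a (I \<inter> K) = p I + translate_pluecker a p' K"
proof -
  have c: "card I = d" "card K = d'" and m: "\<And>R. card R = d \<Longrightarrow> f w I \<le> f w R" "\<And>R. card R = d' \<Longrightarrow> f' a w K \<le> f' a w R"
    using I K unfolding mem_minimizers by blast+
  from q_attained[OF card_Int_covering[OF c cov], of a] obtain R S where RS: "card R = d" "card S = d'" "R \<union> S = UNIV"
    "R \<inter> S = I \<inter> K" "q a (I \<inter> K) = p R + translate_pluecker a p' S" by blast
  show ?thesis using covering_value[OF RS(3), of a w] covering_value[OF cov, of a w] q_le[OF c cov, of a w]
      m(1)[OF RS(1)] m(2)[OF RS(2)] unfolding RS(4,5) by linarith
qed

text \<open>A common member \<open>J\<close> has the same value \<open>q a J\<close> for both
  points, so the pair of minimizers behind it at \<open>w\<close> is also one at \<open>w'\<close>;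
  this gives a common member \<open>?B\<close>. The difference \<open>w' - w\<close> lifts to a
  lineality vector of \<open>Mh a w\<close>, along which all members keep pace with
  \<open>?B\<close>.\<close>

lemma Mh_subset:
  assumes nl: "loopfree (Mh a w)" "loopfree (Mh a w')" and N: "N a w' = N a w"
  shows "Mh a w \<subseteq> Mh a w'"
proof
  fix C assume C: "C \<in> Mh a w"
  obtain J where J: "J \<in> N a w" using N_nonempty by blast
  then have J': "J \<in> N a w'" unfolding N .
  from J[unfolded N_iff[OF nl(1)]] obtain I K where IK: "I \<in> M1 w" "K \<in> M2 a w" "I \<union> K = UNIV" "J = I \<inter> K" by blast
  from J'[unfolded N_iff[OF nl(2)]] obtain R S where RS: "R \<in> M1 w'" "S \<in> M2 a w'" "R \<union> S = UNIV" "J = R \<inter> S" by blast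
  have c: "card I = d" "card K = d'" using IK(1,2) unfolding mem_minimizers by blast+
  have m: "\<And>L. card L = d \<Longrightarrow> f w' R \<le> f w' L" "\<And>L. card L = d' \<Longrightarrow> f' a w' S \<le> f' a w' L"
    using RS(1,2) unfolding mem_minimizers by blast+
  have "p I + translate_pluecker a p' K = p R + translate_pluecker a p' S"
    using covering_pair_value[OF IK(1-3)] covering_pair_value[OF RS(1-3)] unfolding IK(4)[symmetric] RS(4)[symmetric] by simp
  then have "f w' I + f' a w' K = f w' R + f' a w' S"
    using covering_value[OF IK(3), of a w'] covering_value[OF RS(3), of a w'] unfolding IK(4)[symmetric] RS(4)[symmetric] by linarith
  then have le: "f w' I \<le> f w' R" "f' a w' K \<le> f' a w' S" using m(1)[OF c(1)] m(2)[OF c(2)] by linarith+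
  have "I \<in> M1 w'" unfolding mem_minimizers using c(1) order_trans[OF le(1) m(1)] by blast
  moreover have "K \<in> M2 a w'" unfolding mem_minimizers using c(2) order_trans[OF le(2) m(2)] by blast
  ultimately have B': "jn I K \<in> Mh a w'" unfolding Mh_eq mem_dirsum by simp
  have B: "jn I K \<in> Mh a w" unfolding Mh_eq mem_dirsum using IK by simp
  let ?B = "jn I K"
  have "w' - w \<in> lin (N a w)" using N unfolding minimizers_eq_opt by (rule opt_same_diff_lin)
  then have "lft (emb 0 (w' - w)) \<in> lin (N a w)" unfolding emb_simps .
  then have "emb 0 (w' - w) \<in> lin (Id UNIV (Mh a w))" by (rule lin_N_iff[OF nl(1), THEN iffD1])
  then have "hat UNIV (emb 0 (w' - w)) \<in> lin (Mh a w)" by (rule Mh_Id(2)[OF nl(1), THEN iffD1])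
  then have "emb 0 (w' - w) \<in> lin (Mh a w)" unfolding emb_simps(4) .
  from linD[OF this C B] have wt0: "wt (emb 0 (w' - w)) C = wt (emb 0 (w' - w)) ?B" .
  have "emb a w' = emb a w + emb 0 (w' - w)" using emb_add[of a w "w' - w"] by simp
  then have split: "wt (emb a w') D = wt (emb a w) D + wt (emb 0 (w' - w)) D" for D by simp
  have mem: "C \<in> bases" "?B \<in> bases" using B C opt_subset by blast+
  have "height C - wt (emb a w) C \<le> height ?B - wt (emb a w) ?B" using C mem unfolding opt_def by blast
  then have le: "height C - wt (emb a w') C \<le> height ?B - wt (emb a w') ?B" unfolding split wt0 by simp
  have "height C - wt (emb a w') C \<le> height D - wt (emb a w') D" if "D \<in> bases" for D
  proof -
    have "height ?B - wt (emb a w') ?B \<le> height D - wt (emb a w') D" using B' that unfolding opt_def by blast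
    with le show ?thesis by (rule order_trans)
  qed
  then show "C \<in> Mh a w'" unfolding opt_def using mem(1) by blast
qed

lemma same_cells:
  assumes nl: "loopfree (Mh a w)"
  shows "N a w' = N a w \<longleftrightarrow> Mh a w' = Mh a w"
proof
  assume N: "N a w' = N a w"
  have "loopfree (N a w')" unfolding N by (rule Mh_loopfree_N[OF nl])
  then have nl': "loopfree (Mh a w')" by (rule N_loopfree_Mh)
  show "Mh a w' = Mh a w" by (rule equalityI[OF Mh_subset[OF nl' nl N[symmetric]] Mh_subset[OF nl nl' N]])
next
  assume M: "Mh a w' = Mh a w"
  then have nl': "loopfree (Mh a w')" using nl by simp
  show "N a w' = N a w"
  proof (rule set_eqI)
    fix J
    have Id: "J \<in> N a v \<longleftrightarrow> Inl ` J \<in> Id UNIV (Mh a v)" if "loopfree (Mh a v)" for v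
      unfolding N_iff[OF that] mem_Id_Mh by (simp only: inj_image_eq_iff[OF inj_Inl])
    show "J \<in> N a w' \<longleftrightarrow> J \<in> N a w" unfolding Id[OF nl] Id[OF nl'] M ..
  qed
qed

definition "\<Phi> M = closure {w. Mh a w = M}"

lemma \<Phi>_eq:
  assumes nl: "loopfree (Mh a w)"
  shows "\<Phi> (Mh a w) = closure {u. N a u = N a w}"
  unfolding \<Phi>_def same_cells[OF nl] ..

lemma faces_eq: "tropical_faces e (q a) = \<Phi> ` {M. cellat a M \<and> loopfree M}"
proof (rule set_eqI)
  fix F
  show "F \<in> tropical_faces e (q a) \<longleftrightarrow> F \<in> \<Phi> ` {M. cellat a M \<and> loopfree M}"
  proof
    assume "F \<in> tropical_faces e (q a)"
    then obtain N0 where N0: "F = closure {u. N a u = N0}" "{u. N a u = N0} \<noteq> {}"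
      "{u. N a u = N0} \<subseteq> tropical_linear_space e (q a)" unfolding tropical_faces_def by blast
    obtain w where w: "N a w = N0" using N0(2) by blast
    have nl: "loopfree (Mh a w)" using N0(3) w unfolding space_iff[symmetric] by blast
    have "F = \<Phi> (Mh a w)" unfolding \<Phi>_eq[OF nl] w by (rule N0(1))
    then show "F \<in> \<Phi> ` {M. cellat a M \<and> loopfree M}" using nl cellat_iff by blast
  next
    assume "F \<in> \<Phi> ` {M. cellat a M \<and> loopfree M}"
    then obtain w where w: "F = \<Phi> (Mh a w)" and nl: "loopfree (Mh a w)" unfolding cellat_iff by blast
    have "u \<in> tropical_linear_space e (q a)" if "N a u = N a w" for u
    proof -
      have "Mh a u = Mh a w" using that same_cells[OF nl] by blast
      then show ?thesis unfolding space_iff using nl by simp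
    qed
    then have "{u. N a u = N a w} \<subseteq> tropical_linear_space e (q a)" by blast
    moreover have "w \<in> {u. N a u = N a w}" by simp
    ultimately show "F \<in> tropical_faces e (q a)" unfolding w \<Phi>_eq[OF nl] tropical_faces_def by blast
  qed
qed

lemma inj_\<Phi>: "inj_on \<Phi> {M. cellat a M \<and> loopfree M}"
proof (rule inj_onI)
  fix M M' assume "M \<in> {M. cellat a M \<and> loopfree M}" "M' \<in> {M. cellat a M \<and> loopfree M}" and eq: "\<Phi> M = \<Phi> M'"
  then obtain w w' where w: "M = Mh a w" "M' = Mh a w'" and nl: "loopfree (Mh a w)" "loopfree (Mh a w')"
    unfolding cellat_iff by blast
  have "closure {u. N a u = N a w} = closure {u. N a u = N a w'}"
    using eq unfolding w \<Phi>_eq[OF nl(1)] \<Phi>_eq[OF nl(2)] .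
  then have "N a w = N a w'" unfolding minimizers_eq_opt by (rule cell_determined_by_closure[OF e_ne])
  then show "M = M'" unfolding w using same_cells[OF nl(2)] by blast
qed

lemma aff_dim_\<Phi>:
  assumes nl: "loopfree (Mh a w)"
  shows "aff_dim (\<Phi> (Mh a w)) + int CARD('n) = int (dim (lin (Mh a w)))"
proof -
  have "aff_dim (closure {u. N a u = N a w}) = int (dim (lin (N a w)))"
    unfolding minimizers_eq_opt by (rule aff_dim_cell[OF e_ne])
  then show ?thesis unfolding \<Phi>_eq[OF nl] dim_lin_Mh[OF nl] by simp
qed

text \<open>An element that is a coloop on both sides can be raised in both points at once, which
  moves one coordinate away from the others without leaving the cell. This requires a second
  coordinate: over a single element everything is bounded modulo the all-ones line. The converse is
  the bound on good cells.\<close>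

lemma bounded_\<Phi>:
  assumes nl: "loopfree (Mh a w)" and two: "CARD('n) \<noteq> 1"
  shows "bounded_mod_ones (\<Phi> (Mh a w)) \<longleftrightarrow> good (Mh a w)"
proof
  assume gd: "good (Mh a w)"
  obtain K where K: "\<And>w. good (OP w) \<Longrightarrow> (\<forall>i. \<bar>df w $ i\<bar> \<le> norm a) \<Longrightarrow> (\<forall>i j. \<bar>w $ Inl i - w $ Inl j\<bar> \<le> K)"
    using bounded_cells[of "norm a"] by blast
  let ?B = "real CARD('n) * K"
  have "infdist u (span {1}) \<le> ?B" if u: "Mh a u = Mh a w" for u
  proof (rule infdist_le_abs_diff)
    fix i j
    have "\<forall>i. \<bar>df (emb a u) $ i\<bar> \<le> norm a" unfolding emb_simps using component_le_norm_cart by blast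
    moreover have "good (Mh a u)" unfolding u by (rule gd)
    ultimately have "\<bar>emb a u $ Inl i - emb a u $ Inl j\<bar> \<le> K" using K by blast
    then show "\<bar>u $ i - u $ j\<bar> \<le> K" by simp
  qed
  then have "{u. Mh a u = Mh a w} \<subseteq> {u. infdist u (span {1}) \<le> ?B}" by blast
  moreover have "closed {u :: real ^ 'n. infdist u (span {1}) \<le> ?B}"
    by (intro closed_Collect_le continuous_intros)
  ultimately have "\<Phi> (Mh a w) \<subseteq> {u. infdist u (span {1}) \<le> ?B}" unfolding \<Phi>_def by (rule closure_minimal)
  then show "bounded_mod_ones (\<Phi> (Mh a w))" unfolding bounded_mod_ones_def by blast
next
  assume bd: "bounded_mod_ones (\<Phi> (Mh a w))"
  then obtain B where B: "\<And>x. x \<in> \<Phi> (Mh a w) \<Longrightarrow> infdist x (span {1}) \<le> B" unfolding bounded_mod_ones_def by blast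
  show "good (Mh a w)"
  proof (rule ccontr)
    assume "\<not> good (Mh a w)"
    then obtain i where i: "is_coloop (Mh a w) (Inl i)" "is_coloop (Mh a w) (Inr i)" unfolding good_def using nl by blast
    have "\<exists>j. j \<noteq> i"
    proof (rule ccontr)
      assume "\<not> (\<exists>j. j \<noteq> i)"
      then have "(UNIV :: 'n set) = {i}" by blast
      then have "CARD('n) = card {i}" by simp
      then show False using two by simp
    qed
    then obtain j where j: "j \<noteq> i" by blast
    \<comment> \<open>Large enough that the difference of the coordinates \<open>i\<close> and
      \<open>j\<close> exceeds \<open>2 * B\<close>, whatever its value at \<open>w\<close>.\<close>
    define t where "t = 2 * \<bar>B\<bar> + 1 + \<bar>w $ i - w $ j\<bar>"
    have t: "t \<ge> 0" unfolding t_def by simp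
    have "emb a (w + t *\<^sub>R axis i 1) = emb a w + t *\<^sub>R axis (Inl i) 1 + t *\<^sub>R axis (Inr i) 1"
      by (simp add: vec_eq_iff split_sum_all axis_def)
    moreover have r1: "OP (emb a w + t *\<^sub>R axis (Inl i) 1) = Mh a w" by (rule opt_raise_coloop[OF i(1) t ne])
    moreover have "OP (emb a w + t *\<^sub>R axis (Inl i) 1 + t *\<^sub>R axis (Inr i) 1) = OP (emb a w + t *\<^sub>R axis (Inl i) 1)"
      by (rule opt_raise_coloop[OF _ t ne]) (unfold r1, rule i(2))
    ultimately have "Mh a (w + t *\<^sub>R axis i 1) = Mh a w" by simp
    then have "w + t *\<^sub>R axis i 1 \<in> \<Phi> (Mh a w)" unfolding \<Phi>_def by (intro subsetD[OF closure_subset] CollectI)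
    from B[OF this] have "\<bar>(w + t *\<^sub>R axis i 1) $ i - (w + t *\<^sub>R axis i 1) $ j\<bar> \<le> 2 * B"
      using abs_diff_le_infdist[of "w + t *\<^sub>R axis i 1" i j] by linarith
    moreover have "(w + t *\<^sub>R axis i 1) $ i - (w + t *\<^sub>R axis i 1) $ j = w $ i - w $ j + t"
      using j by (simp add: axis_def)
    ultimately show False unfolding t_def by linarith
  qed
qed

text \<open>The degree is shifted by \<open>CARD('n)\<close> because \<open>cnt\<close> measures
  lineality spaces on the doubled ground set, see \<open>dim_lin_Mh\<close>.\<close>

lemma count_faces:
  assumes two: "CARD('n) \<noteq> 1"
  shows "int (card {F \<in> tropical_faces e (q a). bounded_mod_ones F \<and> aff_dim F = int k}) = coeff (cnt a) (k + CARD('n))"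
proof -
  let ?Y = "{M. cellat a M \<and> loopfree M}"
  let ?S = "{M. (good M \<and> cellat a M) \<and> dim (lin M) = k + CARD('n)}"
  have key: "bounded_mod_ones (\<Phi> M) \<and> aff_dim (\<Phi> M) = int k \<longleftrightarrow> good M \<and> dim (lin M) = k + CARD('n)" if MY: "M \<in> ?Y" for M
  proof -
    obtain w where w: "M = Mh a w" and nl: "loopfree (Mh a w)" using MY unfolding cellat_iff by blast
    show ?thesis unfolding w bounded_\<Phi>[OF nl two] using aff_dim_\<Phi>[OF nl] by auto
  qed
  have "{F \<in> tropical_faces e (q a). bounded_mod_ones F \<and> aff_dim F = int k} = \<Phi> ` {M\<in>?Y. bounded_mod_ones (\<Phi> M) \<and> aff_dim (\<Phi> M) = int k}"
    unfolding faces_eq by blast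
  also have "{M\<in>?Y. bounded_mod_ones (\<Phi> M) \<and> aff_dim (\<Phi> M) = int k} = {M\<in>?Y. good M \<and> dim (lin M) = k + CARD('n)}"
    using key by (rule Collect_cong[OF conj_cong[OF refl]])
  also have "\<dots> = ?S" unfolding good_def by (rule Collect_cong) blast
  finally have "{F \<in> tropical_faces e (q a). bounded_mod_ones F \<and> aff_dim F = int k} = \<Phi> ` ?S" .
  moreover have "inj_on \<Phi> ?S" by (rule inj_on_subset[OF inj_\<Phi>]) (unfold good_def, blast)
  ultimately have "card {F \<in> tropical_faces e (q a). bounded_mod_ones F \<and> aff_dim F = int k} = card ?S"
    by (simp add: card_image)
  moreover have "coeff (cnt a) m = int (card {M. (good M \<and> cellat a M) \<and> dim (lin M) = m})" for m
  proof -
    have "coeff (tt ^ l) m = (if l = m then 1 else 0)" for l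
      using monom_altdef[of "1::int" l] unfolding tt_def by (simp add: coeff_monom[symmetric] del: coeff_monom)
    then have "coeff (cnt a) m = (\<Sum>M | good M \<and> cellat a M. if dim (lin M) = m then 1 else 0)"
      unfolding cnt_def by (simp add: coeff_sum)
    also have "\<dots> = int (card ({M. good M \<and> cellat a M} \<inter> {M. dim (lin M) = m}))"
      by (simp add: sum.If_cases)
    also have "{M. good M \<and> cellat a M} \<inter> {M. dim (lin M) = m} = {M. (good M \<and> cellat a M) \<and> dim (lin M) = m}"
      by (rule Collect_conj_eq[symmetric])
    finally show ?thesis .
  qed
  ultimately show ?thesis by simp
qed

end

end

section \<open>The one-element ground set, and the conclusion\<close>

text \<open>Over one element there is at most one set of each size and no minimum is attained twice,
  so the values of \<open>r\<close> have no influence on the faces.\<close>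

lemma tropical_faces_singleton_type:
  fixes r r' :: "'n::finite set \<Rightarrow> real"
  assumes "CARD('n) = 1"
  shows "tropical_faces k r = tropical_faces k r'"
proof -
  obtain x where x: "(UNIV :: 'n set) = {x}" using assms card_1_singletonE by blast
  have sets: "I = {} \<or> I = UNIV" for I :: "'n set" using x by (metis subset_singletonD subset_UNIV)
  have same: "I = K" if "card I = card K" for I K :: "'n set"
    using sets[of I] sets[of K] that assms by auto
  have "minimizers k r w = {I. card I = k}" for r :: "'n set \<Rightarrow> real" and w
  proof (rule set_eqI)
    fix I :: "'n set"
    have "card I = k \<Longrightarrow> card K = k \<Longrightarrow> K = I" for K using same[of K I] by simp
    then show "I \<in> minimizers k r w \<longleftrightarrow> I \<in> {I. card I = k}" unfolding mem_minimizers mem_Collect_eq by (metis order_refl)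
  qed
  moreover have "\<not> min_attained_twice J g" for J :: "'n set" and g
  proof
    assume "min_attained_twice J g"
    then obtain i j :: 'n where "i \<noteq> j" unfolding min_attained_twice_def by blast
    moreover have "i \<in> {x}" "j \<in> {x}" unfolding x[symmetric] by simp_all
    ultimately show False by simp
  qed
  ultimately show ?thesis unfolding tropical_faces_def tropical_linear_space_def by simp
qed

theorem mainTheorem18:
  fixes p p' :: "'n::finite set \<Rightarrow> real" and d d' :: nat and a b :: "real ^ 'n"
  assumes "tropical_pluecker d p" and "series_parallel_tropical d p"
    and "tropical_pluecker d' p'" and "series_parallel_tropical d' p'"
    and "d + d' \<ge> CARD('n)"
    and "meet_transversely d p d' (translate_pluecker a p')"
    and "meet_transversely d p d' (translate_pluecker b p')"
  shows "\<forall>k::nat.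
    card {F \<in> intersection_faces d p d' (translate_pluecker a p').
            bounded_mod_ones F \<and> aff_dim F = int k} =
    card {F \<in> intersection_faces d p d' (translate_pluecker b p').
            bounded_mod_ones F \<and> aff_dim F = int k}"
proof
  fix k :: nat
  interpret pair p p' d d' "d + d' - CARD('n)" by unfold_locales (rule assms refl)+
  have tr: "transv a" "transv b" using meet_transversely_transv assms(6,7) by blast+
  show "card {F \<in> intersection_faces d p d' (translate_pluecker a p'). bounded_mod_ones F \<and> aff_dim F = int k} =
    card {F \<in> intersection_faces d p d' (translate_pluecker b p'). bounded_mod_ones F \<and> aff_dim F = int k}"
  \<comment> \<open>The description of bounded faces by good families needs two coordinates, so the
    one-element ground set is settled separately.\<close>
  proof (cases "CARD('n) = 1")
    case True
    have "intersection_faces d p d' (translate_pluecker a p') = intersection_faces d p d' (translate_pluecker b p')"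
      unfolding intersection_faces_def by (rule tropical_faces_singleton_type[OF True])
    then show ?thesis by simp
  next
    case False
    show ?thesis unfolding intersection_faces_def
      using count_faces[OF tr(1) False, of k] count_faces[OF tr(2) False, of k] cnt_invariant[OF tr] by simp
  qed
qed

end
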